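(* Let $l\ge 1$ be an integer. The existentially closed models of the theory $\mathcal{A}rt_l$ are precisely the Artinian local Gorenstein rings of length (exactly) $l$ with algebraically closed residue field.
   Context: Rings are commutative with identity. The language is the language of rings $\langle +,\cdot,-;0,1\rangle$. $\mathcal{A}rt_l$ is the first-order theory whose models are exactly the Artinian local rings of length at most $l$ (length as a module over itself). A model $R$ of a theory $T$ is existentially closed if every existential ($\exists_1$) sentence with parameters from $R$ which holds in some model $S$ of $T$ containing $R$ as a subring already holds in $R$. An Artinian local ring is Gorenstein if its socle (the annihilator of the maximal ideal) is a principal ideal, equivalently if it is self-injective. *)

theory Defs
  imports
    "HOL-Algebra.QuotRing"
    "HOL-Algebra.Ring_Divisibility"
    "HOL-Algebra.Algebraic_Closure"
    "HOL-Library.Extended_Nat"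
begin

section \<open>The language of rings\<close>

datatype rterm =
    TVar nat
  | TZero
  | TOne
  | TNeg rterm
  | TAdd rterm rterm
  | TMul rterm rterm

datatype rform =
    FEq rterm rterm
  | FNot rform
  | FAnd rform rform
  | FOr rform rform
  | FEx nat rform
  | FAll nat rform

text \<open>Structures are HOL-Algebra ring records. Such a record has no field for the function
  symbol \<open>-\<close>; it is interpreted by the derived operation \<open>\<ominus>\<close>, which is the additive inverse as
  soon as the ring axioms hold.\<close>

definition ring_structure :: "('a, 'm) ring_scheme \<Rightarrow> bool" where
  "ring_structure R \<longleftrightarrow>
     \<zero>\<^bsub>R\<^esub> \<in> carrier R \<and> \<one>\<^bsub>R\<^esub> \<in> carrier R \<and>
     (\<forall>x\<in>carrier R. \<ominus>\<^bsub>R\<^esub> x \<in> carrier R) \<and>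
     (\<forall>x\<in>carrier R. \<forall>y\<in>carrier R. x \<oplus>\<^bsub>R\<^esub> y \<in> carrier R) \<and>
     (\<forall>x\<in>carrier R. \<forall>y\<in>carrier R. x \<otimes>\<^bsub>R\<^esub> y \<in> carrier R)"

primrec teval :: "('a, 'm) ring_scheme \<Rightarrow> (nat \<Rightarrow> 'a) \<Rightarrow> rterm \<Rightarrow> 'a" where
  "teval R e (TVar n) = e n"
| "teval R e TZero = \<zero>\<^bsub>R\<^esub>"
| "teval R e TOne = \<one>\<^bsub>R\<^esub>"
| "teval R e (TNeg s) = \<ominus>\<^bsub>R\<^esub> teval R e s"
| "teval R e (TAdd s t) = teval R e s \<oplus>\<^bsub>R\<^esub> teval R e t"
| "teval R e (TMul s t) = teval R e s \<otimes>\<^bsub>R\<^esub> teval R e t"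

primrec sat :: "('a, 'm) ring_scheme \<Rightarrow> (nat \<Rightarrow> 'a) \<Rightarrow> rform \<Rightarrow> bool" where
  "sat R e (FEq s t) \<longleftrightarrow> teval R e s = teval R e t"
| "sat R e (FNot \<phi>) \<longleftrightarrow> \<not> sat R e \<phi>"
| "sat R e (FAnd \<phi> \<psi>) \<longleftrightarrow> sat R e \<phi> \<and> sat R e \<psi>"
| "sat R e (FOr \<phi> \<psi>) \<longleftrightarrow> sat R e \<phi> \<or> sat R e \<psi>"
| "sat R e (FEx n \<phi>) \<longleftrightarrow> (\<exists>a\<in>carrier R. sat R (e(n := a)) \<phi>)"
| "sat R e (FAll n \<phi>) \<longleftrightarrow> (\<forall>a\<in>carrier R. sat R (e(n := a)) \<phi>)"

text \<open>A theory is a set of formulas, read as their universal closures.\<close>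

definition is_model :: "rform set \<Rightarrow> ('a, 'm) ring_scheme \<Rightarrow> bool" where
  "is_model T R \<longleftrightarrow>
     ring_structure R \<and> (\<forall>\<phi>\<in>T. \<forall>e. range e \<subseteq> carrier R \<longrightarrow> sat R e \<phi>)"

primrec quantifier_free :: "rform \<Rightarrow> bool" where
  "quantifier_free (FEq s t) \<longleftrightarrow> True"
| "quantifier_free (FNot \<phi>) \<longleftrightarrow> quantifier_free \<phi>"
| "quantifier_free (FAnd \<phi> \<psi>) \<longleftrightarrow> quantifier_free \<phi> \<and> quantifier_free \<psi>"
| "quantifier_free (FOr \<phi> \<psi>) \<longleftrightarrow> quantifier_free \<phi> \<and> quantifier_free \<psi>"
| "quantifier_free (FEx n \<phi>) \<longleftrightarrow> False"
| "quantifier_free (FAll n \<phi>) \<longleftrightarrow> False"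

inductive existential :: "rform \<Rightarrow> bool" where
  "quantifier_free \<phi> \<Longrightarrow> existential \<phi>"
| "existential \<phi> \<Longrightarrow> existential (FEx n \<phi>)"

text \<open>An existential sentence with parameters from \<open>R\<close> is an existential formula \<open>\<phi>\<close> together
  with an assignment \<open>e\<close> in \<open>R\<close> supplying the parameters for its free variables. An extension of
  \<open>R\<close> is a model \<open>S\<close> with an embedding \<open>h\<close> of \<open>R\<close> onto a subring of \<open>S\<close>.

  HOL cannot quantify over types, so the type \<open>'b\<close> in which the extensions \<open>S\<close> live is an
  argument. By Loewenheim--Skolem any infinite \<open>'b\<close> with at least as many elements as \<open>R\<close> gives
  the same notion as arbitrary extensions.\<close>

definition existentially_closed ::
    "'b itself \<Rightarrow> rform set \<Rightarrow> ('a, 'm) ring_scheme \<Rightarrow> bool" where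
  "existentially_closed U T R \<longleftrightarrow>
     is_model T R \<and>
     (\<forall>(S :: 'b ring) h \<phi> e.
        is_model T S \<and> h \<in> ring_hom R S \<and> inj_on h (carrier R) \<and>
        existential \<phi> \<and> range e \<subseteq> carrier R \<and> sat S (h \<circ> e) \<phi> \<longrightarrow> sat R e \<phi>)"


section \<open>Artinian local rings\<close>

definition artinian_ring :: "('a, 'm) ring_scheme \<Rightarrow> bool" where
  "artinian_ring R \<longleftrightarrow>
     cring R \<and> \<not> (\<exists>I :: nat \<Rightarrow> 'a set. \<forall>n. ideal (I n) R \<and> I (Suc n) \<subset> I n)"

definition local_ring :: "('a, 'm) ring_scheme \<Rightarrow> bool" where
  "local_ring R \<longleftrightarrow> cring R \<and> (\<exists>!M. maximalideal M R)"

definition artinian_local_ring :: "('a, 'm) ring_scheme \<Rightarrow> bool" where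
  "artinian_local_ring R \<longleftrightarrow> artinian_ring R \<and> local_ring R"

definition max_ideal :: "('a, 'm) ring_scheme \<Rightarrow> 'a set" where
  "max_ideal R = (THE M. maximalideal M R)"

definition residue_field :: "('a, 'm) ring_scheme \<Rightarrow> 'a set ring" where
  "residue_field R = R Quot max_ideal R"

text \<open>The length of a commutative ring as a module over itself: its submodules are its ideals.\<close>

definition ring_length :: "('a, 'm) ring_scheme \<Rightarrow> enat" where
  "ring_length R =
     Sup {enat n | n. \<exists>I :: nat \<Rightarrow> 'a set.
            (\<forall>i\<le>n. ideal (I i) R) \<and> (\<forall>i<n. I i \<subset> I (Suc i))}"

definition socle :: "('a, 'm) ring_scheme \<Rightarrow> 'a set" where
  "socle R = {x \<in> carrier R. \<forall>y\<in>max_ideal R. x \<otimes>\<^bsub>R\<^esub> y = \<zero>\<^bsub>R\<^esub>}"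

definition artinian_local_gorenstein_ring :: "('a, 'm) ring_scheme \<Rightarrow> bool" where
  "artinian_local_gorenstein_ring R \<longleftrightarrow>
     artinian_local_ring R \<and> principalideal (socle R) R"


section \<open>The theory of Artinian local rings of length at most \<open>l\<close>\<close>

definition cring_axioms_fo :: "rform set" where
  "cring_axioms_fo =
    (let x = TVar 0; y = TVar 1; z = TVar 2 in
     {FAll 0 (FAll 1 (FAll 2 (FEq (TAdd (TAdd x y) z) (TAdd x (TAdd y z))))),
      FAll 0 (FAll 1 (FEq (TAdd x y) (TAdd y x))),
      FAll 0 (FEq (TAdd TZero x) x),
      FAll 0 (FEq (TAdd (TNeg x) x) TZero),
      FAll 0 (FAll 1 (FAll 2 (FEq (TMul (TMul x y) z) (TMul x (TMul y z))))),
      FAll 0 (FAll 1 (FEq (TMul x y) (TMul y x))),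
      FAll 0 (FEq (TMul TOne x) x),
      FAll 0 (FAll 1 (FAll 2 (FEq (TMul (TAdd x y) z) (TAdd (TMul x z) (TMul y z)))))})"

text \<open>A commutative ring is local iff \<open>0 \<noteq> 1\<close> and for every \<open>x\<close> one of \<open>x\<close>, \<open>1 - x\<close> is a unit.\<close>

definition local_axioms_fo :: "rform set" where
  "local_axioms_fo =
    (let x = TVar 0; y = TVar 1 in
     {FNot (FEq TZero TOne),
      FAll 0 (FEx 1 (FOr (FEq (TMul x y) TOne)
                         (FEq (TMul (TAdd TOne (TNeg x)) y) TOne)))})"

primrec FDisj :: "rform list \<Rightarrow> rform" where
  "FDisj [] = FNot (FEq TZero TZero)"
| "FDisj (\<phi> # \<phi>s) = FOr \<phi> (FDisj \<phi>s)"

text \<open>A ring has length at most \<open>l\<close> iff for all \<open>a\<^sub>0, \<dots>, a\<^sub>l\<close> there is \<open>i \<le> l\<close> such that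
  \<open>a\<^sub>i = r\<^sub>0 a\<^sub>0 + \<dots> + r\<^sub>i\<^sub>-\<^sub>1 a\<^sub>i\<^sub>-\<^sub>1\<close> for some \<open>r\<^sub>0, \<dots>, r\<^sub>i\<^sub>-\<^sub>1\<close>. The variables \<open>0, \<dots>, l\<close> stand for
  the \<open>a\<^sub>j\<close>, the variables \<open>l + 1, l + 2, \<dots>\<close> for the \<open>r\<^sub>j\<close>.\<close>

primrec lincomb_fo :: "nat \<Rightarrow> nat \<Rightarrow> rterm" where
  "lincomb_fo l 0 = TZero"
| "lincomb_fo l (Suc i) = TAdd (lincomb_fo l i) (TMul (TVar (Suc l + i)) (TVar i))"

definition length_axiom_fo :: "nat \<Rightarrow> rform" where
  "length_axiom_fo l =
     foldr FAll [0..<Suc l]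
       (FDisj (map (\<lambda>i. foldr FEx [Suc l..<Suc l + i] (FEq (TVar i) (lincomb_fo l i)))
                   [0..<Suc l]))"

definition Art :: "nat \<Rightarrow> rform set" where
  "Art l = cring_axioms_fo \<union> local_axioms_fo \<union> {length_axiom_fo l}"


subsection \<open>The models of \<open>Art l\<close> are the Artinian local rings of length at most \<open>l\<close>\<close>

lemma sat_foldr_FAll:
  "sat R e (foldr FAll ns \<phi>) \<longleftrightarrow>
     (\<forall>e'. (\<forall>n. n \<notin> set ns \<longrightarrow> e' n = e n) \<and> (\<forall>n\<in>set ns. e' n \<in> carrier R) \<longrightarrow> sat R e' \<phi>)"
proof (induction ns arbitrary: e)
  case Nil
  have "e' = e" if "\<forall>n. e' n = e n" for e' using that by auto
  then show ?case by auto
next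
  case (Cons m ns)
  show ?case
  proof
    assume L: "sat R e (foldr FAll (m # ns) \<phi>)"
    show "\<forall>e'. (\<forall>n. n \<notin> set (m # ns) \<longrightarrow> e' n = e n) \<and> (\<forall>n\<in>set (m # ns). e' n \<in> carrier R)
            \<longrightarrow> sat R e' \<phi>"
    proof (intro allI impI)
      fix e' assume e': "(\<forall>n. n \<notin> set (m # ns) \<longrightarrow> e' n = e n) \<and> (\<forall>n\<in>set (m # ns). e' n \<in> carrier R)"
      then have "sat R (e(m := e' m)) (foldr FAll ns \<phi>)" using L by auto
      then show "sat R e' \<phi>" using e' unfolding Cons.IH by auto
    qed
  next
    assume A: "\<forall>e'. (\<forall>n. n \<notin> set (m # ns) \<longrightarrow> e' n = e n) \<and> (\<forall>n\<in>set (m # ns). e' n \<in> carrier R)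
            \<longrightarrow> sat R e' \<phi>"
    show "sat R e (foldr FAll (m # ns) \<phi>)"
    proof (simp, intro ballI)
      fix a assume a: "a \<in> carrier R"
      show "sat R (e(m := a)) (foldr FAll ns \<phi>)"
        unfolding Cons.IH
      proof (intro allI impI)
        fix e' assume e': "(\<forall>n. n \<notin> set ns \<longrightarrow> e' n = (e(m := a)) n) \<and> (\<forall>n\<in>set ns. e' n \<in> carrier R)"
        then have "e' m \<in> carrier R" using a by (cases "m \<in> set ns") auto
        then show "sat R e' \<phi>" using e' A by auto
      qed
    qed
  qed
qed

lemma sat_foldr_FEx:
  "sat R e (foldr FEx ns \<phi>) \<longleftrightarrow>
     (\<exists>e'. (\<forall>n. n \<notin> set ns \<longrightarrow> e' n = e n) \<and> (\<forall>n\<in>set ns. e' n \<in> carrier R) \<and> sat R e' \<phi>)"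
proof -
  have "sat R e (foldr FEx ns \<phi>) \<longleftrightarrow> \<not> sat R e (foldr FAll ns (FNot \<phi>))" for e
    by (induction ns arbitrary: e) auto
  then show ?thesis unfolding sat_foldr_FAll by auto
qed

lemma sat_FDisj: "sat R e (FDisj \<phi>s) \<longleftrightarrow> (\<exists>\<phi>\<in>set \<phi>s. sat R e \<phi>)"
  by (induction \<phi>s) auto

primrec lincomb :: "('a, 'm) ring_scheme \<Rightarrow> (nat \<Rightarrow> 'a) \<Rightarrow> (nat \<Rightarrow> 'a) \<Rightarrow> nat \<Rightarrow> 'a" where
  "lincomb R r a 0 = \<zero>\<^bsub>R\<^esub>"
| "lincomb R r a (Suc i) = lincomb R r a i \<oplus>\<^bsub>R\<^esub> r i \<otimes>\<^bsub>R\<^esub> a i"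

lemma teval_lincomb_fo: "teval R e (lincomb_fo l i) = lincomb R (\<lambda>j. e (Suc l + j)) e i"
  by (induction i) auto

lemma lincomb_cong:
  "(\<And>j. j < i \<Longrightarrow> r j = r' j) \<Longrightarrow> (\<And>j. j < i \<Longrightarrow> a j = a' j) \<Longrightarrow> lincomb R r a i = lincomb R r' a' i"
  by (induction i) auto

lemma sat_length_axiom_fo:
  assumes z: "\<zero>\<^bsub>R\<^esub> \<in> carrier R"
  shows "sat R e (length_axiom_fo l) \<longleftrightarrow>
    (\<forall>a. range a \<subseteq> carrier R \<longrightarrow> (\<exists>i\<le>l. \<exists>r. range r \<subseteq> carrier R \<and> a i = lincomb R r a i))"
proof -
  have inner: "sat R e (foldr FEx [Suc l..<Suc l + i] (FEq (TVar i) (lincomb_fo l i))) \<longleftrightarrow>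
      (\<exists>r. range r \<subseteq> carrier R \<and> e i = lincomb R r e i)" (is "?L \<longleftrightarrow> ?R")
    if i: "i \<le> l" for e i
  proof
    assume ?L
    then have "\<exists>e'. (\<forall>n. n \<notin> {Suc l..<Suc l + i} \<longrightarrow> e' n = e n) \<and>
        (\<forall>n\<in>{Suc l..<Suc l + i}. e' n \<in> carrier R) \<and>
        e' i = lincomb R (\<lambda>j. e' (Suc l + j)) e' i"
      unfolding sat_foldr_FEx set_upt by (simp only: sat.simps teval.simps teval_lincomb_fo)
    then obtain e' where e': "\<And>n. n \<notin> {Suc l..<Suc l + i} \<Longrightarrow> e' n = e n"
      "\<And>n. n \<in> {Suc l..<Suc l + i} \<Longrightarrow> e' n \<in> carrier R"
      "e' i = lincomb R (\<lambda>j. e' (Suc l + j)) e' i"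
      by blast
    let ?r = "\<lambda>j. if j < i then e' (Suc l + j) else \<zero>\<^bsub>R\<^esub>"
    have "lincomb R (\<lambda>j. e' (Suc l + j)) e' i = lincomb R ?r e i"
      using e'(1) i by (intro lincomb_cong) auto
    moreover have "e' i = e i" using e'(1) i by auto
    moreover have "range ?r \<subseteq> carrier R" using e'(2) z by auto
    ultimately show ?R using e'(3) by metis
  next
    assume ?R
    then obtain r where r: "range r \<subseteq> carrier R" "e i = lincomb R r e i" by auto
    let ?e = "\<lambda>n. if n \<in> {Suc l..<Suc l + i} then r (n - Suc l) else e n"
    have "lincomb R (\<lambda>j. ?e (Suc l + j)) ?e i = lincomb R r e i"
      using i by (intro lincomb_cong) auto
    then have "sat R ?e (FEq (TVar i) (lincomb_fo l i))"
      using i r(2) unfolding sat.simps teval_lincomb_fo by simp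
    then show ?L unfolding sat_foldr_FEx using r(1) by (intro exI[of _ ?e]) auto
  qed
  have disj: "sat R e' (FDisj (map (\<lambda>i. foldr FEx [Suc l..<Suc l + i]
        (FEq (TVar i) (lincomb_fo l i))) [0..<Suc l])) \<longleftrightarrow>
      (\<exists>i\<le>l. \<exists>r. range r \<subseteq> carrier R \<and> e' i = lincomb R r e' i)" for e'
  proof -
    have "sat R e' (FDisj (map (\<lambda>i. foldr FEx [Suc l..<Suc l + i]
        (FEq (TVar i) (lincomb_fo l i))) [0..<Suc l])) \<longleftrightarrow>
      (\<exists>i\<in>{0..<Suc l}. sat R e' (foldr FEx [Suc l..<Suc l + i] (FEq (TVar i) (lincomb_fo l i))))"
      unfolding sat_FDisj set_map set_upt by blast
    also have "\<dots> \<longleftrightarrow> (\<exists>i\<in>{0..<Suc l}. \<exists>r. range r \<subseteq> carrier R \<and> e' i = lincomb R r e' i)"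
      by (rule bex_cong[OF refl]) (simp only: inner atLeastLessThan_iff less_Suc_eq_le)
    finally show ?thesis by (simp only: Bex_def atLeastLessThan_iff less_Suc_eq_le le0 simp_thms)
  qed
  have "sat R e (length_axiom_fo l) \<longleftrightarrow>
     (\<forall>e'. (\<forall>n. n \<notin> {0..<Suc l} \<longrightarrow> e' n = e n) \<and> (\<forall>n\<in>{0..<Suc l}. e' n \<in> carrier R) \<longrightarrow>
        (\<exists>i\<le>l. \<exists>r. range r \<subseteq> carrier R \<and> e' i = lincomb R r e' i))"
    unfolding length_axiom_fo_def sat_foldr_FAll disj set_upt ..
  also have "\<dots> \<longleftrightarrow> (\<forall>a. range a \<subseteq> carrier R \<longrightarrow>
        (\<exists>i\<le>l. \<exists>r. range r \<subseteq> carrier R \<and> a i = lincomb R r a i))" (is "?A \<longleftrightarrow> ?B")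
  proof
    assume A: ?A
    show ?B
    proof (intro allI impI)
      fix a :: "nat \<Rightarrow> 'a" assume a: "range a \<subseteq> carrier R"
      let ?e = "\<lambda>n. if n \<le> l then a n else e n"
      have "(\<forall>n. n \<notin> {0..<Suc l} \<longrightarrow> ?e n = e n) \<and> (\<forall>n\<in>{0..<Suc l}. ?e n \<in> carrier R)"
        using a by auto
      from mp[OF spec[OF A, of ?e] this]
      obtain i r where ir: "i \<le> l" "range r \<subseteq> carrier R" "?e i = lincomb R r ?e i"
        by (elim exE conjE)
      moreover have "lincomb R r ?e i = lincomb R r a i"
        using ir(1) by (intro lincomb_cong) auto
      ultimately have "a i = lincomb R r a i" by simp
      then show "\<exists>i\<le>l. \<exists>r. range r \<subseteq> carrier R \<and> a i = lincomb R r a i"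
        using ir(1,2) by blast
    qed
  next
    assume B: ?B
    show ?A
    proof (intro allI impI)
      fix e' assume e': "(\<forall>n. n \<notin> {0..<Suc l} \<longrightarrow> e' n = e n) \<and> (\<forall>n\<in>{0..<Suc l}. e' n \<in> carrier R)"
      let ?a = "\<lambda>n. if n \<le> l then e' n else \<zero>\<^bsub>R\<^esub>"
      have "range ?a \<subseteq> carrier R" using e' z by auto
      from mp[OF spec[OF B, of ?a] this]
      obtain i r where ir: "i \<le> l" "range r \<subseteq> carrier R" "?a i = lincomb R r ?a i"
        by (elim exE conjE)
      moreover have "lincomb R r ?a i = lincomb R r e' i"
        using ir(1) by (intro lincomb_cong) auto
      ultimately have "e' i = lincomb R r e' i" by simp
      then show "\<exists>i\<le>l. \<exists>r. range r \<subseteq> carrier R \<and> e' i = lincomb R r e' i"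
        using ir(1,2) by blast
    qed
  qed
  finally show ?thesis .
qed

lemma ring_structure_cring: "cring R \<Longrightarrow> ring_structure R"
proof -
  assume "cring R"
  then interpret cring R .
  show ?thesis unfolding ring_structure_def by auto
qed

lemma is_model_cring_axioms: "is_model cring_axioms_fo R \<longleftrightarrow> cring R"
proof
  assume M: "is_model cring_axioms_fo R"
  then have st: "ring_structure R" unfolding is_model_def by blast
  define e where "e = (\<lambda>n::nat. \<zero>\<^bsub>R\<^esub>)"
  have "range e \<subseteq> carrier R" using st unfolding e_def ring_structure_def by auto
  then have ax: "\<forall>\<phi>\<in>cring_axioms_fo. sat R e \<phi>" using M unfolding is_model_def by blast
  show "cring R"
  proof (rule cringI)
    show "abelian_group R"
    proof (rule abelian_groupI)
      fix x assume "x \<in> carrier R"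
      then show "\<exists>y\<in>carrier R. y \<oplus>\<^bsub>R\<^esub> x = \<zero>\<^bsub>R\<^esub>"
        using st ax unfolding ring_structure_def cring_axioms_fo_def Let_def
        by (intro bexI[of _ "\<ominus>\<^bsub>R\<^esub> x"]) auto
    qed (use st ax in \<open>auto simp: ring_structure_def cring_axioms_fo_def Let_def\<close>)
    show "comm_monoid R"
      using st ax unfolding ring_structure_def cring_axioms_fo_def Let_def
      by (intro comm_monoidI) auto
  qed (use ax in \<open>auto simp: cring_axioms_fo_def Let_def\<close>)
next
  assume c: "cring R"
  then interpret cring R .
  show "is_model cring_axioms_fo R"
    unfolding is_model_def cring_axioms_fo_def Let_def
    using ring_structure_cring[OF c]
    by (auto simp: a_assoc m_assoc l_neg l_distr intro: a_comm m_comm)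
qed

lemma (in cring) lincomb_closed:
  "range r \<subseteq> carrier R \<Longrightarrow> range a \<subseteq> carrier R \<Longrightarrow> lincomb R r a i \<in> carrier R"
  by (induction i) (auto simp: image_subset_iff)

lemma (in cring) lincomb_add:
  assumes "range r \<subseteq> carrier R" "range s \<subseteq> carrier R" "range a \<subseteq> carrier R"
  shows "lincomb R (\<lambda>j. r j \<oplus> s j) a i = lincomb R r a i \<oplus> lincomb R s a i"
proof (induction i)
  case (Suc i)
  have c: "r i \<in> carrier R" "s i \<in> carrier R" "a i \<in> carrier R" using assms by auto
  show ?case using c lincomb_closed[OF assms(1,3), of i] lincomb_closed[OF assms(2,3), of i]
    by (simp add: Suc l_distr a_ac)
qed simp

lemma (in cring) lincomb_smult:
  assumes "x \<in> carrier R" "range s \<subseteq> carrier R" "range a \<subseteq> carrier R"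
  shows "lincomb R (\<lambda>j. x \<otimes> s j) a i = x \<otimes> lincomb R s a i"
proof (induction i)
  case (Suc i)
  have c: "s i \<in> carrier R" "a i \<in> carrier R" using assms by auto
  show ?case using c assms(1) lincomb_closed[OF assms(2,3), of i]
    by (simp add: Suc r_distr m_assoc)
qed (use assms in simp)

lemma (in cring) ideal_lincombs:
  assumes a: "range a \<subseteq> carrier R"
  shows "ideal {lincomb R r a i | r. range r \<subseteq> carrier R} R" (is "ideal ?J R")
proof -
  have zero: "lincomb R (\<lambda>_. \<zero>) a i = \<zero>"
    using a by (induction i) (auto simp: image_subset_iff)
  have mult: "x \<otimes> u \<in> ?J" if x: "x \<in> carrier R" and u: "u \<in> ?J" for x u
  proof -
    obtain r where r: "range r \<subseteq> carrier R" "u = lincomb R r a i" using u by auto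
    have "x \<otimes> u = lincomb R (\<lambda>j. x \<otimes> r j) a i" using lincomb_smult x r a by simp
    moreover have "range (\<lambda>j. x \<otimes> r j) \<subseteq> carrier R" using r x by auto
    ultimately show ?thesis by blast
  qed
  have sub: "?J \<subseteq> carrier R" using lincomb_closed a by auto
  show ?thesis
  proof (rule idealI[OF ring_axioms])
    show "subgroup ?J (add_monoid R)"
    proof (rule add.subgroupI[OF sub])
      show "?J \<noteq> {}" using zero by (auto intro!: exI[of _ "\<lambda>_. \<zero>"])
    next
      fix u assume u: "u \<in> ?J"
      then have "\<ominus> u = (\<ominus> \<one>) \<otimes> u" using sub by (auto simp: l_minus)
      then show "\<ominus> u \<in> ?J" using mult u by simp
    next
      fix u v assume "u \<in> ?J" "v \<in> ?J"
      then obtain r s where rs: "range r \<subseteq> carrier R" "range s \<subseteq> carrier R"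
        "u = lincomb R r a i" "v = lincomb R s a i" by auto
      have "u \<oplus> v = lincomb R (\<lambda>j. r j \<oplus> s j) a i" using lincomb_add rs a by simp
      moreover have "range (\<lambda>j. r j \<oplus> s j) \<subseteq> carrier R" using rs by auto
      ultimately show "u \<oplus> v \<in> ?J" by blast
    qed
  next
    fix u x assume ux: "u \<in> ?J" "x \<in> carrier R"
    show "x \<otimes> u \<in> ?J" using mult ux by simp
    moreover have "u \<otimes> x = x \<otimes> u" using ux sub m_comm by blast
    ultimately show "u \<otimes> x \<in> ?J" by simp
  qed
qed

lemma ring_length_le_iff:
  "ring_length R \<le> enat l \<longleftrightarrow>
     \<not> (\<exists>I :: nat \<Rightarrow> 'a set. (\<forall>i\<le>Suc l. ideal (I i) R) \<and> (\<forall>i\<le>l. I i \<subset> I (Suc i)))"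
  for R :: "('a, 'm) ring_scheme"
proof
  assume L: "ring_length R \<le> enat l"
  show "\<not> (\<exists>I :: nat \<Rightarrow> 'a set. (\<forall>i\<le>Suc l. ideal (I i) R) \<and> (\<forall>i\<le>l. I i \<subset> I (Suc i)))"
  proof
    assume "\<exists>I :: nat \<Rightarrow> 'a set. (\<forall>i\<le>Suc l. ideal (I i) R) \<and> (\<forall>i\<le>l. I i \<subset> I (Suc i))"
    then have "enat (Suc l) \<le> ring_length R"
      unfolding ring_length_def by (intro Sup_upper) (auto simp: less_Suc_eq_le)
    then show False using L by (metis Suc_n_not_le_n enat_ord_simps(1) order.trans)
  qed
next
  assume N: "\<not> (\<exists>I :: nat \<Rightarrow> 'a set. (\<forall>i\<le>Suc l. ideal (I i) R) \<and> (\<forall>i\<le>l. I i \<subset> I (Suc i)))"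
  show "ring_length R \<le> enat l"
    unfolding ring_length_def
  proof (rule Sup_least, clarsimp)
    fix n and I :: "nat \<Rightarrow> 'a set"
    assume I: "\<forall>i\<le>n. ideal (I i) R" "\<forall>i<n. I i \<subset> I (Suc i)"
    show "n \<le> l"
    proof (rule ccontr)
      assume n: "\<not> n \<le> l"
      have "(\<forall>i\<le>Suc l. ideal (I i) R) \<and> (\<forall>i\<le>l. I i \<subset> I (Suc i))"
        using I n by simp
      then show False using N by blast
    qed
  qed
qed

lemma (in cring) length_axiom_iff:
  "(\<forall>a. range a \<subseteq> carrier R \<longrightarrow> (\<exists>i\<le>l. \<exists>r. range r \<subseteq> carrier R \<and> a i = lincomb R r a i))
     \<longleftrightarrow> ring_length R \<le> enat l" (is "?A \<longleftrightarrow> _")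
  unfolding ring_length_le_iff
proof
  assume A: ?A
  show "\<not> (\<exists>I. (\<forall>i\<le>Suc l. ideal (I i) R) \<and> (\<forall>i\<le>l. I i \<subset> I (Suc i)))"
  proof
    assume "\<exists>I. (\<forall>i\<le>Suc l. ideal (I i) R) \<and> (\<forall>i\<le>l. I i \<subset> I (Suc i))"
    then obtain I where I: "\<And>i. i \<le> Suc l \<Longrightarrow> ideal (I i) R" "\<And>i. i \<le> l \<Longrightarrow> I i \<subset> I (Suc i)"
      by blast
    have "\<forall>i. \<exists>x. if i \<le> l then x \<in> I (Suc i) - I i else x = \<zero>" using I(2) by auto
    then obtain a where a: "\<And>i. if i \<le> l then a i \<in> I (Suc i) - I i else a i = \<zero>" by metis
    have sub: "I i \<subseteq> carrier R" if "i \<le> Suc l" for i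
      using I(1)[OF that] by (simp add: additive_subgroup.a_subset ideal.axioms(1))
    have ac: "range a \<subseteq> carrier R"
    proof (clarify)
      fix i show "a i \<in> carrier R" using a[of i] sub[of "Suc i"] by (auto split: if_splits)
    qed
    have "lincomb R r a i \<in> I i" if r: "range r \<subseteq> carrier R" and i: "i \<le> l" for r i
      using i
    proof (induction i)
      case 0
      show ?case using I(1)[of 0] by (simp add: additive_subgroup.zero_closed ideal.axioms(1))
    next
      case (Suc i)
      interpret J: ideal "I (Suc i)" R using I(1) Suc.prems by simp
      have "lincomb R r a i \<in> I (Suc i)" using Suc I(2)[of i] by auto
      moreover have "r i \<otimes> a i \<in> I (Suc i)"
        using a[of i] Suc.prems r by (intro J.I_l_closed) auto
      ultimately show ?case by (simp add: J.a_closed)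
    qed
    moreover obtain i r where "i \<le> l" "range r \<subseteq> carrier R" "a i = lincomb R r a i"
      using A ac by blast
    ultimately show False using a[of i] by auto
  qed
next
  assume N: "\<not> (\<exists>I. (\<forall>i\<le>Suc l. ideal (I i) R) \<and> (\<forall>i\<le>l. I i \<subset> I (Suc i)))"
  show ?A
  proof (rule ccontr)
    assume "\<not> ?A"
    then obtain a where a: "range a \<subseteq> carrier R"
      and n: "\<And>i r. i \<le> l \<Longrightarrow> range r \<subseteq> carrier R \<Longrightarrow> a i \<noteq> lincomb R r a i" by blast
    let ?J = "\<lambda>i. {lincomb R r a i | r. range r \<subseteq> carrier R}"
    have "?J i \<subset> ?J (Suc i)" if i: "i \<le> l" for i
    proof
      show "?J i \<subseteq> ?J (Suc i)"
      proof clarify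
        fix r :: "nat \<Rightarrow> 'a" assume r: "range r \<subseteq> carrier R"
        let ?r = "r(i := \<zero>)"
        have "lincomb R ?r a i = lincomb R r a i" by (intro lincomb_cong) auto
        moreover have "a i \<in> carrier R" using a by auto
        ultimately have "lincomb R r a i = lincomb R ?r a (Suc i)"
          using lincomb_closed[OF r a] by simp
        moreover have "range ?r \<subseteq> carrier R" using r by auto
        ultimately show "\<exists>s. lincomb R r a i = lincomb R s a (Suc i) \<and> range s \<subseteq> carrier R"
          by blast
      qed
      let ?r = "\<lambda>j. if j = i then \<one> else \<zero>"
      have z: "lincomb R ?r a k = \<zero>" if "k \<le> i" for k
        using that a by (induction k) (auto simp: image_subset_iff)
      have "a i \<in> carrier R" using a by auto
      then have "a i = lincomb R ?r a (Suc i)" using z[of i] by simp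
      moreover have "range ?r \<subseteq> carrier R" by auto
      ultimately have "a i \<in> ?J (Suc i)" by blast
      moreover have "a i \<notin> ?J i" using n[OF i] by blast
      ultimately show "?J i \<noteq> ?J (Suc i)" by blast
    qed
    then have "(\<forall>i\<le>Suc l. ideal (?J i) R) \<and> (\<forall>i\<le>l. ?J i \<subset> ?J (Suc i))"
      using ideal_lincombs[OF a] by blast
    with N show False by (elim notE) (rule exI[of _ ?J])
  qed
qed

lemma finite_length_imp_artinian:
  assumes "cring R" "ring_length R \<le> enat l"
  shows "artinian_ring R"
  unfolding artinian_ring_def
proof (intro conjI notI)
  assume "\<exists>I. \<forall>n. ideal (I n) R \<and> I (Suc n) \<subset> I n"
  then obtain I where I: "\<And>n. ideal (I n) R" "\<And>n. I (Suc n) \<subset> I n" by blast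
  have "I (Suc l - i) \<subset> I (Suc l - Suc i)" if "i \<le> l" for i
    using I(2)[of "l - i"] that by (simp add: Suc_diff_le)
  then have "\<exists>I. (\<forall>i\<le>Suc l. ideal (I i) R) \<and> (\<forall>i\<le>l. I i \<subset> I (Suc i))"
    using I(1) by (intro exI[of _ "\<lambda>i. I (Suc l - i)"]) auto
  then show False using assms(2) unfolding ring_length_le_iff by blast
qed (rule assms)

lemma (in cring) proper_ideal_in_maximal:
  assumes "ideal I R" "\<one> \<notin> I"
  obtains M where "maximalideal M R" "I \<subseteq> M"
proof -
  let ?A = "{J. ideal J R \<and> I \<subseteq> J \<and> \<one> \<notin> J}"
  have "\<exists>M\<in>?A. \<forall>N\<in>?A. M \<subseteq> N \<longrightarrow> N = M"
  proof (rule subset_Zorn_nonempty)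
    show "?A \<noteq> {}" using assms by blast
    fix C assume C: "C \<noteq> {}" "subset.chain ?A C"
    then have "subset.chain {I. ideal I R} C" unfolding pred_on.chain_def by auto
    from chain_Union_is_ideal[OF this] C show "\<Union>C \<in> ?A" unfolding pred_on.chain_def by auto
  qed
  then obtain M where M: "M \<in> ?A" and mx: "\<forall>N\<in>?A. M \<subseteq> N \<longrightarrow> N = M" ..
  have M': "ideal M R" "I \<subseteq> M" "\<one> \<notin> M" using M by simp_all
  have "maximalideal M R"
  proof (rule maximalidealI)
    show "ideal M R" by (rule M')
    show "carrier R \<noteq> M" using M' by auto
    fix J assume J: "ideal J R" "M \<subseteq> J" "J \<subseteq> carrier R"
    show "J = M \<or> J = carrier R"
    proof (cases "\<one> \<in> J")
      case True then show ?thesis using J(1) ideal.one_imp_carrier by blast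
    next
      case False
      then have "J \<in> ?A" using J M' by simp
      then show ?thesis using mx J(2) by simp
    qed
  qed
  then show ?thesis using that M'(2) by simp
qed

lemma (in cring) local_axioms_iff:
  "\<zero> \<noteq> \<one> \<and> (\<forall>x\<in>carrier R. \<exists>y\<in>carrier R. x \<otimes> y = \<one> \<or> (\<one> \<oplus> \<ominus> x) \<otimes> y = \<one>)
     \<longleftrightarrow> local_ring R" (is "?A \<longleftrightarrow> _")
proof
  assume A: ?A
  let ?U = "{x \<in> carrier R. \<exists>y\<in>carrier R. x \<otimes> y = \<one>}"
  let ?m = "carrier R - ?U"
  have mult: "x \<otimes> u \<in> ?m" if x: "x \<in> carrier R" and u: "u \<in> ?m" for x u
  proof -
    have uc: "u \<in> carrier R" and un: "\<And>y. y \<in> carrier R \<Longrightarrow> u \<otimes> y \<noteq> \<one>" using u by auto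
    have "(x \<otimes> u) \<otimes> y \<noteq> \<one>" if y: "y \<in> carrier R" for y
    proof -
      have "(x \<otimes> u) \<otimes> y = u \<otimes> (x \<otimes> y)" using x uc y by (simp add: m_ac)
      then show ?thesis using un[of "x \<otimes> y"] x y by simp
    qed
    then show ?thesis using x uc by simp
  qed
  have id: "ideal ?m R"
  proof (rule idealI[OF ring_axioms])
    show "subgroup ?m (add_monoid R)"
    proof (rule add.subgroupI)
      show "?m \<noteq> {}" using A by auto
    next
      fix u assume u: "u \<in> ?m"
      then have "\<ominus> u = (\<ominus> \<one>) \<otimes> u" by (auto simp: l_minus)
      then show "\<ominus> u \<in> ?m" using mult[of "\<ominus> \<one>" u] u by simp
    next
      fix u v assume uv: "u \<in> ?m" "v \<in> ?m"
      show "u \<oplus> v \<in> ?m"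
      proof (rule ccontr)
        assume "u \<oplus> v \<notin> ?m"
        then obtain z where z: "z \<in> carrier R" "(u \<oplus> v) \<otimes> z = \<one>" using uv by auto
        have c: "z \<otimes> u \<in> carrier R" "z \<otimes> v \<in> carrier R" using uv z by auto
        have uv_c: "u \<in> carrier R" "v \<in> carrier R" using uv by auto
        have "z \<otimes> v \<oplus> z \<otimes> u = (u \<oplus> v) \<otimes> z"
          using l_distr[of u v z] m_comm[of u z] m_comm[of v z]
            a_comm[of "z \<otimes> u" "z \<otimes> v"] z(1) uv_c c by simp
        moreover have "(z \<otimes> v \<oplus> z \<otimes> u) \<oplus> \<ominus> (z \<otimes> u) = z \<otimes> v"
          using c by (simp add: a_assoc r_neg)
        ultimately have "\<one> \<oplus> \<ominus> (z \<otimes> u) = z \<otimes> v" using z(2) by simp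
        then have "z \<otimes> u \<in> ?U \<or> z \<otimes> v \<in> ?U" using A c by auto
        then show False using mult[OF z(1) uv(1)] mult[OF z(1) uv(2)] by blast
      qed
    qed auto
  next
    fix u x assume ux: "u \<in> ?m" "x \<in> carrier R"
    show "x \<otimes> u \<in> ?m" using mult ux by simp
    moreover have "u \<otimes> x = x \<otimes> u" using ux m_comm by blast
    ultimately show "u \<otimes> x \<in> ?m" by simp
  qed
  have unit: "J = carrier R" if J: "ideal J R" and x: "x \<in> J" "x \<in> ?U" for J x
    using x ideal.I_r_closed[OF J] ideal.one_imp_carrier[OF J] by fastforce
  have one: "\<one> \<notin> ?m" by auto
  have "maximalideal ?m R"
  proof (rule maximalidealI[OF id])
    show "carrier R \<noteq> ?m" using one by blast
    fix J assume J: "ideal J R" "?m \<subseteq> J" "J \<subseteq> carrier R"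
    then show "J = ?m \<or> J = carrier R" using unit[OF J(1)] by blast
  qed
  moreover have "M = ?m" if "maximalideal M R" for M
  proof -
    interpret M: maximalideal M R by fact
    have "M \<subseteq> ?m" using unit[OF M.ideal_axioms] M.I_notcarr M.a_subset by blast
    then show ?thesis using M.I_maximal[OF id] one by blast
  qed
  ultimately show "local_ring R" unfolding local_ring_def using is_cring by blast
next
  assume L: "local_ring R"
  then obtain M where M: "maximalideal M R" and uni: "\<And>N. maximalideal N R \<Longrightarrow> N = M"
    unfolding local_ring_def by blast
  interpret M: maximalideal M R by (rule M)
  have one: "\<one> \<notin> M" using M.I_notcarr M.one_imp_carrier by auto
  have unit: "\<exists>y\<in>carrier R. x \<otimes> y = \<one>" if x: "x \<in> carrier R" "x \<notin> M" for x
  proof (rule ccontr)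
    assume n: "\<not> ?thesis"
    have "\<one> \<notin> PIdl x"
      using n x(1) unfolding cgenideal_def by (auto simp: m_comm)
    then obtain N where "maximalideal N R" "PIdl x \<subseteq> N"
      using proper_ideal_in_maximal cgenideal_ideal[OF x(1)] by blast
    then show False using uni x cgenideal_self[OF x(1)] by blast
  qed
  have "\<zero> \<noteq> \<one>" using one M.zero_closed by metis
  moreover have "x \<notin> M \<or> \<one> \<oplus> \<ominus> x \<notin> M" if x: "x \<in> carrier R" for x
  proof (rule ccontr)
    assume "\<not> ?thesis"
    then have "(\<one> \<oplus> \<ominus> x) \<oplus> x \<in> M" using M.a_closed by blast
    moreover have "(\<one> \<oplus> \<ominus> x) \<oplus> x = \<one>" using x by (simp add: a_assoc l_neg)
    ultimately show False using one by simp
  qed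
  moreover have "\<one> \<oplus> \<ominus> x \<in> carrier R" if "x \<in> carrier R" for x using that by simp
  ultimately show ?A using unit by fast
qed

lemma is_model_Un: "is_model (T \<union> T') R \<longleftrightarrow> is_model T R \<and> is_model T' R"
  unfolding is_model_def by blast

theorem is_model_Art_iff:
  "is_model (Art l) R \<longleftrightarrow> artinian_local_ring R \<and> ring_length R \<le> enat l"
proof (cases "cring R")
  case False
  then show ?thesis
    unfolding Art_def is_model_Un is_model_cring_axioms artinian_local_ring_def local_ring_def
    by simp
next
  case True
  then interpret cring R .
  have st: "ring_structure R" using ring_structure_cring[OF True] .
  have ex: "\<exists>e :: nat \<Rightarrow> 'a. range e \<subseteq> carrier R" by (rule exI[of _ "\<lambda>_. \<one>\<^bsub>R\<^esub>"]) auto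
  have "is_model local_axioms_fo R \<longleftrightarrow> local_ring R"
    unfolding is_model_def local_axioms_fo_def Let_def local_axioms_iff[symmetric]
    using st ex by auto
  moreover have "is_model {length_axiom_fo l} R \<longleftrightarrow> ring_length R \<le> enat l"
    unfolding is_model_def using st ex sat_length_axiom_fo[OF zero_closed] length_axiom_iff by auto
  ultimately show ?thesis
    unfolding Art_def is_model_Un is_model_cring_axioms artinian_local_ring_def
    using True finite_length_imp_artinian by blast
qed

end

theory Submission
  imports Defs "HOL-Algebra.UnivPoly" "HOL-Algebra.Chinese_Remainder"
    "HOL-Computational_Algebra.Primes" "HOL-Library.Countable"
begin

text \<open>If \<open>R\<close> is existentially closed, then each of the three properties is obtained by embedding \<open>R\<close> in
  a model where its failure is visible: one with a root of a given monic polynomial modulo the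
  maximal ideal, one with a new square root of a socle element, and one in which two independent
  socle elements become proportional.

  Conversely let \<open>R\<close> be Gorenstein of length \<open>l\<close> with algebraically closed residue field, let \<open>S \<supseteq> R\<close> be
  a model and \<open>T\<close> an ultrapower of \<open>R\<close> with a large residue field. A composition series of \<open>R\<close> remains
  one in \<open>S\<close> and in \<open>T\<close>, so \<open>S\<close> and \<open>T\<close> are determined over \<open>R\<close> by their residue fields up to
  nilpotents. A maximal partial isomorphism between the residue fields, lifted to a subring of
  \<open>S \<times> T\<close> containing the diagonal of \<open>R\<close>, contains the graph of an embedding of \<open>S\<close> in \<open>T\<close> over \<open>R\<close>
  in residue characteristic \<open>0\<close>; in residue characteristic \<open>p\<close> it only does so for the subring generated
  over \<open>R\<close> by \<open>p\<^sup>m\<close>-th powers, but any finitely many elements of \<open>S\<close> lie in that subring for some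
  extension of \<open>S\<close>. Hence quantifier free formulas transfer from \<open>S\<close> to \<open>T\<close>, and from there to \<open>R\<close> by
  elementarity.\<close>

hide_const (open) Divisibility.prime

(* otherwise n-fold sums [n] \<cdot> x have a second parse as products of ideals *)
no_notation ideal_prod (infixl "\<cdot>\<index>" 80)

section \<open>Length of local rings\<close>

text \<open>What replaces a coefficient field is a dual system: a principal socle yields for every
  \<open>b j\<close> in the composition series an element of \<open>R\<close> that annihilates
  \<open>b 0\<close>, ..., \<open>b (j - 1)\<close> but not \<open>b j\<close>. Such relations hold
  in every extension, so the series cannot collapse there, and the bound on the length leaves no
  room for more. An element of the subring of \<open>S \<times> T\<close> is expanded along the
  series with coefficients in that subring. If one component vanishes, the top coefficient is a
  nonunit; if nonunits of the subring come from nonunits of \<open>R\<close>, the expansion shortens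
  by one step, and finally the element is zero.

  So residues must be lifted without creating new nonunits. Newton's iteration does this for
  separable equations. In residue characteristic \<open>p\<close> equations may be inseparable, but
  the \<open>p^l\<close>-th power of an element depends on its residue alone; iterating this power
  \<open>l\<close> times gives one subring per step of the series.

  The residue field of \<open>T\<close> must have more elements than there are polynomials over
  \<open>S\<close>, in order to offer an image for every transcendental residue.\<close>

definition nonunits :: "('a, 'm) ring_scheme \<Rightarrow> 'a set" where
  "nonunits R = carrier R - Units R"

lemma (in cring) unit_iff: "x \<in> Units R \<longleftrightarrow> x \<in> carrier R \<and> (\<exists>y\<in>carrier R. x \<otimes> y = \<one>)"
  unfolding Units_def by (auto simp: m_comm)

lemma (in cring) nakayama_identity:
  assumes "x \<in> carrier R" "r \<in> carrier R" "a \<in> carrier R" "b \<in> carrier R" "b = x \<oplus> r \<otimes> (a \<otimes> b)"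
  shows "(\<one> \<ominus> r \<otimes> a) \<otimes> b = x"
proof -
  have "(\<one> \<ominus> r \<otimes> a) \<otimes> b = b \<ominus> r \<otimes> (a \<otimes> b)" using assms(1-4) by algebra
  also have "\<dots> = (x \<oplus> r \<otimes> (a \<otimes> b)) \<ominus> r \<otimes> (a \<otimes> b)" using assms(5) by simp
  also have "\<dots> = x" using assms(1-4) by algebra
  finally show ?thesis .
qed

lemma (in cring) nonunit_mult: "x \<in> nonunits R \<Longrightarrow> y \<in> carrier R \<Longrightarrow> x \<otimes> y \<in> nonunits R"
  by (metis DiffD1 DiffD2 DiffI m_assoc m_closed nonunits_def unit_iff)

locale loc_ring = cring +
  assumes local: "local_ring R"

lemma loc_ringI: "local_ring R \<Longrightarrow> loc_ring R"
  unfolding loc_ring_def loc_ring_axioms_def local_ring_def by blast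

lemma (in cring) maximal_subset_nonunits: "maximalideal M R \<Longrightarrow> M \<subseteq> nonunits R"
proof
  fix x assume M: "maximalideal M R" and x: "x \<in> M"
  interpret M: maximalideal M R by fact
  show "x \<in> nonunits R"
    unfolding nonunits_def
  proof (intro DiffI notI)
    assume "x \<in> Units R"
    then obtain y where "y \<in> carrier R" "x \<otimes> y = \<one>" by (auto simp: unit_iff)
    then have "\<one> \<in> M" using M.I_r_closed[OF x] by metis
    then show False using M.I_notcarr M.one_imp_carrier by auto
  qed (use x in simp)
qed

lemma (in cring) nonunit_in_maximal:
  assumes "x \<in> nonunits R"
  obtains M where "maximalideal M R" "x \<in> M"
proof -
  have x: "x \<in> carrier R" "x \<notin> Units R" using assms by (auto simp: nonunits_def)
  have "\<one> \<notin> PIdl x"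
    using x unfolding cgenideal_def by (auto simp: unit_iff m_comm)
  then show ?thesis
    using proper_ideal_in_maximal[OF cgenideal_ideal[OF x(1)]] cgenideal_self[OF x(1)] that by blast
qed

context loc_ring
begin

lemma maximalideal_iff: "maximalideal M R \<longleftrightarrow> M = nonunits R"
proof -
  obtain M0 where M0: "maximalideal M0 R" and u: "\<And>N. maximalideal N R \<Longrightarrow> N = M0"
    using local unfolding local_ring_def by blast
  have "nonunits R \<subseteq> M0"
    using u nonunit_in_maximal by (metis subsetI)
  then have "M0 = nonunits R" using maximal_subset_nonunits[OF M0] by blast
  then show ?thesis using u M0 by blast
qed

lemma max_ideal_eq: "max_ideal R = nonunits R"
  unfolding max_ideal_def maximalideal_iff by simp

lemma one_neq_zero: "\<one> \<noteq> \<zero>"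
proof
  assume "\<one> = \<zero>"
  then have "carrier R = {\<zero>}" using carrier_one_zero by simp
  moreover have "maximalideal (nonunits R) R" by (simp add: maximalideal_iff)
  moreover have "\<zero> \<in> nonunits R"
    using additive_subgroup.zero_closed[OF ideal.axioms(1)[OF maximalideal.axioms(1)[OF calculation(2)]]] .
  ultimately show False using \<open>\<one> = \<zero>\<close> by (metis DiffD2 Units_one_closed nonunits_def)
qed

sublocale N: maximalideal "nonunits R" R
  by (simp add: maximalideal_iff)

lemma nonunitI: "x \<in> carrier R \<Longrightarrow> x \<notin> Units R \<Longrightarrow> x \<in> nonunits R"
  by (simp add: nonunits_def)

lemma unit_not_nonunit: "x \<in> Units R \<Longrightarrow> x \<notin> nonunits R"
  by (simp add: nonunits_def)

lemma nonunit_carrier [simp]: "x \<in> nonunits R \<Longrightarrow> x \<in> carrier R"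
  by (simp add: nonunits_def)

lemma zero_nonunit [simp]: "\<zero> \<in> nonunits R"
  by (rule N.zero_closed)

lemma one_not_nonunit [simp]: "\<one> \<notin> nonunits R"
  by (simp add: unit_not_nonunit)

lemma nonunit_iff: "x \<in> carrier R \<Longrightarrow> x \<in> nonunits R \<longleftrightarrow> x \<notin> Units R"
  using nonunitI unit_not_nonunit by blast

lemma nonunit_minus_closed: "x \<in> nonunits R \<Longrightarrow> y \<in> nonunits R \<Longrightarrow> x \<ominus> y \<in> nonunits R"
  by (simp add: a_minus_def)

lemma unit_mult_nonunit_iff:
  assumes "x \<in> Units R" "y \<in> carrier R"
  shows "x \<otimes> y \<in> nonunits R \<longleftrightarrow> y \<in> nonunits R"
proof
  assume "x \<otimes> y \<in> nonunits R"
  then have "inv x \<otimes> (x \<otimes> y) \<in> nonunits R" using assms by (metis N.I_l_closed Units_inv_closed)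
  moreover have "inv x \<otimes> (x \<otimes> y) = y" using assms by (metis Units_closed Units_inv_closed Units_l_inv l_one m_assoc)
  ultimately show "y \<in> nonunits R" by simp
qed (use assms in \<open>auto intro: N.I_l_closed\<close>)

lemma nonunit_mult_iff:
  assumes "x \<in> carrier R" "y \<in> carrier R"
  shows "x \<otimes> y \<in> nonunits R \<longleftrightarrow> x \<in> nonunits R \<or> y \<in> nonunits R"
  using assms unit_mult_nonunit_iff[of x y] nonunit_iff nonunit_mult N.I_l_closed by blast

lemma one_minus_nonunit: "x \<in> nonunits R \<Longrightarrow> \<one> \<ominus> x \<in> Units R"
proof (rule ccontr)
  assume x: "x \<in> nonunits R" and "\<one> \<ominus> x \<notin> Units R"
  then have "\<one> \<ominus> x \<in> nonunits R" using x by (intro nonunitI) auto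
  then have "(\<one> \<ominus> x) \<oplus> x \<in> nonunits R" using x by simp
  moreover have "x \<in> carrier R" using x by simp
  then have "(\<one> \<ominus> x) \<oplus> x = \<one>" by algebra
  ultimately show False by simp
qed

lemma unit_plus_nonunit:
  assumes "u \<in> Units R" "x \<in> nonunits R"
  shows "u \<oplus> x \<in> Units R"
proof (rule ccontr)
  assume "u \<oplus> x \<notin> Units R"
  then have "u \<oplus> x \<in> nonunits R" using assms by (intro nonunitI) auto
  then have "(u \<oplus> x) \<ominus> x \<in> nonunits R" using assms(2) nonunit_minus_closed by blast
  moreover have "u \<in> carrier R" "x \<in> carrier R" using assms by auto
  then have "(u \<oplus> x) \<ominus> x = u" by algebra
  ultimately show False using assms(1) unit_not_nonunit by simp
qed

end

text \<open>The coefficients are restricted to a set \<open>G\<close> because the graph argument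
  expands elements of a product ring with coefficients in a subring; for
  \<open>G = carrier R\<close> these are the ideals of the chain.\<close>

primrec lspan :: "('a, 'm) ring_scheme \<Rightarrow> 'a set \<Rightarrow> (nat \<Rightarrow> 'a) \<Rightarrow> nat \<Rightarrow> 'a set" where
  "lspan R G b 0 = {\<zero>\<^bsub>R\<^esub>}"
| "lspan R G b (Suc j) = {x \<oplus>\<^bsub>R\<^esub> g \<otimes>\<^bsub>R\<^esub> b j | x g. x \<in> lspan R G b j \<and> g \<in> G}"

lemma (in cring) lspan_subset:
  "range b \<subseteq> A \<Longrightarrow> G \<subseteq> A \<Longrightarrow> subring A R \<Longrightarrow> lspan R G b j \<subseteq> A"
proof (induction j)
  case 0 then show ?case using subringE(2) by auto
next
  case (Suc j)
  have "x \<oplus> g \<otimes> b j \<in> A" if "x \<in> lspan R G b j" "g \<in> G" for x g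
    using Suc that subringE(6)[OF Suc.prems(3)] subringE(7)[OF Suc.prems(3)] by blast
  then show ?case by auto
qed

lemma (in cring) lspan_ideal:
  assumes b: "range b \<subseteq> carrier R"
  shows "ideal (lspan R (carrier R) b j) R"
proof (induction j)
  case 0 show ?case using zeroideal by simp
next
  case (Suc j)
  let ?J = "lspan R (carrier R) b (Suc j)"
  interpret J: ideal "lspan R (carrier R) b j" R by fact
  have bc: "b j \<in> carrier R" using b by auto
  have eq: "?J = lspan R (carrier R) b j <+> PIdl (b j)"
    by (auto simp: set_add_def set_mult_def cgenideal_def)
  show ?case unfolding eq
    using add_ideals[OF Suc cgenideal_ideal[OF bc]] .
qed

lemma (in cring) lspan_Suc_mono:
  assumes "G \<subseteq> carrier R" "range b \<subseteq> carrier R" "\<zero> \<in> G"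
  shows "lspan R G b j \<subseteq> lspan R G b (Suc j)"
proof
  fix x assume x: "x \<in> lspan R G b j"
  have "x \<in> carrier R" using lspan_subset[OF assms(2,1) carrier_is_subring] x by blast
  moreover have "b j \<in> carrier R" using assms(2) by auto
  ultimately have "x = x \<oplus> \<zero> \<otimes> b j" by simp
  then show "x \<in> lspan R G b (Suc j)" using x assms(3) by auto
qed

lemma lspan_mono: "G \<subseteq> H \<Longrightarrow> lspan R G b j \<subseteq> lspan R H b j"
  by (induction j) auto

lemma (in cring) mem_lspan_Suc:
  assumes "range b \<subseteq> carrier R"
  shows "b j \<in> lspan R (carrier R) b (Suc j)"
proof -
  have "b j \<in> carrier R" using assms by auto
  then have "b j = \<zero> \<oplus> \<one> \<otimes> b j" by simp
  then show ?thesis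
    using additive_subgroup.zero_closed[OF ideal.axioms(1)[OF lspan_ideal[OF assms, of j]]] by auto
qed

definition strict_seq :: "('a, 'm) ring_scheme \<Rightarrow> (nat \<Rightarrow> 'a) \<Rightarrow> nat \<Rightarrow> bool" where
  "strict_seq R b n \<longleftrightarrow> range b \<subseteq> carrier R \<and> (\<forall>j<n. b j \<notin> lspan R (carrier R) b j)"

text \<open>Each factor of the chain of spans is zero or simple, and the chain reaches the whole
  ring. Strictness is kept apart in \<open>strict_seq\<close>, so that an upper bound for the length
  can be read off a chain some of whose steps may collapse.\<close>

definition comp_seq :: "('a, 'm) ring_scheme \<Rightarrow> (nat \<Rightarrow> 'a) \<Rightarrow> nat \<Rightarrow> bool" where
  "comp_seq R b n \<longleftrightarrow> range b \<subseteq> carrier R \<and>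
     (\<forall>j<n. \<forall>a\<in>nonunits R. a \<otimes>\<^bsub>R\<^esub> b j \<in> lspan R (carrier R) b j) \<and>
     \<one>\<^bsub>R\<^esub> \<in> lspan R (carrier R) b n"

lemma (in cring) strict_seq_chain:
  assumes "strict_seq R b n" "j < n"
  shows "lspan R (carrier R) b j \<subset> lspan R (carrier R) b (Suc j)"
  using assms mem_lspan_Suc[of b j] lspan_Suc_mono[OF order.refl _ zero_closed, of b j]
  unfolding strict_seq_def by blast

lemma (in cring) strict_seq_le_length:
  assumes "strict_seq R b n"
  shows "enat n \<le> ring_length R"
proof -
  have "\<forall>i\<le>n. ideal (lspan R (carrier R) b i) R"
    using lspan_ideal assms unfolding strict_seq_def by blast
  moreover have "\<forall>i<n. lspan R (carrier R) b i \<subset> lspan R (carrier R) b (Suc i)"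
    using strict_seq_chain[OF assms] by blast
  ultimately show ?thesis unfolding ring_length_def by (intro Sup_upper) blast
qed

lemma (in cring) ex_strict_seq:
  assumes "ring_length R = enat n"
  shows "\<exists>b. strict_seq R b n"
proof (cases n)
  case 0
  then show ?thesis unfolding strict_seq_def by (intro exI[of _ "\<lambda>_. \<zero>"]) auto
next
  case (Suc m)
  then have "\<not> ring_length R \<le> enat m" using assms by simp
  then obtain I where I: "\<And>i. i \<le> n \<Longrightarrow> ideal (I i) R" "\<And>i. i < n \<Longrightarrow> I i \<subset> I (Suc i)"
    unfolding ring_length_le_iff Suc less_Suc_eq_le by blast
  have "\<forall>i. \<exists>x. if i < n then x \<in> I (Suc i) - I i else x = \<zero>" using I(2) by auto
  then obtain b where b: "\<And>i. if i < n then b i \<in> I (Suc i) - I i else b i = \<zero>" by metis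
  have bc: "range b \<subseteq> carrier R"
  proof (clarify)
    fix i
    show "b i \<in> carrier R"
      using b[of i] I(1)[of "Suc i"] ideal.Icarr by (cases "i < n") fastforce+
  qed
  have "lspan R (carrier R) b j \<subseteq> I j" if "j \<le> n" for j
    using that
  proof (induction j)
    case 0
    show ?case using I(1)[of 0] by (simp add: additive_subgroup.zero_closed ideal.axioms(1))
  next
    case (Suc j)
    interpret J: ideal "I (Suc j)" R using I(1) Suc.prems by simp
    have "lspan R (carrier R) b j \<subseteq> I (Suc j)" using Suc I(2)[of j] by auto
    moreover have "b j \<in> I (Suc j)" using b[of j] Suc.prems by simp
    ultimately show ?case using J.I_l_closed J.a_closed by auto
  qed
  then have "strict_seq R b n"
    unfolding strict_seq_def using bc b by (metis DiffD2 less_imp_le subsetD)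
  then show ?thesis by blast
qed

text \<open>Inserting \<open>K\<close> after position \<open>j\<close> would give a chain with
  \<open>l + 1\<close> strict steps.\<close>

lemma (in cring) strict_seq_no_between:
  assumes b: "strict_seq R b l" and len: "ring_length R \<le> enat l" and K: "ideal K R" and j: "j < l"
    and sub: "lspan R (carrier R) b j \<subset> K" "K \<subset> lspan R (carrier R) b (Suc j)"
  shows False
proof -
  let ?J = "lspan R (carrier R) b"
  let ?I = "\<lambda>k. if k \<le> j then ?J k else if k = Suc j then K else ?J (k - 1)"
  have 1: "ideal (?I i) R" for i using K lspan_ideal b unfolding strict_seq_def by auto
  have 2: "?I i \<subset> ?I (Suc i)" if i: "i \<le> l" for i
  proof -
    consider "i < j" | "i = j" | "i = Suc j" | "i > Suc j" by linarith
    then show ?thesis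
    proof cases
      case 4
      then have "?J (i - 1) \<subset> ?J (Suc (i - 1))" using strict_seq_chain[OF b, of "i - 1"] i by simp
      then show ?thesis using 4 by simp
    qed (use strict_seq_chain[OF b] j sub in auto)
  qed
  have "(\<forall>i\<le>Suc l. ideal (?I i) R) \<and> (\<forall>i\<le>l. ?I i \<subset> ?I (Suc i))" using 1 2 by blast
  then show False using len unfolding ring_length_le_iff by (elim notE) (rule exI[of _ ?I])
qed

text \<open>A strict sequence of maximal length cannot be refined. If a nonunit \<open>a\<close> did
  not push \<open>b j\<close> into the span of its predecessors, adjoining
  \<open>a \<otimes> b j\<close> to that span would give an ideal strictly between two neighbours;
  it misses \<open>b j\<close> by Nakayama's argument. If the last span were proper,
  \<open>\<one>\<close> would prolong the sequence.\<close>

lemma (in loc_ring) strict_seq_imp_comp_seq: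
  assumes b: "strict_seq R b l" and len: "ring_length R \<le> enat l"
  shows "comp_seq R b l"
proof -
  let ?J = "lspan R (carrier R) b"
  have bc: "range b \<subseteq> carrier R" using b unfolding strict_seq_def by blast
  have step: "a \<otimes> b j \<in> ?J j" if j: "j < l" and a: "a \<in> nonunits R" for a j
  proof (rule ccontr)
    assume n: "a \<otimes> b j \<notin> ?J j"
    let ?b = "b(j := a \<otimes> b j)"
    have bj: "b j \<in> carrier R" using bc by auto
    have ac: "a \<in> carrier R" using a by simp
    have bc': "range ?b \<subseteq> carrier R" using bc bj ac by auto
    have same: "lspan R (carrier R) ?b k = ?J k" if "k \<le> j" for k
      using that by (induction k) auto
    let ?K = "lspan R (carrier R) ?b (Suc j)"
    interpret J: ideal "?J j" R using lspan_ideal bc by blast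
    have "lspan R (carrier R) ?b j \<subseteq> ?K"
      by (rule lspan_Suc_mono[OF order.refl bc' zero_closed])
    moreover have "?b j \<in> ?K" by (rule mem_lspan_Suc[OF bc'])
    ultimately have "?J j \<subset> ?K" using same[of j] n by (simp only: fun_upd_same) blast
    moreover have "?K \<subset> ?J (Suc j)"
    proof
      show "?K \<subseteq> ?J (Suc j)"
      proof
        fix z assume "z \<in> ?K"
        then obtain x r where "x \<in> ?J j" "r \<in> carrier R" "z = x \<oplus> r \<otimes> (a \<otimes> b j)"
          using same by auto
        then show "z \<in> ?J (Suc j)" using ac bj by (auto simp: m_assoc[symmetric])
      qed
      have "b j \<notin> ?K"
      proof
        assume "b j \<in> ?K"
        then obtain x r where x: "x \<in> ?J j" "r \<in> carrier R" "b j = x \<oplus> r \<otimes> (a \<otimes> b j)"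
          using same by auto
        have xc: "x \<in> carrier R" using x by simp
        have u: "\<one> \<ominus> r \<otimes> a \<in> Units R"
          by (rule one_minus_nonunit) (use a x(2) in \<open>simp add: N.I_l_closed\<close>)
        have "(\<one> \<ominus> r \<otimes> a) \<otimes> b j = x"
          using nakayama_identity[OF xc x(2) ac bj x(3)] .
        then have "inv (\<one> \<ominus> r \<otimes> a) \<otimes> ((\<one> \<ominus> r \<otimes> a) \<otimes> b j) \<in> ?J j"
          using u x(1) J.I_l_closed by auto
        then have "b j \<in> ?J j" using u bj by (metis Units_closed Units_inv_closed Units_l_inv l_one m_assoc)
        then show False using b j unfolding strict_seq_def by blast
      qed
      then show "?K \<noteq> ?J (Suc j)" using mem_lspan_Suc[OF bc] by blast
    qed
    ultimately show False
      using strict_seq_no_between[OF b len lspan_ideal[OF bc'] j] by blast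
  qed
  have "\<one> \<in> ?J l"
  proof (rule ccontr)
    assume n: "\<one> \<notin> ?J l"
    let ?b = "b(l := \<one>)"
    have same: "lspan R (carrier R) ?b k = ?J k" if "k \<le> l" for k
      using that by (induction k) auto
    have "strict_seq R ?b (Suc l)"
      using b n same unfolding strict_seq_def by (auto simp: less_Suc_eq)
    then show False using strict_seq_le_length len by (meson Suc_n_not_le_n enat_ord_simps(1) order.trans)
  qed
  then show ?thesis using step bc unfolding comp_seq_def by blast
qed

text \<open>Jordan--Hoelder: an ideal \<open>I\<close> is determined among the ideals above it by the set of those
  \<open>j\<close> for which \<open>I\<close> meets \<open>J\<^sub>j\<^sub>+\<^sub>1\<close> outside \<open>J\<^sub>j\<close>, where \<open>J\<^sub>j\<close> is the span of \<open>b\<^sub>0, \<dots>, b\<^sub>j\<^sub>-\<^sub>1\<close>.\<close>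

lemma (in loc_ring) comp_seq_length_le:
  assumes b: "comp_seq R b n"
  shows "ring_length R \<le> enat (card {j. j < n \<and> b j \<notin> lspan R (carrier R) b j})"
  unfolding ring_length_def
proof (rule Sup_least)
  let ?J = "lspan R (carrier R) b"
  let ?A = "{j. j < n \<and> b j \<notin> ?J j}"
  have bc: "range b \<subseteq> carrier R" using b unfolding comp_seq_def by blast
  fix x assume "x \<in> {enat n | n. \<exists>I. (\<forall>i\<le>n. ideal (I i) R) \<and> (\<forall>i<n. I i \<subset> I (Suc i))}"
  then obtain N I where xN: "x = enat N"
    and I: "\<forall>i\<le>N. ideal (I i) R" "\<forall>i<N. I i \<subset> I (Suc i)" by blast
  let ?D = "\<lambda>i. {j. j < n \<and> (\<exists>x\<in>I i. x \<in> ?J (Suc j) \<and> x \<notin> ?J j)}"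
  have DA: "?D i \<subseteq> ?A" if "i \<le> N" for i
  proof
    fix j assume "j \<in> ?D i"
    then obtain x y g where x: "j < n" "x \<notin> ?J j" "x = y \<oplus> g \<otimes> b j" "y \<in> ?J j" "g \<in> carrier R"
      by auto
    interpret J: ideal "?J j" R using lspan_ideal bc by blast
    have "b j \<notin> ?J j" using x J.a_closed J.I_l_closed by blast
    then show "j \<in> ?A" using x(1) by simp
  qed
  have strict: "?D i \<subset> ?D (Suc i)" if i: "i < N" for i
  proof
    show sub: "?D i \<subseteq> ?D (Suc i)" using I(2) i by blast
    show "?D i \<noteq> ?D (Suc i)"
    proof
      assume eq: "?D i = ?D (Suc i)"
      interpret I: ideal "I i" R using I(1) i by simp
      interpret I': ideal "I (Suc i)" R using I(1) i by simp
      have "x \<in> I i" if "j \<le> n" "x \<in> I (Suc i)" "x \<in> ?J j" for j x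
        using that
      proof (induction j arbitrary: x)
        case 0 then show ?case using I.zero_closed by simp
      next
        case (Suc j)
        interpret J: ideal "?J j" R using lspan_ideal bc by blast
        show ?case
        proof (cases "x \<in> ?J j")
          case True then show ?thesis using Suc by simp
        next
          case False
          have bj: "b j \<in> carrier R" using bc by auto
          have "j \<in> ?D (Suc i)" using False Suc.prems by auto
          then have "j \<in> ?D i" using eq by simp
          then obtain y where y: "y \<in> I i" "y \<in> ?J (Suc j)" "y \<notin> ?J j" by auto
          obtain y' u where yu: "y = y' \<oplus> u \<otimes> b j" "y' \<in> ?J j" "u \<in> carrier R" using y(2) by auto
          obtain x' v where xv: "x = x' \<oplus> v \<otimes> b j" "x' \<in> ?J j" "v \<in> carrier R" using Suc.prems by auto
          \<comment> \<open>Nonunits kill the quotient of the two spans, so \<open>y\<close>, which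
            is nonzero there, has a unit coefficient at \<open>b j\<close>. A multiple of
            \<open>y\<close> cancels the coefficient of \<open>x\<close>, and the difference
            \<open>z\<close> is covered by the induction hypothesis.\<close>
          have "u \<in> Units R"
          proof (rule ccontr)
            assume "u \<notin> Units R"
            then have "u \<otimes> b j \<in> ?J j"
              using b nonunitI[OF yu(3)] Suc.prems(1) unfolding comp_seq_def by simp
            then show False using yu y(3) by simp
          qed
          then have iu: "inv u \<in> carrier R" "inv u \<otimes> u = \<one>" by simp_all
          obtain w where w: "w \<in> carrier R" "w \<otimes> u = \<one>" using iu by blast
          obtain B where B: "B = b j" by simp
          define z where "z = x \<ominus> v \<otimes> w \<otimes> y"
          have c: "x \<in> carrier R" "y \<in> carrier R" "x' \<in> carrier R" "y' \<in> carrier R" "B \<in> carrier R"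
            using y Suc.prems J.Icarr xv yu bj B by auto
          have "z = x' \<ominus> v \<otimes> w \<otimes> y' \<oplus> (v \<otimes> B \<ominus> v \<otimes> (w \<otimes> u) \<otimes> B)"
            unfolding z_def xv(1) yu(1) B[symmetric] using c(3-5) w(1) yu(3) xv(3) by algebra
          also have "\<dots> = x' \<ominus> v \<otimes> w \<otimes> y'"
            unfolding w(2) using c(3-5) w(1) yu(3) xv(3) by algebra
          finally have "z \<in> ?J j"
            using xv yu w(1) J.I_l_closed by (simp add: a_minus_def)
          moreover have "y \<in> I (Suc i)" using y(1) I(2) i by blast
          then have "z \<in> I (Suc i)"
            using Suc.prems(2) xv(3) w(1) I'.I_l_closed[of y "v \<otimes> w"]
            by (auto simp: a_minus_def z_def)
          ultimately have "z \<in> I i" using Suc by simp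
          then have "z \<oplus> v \<otimes> w \<otimes> y \<in> I i"
            using y(1) xv(3) w(1) I.I_l_closed[of y "v \<otimes> w"] by simp
          moreover have "z \<oplus> v \<otimes> w \<otimes> y = x" unfolding z_def using c w(1) xv(3) by algebra
          ultimately show ?thesis by simp
        qed
      qed
      moreover have "carrier R \<subseteq> ?J n"
        using b ideal.one_imp_carrier[OF lspan_ideal[OF bc, of n]] unfolding comp_seq_def by simp
      ultimately have "I (Suc i) \<subseteq> I i" using I'.a_subset by blast
      then show False using I(2) i by blast
    qed
  qed
  have fin: "finite ?A" by simp
  have "i \<le> card (?D i)" if "i \<le> N" for i
    using that
  proof (induction i)
    case (Suc i)
    have "card (?D i) < card (?D (Suc i))"
      using strict[of i] Suc.prems DA[of "Suc i"] finite_subset[OF _ fin] by (intro psubset_card_mono) auto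
    then show ?case using Suc by simp
  qed simp
  then have "N \<le> card (?D N)" by simp
  also have "\<dots> \<le> card ?A" using DA[of N] by (intro card_mono fin) simp
  finally show "x \<le> enat (card ?A)" using xN by simp
qed

lemma (in loc_ring) ex_comp_seq:
  assumes "ring_length R = enat n"
  obtains b where "strict_seq R b n" "comp_seq R b n"
  using ex_strict_seq[OF assms] strict_seq_imp_comp_seq[of _ n] assms by auto

text \<open>The powers of \<open>a\<close> are listed by decreasing exponent, so the length axiom
  writes some \<open>a [^] (l - i)\<close> as a combination of higher powers, hence as
  \<open>t \<otimes> a\<close> times itself, where \<open>\<one> \<ominus> t \<otimes> a\<close> is
  a unit. The exponent is the same for all \<open>a\<close>, so in formulas being a nonunit becomes
  the equation \<open>x [^] l = \<zero>\<close>.\<close>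

lemma (in cring) length_nilpotent:
  assumes len: "ring_length R \<le> enat l" and loc: "local_ring R" and a: "a \<in> nonunits R"
  shows "a [^] l = \<zero>"
proof -
  interpret loc_ring R using loc by (rule loc_ringI)
  have ac: "a \<in> carrier R" using a by simp
  let ?f = "\<lambda>i. a [^] (l - i)"
  have "range ?f \<subseteq> carrier R" using ac by auto
  then obtain i r where i: "i \<le> l" and r: "range r \<subseteq> carrier R" and eq: "?f i = lincomb R r ?f i"
    using len unfolding length_axiom_iff[symmetric] by blast
  have "\<exists>t\<in>carrier R. lincomb R r ?f k = t \<otimes> (a \<otimes> a [^] (l - i))" if "k \<le> i" for k
    using that
  proof (induction k)
    case 0
    have "lincomb R r ?f 0 = \<zero> \<otimes> (a \<otimes> a [^] (l - i))" using ac by simp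
    then show ?case by blast
  next
    case (Suc k)
    then obtain t where t: "t \<in> carrier R" "lincomb R r ?f k = t \<otimes> (a \<otimes> a [^] (l - i))" by auto
    have "l - k = (i - Suc k) + Suc (l - i)" using Suc.prems i by simp
    then have e: "a [^] (l - k) = a [^] (i - Suc k) \<otimes> (a \<otimes> a [^] (l - i))"
      using ac by (metis nat_pow_Suc2 nat_pow_mult)
    obtain s where rk: "s = r k" "s \<in> carrier R" using r by auto
    obtain p where p: "p = a [^] (i - Suc k)" "p \<in> carrier R" using ac by simp
    obtain q where q: "q = a \<otimes> a [^] (l - i)" "q \<in> carrier R" using ac by simp
    have "t \<otimes> q \<oplus> s \<otimes> (p \<otimes> q) = (t \<oplus> s \<otimes> p) \<otimes> q"
      using t(1) rk(2) p(2) q(2) by algebra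
    then have "lincomb R r ?f (Suc k) = (t \<oplus> s \<otimes> p) \<otimes> q"
      using t(2) e p(1) q(1) rk(1) by simp
    then show ?case using t(1) rk(2) p(2) q(1) by blast
  qed
  then obtain t where t: "t \<in> carrier R" "a [^] (l - i) = t \<otimes> (a \<otimes> a [^] (l - i))" using eq by auto
  obtain q where q: "q = a [^] (l - i)" "q \<in> carrier R" using ac by simp
  have "(\<one> \<ominus> t \<otimes> a) \<otimes> q = q \<ominus> t \<otimes> (a \<otimes> q)" using t(1) ac q(2) by algebra
  also have "\<dots> = \<zero>" using t(2) q by (simp add: a_minus_def r_neg)
  finally have z: "(\<one> \<ominus> t \<otimes> a) \<otimes> q = \<zero>" .
  have "\<one> \<ominus> t \<otimes> a \<in> Units R"
    using a t(1) by (intro one_minus_nonunit N.I_l_closed)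
  then have "q = \<zero>" using z q(2) by (metis Units_closed Units_l_cancel r_null zero_closed)
  moreover have "a [^] l = a [^] (l - i) \<otimes> a [^] i" using ac i by (simp add: nat_pow_mult)
  ultimately show ?thesis using q ac by simp
qed

section \<open>Elementary substructures and ultrapowers\<close>

primrec tbound :: "rterm \<Rightarrow> nat" where
  "tbound (TVar n) = Suc n"
| "tbound TZero = 0"
| "tbound TOne = 0"
| "tbound (TNeg s) = tbound s"
| "tbound (TAdd s t) = max (tbound s) (tbound t)"
| "tbound (TMul s t) = max (tbound s) (tbound t)"

text \<open>A quantifier does not lower the bound. It only has to be an upper bound for the
  variables that matter, so that an assignment can be replaced by a finite list.\<close>

primrec fbound :: "rform \<Rightarrow> nat" where
  "fbound (FEq s t) = max (tbound s) (tbound t)"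
| "fbound (FNot \<phi>) = fbound \<phi>"
| "fbound (FAnd \<phi> \<psi>) = max (fbound \<phi>) (fbound \<psi>)"
| "fbound (FOr \<phi> \<psi>) = max (fbound \<phi>) (fbound \<psi>)"
| "fbound (FEx n \<phi>) = fbound \<phi>"
| "fbound (FAll n \<phi>) = fbound \<phi>"

lemma teval_cong: "(\<And>n. n < tbound t \<Longrightarrow> e n = e' n) \<Longrightarrow> teval R e t = teval R e' t"
  by (induction t) auto

lemma sat_cong: "(\<And>n. n < fbound \<phi> \<Longrightarrow> e n = e' n) \<Longrightarrow> sat R e \<phi> = sat R e' \<phi>"
proof (induction \<phi> arbitrary: e e')
  case (FEq s t)
  have "teval R e s = teval R e' s" "teval R e t = teval R e' t"
    by (rule teval_cong; simp add: FEq)+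
  then show ?case by simp
next
  case (FNot \<phi>)
  have "sat R e \<phi> = sat R e' \<phi>" by (rule FNot.IH) (simp add: FNot.prems)
  then show ?case by simp
next
  case (FAnd \<phi> \<psi>)
  have "sat R e \<phi> = sat R e' \<phi>" by (rule FAnd.IH) (simp add: FAnd.prems)
  moreover have "sat R e \<psi> = sat R e' \<psi>" by (rule FAnd.IH) (simp add: FAnd.prems)
  ultimately show ?case by simp
next
  case (FOr \<phi> \<psi>)
  have "sat R e \<phi> = sat R e' \<phi>" by (rule FOr.IH) (simp add: FOr.prems)
  moreover have "sat R e \<psi> = sat R e' \<psi>" by (rule FOr.IH) (simp add: FOr.prems)
  ultimately show ?case by simp
next
  case (FEx n \<phi>)
  have "sat R (e(n := a)) \<phi> = sat R (e'(n := a)) \<phi>" for a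
    by (rule FEx.IH) (simp add: FEx.prems)
  then show ?case by simp
next
  case (FAll n \<phi>)
  have "sat R (e(n := a)) \<phi> = sat R (e'(n := a)) \<phi>" for a
    by (rule FAll.IH) (simp add: FAll.prems)
  then show ?case by simp
qed

lemma (in cring) teval_closed: "range e \<subseteq> carrier R \<Longrightarrow> teval R e t \<in> carrier R"
  by (induction t) auto

lemma ring_hom_minus:
  assumes "cring R" "cring S" "h \<in> ring_hom R S" "x \<in> carrier R"
  shows "h (\<ominus>\<^bsub>R\<^esub> x) = \<ominus>\<^bsub>S\<^esub> h x"
proof -
  interpret ring_hom_cring R S h
    using assms unfolding ring_hom_cring_def ring_hom_cring_axioms_def by blast
  show ?thesis using assms(4) by simp
qed

lemma teval_hom:
  assumes "cring R" "cring S" "h \<in> ring_hom R S" "range e \<subseteq> carrier R"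
  shows "teval S (h \<circ> e) t = h (teval R e t)"
proof -
  interpret R: cring R by fact
  note [simp] = ring_hom_closed[OF assms(3)] ring_hom_mult[OF assms(3)] ring_hom_add[OF assms(3)]
    ring_hom_one[OF assms(3)] ring_hom_minus[OF assms(1-3)]
    R.teval_closed[OF assms(4)]
  have z: "h \<zero>\<^bsub>R\<^esub> = \<zero>\<^bsub>S\<^esub>"
    using ring_hom_zero[OF assms(3)] cring.axioms(1)[OF assms(1)] cring.axioms(1)[OF assms(2)] by blast
  show ?thesis by (induction t) (use z in auto)
qed

subsection \<open>The downward Loewenheim--Skolem theorem\<close>

instance rterm :: countable by countable_datatype
instance rform :: countable by countable_datatype

text \<open>Terms over the Skolem functions of all formulas, with generators from a set and countably many
  further constants; a tuple of arguments is turned into an assignment by padding it with zeros.\<close>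

datatype (sk_set: 'c) sk = Base 'c | Extra nat | Sk rform nat "'c sk list"

definition padded :: "'a \<Rightarrow> 'a list \<Rightarrow> nat \<Rightarrow> 'a" where
  "padded z xs i = (if i < length xs then xs ! i else z)"

definition skolem :: "('a, 'm) ring_scheme \<Rightarrow> rform \<Rightarrow> nat \<Rightarrow> (nat \<Rightarrow> 'a) \<Rightarrow> 'a" where
  "skolem S \<phi> n e = (if \<exists>a\<in>carrier S. sat S (e(n := a)) \<phi>
     then SOME a. a \<in> carrier S \<and> sat S (e(n := a)) \<phi> else \<zero>\<^bsub>S\<^esub>)"

primrec sk_val :: "('a, 'm) ring_scheme \<Rightarrow> ('c \<Rightarrow> 'a) \<Rightarrow> (nat \<Rightarrow> 'a) \<Rightarrow> 'c sk \<Rightarrow> 'a" where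
  "sk_val S h Y (Base c) = h c"
| "sk_val S h Y (Extra n) = Y n"
| "sk_val S h Y (Sk \<phi> n ts) = skolem S \<phi> n (padded \<zero>\<^bsub>S\<^esub> (map (sk_val S h Y) ts))"

text \<open>The first component is a tag taken from a copy of the naturals in \<open>'b\<close>;
  with injective \<open>p\<close> and \<open>\<nu>\<close> the two list constructors cannot
  collide.\<close>

primrec list_code :: "('b \<times> 'b \<Rightarrow> 'b) \<Rightarrow> (nat \<Rightarrow> 'b) \<Rightarrow> 'b list \<Rightarrow> 'b" where
  "list_code p \<nu> [] = p (\<nu> 0, \<nu> 0)"
| "list_code p \<nu> (x # xs) = p (\<nu> 1, p (x, list_code p \<nu> xs))"

text \<open>This replaces a cardinality computation for the Skolem hull: the hull is copied into
  \<open>'b\<close> along the codes of its terms. The numbers 0, 1 and 2 tag the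
  constructors.\<close>

primrec sk_code :: "('b \<times> 'b \<Rightarrow> 'b) \<Rightarrow> (nat \<Rightarrow> 'b) \<Rightarrow> ('c \<Rightarrow> 'b) \<Rightarrow> 'c sk \<Rightarrow> 'b" where
  "sk_code p \<nu> f (Base c) = p (\<nu> 0, f c)"
| "sk_code p \<nu> f (Extra n) = p (\<nu> 1, \<nu> n)"
| "sk_code p \<nu> f (Sk \<phi> n ts) = p (\<nu> 2, p (\<nu> (to_nat (\<phi>, n)), list_code p \<nu> (map (sk_code p \<nu> f) ts)))"

lemma list_code_inject:
  assumes "inj p" "inj \<nu>"
  shows "list_code p \<nu> xs = list_code p \<nu> ys \<longleftrightarrow> xs = ys"
proof (induction xs arbitrary: ys)
  case Nil
  then show ?case using assms by (cases ys) (auto simp: inj_eq)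
next
  case (Cons x xs)
  then show ?case using assms by (cases ys) (auto simp: inj_eq)
qed

lemma sk_code_inj:
  assumes "inj p" "inj \<nu>" "inj_on f C"
  shows "sk_set t \<subseteq> C \<Longrightarrow> sk_set t' \<subseteq> C \<Longrightarrow> sk_code p \<nu> f t = sk_code p \<nu> f t' \<Longrightarrow> t = t'"
proof (induction t arbitrary: t')
  case (Base c)
  then show ?case using assms(1,2) inj_onD[OF assms(3)] by (cases t') (auto simp: inj_eq)
next
  case (Extra n)
  then show ?case using assms by (cases t') (auto simp: inj_eq)
next
  case (Sk \<phi> n ts)
  from Sk.prems(3) obtain ts' where t': "t' = Sk \<phi> n ts'"
    and m: "map (sk_code p \<nu> f) ts = map (sk_code p \<nu> f) ts'"
    using assms(1,2) by (cases t') (auto simp: list_code_inject inj_eq)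
  have "ts = ts'"
  proof (rule nth_equalityI)
    show len: "length ts = length ts'" using m by (metis length_map)
    fix i assume i: "i < length ts"
    show "ts ! i = ts' ! i"
    proof (rule Sk.IH)
      show "ts ! i \<in> set ts" using i by simp
      show "sk_set (ts ! i) \<subseteq> C" using Sk.prems(1) nth_mem[OF i] by fastforce
      show "sk_set (ts' ! i) \<subseteq> C" using Sk.prems(2) nth_mem[of i ts'] i len t' by fastforce
      show "sk_code p \<nu> f (ts ! i) = sk_code p \<nu> f (ts' ! i)" using m i len by (metis nth_map)
    qed
  qed
  then show ?case using t' by simp
qed

lemma infinite_pairing:
  assumes "infinite (UNIV :: 'b set)"
  shows "\<exists>p :: 'b \<times> 'b \<Rightarrow> 'b. inj p" "\<exists>\<nu> :: nat \<Rightarrow> 'b. inj \<nu>"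
proof -
  show "\<exists>p :: 'b \<times> 'b \<Rightarrow> 'b. inj p"
    using ordIso_imp_ordLeq[OF card_of_Times_same_infinite[OF assms]]
    unfolding card_of_ordLeq[symmetric] by auto
  show "\<exists>\<nu> :: nat \<Rightarrow> 'b. inj \<nu>"
    using assms infinite_countable_subset by blast
qed

text \<open>\<open>S0\<close> is a copy in \<open>'b\<close> of the Skolem hull in \<open>S\<close>
  generated by the image of \<open>C\<close> and by \<open>range Y\<close>. The sequence
  \<open>Y\<close> makes room for elements that do not come from \<open>C\<close>, such as a root
  that has to survive in the small structure.\<close>

lemma loewenheim_skolem:
  fixes S :: "('s, 'm) ring_scheme" and h :: "'c \<Rightarrow> 's" and Y :: "nat \<Rightarrow> 's" and f :: "'c \<Rightarrow> 'b"
  assumes S: "cring S" and hC: "h ` C \<subseteq> carrier S" and YS: "range Y \<subseteq> carrier S"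
    and inf: "infinite (UNIV :: 'b set)" and f: "inj_on f C"
  obtains S0 :: "'b ring" and g where
    "cring S0" "g \<in> ring_hom S0 S" "inj_on g (carrier S0)"
    "h ` C \<subseteq> g ` carrier S0" "range Y \<subseteq> g ` carrier S0"
    "\<And>e \<phi>. range e \<subseteq> carrier S0 \<Longrightarrow> sat S0 e \<phi> \<longleftrightarrow> sat S (g \<circ> e) \<phi>"
proof -
  interpret S: cring S by fact
  obtain p :: "'b \<times> 'b \<Rightarrow> 'b" and \<nu> :: "nat \<Rightarrow> 'b" where p\<nu>: "inj p" "inj \<nu>"
    using infinite_pairing[OF inf] by blast
  define H where "H = sk_val S h Y ` {t. sk_set t \<subseteq> C}"
  have skc: "skolem S \<phi> n e \<in> carrier S" for \<phi> n e
    unfolding skolem_def using someI_ex[of "\<lambda>a. a \<in> carrier S \<and> sat S (e(n := a)) \<phi>"] by auto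
  have HS: "H \<subseteq> carrier S"
  proof -
    have "sk_val S h Y t \<in> carrier S" if "sk_set t \<subseteq> C" for t
      \<comment> \<open>No induction on terms: the default value keeps every Skolem function inside
        the carrier, whatever its arguments are.\<close>
      using that hC YS skc by (cases t) auto
    then show ?thesis unfolding H_def by blast
  qed
  have skH: "skolem S \<phi> n (padded \<zero>\<^bsub>S\<^esub> xs) \<in> H" if xs: "set xs \<subseteq> H" for \<phi> n xs
  proof -
    have "\<forall>x\<in>set xs. \<exists>t. sk_set t \<subseteq> C \<and> x = sk_val S h Y t" using xs unfolding H_def by blast
    then obtain \<tau> where \<tau>: "\<forall>x\<in>set xs. sk_set (\<tau> x) \<subseteq> C \<and> x = sk_val S h Y (\<tau> x)"
      by (rule bchoice[THEN exE])
    have "map (sk_val S h Y) (map \<tau> xs) = xs" using \<tau> by (induction xs) auto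
    then have "skolem S \<phi> n (padded \<zero>\<^bsub>S\<^esub> xs) = sk_val S h Y (Sk \<phi> n (map \<tau> xs))" by simp
    moreover have "sk_set (Sk \<phi> n (map \<tau> xs)) \<subseteq> C" using \<tau> by auto
    ultimately show ?thesis unfolding H_def by blast
  qed
  \<comment> \<open>The Tarski-Vaught criterion. Only the first \<open>fbound \<phi>\<close> values
    of \<open>e\<close> matter, and they are the arguments of one Skolem function.\<close>
  have TV: "\<exists>a\<in>H. sat S (e(n := a)) \<phi>"
    if e: "range e \<subseteq> H" and ex: "\<exists>a\<in>carrier S. sat S (e(n := a)) \<phi>" for e n \<phi>
  proof -
    define xs where "xs = map e [0..<fbound \<phi>]"
    have same: "sat S (e(n := a)) \<phi> = sat S ((padded \<zero>\<^bsub>S\<^esub> xs)(n := a)) \<phi>" for a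
      by (rule sat_cong) (auto simp: padded_def xs_def)
    have "set xs \<subseteq> H" using e unfolding xs_def by auto
    moreover have "sat S ((padded \<zero>\<^bsub>S\<^esub> xs)(n := skolem S \<phi> n (padded \<zero>\<^bsub>S\<^esub> xs))) \<phi>"
      using ex unfolding same skolem_def
      using someI_ex[of "\<lambda>a. a \<in> carrier S \<and> sat S ((padded \<zero>\<^bsub>S\<^esub> xs)(n := a)) \<phi>"] by auto
    ultimately show ?thesis using skH same by blast
  qed
  \<comment> \<open>Closure under the ring operations follows from the same criterion: the variable
    \<open>tbound t\<close> is fresh, and the formula that equates it with \<open>t\<close> has a
    witness in the hull.\<close>
  have term_closed: "teval S e t \<in> H" if e: "range e \<subseteq> H" for e t
  proof -
    have ec: "range e \<subseteq> carrier S" using e HS by blast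
    let ?n = "tbound t"
    have same: "teval S (e(?n := a)) t = teval S e t" for a by (rule teval_cong) auto
    obtain a where "a \<in> H" "sat S (e(?n := a)) (FEq (TVar ?n) t)"
      using TV[OF e, of ?n "FEq (TVar ?n) t"] S.teval_closed[OF ec, of t] same by auto
    then show ?thesis using same by simp
  qed
  have H0: "\<zero>\<^bsub>S\<^esub> \<in> H"
  proof -
    have "skolem S (FEq (TVar 0) TZero) 0 e = \<zero>\<^bsub>S\<^esub>" for e
      unfolding skolem_def by (auto intro: some_equality)
    then show ?thesis using skH[of "[]" "FEq (TVar 0) TZero" 0] by simp
  qed
  have clos: "\<one>\<^bsub>S\<^esub> \<in> H" "\<And>x. x \<in> H \<Longrightarrow> \<ominus>\<^bsub>S\<^esub> x \<in> H"
    "\<And>x y. x \<in> H \<Longrightarrow> y \<in> H \<Longrightarrow> x \<oplus>\<^bsub>S\<^esub> y \<in> H" "\<And>x y. x \<in> H \<Longrightarrow> y \<in> H \<Longrightarrow> x \<otimes>\<^bsub>S\<^esub> y \<in> H"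
  proof -
    show "\<one>\<^bsub>S\<^esub> \<in> H" using term_closed[of "\<lambda>_. \<zero>\<^bsub>S\<^esub>" TOne] H0 by auto
    fix x assume x: "x \<in> H"
    show "\<ominus>\<^bsub>S\<^esub> x \<in> H" using term_closed[of "\<lambda>_. x" "TNeg (TVar 0)"] x by auto
    fix y assume y: "y \<in> H"
    let ?e = "\<lambda>n::nat. if n = 0 then x else y"
    have e: "range ?e \<subseteq> H" using x y by auto
    show "x \<oplus>\<^bsub>S\<^esub> y \<in> H" using term_closed[OF e, of "TAdd (TVar 0) (TVar 1)"] by simp
    show "x \<otimes>\<^bsub>S\<^esub> y \<in> H" using term_closed[OF e, of "TMul (TVar 0) (TVar 1)"] by simp
  qed
  \<comment> \<open>Each element of the hull gets the code of one chosen Skolem term; the ring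
    structure of \<open>S0\<close> is transported along this bijection.\<close>
  define c where "c x = sk_code p \<nu> f (SOME t. sk_set t \<subseteq> C \<and> x = sk_val S h Y t)" for x
  have c_inj: "inj_on c H"
  proof (rule inj_onI)
    fix x y assume xy: "x \<in> H" "y \<in> H" "c x = c y"
    let ?P = "\<lambda>x t. sk_set t \<subseteq> C \<and> x = sk_val S h Y t"
    have x: "?P x (SOME t. ?P x t)" using xy(1) unfolding H_def by (intro someI_ex[of "?P x"]) auto
    have y: "?P y (SOME t. ?P y t)" using xy(2) unfolding H_def by (intro someI_ex[of "?P y"]) auto
    have "(SOME t. ?P x t) = (SOME t. ?P y t)"
      using sk_code_inj[OF p\<nu> f] x y xy(3) unfolding c_def by blast
    then show "x = y" using x y by metis
  qed
  define g where "g = inv_into H c"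
  have gc: "g (c x) = x" if "x \<in> H" for x using that c_inj unfolding g_def by simp
  have cg: "c (g a) = a" "g a \<in> H" if "a \<in> c ` H" for a using that gc by auto
  define S0 :: "'b ring" where "S0 = \<lparr>carrier = c ` H, monoid.mult = \<lambda>a b. c (g a \<otimes>\<^bsub>S\<^esub> g b),
    one = c \<one>\<^bsub>S\<^esub>, zero = c \<zero>\<^bsub>S\<^esub>, add = \<lambda>a b. c (g a \<oplus>\<^bsub>S\<^esub> g b)\<rparr>"
  have S0[simp]: "carrier S0 = c ` H" "a \<otimes>\<^bsub>S0\<^esub> b = c (g a \<otimes>\<^bsub>S\<^esub> g b)" "\<one>\<^bsub>S0\<^esub> = c \<one>\<^bsub>S\<^esub>"
    "\<zero>\<^bsub>S0\<^esub> = c \<zero>\<^bsub>S\<^esub>" "a \<oplus>\<^bsub>S0\<^esub> b = c (g a \<oplus>\<^bsub>S\<^esub> g b)" for a b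
    by (simp_all add: S0_def)
  note HSD[simp] = subsetD[OF HS]
  have cr: "cring S0"
  proof (rule cringI)
    show "abelian_group S0"
    proof (rule abelian_groupI)
      fix x assume x: "x \<in> carrier S0"
      then show "\<exists>y\<in>carrier S0. y \<oplus>\<^bsub>S0\<^esub> x = \<zero>\<^bsub>S0\<^esub>"
        using clos by (intro bexI[of _ "c (\<ominus>\<^bsub>S\<^esub> g x)"]) (auto simp: gc S.l_neg)
    qed (use clos H0 in \<open>auto simp: gc S.a_ac\<close>)
    show "comm_monoid S0"
      by (rule comm_monoidI) (use clos in \<open>auto simp: gc S.m_ac\<close>)
  qed (use clos in \<open>auto simp: gc S.l_distr\<close>)
  have hom: "g \<in> ring_hom S0 S"
    by (rule ring_hom_memI) (use clos in \<open>auto simp: gc\<close>)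
  have ginj: "inj_on g (carrier S0)" by (rule inj_onI) (auto simp: gc)
  have satS0: "sat S0 e \<phi> \<longleftrightarrow> sat S (g \<circ> e) \<phi>" if "range e \<subseteq> carrier S0" for e \<phi>
    using that
  proof (induction \<phi> arbitrary: e)
    case (FEq s t)
    have t: "teval S (g \<circ> e) u = g (teval S0 e u)" for u using teval_hom[OF cr S hom FEq] .
    have "teval S0 e u \<in> carrier S0" for u using cring.teval_closed[OF cr FEq] .
    from inj_on_eq_iff[OF ginj this this] show ?case unfolding sat.simps t by (rule sym)
  next
    case (FEx n \<phi>)
    have ge: "range (g \<circ> e) \<subseteq> H" using FEx.prems cg by auto
    have IH: "sat S0 (e(n := a)) \<phi> \<longleftrightarrow> sat S ((g \<circ> e)(n := g a)) \<phi>" if "a \<in> c ` H" for a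
    proof -
      have "range (e(n := a)) \<subseteq> carrier S0" using FEx.prems that by auto
      moreover have "g \<circ> e(n := a) = (g \<circ> e)(n := g a)" by auto
      ultimately show ?thesis using FEx.IH[of "e(n := a)"] by metis
    qed
    have "sat S0 e (FEx n \<phi>) \<longleftrightarrow> (\<exists>a\<in>c ` H. sat S ((g \<circ> e)(n := g a)) \<phi>)"
      using IH by simp
    also have "\<dots> \<longleftrightarrow> (\<exists>a\<in>H. sat S ((g \<circ> e)(n := a)) \<phi>)" by (auto simp: gc)
    also have "\<dots> \<longleftrightarrow> (\<exists>a\<in>carrier S. sat S ((g \<circ> e)(n := a)) \<phi>)" using TV[OF ge] HS by blast
    finally show ?case by (simp only: sat.simps)
  next
    case (FAll n \<phi>)
    have ge: "range (g \<circ> e) \<subseteq> H" using FAll.prems cg by auto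
    have IH: "sat S0 (e(n := a)) \<phi> \<longleftrightarrow> sat S ((g \<circ> e)(n := g a)) \<phi>" if "a \<in> c ` H" for a
    proof -
      have "range (e(n := a)) \<subseteq> carrier S0" using FAll.prems that by auto
      moreover have "g \<circ> e(n := a) = (g \<circ> e)(n := g a)" by auto
      ultimately show ?thesis using FAll.IH[of "e(n := a)"] by metis
    qed
    have "sat S0 e (FAll n \<phi>) \<longleftrightarrow> (\<forall>a\<in>c ` H. sat S ((g \<circ> e)(n := g a)) \<phi>)"
      using IH by simp
    also have "\<dots> \<longleftrightarrow> (\<forall>a\<in>H. sat S ((g \<circ> e)(n := a)) \<phi>)" by (auto simp: gc)
    also have "\<dots> \<longleftrightarrow> (\<forall>a\<in>carrier S. sat S ((g \<circ> e)(n := a)) \<phi>)"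
      using TV[OF ge, of n "FNot \<phi>"] HS by (auto simp: subset_iff)
    finally show ?case by (simp only: sat.simps)
  qed auto
  have "h ` C \<subseteq> H"
  proof
    fix x assume "x \<in> h ` C"
    then obtain a where "a \<in> C" "x = sk_val S h Y (Base a)" by auto
    then show "x \<in> H" unfolding H_def by (intro image_eqI[of _ _ "Base a"]) auto
  qed
  moreover have "range Y \<subseteq> H"
  proof
    fix x assume "x \<in> range Y"
    then obtain n where "x = sk_val S h Y (Extra n)" by auto
    then show "x \<in> H" unfolding H_def by (intro image_eqI[of _ _ "Extra n"]) auto
  qed
  moreover have "H \<subseteq> g ` carrier S0" using gc by (auto simp: image_image intro!: image_eqI)
  ultimately show ?thesis using that[OF cr hom ginj _ _ satS0] by blast
qed

lemma elementary_is_model: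
  assumes "ring_structure S0" "\<And>x. x \<in> carrier S0 \<Longrightarrow> g x \<in> carrier S"
    and "\<And>e \<phi>. range e \<subseteq> carrier S0 \<Longrightarrow> sat S0 e \<phi> \<longleftrightarrow> sat S (g \<circ> e) \<phi>"
    and "is_model T S"
  shows "is_model T S0"
proof -
  have "range (g \<circ> e) \<subseteq> carrier S" if "range e \<subseteq> carrier S0" for e
    using that assms(2) by (auto simp: image_subset_iff)
  then show ?thesis using assms(1,3,4) unfolding is_model_def by blast
qed

subsection \<open>Ultrapowers\<close>

text \<open>In the order on filters the finer one is the smaller, so an ultrafilter is a minimal
  filter other than \<open>bot\<close> and Zorn's lemma is applied to the reversed order.\<close>

lemma ultrafilter_exists:
  fixes F0 :: "'i filter"
  assumes "F0 \<noteq> bot"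
  obtains U where "U \<le> F0" "U \<noteq> bot" "\<And>P. eventually P U \<or> eventually (\<lambda>x. \<not> P x) U"
proof -
  let ?A = "{F. F \<noteq> bot \<and> F \<le> F0}"
  let ?P = "\<lambda>F G :: 'i filter. G \<le> F"
  have "\<exists>m\<in>?A. \<forall>a\<in>?A. ?P m a \<longrightarrow> a = m"
  proof (rule predicate_Zorn)
    show "partial_order_on ?A (relation_of ?P ?A)"
      by (rule partial_order_on_relation_ofI) auto
    fix C assume C: "C \<in> Chains (relation_of ?P ?A)"
    show "\<exists>u\<in>?A. \<forall>a\<in>C. ?P a u"
    proof (cases "C = {}")
      case True then show ?thesis using assms by auto
    next
      case False
      have CA: "C \<subseteq> ?A" using C unfolding Chains_def relation_of_def by blast
      have tot: "F \<le> G \<or> G \<le> F" if "F \<in> C" "G \<in> C" for F G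
        using C that unfolding Chains_def relation_of_def by blast
      \<comment> \<open>A chain is a filter base: what holds eventually for its infimum already
        holds eventually for one of its members.\<close>
      have "\<not> eventually (\<lambda>_. False) (Inf C)"
      proof
        assume "eventually (\<lambda>_. False) (Inf C)"
        moreover have "\<exists>x\<in>C. x \<le> inf F G" if "F \<in> C" "G \<in> C" for F G
          using tot[OF that] that by (metis inf.absorb1 inf.absorb2 order.refl)
        ultimately obtain b where "b \<in> C" "eventually (\<lambda>_. False) b"
          using eventually_Inf_base[OF False] by blast
        then show False using CA by (auto simp: trivial_limit_def)
      qed
      then have "Inf C \<noteq> bot" by (auto simp: trivial_limit_def)
      moreover obtain F where F: "F \<in> C" using False by blast
      then have "F \<le> F0" using CA by auto
      with Inf_lower[OF F] have "Inf C \<le> F0" by (rule order.trans)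
      ultimately show ?thesis using Inf_lower by blast
    qed
  qed
  then obtain U where U: "U \<noteq> bot" "U \<le> F0" and mx: "\<And>G. G \<noteq> bot \<Longrightarrow> G \<le> F0 \<Longrightarrow> G \<le> U \<Longrightarrow> G = U"
    by blast
  have "eventually P U \<or> eventually (\<lambda>x. \<not> P x) U" for P
  proof (cases "inf U (principal {x. P x}) = bot")
    case True
    then show ?thesis unfolding trivial_limit_def eventually_inf_principal by simp
  next
    case False
    then have "inf U (principal {x. P x}) = U" using mx U by (meson inf.cobounded1 order.trans)
    moreover have "eventually P (inf U (principal {x. P x}))" by (simp add: eventually_inf_principal)
    ultimately show ?thesis by simp
  qed
  then show ?thesis using that U by blast
qed

text \<open>The carrier of the ultrapower consists of canonical representatives of the classes of functions
  that agree almost everywhere.\<close>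

definition upow_rep :: "'i filter \<Rightarrow> 'a set \<Rightarrow> ('i \<Rightarrow> 'a) \<Rightarrow> 'i \<Rightarrow> 'a" where
  "upow_rep U A f = (SOME g. (\<forall>i. g i \<in> A) \<and> eventually (\<lambda>i. g i = f i) U)"

definition upow :: "'i filter \<Rightarrow> ('a, 'm) ring_scheme \<Rightarrow> ('i \<Rightarrow> 'a) ring" where
  "upow U R = \<lparr>carrier = upow_rep U (carrier R) ` {f. \<forall>i. f i \<in> carrier R},
     monoid.mult = \<lambda>f g. upow_rep U (carrier R) (\<lambda>i. f i \<otimes>\<^bsub>R\<^esub> g i),
     one = upow_rep U (carrier R) (\<lambda>i. \<one>\<^bsub>R\<^esub>), zero = upow_rep U (carrier R) (\<lambda>i. \<zero>\<^bsub>R\<^esub>),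
     add = \<lambda>f g. upow_rep U (carrier R) (\<lambda>i. f i \<oplus>\<^bsub>R\<^esub> g i)\<rparr>"

locale ultrapower = cring R for R :: "('a, 'm) ring_scheme" (structure) +
  fixes U :: "'i filter"
  assumes Ubot: "U \<noteq> bot" and ultra: "\<And>P. eventually P U \<or> eventually (\<lambda>x. \<not> P x) U"
begin

definition rep :: "('i \<Rightarrow> 'a) \<Rightarrow> 'i \<Rightarrow> 'a" where "rep = upow_rep U (carrier R)"

definition P :: "('i \<Rightarrow> 'a) ring" where "P = upow U R"

lemma P_simps: "carrier P = rep ` {f. \<forall>i. f i \<in> carrier R}"
  "f \<otimes>\<^bsub>P\<^esub> g = rep (\<lambda>i. f i \<otimes> g i)" "\<one>\<^bsub>P\<^esub> = rep (\<lambda>i. \<one>)" "\<zero>\<^bsub>P\<^esub> = rep (\<lambda>i. \<zero>)"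
  "f \<oplus>\<^bsub>P\<^esub> g = rep (\<lambda>i. f i \<oplus> g i)"
  by (simp_all add: P_def upow_def rep_def)

lemma rep:
  assumes "\<And>i. f i \<in> carrier R"
  shows "\<forall>i. rep f i \<in> carrier R" "eventually (\<lambda>i. rep f i = f i) U"
proof -
  have "\<exists>g. (\<forall>i. g i \<in> carrier R) \<and> eventually (\<lambda>i. g i = f i) U"
    using assms by (intro exI[of _ f]) simp
  from someI_ex[OF this] show "\<forall>i. rep f i \<in> carrier R" "eventually (\<lambda>i. rep f i = f i) U"
    unfolding rep_def upow_rep_def by blast+
qed

lemma rep_cong:
  assumes "eventually (\<lambda>i. f i = g i) U"
  shows "rep f = rep g"
proof -
  have "eventually (\<lambda>i. h i = f i) U \<longleftrightarrow> eventually (\<lambda>i. h i = g i) U" for h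
    using assms by (auto elim: eventually_elim2)
  then show ?thesis unfolding rep_def upow_rep_def by simp
qed

lemma P_memI: "(\<And>i. f i \<in> carrier R) \<Longrightarrow> rep f \<in> carrier P"
  unfolding P_simps by blast

lemma P_mem: "f \<in> carrier P \<Longrightarrow> f i \<in> carrier R"
  using rep(1) unfolding P_simps by auto

lemma P_eq_iff: "f \<in> carrier P \<Longrightarrow> g \<in> carrier P \<Longrightarrow> f = g \<longleftrightarrow> eventually (\<lambda>i. f i = g i) U"
proof
  assume fg: "f \<in> carrier P" "g \<in> carrier P" and ev: "eventually (\<lambda>i. f i = g i) U"
  have id: "rep h = h" if "h \<in> carrier P" for h
    using that rep_cong[OF rep(2)] unfolding P_simps by auto
  show "f = g" using rep_cong[OF ev] id fg by simp
qed simp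

lemma P_mult: "f \<in> carrier P \<Longrightarrow> g \<in> carrier P \<Longrightarrow> eventually (\<lambda>i. (f \<otimes>\<^bsub>P\<^esub> g) i = f i \<otimes> g i) U"
  unfolding P_simps(2) by (rule rep(2)) (simp add: P_mem)

lemma P_add: "f \<in> carrier P \<Longrightarrow> g \<in> carrier P \<Longrightarrow> eventually (\<lambda>i. (f \<oplus>\<^bsub>P\<^esub> g) i = f i \<oplus> g i) U"
  unfolding P_simps(5) by (rule rep(2)) (simp add: P_mem)

lemma P_closed: "f \<in> carrier P \<Longrightarrow> g \<in> carrier P \<Longrightarrow> f \<otimes>\<^bsub>P\<^esub> g \<in> carrier P"
  "f \<in> carrier P \<Longrightarrow> g \<in> carrier P \<Longrightarrow> f \<oplus>\<^bsub>P\<^esub> g \<in> carrier P"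
  "\<zero>\<^bsub>P\<^esub> \<in> carrier P" "\<one>\<^bsub>P\<^esub> \<in> carrier P"
  unfolding P_simps(2-5) by (auto intro!: P_memI simp: P_mem)

lemma P_zero: "eventually (\<lambda>i. \<zero>\<^bsub>P\<^esub> i = \<zero>) U" and P_one: "eventually (\<lambda>i. \<one>\<^bsub>P\<^esub> i = \<one>) U"
  unfolding P_simps by (auto intro: rep(2))

lemma P_cring: "cring P"
proof (rule cringI)
  show "abelian_group P"
  proof (rule abelian_groupI)
    fix f g h assume f: "f \<in> carrier P" "g \<in> carrier P" "h \<in> carrier P"
    note ev = P_add[OF P_closed(2)[OF f(1,2)] f(3)] P_add[OF f(1,2)] P_add[OF f(1) P_closed(2)[OF f(2,3)]] P_add[OF f(2,3)]
    show "f \<oplus>\<^bsub>P\<^esub> g \<oplus>\<^bsub>P\<^esub> h = f \<oplus>\<^bsub>P\<^esub> (g \<oplus>\<^bsub>P\<^esub> h)"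
      unfolding P_eq_iff[OF P_closed(2)[OF P_closed(2)[OF f(1,2)] f(3)] P_closed(2)[OF f(1) P_closed(2)[OF f(2,3)]]]
      using ev(1) ev(2) ev(3) ev(4) by eventually_elim (use f in \<open>simp add: a_assoc P_mem\<close>)
  next
    fix f g assume f: "f \<in> carrier P" "g \<in> carrier P"
    show "f \<oplus>\<^bsub>P\<^esub> g = g \<oplus>\<^bsub>P\<^esub> f" unfolding P_simps using f by (simp add: a_comm P_mem)
  next
    fix f assume f: "f \<in> carrier P"
    show "\<zero>\<^bsub>P\<^esub> \<oplus>\<^bsub>P\<^esub> f = f"
      unfolding P_eq_iff[OF P_closed(2)[OF P_closed(3) f] f]
      using P_add[OF P_closed(3) f] P_zero by eventually_elim (use f in \<open>simp add: P_mem\<close>)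
    have n: "rep (\<lambda>i. \<ominus> f i) \<in> carrier P" using f by (intro P_memI) (simp add: P_mem)
    have "eventually (\<lambda>i. rep (\<lambda>i. \<ominus> f i) i = \<ominus> f i) U" using f by (intro rep(2)) (simp add: P_mem)
    then have "rep (\<lambda>i. \<ominus> f i) \<oplus>\<^bsub>P\<^esub> f = \<zero>\<^bsub>P\<^esub>"
      unfolding P_eq_iff[OF P_closed(2)[OF n f] P_closed(3)]
      using P_add[OF n f] P_zero by eventually_elim (use f in \<open>simp add: P_mem l_neg\<close>)
    then show "\<exists>y\<in>carrier P. y \<oplus>\<^bsub>P\<^esub> f = \<zero>\<^bsub>P\<^esub>" using n by blast
  qed (simp_all add: P_closed)
  show "comm_monoid P"
  proof (rule comm_monoidI)
    fix f g h assume f: "f \<in> carrier P" "g \<in> carrier P" "h \<in> carrier P"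
    note ev = P_mult[OF P_closed(1)[OF f(1,2)] f(3)] P_mult[OF f(1,2)] P_mult[OF f(1) P_closed(1)[OF f(2,3)]] P_mult[OF f(2,3)]
    show "f \<otimes>\<^bsub>P\<^esub> g \<otimes>\<^bsub>P\<^esub> h = f \<otimes>\<^bsub>P\<^esub> (g \<otimes>\<^bsub>P\<^esub> h)"
      unfolding P_eq_iff[OF P_closed(1)[OF P_closed(1)[OF f(1,2)] f(3)] P_closed(1)[OF f(1) P_closed(1)[OF f(2,3)]]]
      using ev(1) ev(2) ev(3) ev(4) by eventually_elim (use f in \<open>simp add: m_assoc P_mem\<close>)
  next
    fix f g assume f: "f \<in> carrier P" "g \<in> carrier P"
    show "f \<otimes>\<^bsub>P\<^esub> g = g \<otimes>\<^bsub>P\<^esub> f" unfolding P_simps using f by (simp add: m_comm P_mem)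
  next
    fix f assume f: "f \<in> carrier P"
    show "\<one>\<^bsub>P\<^esub> \<otimes>\<^bsub>P\<^esub> f = f"
      unfolding P_eq_iff[OF P_closed(1)[OF P_closed(4) f] f]
      using P_mult[OF P_closed(4) f] P_one by eventually_elim (use f in \<open>simp add: P_mem\<close>)
  qed (simp_all add: P_closed)
  fix f g h assume f: "f \<in> carrier P" "g \<in> carrier P" "h \<in> carrier P"
  note ev = P_mult[OF P_closed(2)[OF f(1,2)] f(3)] P_add[OF f(1,2)] P_add[OF P_closed(1)[OF f(1,3)] P_closed(1)[OF f(2,3)]] P_mult[OF f(1,3)] P_mult[OF f(2,3)]
  show "(f \<oplus>\<^bsub>P\<^esub> g) \<otimes>\<^bsub>P\<^esub> h = f \<otimes>\<^bsub>P\<^esub> h \<oplus>\<^bsub>P\<^esub> g \<otimes>\<^bsub>P\<^esub> h"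
    unfolding P_eq_iff[OF P_closed(1)[OF P_closed(2)[OF f(1,2)] f(3)] P_closed(2)[OF P_closed(1)[OF f(1,3)] P_closed(1)[OF f(2,3)]]]
    using ev(1) ev(2) ev(3) ev(4) ev(5) by eventually_elim (use f in \<open>simp add: l_distr P_mem\<close>)
qed

sublocale P: cring P by (rule P_cring)

lemma P_minus: "f \<in> carrier P \<Longrightarrow> eventually (\<lambda>i. (\<ominus>\<^bsub>P\<^esub> f) i = \<ominus> f i) U"
proof -
  assume f: "f \<in> carrier P"
  have "f \<oplus>\<^bsub>P\<^esub> (\<ominus>\<^bsub>P\<^esub> f) = \<zero>\<^bsub>P\<^esub>" using f by (simp add: P.r_neg)
  then have "eventually (\<lambda>i. (f \<oplus>\<^bsub>P\<^esub> (\<ominus>\<^bsub>P\<^esub> f)) i = \<zero>\<^bsub>P\<^esub> i) U" by simp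
  then show ?thesis using P_add[OF f P.a_inv_closed[OF f]] P_zero
  proof eventually_elim
    case (elim i)
    have "f i \<in> carrier R" "(\<ominus>\<^bsub>P\<^esub> f) i \<in> carrier R" using f by (simp_all add: P_mem)
    then show ?case using elim by (metis a_comm minus_equality)
  qed
qed

lemma P_teval:
  assumes e: "range e \<subseteq> carrier P"
  shows "eventually (\<lambda>i. teval P e t i = teval R (\<lambda>n. e n i) t) U"
proof (induction t)
  case (TNeg t)
  then show ?case using P_minus[OF P.teval_closed[OF e, of t]] by eventually_elim simp
next
  case (TAdd s t)
  then show ?case using P_add[OF P.teval_closed[OF e, of s] P.teval_closed[OF e, of t]]
    by eventually_elim simp
next
  case (TMul s t)
  then show ?case using P_mult[OF P.teval_closed[OF e, of s] P.teval_closed[OF e, of t]]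
    by eventually_elim simp
qed (simp_all add: P_zero P_one)

lemma ultra_not: "eventually (\<lambda>x. \<not> Q x) U \<longleftrightarrow> \<not> eventually Q U"
  using ultra[of Q] Ubot eventually_conj[of Q U "\<lambda>x. \<not> Q x"] by (auto simp: trivial_limit_def)

lemma los:
  "range e \<subseteq> carrier P \<Longrightarrow> sat P e \<phi> \<longleftrightarrow> eventually (\<lambda>i. sat R (\<lambda>n. e n i) \<phi>) U"
proof (induction \<phi> arbitrary: e)
  case (FEq s t)
  show ?case
    unfolding sat.simps P_eq_iff[OF P.teval_closed[OF FEq, of s] P.teval_closed[OF FEq, of t]]
    by (rule eventually_subst, rule eventually_elim2[OF P_teval[OF FEq, of s] P_teval[OF FEq, of t]]) simp
next
  case (FNot \<phi>)
  then show ?case by (simp add: ultra_not)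
next
  case (FAnd \<phi> \<psi>)
  then show ?case by (simp add: eventually_conj_iff)
next
  case (FOr \<phi> \<psi>)
  have "eventually (\<lambda>i. A i \<or> B i) U \<longleftrightarrow> eventually A U \<or> eventually B U" for A B
    using ultra_not[of "\<lambda>i. A i \<or> B i"] ultra_not[of A] ultra_not[of B]
    unfolding de_Morgan_disj eventually_conj_iff by blast
  then show ?case using FOr by simp
next
  case (FEx n \<phi>)
  have IH: "sat P (e(n := f)) \<phi> \<longleftrightarrow> eventually (\<lambda>i. sat R ((\<lambda>m. e m i)(n := f i)) \<phi>) U"
    if f: "f \<in> carrier P" for f
  proof -
    have "range (e(n := f)) \<subseteq> carrier P" using FEx.prems f by auto
    moreover have "(\<lambda>m. (e(n := f)) m i) = (\<lambda>m. e m i)(n := f i)" for i by auto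
    ultimately show ?thesis using FEx.IH[of "e(n := f)"] by (simp only:)
  qed
  show ?case
  proof
    assume "sat P e (FEx n \<phi>)"
    then obtain f where f: "f \<in> carrier P" "eventually (\<lambda>i. sat R ((\<lambda>m. e m i)(n := f i)) \<phi>) U"
      using IH by auto
    show "eventually (\<lambda>i. sat R (\<lambda>n. e n i) (FEx n \<phi>)) U"
      using f(2) by eventually_elim (use f(1) P_mem in auto)
  next
    assume ev: "eventually (\<lambda>i. sat R (\<lambda>n. e n i) (FEx n \<phi>)) U"
    \<comment> \<open>Witnesses are chosen index by index; the default keeps \<open>f\<close> inside
      the carrier at those indices, negligible for \<open>U\<close>, where there is none.\<close>
    define f where "f i = (if \<exists>a\<in>carrier R. sat R ((\<lambda>m. e m i)(n := a)) \<phi>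
      then SOME a. a \<in> carrier R \<and> sat R ((\<lambda>m. e m i)(n := a)) \<phi> else \<zero>)" for i
    have f: "f i \<in> carrier R" for i
      unfolding f_def using someI_ex[of "\<lambda>a. a \<in> carrier R \<and> sat R ((\<lambda>m. e m i)(n := a)) \<phi>"] by auto
    have "eventually (\<lambda>i. sat R ((\<lambda>m. e m i)(n := f i)) \<phi>) U"
      using ev
    proof eventually_elim
      case (elim i)
      then show ?case unfolding f_def
        using someI_ex[of "\<lambda>a. a \<in> carrier R \<and> sat R ((\<lambda>m. e m i)(n := a)) \<phi>"] by auto
    qed
    then have "eventually (\<lambda>i. sat R ((\<lambda>m. e m i)(n := rep f i)) \<phi>) U"
      using rep(2)[of f, OF f] by eventually_elim simp
    then show "sat P e (FEx n \<phi>)" using IH[OF P_memI[of f, OF f]] P_memI[of f, OF f] by auto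
  qed
next
  case (FAll n \<phi>)
  have IH: "sat P (e(n := f)) \<phi> \<longleftrightarrow> eventually (\<lambda>i. sat R ((\<lambda>m. e m i)(n := f i)) \<phi>) U"
    if f: "f \<in> carrier P" for f
  proof -
    have "range (e(n := f)) \<subseteq> carrier P" using FAll.prems f by auto
    moreover have "(\<lambda>m. (e(n := f)) m i) = (\<lambda>m. e m i)(n := f i)" for i by auto
    ultimately show ?thesis using FAll.IH[of "e(n := f)"] by (simp only:)
  qed
  show ?case
  proof
    assume ev: "eventually (\<lambda>i. sat R (\<lambda>n. e n i) (FAll n \<phi>)) U"
    have "sat P (e(n := f)) \<phi>" if f: "f \<in> carrier P" for f
      unfolding IH[OF f] using ev by eventually_elim (use P_mem[OF f] in auto)
    then show "sat P e (FAll n \<phi>)" by simp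
  next
    assume A: "sat P e (FAll n \<phi>)"
    show "eventually (\<lambda>i. sat R (\<lambda>n. e n i) (FAll n \<phi>)) U"
    proof (rule ccontr)
      assume "\<not> eventually (\<lambda>i. sat R (\<lambda>n. e n i) (FAll n \<phi>)) U"
      then have ev: "eventually (\<lambda>i. \<not> sat R (\<lambda>n. e n i) (FAll n \<phi>)) U" unfolding ultra_not .
      define f where "f i = (if \<exists>a\<in>carrier R. \<not> sat R ((\<lambda>m. e m i)(n := a)) \<phi>
        then SOME a. a \<in> carrier R \<and> \<not> sat R ((\<lambda>m. e m i)(n := a)) \<phi> else \<zero>)" for i
      have f: "f i \<in> carrier R" for i
        unfolding f_def using someI_ex[of "\<lambda>a. a \<in> carrier R \<and> \<not> sat R ((\<lambda>m. e m i)(n := a)) \<phi>"] by auto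
      have "eventually (\<lambda>i. \<not> sat R ((\<lambda>m. e m i)(n := f i)) \<phi>) U"
        using ev
      proof eventually_elim
        case (elim i)
        then show ?case unfolding f_def
          using someI_ex[of "\<lambda>a. a \<in> carrier R \<and> \<not> sat R ((\<lambda>m. e m i)(n := a)) \<phi>"] by auto
      qed
      then have "eventually (\<lambda>i. \<not> sat R ((\<lambda>m. e m i)(n := rep f i)) \<phi>) U"
        using rep(2)[of f, OF f] by eventually_elim simp
      then have "\<not> sat P (e(n := rep f)) \<phi>" unfolding IH[OF P_memI[of f, OF f]] ultra_not .
      then show False using A P_memI[of f, OF f] by auto
    qed
  qed
qed

lemma diag_mem: "a \<in> carrier R \<Longrightarrow> rep (\<lambda>_. a) \<in> carrier P"
  by (rule P_memI)

lemma diag_ev: "a \<in> carrier R \<Longrightarrow> eventually (\<lambda>i. rep (\<lambda>_. a) i = a) U"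
  by (rule rep(2))

lemma diag_sat:
  assumes e: "range e \<subseteq> carrier R"
  shows "sat P ((\<lambda>a. rep (\<lambda>_. a)) \<circ> e) \<phi> \<longleftrightarrow> sat R e \<phi>"
proof -
  have "range ((\<lambda>a. rep (\<lambda>_. a)) \<circ> e) \<subseteq> carrier P" using e diag_mem by auto
  from los[OF this] have "sat P ((\<lambda>a. rep (\<lambda>_. a)) \<circ> e) \<phi> \<longleftrightarrow>
      eventually (\<lambda>i. sat R (\<lambda>n. rep (\<lambda>_. e n) i) \<phi>) U" by simp
  also have "\<dots> \<longleftrightarrow> eventually (\<lambda>i. sat R e \<phi>) U"
  proof (rule eventually_subst)
    have "eventually (\<lambda>i. \<forall>n\<in>{..<fbound \<phi>}. rep (\<lambda>_. e n) i = e n) U"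
      using diag_ev e by (intro eventually_ball_finite) auto
    then show "eventually (\<lambda>i. sat R (\<lambda>n. rep (\<lambda>_. e n) i) \<phi> = sat R e \<phi>) U"
      by eventually_elim (rule sat_cong, simp)
  qed
  also have "\<dots> \<longleftrightarrow> sat R e \<phi>" using Ubot by simp
  finally show ?thesis .
qed

lemma diag_hom: "(\<lambda>a. rep (\<lambda>_. a)) \<in> ring_hom R P"
proof (rule ring_hom_memI)
  fix a b assume ab: "a \<in> carrier R" "b \<in> carrier R"
  show "rep (\<lambda>_. a \<otimes> b) = rep (\<lambda>_. a) \<otimes>\<^bsub>P\<^esub> rep (\<lambda>_. b)"
    unfolding P_simps(2)
    by (rule rep_cong, rule eventually_elim2[OF diag_ev[OF ab(1)] diag_ev[OF ab(2)]]) simp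
  show "rep (\<lambda>_. a \<oplus> b) = rep (\<lambda>_. a) \<oplus>\<^bsub>P\<^esub> rep (\<lambda>_. b)"
    unfolding P_simps(5)
    by (rule rep_cong, rule eventually_elim2[OF diag_ev[OF ab(1)] diag_ev[OF ab(2)]]) simp
qed (simp_all add: diag_mem P_simps(3))

lemma diag_inj: "inj_on (\<lambda>a. rep (\<lambda>_. a)) (carrier R)"
proof (rule inj_onI)
  fix a b assume ab: "a \<in> carrier R" "b \<in> carrier R" "rep (\<lambda>_. a) = rep (\<lambda>_. b)"
  have "eventually (\<lambda>i. a = b) U"
    using diag_ev[OF ab(1)] diag_ev[OF ab(2)] unfolding ab(3) by eventually_elim simp
  then show "a = b" using Ubot by simp
qed

end

text \<open>Compactness by an ultrapower over the finite subsets \<open>A\<close> of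
  \<open>'z\<close>. At the index \<open>A\<close> the elements of \<open>A\<close> are sent to
  different members of a family with unit differences, which exists for every finite size. Two given
  elements of \<open>'z\<close> lie in almost every \<open>A\<close>, so their images differ by a
  unit. The residue field thus becomes at least as large as \<open>'z\<close>, which is
  arbitrary.\<close>

lemma (in cring) elementary_extension:
  assumes indep: "\<And>n. \<exists>c. range c \<subseteq> carrier R \<and> (\<forall>i<n. \<forall>j<n. i \<noteq> j \<longrightarrow> c i \<ominus> c (j::nat) \<in> Units R)"
  obtains R' :: "('z set \<Rightarrow> 'a) ring" and k and \<iota> :: "'z \<Rightarrow> 'z set \<Rightarrow> 'a" where
    "cring R'" "k \<in> ring_hom R R'" "inj_on k (carrier R)"
    "\<And>e \<phi>. range e \<subseteq> carrier R \<Longrightarrow> sat R' (k \<circ> e) \<phi> \<longleftrightarrow> sat R e \<phi>"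
    "range \<iota> \<subseteq> carrier R'" "\<And>z z'. z \<noteq> z' \<Longrightarrow> \<iota> z \<ominus>\<^bsub>R'\<^esub> \<iota> z' \<in> Units R'"
proof -
  let ?F = "finite_subsets_at_top (UNIV :: 'z set)"
  obtain U where U: "U \<le> ?F" "U \<noteq> bot" "\<And>P. eventually P U \<or> eventually (\<lambda>x. \<not> P x) U"
    using ultrafilter_exists[OF finite_subsets_at_top_neq_bot] by blast
  interpret ultrapower R U by unfold_locales (use U in auto)
  have "\<forall>n. \<exists>c. range c \<subseteq> carrier R \<and> (\<forall>i<n. \<forall>j<n. i \<noteq> j \<longrightarrow> c i \<ominus> c (j::nat) \<in> Units R)"
    by (rule allI) (rule indep)
  from choice[OF this] obtain c where
    c': "\<forall>n. range (c n) \<subseteq> carrier R \<and> (\<forall>i<n. \<forall>j<n. i \<noteq> j \<longrightarrow> c n i \<ominus> c n (j::nat) \<in> Units R)" ..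
  then have c: "\<And>n. range (c n) \<subseteq> carrier R"
    "\<And>n i j. i < n \<Longrightarrow> j < n \<Longrightarrow> i \<noteq> j \<Longrightarrow> c n i \<ominus> c n j \<in> Units R" by blast+
  have "\<forall>A :: 'z set. \<exists>g. finite A \<longrightarrow> bij_betw g A {0..<card A}"
    using ex_bij_betw_finite_nat by blast
  then obtain g where g: "\<And>A :: 'z set. finite A \<Longrightarrow> bij_betw (g A) A {0..<card A}" by metis
  define f where "f z A = c (card A) (g A z)" for z A
  have f: "f z A \<in> carrier R" for z A unfolding f_def using c(1) by blast
  define \<iota> where "\<iota> z = rep (f z)" for z
  have \<iota>: "\<iota> z \<in> carrier P" for z unfolding \<iota>_def by (rule P_memI) (rule f)
  have unit: "\<iota> z \<ominus>\<^bsub>P\<^esub> \<iota> z' \<in> Units P" if zz: "z \<noteq> z'" for z z'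
  proof -
    have "eventually (\<lambda>A. finite A \<and> {z, z'} \<subseteq> A) ?F"
      unfolding eventually_finite_subsets_at_top by (intro exI[of _ "{z, z'}"]) auto
    then have ev: "eventually (\<lambda>A. finite A \<and> {z, z'} \<subseteq> A) U" using U(1) filter_leD by blast
    let ?e = "\<lambda>n::nat. if n = 0 then \<iota> z else \<iota> z'"
    have er: "range ?e \<subseteq> carrier P" using \<iota> by auto
    have "sat P ?e (FEx 2 (FEq (TMul (TAdd (TVar 0) (TNeg (TVar 1))) (TVar 2)) TOne))"
      unfolding los[OF er]
      using ev rep(2)[of "f z", OF f] rep(2)[of "f z'", OF f]
    proof eventually_elim
      case (elim A)
      have inj: "inj_on (g A) A" "g A ` A = {0..<card A}"
        using g elim(1) unfolding bij_betw_def by blast+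
      have "g A z < card A" "g A z' < card A" using inj(2) elim(1) by auto
      moreover have "g A z \<noteq> g A z'" using inj(1) elim(1) zz unfolding inj_on_def by blast
      ultimately have "f z A \<ominus> f z' A \<in> Units R" unfolding f_def using c(2) by blast
      then show ?case using elim(2,3) unfolding \<iota>_def by (auto simp: unit_iff a_minus_def)
    qed
    then show ?thesis using \<iota> unfolding P.unit_iff by (auto simp: a_minus_def)
  qed
  show ?thesis
    by (rule that[OF P_cring diag_hom diag_inj diag_sat _ unit]) (use \<iota> in auto)
qed

section \<open>Polynomials in Horner form\<close>

text \<open>Lists of coefficients, constant coefficient first; trailing zeros are allowed.\<close>

primrec heval :: "('a, 'm) ring_scheme \<Rightarrow> 'a list \<Rightarrow> 'a \<Rightarrow> 'a" where
  "heval R [] x = \<zero>\<^bsub>R\<^esub>"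
| "heval R (c # cs) x = c \<oplus>\<^bsub>R\<^esub> x \<otimes>\<^bsub>R\<^esub> heval R cs x"

fun ladd :: "('a, 'm) ring_scheme \<Rightarrow> 'a list \<Rightarrow> 'a list \<Rightarrow> 'a list" where
  "ladd R [] ds = ds"
| "ladd R (c # cs) [] = c # cs"
| "ladd R (c # cs) (d # ds) = (c \<oplus>\<^bsub>R\<^esub> d) # ladd R cs ds"

primrec lmul :: "('a, 'm) ring_scheme \<Rightarrow> 'a list \<Rightarrow> 'a list \<Rightarrow> 'a list" where
  "lmul R [] ds = []"
| "lmul R (c # cs) ds = ladd R (map (\<lambda>d. c \<otimes>\<^bsub>R\<^esub> d) ds) (\<zero>\<^bsub>R\<^esub> # lmul R cs ds)"

text \<open>Horner's scheme: the coefficients of the difference quotient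
  \<open>(f(x) - f(a)) / (x - a)\<close>.\<close>

fun synth_div :: "('a, 'm) ring_scheme \<Rightarrow> 'a \<Rightarrow> 'a list \<Rightarrow> 'a list" where
  "synth_div R a [] = []"
| "synth_div R a [c] = []"
| "synth_div R a (c # d # cs) = heval R (d # cs) a # synth_div R a (d # cs)"

primrec hder :: "('a, 'm) ring_scheme \<Rightarrow> 'a list \<Rightarrow> 'a \<Rightarrow> 'a" where
  "hder R [] x = \<zero>\<^bsub>R\<^esub>"
| "hder R (c # cs) x = heval R cs x \<oplus>\<^bsub>R\<^esub> x \<otimes>\<^bsub>R\<^esub> hder R cs x"

text \<open>The number \<open>k\<close> is the exponent belonging to the first coefficient. With the
  constant coefficient removed and \<open>k = 1\<close> this is the list of the formal
  derivative.\<close>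

primrec der_list :: "('a, 'm) ring_scheme \<Rightarrow> nat \<Rightarrow> 'a list \<Rightarrow> 'a list" where
  "der_list R k [] = []"
| "der_list R k (c # cs) = ([k] \<cdot>\<^bsub>R\<^esub> c) # der_list R (Suc k) cs"

lemma length_synth_div: "length (synth_div R a cs) = length cs - 1"
  by (induction R a cs rule: synth_div.induct) auto

lemma length_der_list [simp]: "length (der_list R k cs) = length cs"
  by (induction cs arbitrary: k) auto

lemma last_der_list: "cs \<noteq> [] \<Longrightarrow> last (der_list R k cs) = [(k + length cs - 1)] \<cdot>\<^bsub>R\<^esub> (last cs)"
proof (induction cs arbitrary: k)
  case (Cons c cs)
  show ?case
  proof (cases "cs = []")
    case False
    then have "der_list R (Suc k) cs \<noteq> []" by (cases cs) auto
    then show ?thesis using Cons.IH[OF False, of "Suc k"] False by simp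
  qed simp
qed simp

context cring
begin

lemma heval_closed_sub: "subring G R \<Longrightarrow> set cs \<subseteq> G \<Longrightarrow> x \<in> G \<Longrightarrow> heval R cs x \<in> G"
  by (induction cs) (auto simp: subringE)

lemma heval_closed [simp]: "set cs \<subseteq> carrier R \<Longrightarrow> x \<in> carrier R \<Longrightarrow> heval R cs x \<in> carrier R"
  using heval_closed_sub[OF carrier_is_subring] .

lemma heval_ideal: "ideal I R \<Longrightarrow> set cs \<subseteq> I \<Longrightarrow> x \<in> carrier R \<Longrightarrow> heval R cs x \<in> I"
  by (induction cs)
    (auto simp: ideal.I_l_closed additive_subgroup.a_closed ideal.axioms(1) additive_subgroup.zero_closed)

lemma hder_closed [simp]: "set cs \<subseteq> carrier R \<Longrightarrow> x \<in> carrier R \<Longrightarrow> hder R cs x \<in> carrier R"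
  by (induction cs) auto

lemma ladd_set: "subring G R \<Longrightarrow> set cs \<subseteq> G \<Longrightarrow> set ds \<subseteq> G \<Longrightarrow> set (ladd R cs ds) \<subseteq> G"
  by (induction R cs ds rule: ladd.induct) (auto simp: subringE)

lemma lmul_set: "subring G R \<Longrightarrow> set cs \<subseteq> G \<Longrightarrow> set ds \<subseteq> G \<Longrightarrow> set (lmul R cs ds) \<subseteq> G"
proof (induction cs)
  case (Cons c cs)
  have "set (map (\<lambda>d. c \<otimes> d) ds) \<subseteq> G" using Cons.prems by (auto simp: subringE)
  moreover have "set (\<zero> # lmul R cs ds) \<subseteq> G" using Cons by (auto simp: subringE)
  ultimately show ?case using ladd_set[OF Cons.prems(1)] by simp
qed simp

lemma heval_ladd:
  "set cs \<subseteq> carrier R \<Longrightarrow> set ds \<subseteq> carrier R \<Longrightarrow> x \<in> carrier R \<Longrightarrow>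
    heval R (ladd R cs ds) x = heval R cs x \<oplus> heval R ds x"
proof (induction cs arbitrary: ds)
  case (Cons c cs)
  show ?case
  proof (cases ds)
    case Nil then show ?thesis using Cons.prems by simp
  next
    case ds: (Cons d ds')
    have "c \<in> carrier R" "d \<in> carrier R" "heval R cs x \<in> carrier R" "heval R ds' x \<in> carrier R"
      using Cons.prems ds by auto
    moreover have "heval R (ladd R cs ds') x = heval R cs x \<oplus> heval R ds' x" using Cons ds by simp
    ultimately show ?thesis using Cons.prems(3) unfolding ds by simp algebra
  qed
qed simp

lemma heval_map_mult:
  "c \<in> carrier R \<Longrightarrow> set cs \<subseteq> carrier R \<Longrightarrow> x \<in> carrier R \<Longrightarrow>
    heval R (map (\<lambda>d. c \<otimes> d) cs) x = c \<otimes> heval R cs x"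
proof (induction cs)
  case (Cons d cs)
  have cl: "d \<in> carrier R" "heval R cs x \<in> carrier R" using Cons.prems by auto
  have IH: "heval R (map (\<lambda>d. c \<otimes> d) cs) x = c \<otimes> heval R cs x" using Cons by simp
  show ?case unfolding list.map heval.simps IH using cl Cons.prems(1,3) by algebra
qed simp

lemma heval_lmul:
  "set cs \<subseteq> carrier R \<Longrightarrow> set ds \<subseteq> carrier R \<Longrightarrow> x \<in> carrier R \<Longrightarrow>
    heval R (lmul R cs ds) x = heval R cs x \<otimes> heval R ds x"
proof (induction cs)
  case (Cons c cs)
  have c: "c \<in> carrier R" "heval R cs x \<in> carrier R" "heval R ds x \<in> carrier R" using Cons.prems by auto
  have s: "set (map (\<lambda>d. c \<otimes> d) ds) \<subseteq> carrier R" "set (\<zero> # lmul R cs ds) \<subseteq> carrier R"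
    using Cons.prems lmul_set[OF carrier_is_subring, of cs ds] by auto
  have "heval R (lmul R (c # cs) ds) x = c \<otimes> heval R ds x \<oplus> (\<zero> \<oplus> x \<otimes> (heval R cs x \<otimes> heval R ds x))"
    using heval_ladd[OF s Cons.prems(3)] heval_map_mult[OF c(1) Cons.prems(2,3)] Cons by simp
  then show ?case using c Cons.prems(3) by simp algebra
qed simp

lemma heval_append:
  "set cs \<subseteq> carrier R \<Longrightarrow> set ds \<subseteq> carrier R \<Longrightarrow> x \<in> carrier R \<Longrightarrow>
    heval R (cs @ ds) x = heval R cs x \<oplus> x [^] length cs \<otimes> heval R ds x"
proof (induction cs)
  case (Cons c cs)
  have p: "x [^] length (c # cs) = x \<otimes> x [^] length cs" using nat_pow_Suc2[OF Cons.prems(3)] by simp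
  have cl: "c \<in> carrier R" "heval R cs x \<in> carrier R" "heval R ds x \<in> carrier R" "x [^] length cs \<in> carrier R"
    using Cons.prems by auto
  have IH: "heval R (cs @ ds) x = heval R cs x \<oplus> x [^] length cs \<otimes> heval R ds x" using Cons by simp
  show ?case unfolding p append_Cons heval.simps IH using cl Cons.prems(3) by algebra
qed simp

lemma heval_snoc:
  assumes "set cs \<subseteq> carrier R" "a \<in> carrier R" "x \<in> carrier R"
  shows "heval R (cs @ [a]) x = heval R cs x \<oplus> a \<otimes> x [^] length cs"
  using heval_append[of cs "[a]" x] assms m_comm[of "x [^] length cs" a] by simp

lemma heval_replicate_zero: "x \<in> carrier R \<Longrightarrow> heval R (replicate n \<zero>) x = \<zero>"
  by (induction n) auto

definition adjoin :: "'a set \<Rightarrow> 'a \<Rightarrow> 'a set" where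
  "adjoin G x = {heval R cs x | cs. set cs \<subseteq> G}"

lemma adjoin_subring:
  assumes "subring G R" "x \<in> carrier R"
  shows "subring (adjoin G x) R" "G \<subseteq> adjoin G x" "x \<in> adjoin G x"
proof -
  have GR: "G \<subseteq> carrier R" using subringE(1)[OF assms(1)] .
  show G: "G \<subseteq> adjoin G x"
  proof
    fix g assume "g \<in> G"
    then have "g = heval R [g] x" "set [g] \<subseteq> G" using GR assms(2) by auto
    then show "g \<in> adjoin G x" unfolding adjoin_def by blast
  qed
  have "x = heval R [\<zero>, \<one>] x" "set [\<zero>, \<one>] \<subseteq> G" using assms subringE[OF assms(1)] by auto
  then show "x \<in> adjoin G x" unfolding adjoin_def by blast
  have mult: "a \<otimes> b \<in> adjoin G x" if ab: "a \<in> adjoin G x" "b \<in> adjoin G x" for a b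
  proof -
    obtain cs ds where "set cs \<subseteq> G" "a = heval R cs x" "set ds \<subseteq> G" "b = heval R ds x"
      using ab unfolding adjoin_def by auto
    then have "a \<otimes> b = heval R (lmul R cs ds) x" "set (lmul R cs ds) \<subseteq> G"
      using heval_lmul[of cs ds x] GR assms lmul_set[OF assms(1)] by auto
    then show ?thesis unfolding adjoin_def by blast
  qed
  show "subring (adjoin G x) R"
  proof (rule subringI)
    show "adjoin G x \<subseteq> carrier R" unfolding adjoin_def using GR assms(2) by auto
    show "\<one> \<in> adjoin G x" using G subringE(3)[OF assms(1)] by blast
    fix a b assume ab: "a \<in> adjoin G x" "b \<in> adjoin G x"
    show "a \<otimes> b \<in> adjoin G x" using mult ab .
    have "\<ominus> \<one> \<in> adjoin G x" using G subringE(3,5)[OF assms(1)] by blast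
    moreover have "\<ominus> a = \<ominus> \<one> \<otimes> a"
      using ab(1) \<open>adjoin G x \<subseteq> carrier R\<close> by (auto simp: l_minus)
    ultimately show "\<ominus> a \<in> adjoin G x" using mult ab(1) by simp
    obtain cs ds where "set cs \<subseteq> G" "a = heval R cs x" "set ds \<subseteq> G" "b = heval R ds x"
      using ab unfolding adjoin_def by auto
    then have "a \<oplus> b = heval R (ladd R cs ds) x" "set (ladd R cs ds) \<subseteq> G"
      using heval_ladd[of cs ds x] GR assms ladd_set[OF assms(1)] by auto
    then show "a \<oplus> b \<in> adjoin G x" unfolding adjoin_def by blast
  qed
qed

lemma division_step:
  assumes "c \<in> carrier R" "z \<in> carrier R" "A \<in> carrier R" "Q \<in> carrier R" "B \<in> carrier R" "t \<in> carrier R"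
    "H \<in> carrier R" "p \<in> carrier R"
  shows "c \<oplus> z \<otimes> ((H \<oplus> p) \<otimes> Q \<oplus> B)
    = (H \<oplus> p) \<otimes> (t \<oplus> z \<otimes> Q) \<oplus> ((c \<oplus> z \<otimes> B) \<ominus> t \<otimes> (H \<oplus> p))"
  using assms by algebra

text \<open>Degrees are tracked through list lengths. The remainder is padded to the length of
  \<open>hl\<close>, and the clause for \<open>length cs = length hl\<close> identifies the leading
  coefficient at the moment when the quotient becomes nonempty.\<close>

lemma monic_division:
  assumes G: "subring G R" and hl: "set hl \<subseteq> G" "hl \<noteq> []" and cs: "set cs \<subseteq> G"
  shows "\<exists>q r. set q \<subseteq> G \<and> set r \<subseteq> G \<and> length r = length hl \<and> length q = length cs - length hl \<and>
    (q \<noteq> [] \<longrightarrow> last q = last cs) \<and> (length cs = length hl \<longrightarrow> r = cs) \<and>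
    (\<forall>z\<in>carrier R. heval R cs z = heval R (hl @ [\<one>]) z \<otimes> heval R q z \<oplus> heval R r z)"
  using cs
proof (induction cs)
  have GR: "G \<subseteq> carrier R" using subringE(1)[OF G] .
  have short: "\<exists>q r. set q \<subseteq> G \<and> set r \<subseteq> G \<and> length r = length hl \<and> length q = length cs - length hl \<and>
    (q \<noteq> [] \<longrightarrow> last q = last cs) \<and> (length cs = length hl \<longrightarrow> r = cs) \<and>
    (\<forall>z\<in>carrier R. heval R cs z = heval R (hl @ [\<one>]) z \<otimes> heval R q z \<oplus> heval R r z)"
    if cs: "length cs \<le> length hl" "set cs \<subseteq> G" for cs
  proof (rule exI[of _ "[]"], rule exI[of _ "cs @ replicate (length hl - length cs) \<zero>"], intro conjI ballI)
    let ?r = "cs @ replicate (length hl - length cs) \<zero>"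
    show "set ?r \<subseteq> G" using cs(2) subringE(2)[OF G] by auto
    fix z assume z: "z \<in> carrier R"
    have c: "set cs \<subseteq> carrier R" "set (replicate (length hl - length cs) \<zero>) \<subseteq> carrier R"
      "set (hl @ [\<one>]) \<subseteq> carrier R"
      using cs(2) hl(1) GR by auto
    show "heval R cs z = heval R (hl @ [\<one>]) z \<otimes> heval R [] z \<oplus> heval R ?r z"
      using heval_append[OF c(1,2) z] c z by (simp add: heval_replicate_zero del: set_append)
  qed (use cs in auto)
  {
    case Nil show ?case by (rule short) auto
  next
    case (Cons c cs)
    show ?case
    proof (cases "length (c # cs) \<le> length hl")
      case True then show ?thesis by (rule short) (use Cons.prems in auto)
    next
      case False
      obtain q r where q: "set q \<subseteq> G" "length q = length cs - length hl" "q \<noteq> [] \<longrightarrow> last q = last cs"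
        and r: "set r \<subseteq> G" "length r = length hl" "length cs = length hl \<longrightarrow> r = cs"
        and eq': "\<forall>z\<in>carrier R. heval R cs z = heval R (hl @ [\<one>]) z \<otimes> heval R q z \<oplus> heval R r z"
        using Cons.IH[OF order.trans[OF set_subset_Cons Cons.prems]] by blast
      note eq = bspec[OF eq']
      \<comment> \<open>After multiplication by the variable, \<open>t\<close> becomes the
        coefficient in the degree of the divisor. It is moved to the quotient by subtracting
        \<open>t\<close> times the divisor.\<close>
      obtain r' t where r': "r = r' @ [t]" using r(2) hl(2) by (metis length_0_conv rev_exhaust)
      define s where "s = ladd R (c # r') (map (\<lambda>d. (\<ominus> t) \<otimes> d) hl)"
      have t: "t \<in> G" and r'G: "set (c # r') \<subseteq> G" using r(1) r' Cons.prems by auto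
      have tc: "t \<in> carrier R" "c \<in> carrier R" using t GR Cons.prems by auto
      have mG: "set (map (\<lambda>d. (\<ominus> t) \<otimes> d) hl) \<subseteq> G"
        using hl(1) t subringE(5,6)[OF G] by auto
      have sG: "set s \<subseteq> G" unfolding s_def by (rule ladd_set[OF G r'G mG])
      have len_ladd: "length xs = length ys \<Longrightarrow> length (ladd R xs ys) = length ys" for xs ys
        by (induction xs ys rule: list_induct2') auto
      have sl: "length s = length hl" unfolding s_def using r(2) r' by (subst len_ladd) auto
      have "heval R (c # cs) z = heval R (hl @ [\<one>]) z \<otimes> heval R (t # q) z \<oplus> heval R s z"
        if z: "z \<in> carrier R" for z
      proof -
        let ?H = "heval R hl z" and ?p = "z [^] length hl" and ?Q = "heval R q z"
        have hc: "set hl \<subseteq> carrier R" "set r' \<subseteq> carrier R" using hl r'G GR by auto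
        have cl: "?H \<in> carrier R" "?p \<in> carrier R" "?Q \<in> carrier R" "heval R r' z \<in> carrier R"
          using hc q(1) GR z by auto
        have F: "heval R (hl @ [\<one>]) z = ?H \<oplus> ?p" using heval_snoc[OF hc(1) one_closed z] z by simp
        have e1: "heval R s z = (c \<oplus> z \<otimes> heval R r' z) \<oplus> (\<ominus> t) \<otimes> ?H"
          unfolding s_def using heval_ladd[of "c # r'" "map (\<lambda>d. (\<ominus> t) \<otimes> d) hl" z]
            heval_map_mult[of "\<ominus> t" hl z] r'G mG GR hc z tc by auto
        have lp: "?p = z \<otimes> z [^] length r'" using r' r(2)[symmetric] nat_pow_Suc2[OF z] by simp
        have e2: "heval R r z = heval R r' z \<oplus> t \<otimes> z [^] length r'"
          unfolding r' using heval_snoc[OF hc(2) tc(1) z] .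
        have zp: "z [^] length r' \<in> carrier R" using z by simp
        have "heval R (c # cs) z = c \<oplus> z \<otimes> ((?H \<oplus> ?p) \<otimes> ?Q \<oplus> (heval R r' z \<oplus> t \<otimes> z [^] length r'))"
          using eq[OF z] F e2 by simp
        also have "\<dots> = (?H \<oplus> ?p) \<otimes> (t \<oplus> z \<otimes> ?Q) \<oplus> ((c \<oplus> z \<otimes> (heval R r' z \<oplus> t \<otimes> z [^] length r')) \<ominus> t \<otimes> (?H \<oplus> ?p))"
          by (rule division_step) (use tc z cl zp in auto)
        also have "(c \<oplus> z \<otimes> (heval R r' z \<oplus> t \<otimes> z [^] length r')) \<ominus> t \<otimes> (?H \<oplus> ?p) = heval R s z"
          unfolding e1 lp using tc z cl zp by algebra
        finally show ?thesis using F by simp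
      qed
      moreover have "set (t # q) \<subseteq> G" using t q by auto
      moreover have "length (t # q) = length (c # cs) - length hl" using False q(2) by auto
      moreover have "last (t # q) = last (c # cs)"
      proof (cases "q = []")
        case True
        then have "length cs = length hl" using q(2) False by auto
        then show ?thesis using r(3) r' True by auto
      next
        case False
        then show ?thesis using q by (cases cs) auto
      qed
      ultimately show ?thesis using sG sl False
        by (intro exI[of _ "t # q"] exI[of _ s]) auto
    qed
  }
qed

lemma synth_div_set:
  "a \<in> carrier R \<Longrightarrow> set cs \<subseteq> carrier R \<Longrightarrow> set (synth_div R a cs) \<subseteq> carrier R"
proof (induction cs rule: induct_list012)
  case (3 c d cs)
  then have "heval R (d # cs) a \<in> carrier R" by (intro heval_closed) auto
  then show ?case using 3 by simp
qed auto

lemma heval_synth_div: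
  "a \<in> carrier R \<Longrightarrow> x \<in> carrier R \<Longrightarrow> set cs \<subseteq> carrier R \<Longrightarrow>
    heval R cs x = heval R cs a \<oplus> (x \<ominus> a) \<otimes> heval R (synth_div R a cs) x"
proof (induction cs rule: induct_list012)
  case (3 c d cs)
  let ?A = "heval R (d # cs) a" and ?X = "heval R (d # cs) x" and ?q = "heval R (synth_div R a (d # cs)) x"
  have cl: "c \<in> carrier R" "?A \<in> carrier R" "?q \<in> carrier R"
    using 3(3-5) synth_div_set[of a "d # cs"] by (auto simp del: heval.simps intro!: heval_closed)
  have "?X = ?A \<oplus> (x \<ominus> a) \<otimes> ?q" using 3 by simp
  then have "heval R (c # d # cs) x = c \<oplus> x \<otimes> (?A \<oplus> (x \<ominus> a) \<otimes> ?q)" by simp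
  also have "\<dots> = (c \<oplus> a \<otimes> ?A) \<oplus> (x \<ominus> a) \<otimes> (?A \<oplus> x \<otimes> ?q)" using cl 3(3,4) by algebra
  finally show ?case by simp
qed auto

lemma taylor:
  assumes "x \<in> carrier R" "e \<in> carrier R" "set cs \<subseteq> carrier R"
  shows "\<exists>t\<in>carrier R. heval R cs (x \<oplus> e) = heval R cs x \<oplus> hder R cs x \<otimes> e \<oplus> e \<otimes> e \<otimes> t"
  using assms(3)
proof (induction cs)
  case Nil show ?case using assms by (auto intro!: bexI[of _ \<zero>])
next
  case (Cons c cs)
  then obtain t where t: "t \<in> carrier R"
    "heval R cs (x \<oplus> e) = heval R cs x \<oplus> hder R cs x \<otimes> e \<oplus> e \<otimes> e \<otimes> t" by auto
  have cl: "c \<in> carrier R" "heval R cs x \<in> carrier R" "hder R cs x \<in> carrier R" using Cons.prems assms by auto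
  have "c \<oplus> (x \<oplus> e) \<otimes> (heval R cs x \<oplus> hder R cs x \<otimes> e \<oplus> e \<otimes> e \<otimes> t)
    = (c \<oplus> x \<otimes> heval R cs x) \<oplus> (heval R cs x \<oplus> x \<otimes> hder R cs x) \<otimes> e
      \<oplus> e \<otimes> e \<otimes> (hder R cs x \<oplus> (x \<oplus> e) \<otimes> t)"
    using cl t(1) assms(1,2) by algebra
  then show ?case using t cl assms(1,2)
    by (intro bexI[of _ "hder R cs x \<oplus> (x \<oplus> e) \<otimes> t"]) auto
qed

lemma der_list_set: "subring G R \<Longrightarrow> set cs \<subseteq> G \<Longrightarrow> set (der_list R k cs) \<subseteq> G"
proof (induction cs arbitrary: k)
  case (Cons c cs)
  have "[n] \<cdot> c \<in> G" for n :: nat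
    using Cons.prems subringE(1)[OF Cons.prems(1)]
    by (induction n) (auto simp: subringE add.nat_pow_Suc)
  then show ?case using Cons by simp
qed simp

text \<open>Raising all multiplicities by \<open>k\<close> adds \<open>k\<close> times the
  polynomial. The induction needs arbitrary \<open>k\<close>; the derivative is the case
  \<open>k = 1\<close>.\<close>

lemma heval_der_list:
  assumes "x \<in> carrier R" "set cs \<subseteq> carrier R"
  shows "heval R (der_list R k cs) x = [k] \<cdot> (heval R cs x) \<oplus> x \<otimes> hder R cs x"
  using assms(2)
proof (induction cs arbitrary: k)
  case (Cons c cs)
  have cl: "c \<in> carrier R" "heval R cs x \<in> carrier R" "hder R cs x \<in> carrier R" using Cons.prems assms by auto
  have m: "[k] \<cdot> (x \<otimes> heval R cs x) = x \<otimes> [k] \<cdot> (heval R cs x)"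
    using add_pow_rdistr[OF assms(1) cl(2)] by simp
  have d: "[k] \<cdot> (c \<oplus> x \<otimes> heval R cs x) = [k] \<cdot> c \<oplus> x \<otimes> [k] \<cdot> (heval R cs x)"
    using cl assms(1) m by (simp add: add.nat_pow_distrib)
  have kc: "[k] \<cdot> c \<in> carrier R" "[k] \<cdot> (heval R cs x) \<in> carrier R" using cl by auto
  have "[k] \<cdot> c \<oplus> x \<otimes> (([k] \<cdot> (heval R cs x) \<oplus> heval R cs x) \<oplus> x \<otimes> hder R cs x)
      = ([k] \<cdot> c \<oplus> x \<otimes> [k] \<cdot> (heval R cs x)) \<oplus> x \<otimes> (heval R cs x \<oplus> x \<otimes> hder R cs x)"
    using cl kc assms(1) by algebra
  then show ?case using Cons d by (simp add: add.nat_pow_Suc)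
qed (simp add: assms)

lemma hder_eq_heval:
  assumes "x \<in> carrier R" "set (c # cs) \<subseteq> carrier R"
  shows "hder R (c # cs) x = heval R (der_list R 1 cs) x"
  using heval_der_list[OF assms(1), of cs 1] assms by simp

end

lemma heval_hom:
  assumes "cring R" "cring S" "h \<in> ring_hom R S" "set cs \<subseteq> carrier R" "x \<in> carrier R"
  shows "h (heval R cs x) = heval S (map h cs) (h x)"
  using assms(4)
proof (induction cs)
  case Nil
  show ?case using ring_hom_zero[OF assms(3) cring.axioms(1)[OF assms(1)] cring.axioms(1)[OF assms(2)]] by simp
next
  case (Cons c cs)
  have "heval R cs x \<in> carrier R" using cring.heval_closed[OF assms(1) _ assms(5)] Cons.prems by simp
  then have "h (heval R (c # cs) x) = h c \<oplus>\<^bsub>S\<^esub> h x \<otimes>\<^bsub>S\<^esub> h (heval R cs x)"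
    using ring_hom_add[OF assms(3)] ring_hom_mult[OF assms(3)] Cons.prems assms(5)
      cring.axioms(1)[OF assms(1)] by (simp add: ring.ring_simprules)
  then show ?case using Cons by simp
qed

context loc_ring
begin

text \<open>This keeps the induction on the number of roots alive: after division by a root modulo
  the nonunits, some coefficient is still a unit.\<close>

lemma synth_div_nonunits:
  assumes "a \<in> carrier R" "set cs \<subseteq> carrier R" "heval R cs a \<in> nonunits R" "set (synth_div R a cs) \<subseteq> nonunits R"
  shows "set cs \<subseteq> nonunits R"
  using assms(2-4)
proof (induction cs rule: induct_list012)
  case (2 c)
  then show ?case using assms(1) by simp
next
  case (3 c d cs)
  let ?A = "heval R (d # cs) a"
  have A: "?A \<in> nonunits R" using 3(5) by simp
  have "set (d # cs) \<subseteq> nonunits R"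
    by (rule 3(2)) (use 3(3,5) A in simp_all)
  moreover have "c \<oplus> a \<otimes> ?A \<in> nonunits R" using 3(4) by simp
  then have "(c \<oplus> a \<otimes> ?A) \<ominus> a \<otimes> ?A \<in> nonunits R"
    using A assms(1) by (intro nonunit_minus_closed N.I_l_closed)
  moreover have "(c \<oplus> a \<otimes> ?A) \<ominus> a \<otimes> ?A = c"
  proof -
    have "c \<in> carrier R" using 3(3) by simp
    then show ?thesis using nonunit_carrier[OF A] assms(1) by algebra
  qed
  ultimately show ?case by simp
qed simp

text \<open>The count of roots over a field, carried out without passing to the residue field: after
  division by one root \<open>a\<close>, the factor \<open>y \<ominus> a\<close> is a unit at every
  other root \<open>y\<close> and can be cancelled.\<close>

lemma finite_roots:
  assumes "set cs \<subseteq> carrier R" "\<not> set cs \<subseteq> nonunits R" "Y \<subseteq> carrier R"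
    "\<And>x y. x \<in> Y \<Longrightarrow> y \<in> Y \<Longrightarrow> x \<noteq> y \<Longrightarrow> x \<ominus> y \<in> Units R"
    "\<And>y. y \<in> Y \<Longrightarrow> heval R cs y \<in> nonunits R"
  shows "finite Y"
  using assms
proof (induction "length cs" arbitrary: cs Y)
  case 0
  then show ?case by simp
next
  case (Suc n)
  show ?case
  proof (cases "Y = {}")
    case False
    then obtain a where a: "a \<in> Y" by blast
    let ?q = "synth_div R a cs"
    have ac: "a \<in> carrier R" using a Suc.prems(3) by blast
    have "finite (Y - {a})"
    proof (rule Suc.hyps(1))
      show "n = length ?q" using Suc.hyps(2) by (simp add: length_synth_div)
      show qc: "set ?q \<subseteq> carrier R" using synth_div_set ac Suc.prems(1) by blast
      show "\<not> set ?q \<subseteq> nonunits R"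
        using synth_div_nonunits[OF ac Suc.prems(1)] Suc.prems(2,5) a by blast
      fix y assume y: "y \<in> Y - {a}"
      have yc: "y \<in> carrier R" using y Suc.prems(3) by blast
      have cl: "heval R cs a \<in> carrier R" "heval R ?q y \<in> carrier R" "y \<ominus> a \<in> carrier R"
        using Suc.prems(1) ac yc qc by auto
      have "heval R cs y \<ominus> heval R cs a \<in> nonunits R"
        using Suc.prems(5) a y by (intro nonunit_minus_closed) auto
      moreover have "heval R cs y \<ominus> heval R cs a = (y \<ominus> a) \<otimes> heval R ?q y"
        unfolding heval_synth_div[OF ac yc Suc.prems(1)] using cl by algebra
      moreover have "y \<ominus> a \<in> Units R" using Suc.prems(4) y a by auto
      ultimately show "heval R ?q y \<in> nonunits R" using unit_mult_nonunit_iff cl(2) by simp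
    qed (use Suc.prems in auto)
    then show ?thesis by simp
  qed simp
qed

end

section \<open>Adjoining a root modulo the maximal ideal\<close>

lemma Art_model_iff:
  "is_model (Art l) R \<longleftrightarrow> cring R \<and> local_ring R \<and> ring_length R \<le> enat l"
  unfolding is_model_Art_iff artinian_local_ring_def
  using finite_length_imp_artinian by (auto simp: local_ring_def)

lemma hom_lspan:
  assumes "cring R" "cring S" "h \<in> ring_hom R S" "G \<subseteq> carrier R" "range b \<subseteq> carrier R"
  shows "h ` lspan R G b j \<subseteq> lspan S (h ` G) (h \<circ> b) j"
proof (induction j)
  case 0
  show ?case using ring_hom_zero[OF assms(3) cring.axioms(1)[OF assms(1)] cring.axioms(1)[OF assms(2)]] by simp
next
  case (Suc j)
  show ?case
  proof
    fix y assume "y \<in> h ` lspan R G b (Suc j)"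
    then obtain x g where x: "x \<in> lspan R G b j" "g \<in> G" "y = h (x \<oplus>\<^bsub>R\<^esub> g \<otimes>\<^bsub>R\<^esub> b j)" by auto
    interpret R: cring R by fact
    have c: "x \<in> carrier R" "g \<in> carrier R" "b j \<in> carrier R"
      using R.lspan_subset[OF assms(5,4) R.carrier_is_subring] x assms(4,5) by auto
    then have "y = h x \<oplus>\<^bsub>S\<^esub> h g \<otimes>\<^bsub>S\<^esub> h (b j)"
      using x(3) ring_hom_add[OF assms(3)] ring_hom_mult[OF assms(3)] by simp
    moreover have "h x \<in> lspan S (h ` G) (h \<circ> b) j" "h g \<in> h ` G" using Suc x by blast+
    ultimately show "y \<in> lspan S (h ` G) (h \<circ> b) (Suc j)"
      unfolding lspan.simps o_apply by blast
  qed
qed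

lemma ring_hom_unit:
  assumes "cring R" "cring S" "h \<in> ring_hom R S" "x \<in> Units R"
  shows "h x \<in> Units S"
proof -
  obtain y where "y \<in> carrier R" "x \<otimes>\<^bsub>R\<^esub> y = \<one>\<^bsub>R\<^esub>" "x \<in> carrier R"
    using assms(4) unfolding cring.unit_iff[OF assms(1)] by blast
  then show ?thesis
    unfolding cring.unit_iff[OF assms(2)]
    using ring_hom_mult[OF assms(3)] ring_hom_one[OF assms(3)] ring_hom_closed[OF assms(3)] by metis
qed

text \<open>It pulls an embedding back to the small elementary substructure of
  \<open>loewenheim_skolem\<close>, whose image contains the image of \<open>h\<close>.\<close>

lemma ring_hom_factor:
  assumes g: "g \<in> ring_hom T0 T" "inj_on g (carrier T0)" and h: "h \<in> ring_hom S T"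
    and T0: "cring T0" and S: "cring S" and sub: "h ` carrier S \<subseteq> g ` carrier T0"
  shows "inv_into (carrier T0) g \<circ> h \<in> ring_hom S T0"
    and "\<And>x. x \<in> carrier S \<Longrightarrow> g (inv_into (carrier T0) g (h x)) = h x"
proof -
  let ?k = "inv_into (carrier T0) g"
  interpret S: cring S by fact
  interpret T0: cring T0 by fact
  show gk: "g (?k (h x)) = h x" if "x \<in> carrier S" for x
    using that sub by (intro f_inv_into_f) blast
  have kc: "?k (h x) \<in> carrier T0" if "x \<in> carrier S" for x
    using that sub by (intro inv_into_into) blast
  show "?k \<circ> h \<in> ring_hom S T0"
  proof (rule ring_hom_memI)
    fix x y assume xy: "x \<in> carrier S" "y \<in> carrier S"
    have "g (?k (h (x \<otimes>\<^bsub>S\<^esub> y))) = g (?k (h x) \<otimes>\<^bsub>T0\<^esub> ?k (h y))"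
      using gk[of "x \<otimes>\<^bsub>S\<^esub> y"] gk[OF xy(1)] gk[OF xy(2)] xy
        ring_hom_mult[OF g(1) kc[OF xy(1)] kc[OF xy(2)]] ring_hom_mult[OF h xy] by (simp only: S.m_closed)
    then show "(?k \<circ> h) (x \<otimes>\<^bsub>S\<^esub> y) = (?k \<circ> h) x \<otimes>\<^bsub>T0\<^esub> (?k \<circ> h) y"
      unfolding o_apply by (rule inj_onD[OF g(2)]) (use xy kc in simp_all)
    have "g (?k (h (x \<oplus>\<^bsub>S\<^esub> y))) = g (?k (h x) \<oplus>\<^bsub>T0\<^esub> ?k (h y))"
      using gk[of "x \<oplus>\<^bsub>S\<^esub> y"] gk[OF xy(1)] gk[OF xy(2)] xy
        ring_hom_add[OF g(1) kc[OF xy(1)] kc[OF xy(2)]] ring_hom_add[OF h xy] by (simp only: S.a_closed)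
    then show "(?k \<circ> h) (x \<oplus>\<^bsub>S\<^esub> y) = (?k \<circ> h) x \<oplus>\<^bsub>T0\<^esub> (?k \<circ> h) y"
      unfolding o_apply by (rule inj_onD[OF g(2)]) (use xy kc in simp_all)
  next
    have "g (?k (h \<one>\<^bsub>S\<^esub>)) = g \<one>\<^bsub>T0\<^esub>"
      using gk[OF S.one_closed] ring_hom_one[OF g(1)] ring_hom_one[OF h] by (simp only:)
    then show "(?k \<circ> h) \<one>\<^bsub>S\<^esub> = \<one>\<^bsub>T0\<^esub>"
      unfolding o_apply by (rule inj_onD[OF g(2)]) (use kc in simp_all)
  qed (use kc in auto)
qed

lemma (in cring) prime_nilpotent:
  assumes "primeideal M R" "x \<in> carrier R" "x [^] (n::nat) \<in> M"
  shows "x \<in> M"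
proof -
  interpret M: primeideal M R by fact
  have "x [^] (k::nat) \<in> M \<Longrightarrow> x \<in> M" for k
  proof (induction k)
    case 0
    then have "\<one> \<in> M" by simp
    then show ?case using M.I_notcarr M.one_imp_carrier by simp
  next
    case (Suc k)
    then show ?case using M.I_prime[of "x [^] k" x] assms(2) by auto
  qed
  then show ?thesis using assms(3) by blast
qed

lemma (in cring) heval_mult_ideal:
  assumes "ideal I R" "B \<in> carrier R" "x \<in> carrier R" "set cs \<subseteq> carrier R"
    "\<And>c. c \<in> set cs \<Longrightarrow> c \<otimes> B \<in> I"
  shows "heval R cs x \<otimes> B \<in> I"
  using assms(4,5)
proof (induction cs)
  case Nil
  then show ?case using assms(1,2) by (simp add: additive_subgroup.zero_closed ideal.axioms(1))
next
  case (Cons c cs)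
  have cl: "c \<in> carrier R" "heval R cs x \<in> carrier R" using Cons.prems assms(3) by auto
  have "heval R (c # cs) x \<otimes> B = c \<otimes> B \<oplus> x \<otimes> (heval R cs x \<otimes> B)"
    unfolding heval.simps using cl assms(2,3) by algebra
  moreover have "c \<otimes> B \<in> I" "heval R cs x \<otimes> B \<in> I" using Cons by auto
  ultimately show ?case
    using assms(1,3) ideal.I_l_closed[OF assms(1)] additive_subgroup.a_closed[OF ideal.axioms(1)[OF assms(1)]]
    by simp
qed

section \<open>The extension \<open>R[X] / (F)\<close> by a monic polynomial\<close>

context UP_cring
begin

definition horner :: "'a list \<Rightarrow> nat \<Rightarrow> 'a" where
  "horner cs = heval P (map (\<lambda>a. up_ring.monom P a 0) cs) (up_ring.monom P \<one> 1)"

lemma const_hom: "(\<lambda>a. up_ring.monom P a 0) \<in> ring_hom R P"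
  using const_ring_hom .

lemma map_const_set: "set cs \<subseteq> carrier R \<Longrightarrow> set (map (\<lambda>a. up_ring.monom P a 0) cs) \<subseteq> carrier P"
  by auto

lemma horner_closed [simp]: "set cs \<subseteq> carrier R \<Longrightarrow> horner cs \<in> carrier P"
  unfolding horner_def using cring.heval_closed[OF UP_cring] map_const_set by simp

lemma coeff_X_mult:
  assumes "q \<in> carrier P"
  shows "up_ring.coeff P (up_ring.monom P \<one> 1 \<otimes>\<^bsub>P\<^esub> q) n = (case n of 0 \<Rightarrow> \<zero> | Suc m \<Rightarrow> up_ring.coeff P q m)"
proof (cases n)
  case 0
  then show ?thesis using assms by simp
next
  case (Suc m)
  have "up_ring.coeff P (up_ring.monom P \<one> 1 \<otimes>\<^bsub>P\<^esub> q) (m + 1) = \<one> \<otimes> up_ring.coeff P q m"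
    using coeff_monom_mult[OF R.one_closed assms, of 1 m] by simp
  then show ?thesis using Suc assms by simp
qed

lemma coeff_horner:
  "set cs \<subseteq> carrier R \<Longrightarrow> up_ring.coeff P (horner cs) n = (if n < length cs then cs ! n else \<zero>)"
proof (induction cs arbitrary: n)
  case Nil
  then show ?case unfolding horner_def by simp
next
  case (Cons c cs)
  have eq: "horner (c # cs) = up_ring.monom P c 0 \<oplus>\<^bsub>P\<^esub> up_ring.monom P \<one> 1 \<otimes>\<^bsub>P\<^esub> horner cs"
    unfolding horner_def by simp
  have "up_ring.coeff P (horner (c # cs)) n = up_ring.coeff P (up_ring.monom P c 0) n \<oplus> (case n of 0 \<Rightarrow> \<zero> | Suc m \<Rightarrow> up_ring.coeff P (horner cs) m)"
    unfolding eq using coeff_X_mult[OF horner_closed] Cons.prems by simp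
  then show ?case using Cons by (auto split: nat.splits intro!: R.l_zero subsetD[OF _ nth_mem])
qed

lemma ex_horner:
  assumes "p \<in> carrier P"
  obtains cs where "set cs \<subseteq> carrier R" "p = horner cs"
proof -
  let ?cs = "map (up_ring.coeff P p) [0..<Suc (deg R p)]"
  have s: "set ?cs \<subseteq> carrier R" using assms by auto
  have "p = horner ?cs"
  proof (rule up_eqI)
    fix n show "up_ring.coeff P p n = up_ring.coeff P (horner ?cs) n"
      unfolding coeff_horner[OF s] using deg_aboveD[of p n] assms
      by (auto simp del: upt_Suc simp: nth_append)
  qed (use assms s in auto)
  then show ?thesis using that s by blast
qed

lemma coeff_monic_mult:
  assumes cs: "set cs \<subseteq> carrier R" and p: "p \<in> carrier P" and z: "\<And>m. m > n \<Longrightarrow> up_ring.coeff P p m = \<zero>"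
  shows "up_ring.coeff P (horner (cs @ [\<one>]) \<otimes>\<^bsub>P\<^esub> p) (n + length cs) = up_ring.coeff P p n"
proof -
  let ?f = "\<lambda>i. up_ring.coeff P (horner (cs @ [\<one>])) i \<otimes> up_ring.coeff P p (n + length cs - i)"
  have s: "set (cs @ [\<one>]) \<subseteq> carrier R" using cs by simp
  have f: "?f i = (if length cs = i then up_ring.coeff P p n else \<zero>)" if "i \<in> {..n + length cs}" for i
  proof -
    consider "i < length cs" | "i = length cs" | "i > length cs" by linarith
    then show ?thesis
    proof cases
      case 1
      then have "up_ring.coeff P p (n + length cs - i) = \<zero>" using z by simp
      then show ?thesis using 1 s by (simp add: horner_closed[OF s])
    qed (use p in \<open>auto simp: coeff_horner[OF s] nth_append\<close>)
  qed
  have "up_ring.coeff P (horner (cs @ [\<one>]) \<otimes>\<^bsub>P\<^esub> p) (n + length cs) = (\<Oplus>i\<in>{..n + length cs}. ?f i)"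
    using coeff_mult[OF horner_closed[OF s] p] by simp
  also have "\<dots> = (\<Oplus>i\<in>{..n + length cs}. if length cs = i then up_ring.coeff P p n else \<zero>)"
    by (rule R.finsum_cong') (use f p in auto)
  also have "\<dots> = up_ring.coeff P p n"
    by (rule R.finsum_singleton) (use p in auto)
  finally show ?thesis .
qed

text \<open>The product of a monic polynomial with a nonzero cofactor keeps the leading coefficient
  of the cofactor in positive degree, so it is never constant. This makes \<open>R\<close> embed
  into \<open>R[X] / (F)\<close>.\<close>

lemma const_monic_multiple:
  assumes cs: "set cs \<subseteq> carrier R" "cs \<noteq> []" and r: "r \<in> carrier R" and p: "p \<in> carrier P"
    and eq: "up_ring.monom P r 0 = horner (cs @ [\<one>]) \<otimes>\<^bsub>P\<^esub> p"
  shows "r = \<zero>"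
proof (cases "p = \<zero>\<^bsub>P\<^esub>")
  case True
  then have "up_ring.monom P r 0 = \<zero>\<^bsub>P\<^esub>"
    using eq cs by (simp add: ring.ring_simprules(24)[OF UP_ring] horner_closed)
  then have "up_ring.coeff P (up_ring.monom P r 0) 0 = \<zero>" by simp
  then show ?thesis using r by simp
next
  case False
  have "up_ring.coeff P p (deg R p) = up_ring.coeff P (horner (cs @ [\<one>]) \<otimes>\<^bsub>P\<^esub> p) (deg R p + length cs)"
    by (rule coeff_monic_mult[symmetric]) (use cs p deg_aboveD in auto)
  also have "\<dots> = \<zero>" unfolding eq[symmetric] using r cs(2) by simp
  finally show ?thesis using lcoeff_nonzero2[OF p False] by simp
qed

text \<open>Let \<open>M\<close> be a maximal ideal of \<open>R[X]\<close> above the given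
  polynomial and \<open>F\<close> a monic element of \<open>M\<close> of least degree, that is, a
  lift of an irreducible factor modulo the nonunits. Then \<open>F\<close> and the nonunits of
  \<open>R\<close> generate \<open>M\<close>, so the maximal ideal of \<open>R[X] / (F)\<close> is
  the extension of that of \<open>R\<close>, and a composition series of \<open>R\<close> bounds the
  length. Dividing by the given polynomial itself could make the quotient longer or destroy
  locality; the price is that it acquires a root only modulo nonunits.\<close>

lemma root_extension_UP:
  assumes loc: "local_ring R" and len: "ring_length R \<le> enat l"
    and cs: "set cs \<subseteq> carrier R" "cs \<noteq> []"
  shows "\<exists>(T :: (nat \<Rightarrow> 'a) set ring) h y. is_model (Art l) T \<and> h \<in> ring_hom R T \<and> inj_on h (carrier R) \<and>
    y \<in> carrier T \<and> heval T (map h (cs @ [\<one>])) y \<in> nonunits T"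
proof -
  interpret L: loc_ring R using loc by (rule loc_ringI)
  let ?C = "\<lambda>a. up_ring.monom P a 0"
  let ?X = "up_ring.monom P \<one> 1"
  have Xc: "?X \<in> carrier P" by simp
  have C1: "?C \<one> = \<one>\<^bsub>P\<^esub>" using ring_hom_one[OF const_hom] .
  have Cnz: "?C \<one> \<notin> PIdl\<^bsub>P\<^esub> horner (ds @ [\<one>])" if ds: "set ds \<subseteq> carrier R" "ds \<noteq> []" for ds
  proof
    have fc: "horner (ds @ [\<one>]) \<in> carrier P" using ds by (intro horner_closed) simp
    assume "?C \<one> \<in> PIdl\<^bsub>P\<^esub> horner (ds @ [\<one>])"
    then obtain p where "p \<in> carrier P" "?C \<one> = p \<otimes>\<^bsub>P\<^esub> horner (ds @ [\<one>])"
      unfolding cgenideal_def by blast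
    then have "\<one> = \<zero>" using const_monic_multiple[OF ds R.one_closed] P.m_comm[OF _ fc] by metis
    then show False using L.one_neq_zero by simp
  qed
  have Fc: "horner (cs @ [\<one>]) \<in> carrier P" using cs by (intro horner_closed) simp
  obtain M where M: "maximalideal M P" and FM: "PIdl\<^bsub>P\<^esub> horner (cs @ [\<one>]) \<subseteq> M"
    using P.proper_ideal_in_maximal[OF P.cgenideal_ideal[OF Fc]] Cnz[OF cs] C1 by metis
  interpret M: maximalideal M P by fact
  have Mprime: "primeideal M P" using P.maximalideal_prime[OF M] .
  have FM': "horner (cs @ [\<one>]) \<in> M" using FM P.cgenideal_self[OF Fc] by blast
  have oneM: "\<one>\<^bsub>P\<^esub> \<notin> M" using M.I_notcarr M.one_imp_carrier by auto
  \<comment> \<open>Nonunits of \<open>R\<close> are nilpotent and therefore lie in every prime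
    ideal of \<open>R[X]\<close>.\<close>
  have nM: "?C a \<in> M" if a: "a \<in> nonunits R" for a
  proof (rule P.prime_nilpotent[OF Mprime])
    show "?C a [^]\<^bsub>P\<^esub> l \<in> M"
      using R.length_nilpotent[OF len loc a] monom_pow[of a 0 l] a by simp
  qed (use a in simp)
  let ?D = "\<lambda>n. \<exists>ds. length ds = n \<and> set ds \<subseteq> carrier R \<and> horner (ds @ [\<one>]) \<in> M"
  have "?D (length cs)" using cs FM' by blast
  define d where "d = (LEAST n. ?D n)"
  have "?D d" unfolding d_def by (rule LeastI) fact
  then obtain ds where ds: "length ds = d" "set ds \<subseteq> carrier R" "horner (ds @ [\<one>]) \<in> M" by blast
  have d_min: "\<not> ?D n" if "n < d" for n using that not_less_Least unfolding d_def by blast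
  have dne: "ds \<noteq> []"
  proof
    assume "ds = []"
    then have "horner (ds @ [\<one>]) = \<one>\<^bsub>P\<^esub>" unfolding horner_def using C1 by simp
    then show False using ds(3) oneM by simp
  qed
  define F where "F = horner (ds @ [\<one>])"
  have FcP: "F \<in> carrier P" and FM1: "F \<in> M" using ds unfolding F_def by (auto intro!: horner_closed)
  have Cset: "subring (?C ` carrier R) P"
    using ring_hom_ring.img_is_subring[of R P ?C "carrier R"] R.carrier_is_subring R.ring_axioms
      P.ring_axioms const_hom by (simp add: ring_hom_ring_def ring_hom_ring_axioms_def)
  \<comment> \<open>Division by \<open>F\<close> leaves a remainder in \<open>M\<close> of smaller
    degree. If it had a unit among its coefficients, dropping the nonunits above the last unit and
    normalizing would give a monic element of \<open>M\<close> below the minimal degree.\<close>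
  have Mgen: "\<exists>q \<rho>. q \<in> carrier P \<and> set \<rho> \<subseteq> nonunits R \<and> g = F \<otimes>\<^bsub>P\<^esub> q \<oplus>\<^bsub>P\<^esub> horner \<rho>" if g: "g \<in> M" for g
  proof -
    have gc: "g \<in> carrier P" using g M.Icarr by simp
    obtain gs where gs: "set gs \<subseteq> carrier R" "g = horner gs" using ex_horner[OF gc] .
    have hl: "set (map ?C ds) \<subseteq> ?C ` carrier R" "map ?C ds \<noteq> []" and gss: "set (map ?C gs) \<subseteq> ?C ` carrier R"
      using ds dne gs by auto
    obtain q r where q: "set q \<subseteq> ?C ` carrier R" and r: "set r \<subseteq> ?C ` carrier R" "length r = length (map ?C ds)"
      and eq: "\<forall>z\<in>carrier P. heval P (map ?C gs) z = heval P (map ?C ds @ [\<one>\<^bsub>P\<^esub>]) z \<otimes>\<^bsub>P\<^esub> heval P q z \<oplus>\<^bsub>P\<^esub> heval P r z"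
      using P.monic_division[OF Cset hl gss] by blast
    have "\<exists>\<rho>. set \<rho> \<subseteq> carrier R \<and> r = map ?C \<rho>"
      using r(1) by (induction r) (auto, metis insert_subset list.set(2) list.simps(9))
    then obtain \<rho> where \<rho>: "set \<rho> \<subseteq> carrier R" "r = map ?C \<rho>" by blast
    let ?Q = "heval P q ?X"
    have Qc: "?Q \<in> carrier P" using q by (intro P.heval_closed) auto
    have geq: "g = F \<otimes>\<^bsub>P\<^esub> ?Q \<oplus>\<^bsub>P\<^esub> horner \<rho>"
      using bspec[OF eq Xc] gs(2) \<rho>(2) C1 unfolding F_def horner_def by simp
    have hc: "horner \<rho> \<in> carrier P" using \<rho> by simp
    have FQ: "F \<otimes>\<^bsub>P\<^esub> ?Q \<in> M" using FM1 Qc M.I_r_closed by blast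
    have "g \<ominus>\<^bsub>P\<^esub> F \<otimes>\<^bsub>P\<^esub> ?Q \<in> M" using g FQ by (simp add: a_minus_def)
    moreover have "g \<ominus>\<^bsub>P\<^esub> F \<otimes>\<^bsub>P\<^esub> ?Q = horner \<rho>" unfolding geq using FcP Qc hc by algebra
    ultimately have hM: "horner \<rho> \<in> M" by simp
    have "set \<rho> \<subseteq> nonunits R"
    proof (rule ccontr)
      assume "\<not> set \<rho> \<subseteq> nonunits R"
      then have "\<exists>x\<in>set \<rho>. x \<notin> nonunits R" by blast
      then obtain r1 u r2 where sp: "\<rho> = r1 @ u # r2" "u \<notin> nonunits R" "\<forall>x\<in>set r2. \<not> x \<notin> nonunits R"
        using split_list_last_prop[of \<rho> "\<lambda>x. x \<notin> nonunits R"] by blast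
      have "u \<in> carrier R" using sp(1) \<rho>(1) by simp
      then have u: "u \<in> Units R" using sp(2) L.nonunitI by blast
      have s1: "set (map ?C (r1 @ [u])) \<subseteq> carrier P" "set (map ?C r2) \<subseteq> carrier P"
        using \<rho>(1) sp(1) by auto
      have e: "horner \<rho> = horner (r1 @ [u]) \<oplus>\<^bsub>P\<^esub> ?X [^]\<^bsub>P\<^esub> length (r1 @ [u]) \<otimes>\<^bsub>P\<^esub> horner r2"
        using P.heval_append[OF s1 Xc] sp(1) unfolding horner_def by simp
      have "horner r2 \<in> M" unfolding horner_def
        by (rule P.heval_ideal[OF M.ideal_axioms _ Xc]) (use sp(3) nM in auto)
      then have B: "?X [^]\<^bsub>P\<^esub> length (r1 @ [u]) \<otimes>\<^bsub>P\<^esub> horner r2 \<in> M"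
        using M.I_l_closed by simp
      have Ac: "horner (r1 @ [u]) \<in> carrier P" using sp \<rho> by (intro horner_closed) auto
      have "horner \<rho> \<ominus>\<^bsub>P\<^esub> ?X [^]\<^bsub>P\<^esub> length (r1 @ [u]) \<otimes>\<^bsub>P\<^esub> horner r2 \<in> M"
        using hM B by (simp add: a_minus_def)
      moreover have "horner \<rho> \<ominus>\<^bsub>P\<^esub> ?X [^]\<^bsub>P\<^esub> length (r1 @ [u]) \<otimes>\<^bsub>P\<^esub> horner r2 = horner (r1 @ [u])"
        unfolding e using M.Icarr[OF B] Ac by algebra
      ultimately have "horner (r1 @ [u]) \<in> M" by simp
      moreover obtain v where v: "v \<in> carrier R" "v \<otimes> u = \<one>"
        using R.Units_inv_closed[OF u] R.Units_l_inv[OF u] by blast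
      ultimately have "?C v \<otimes>\<^bsub>P\<^esub> horner (r1 @ [u]) \<in> M" using M.I_l_closed by simp
      also have "?C v \<otimes>\<^bsub>P\<^esub> horner (r1 @ [u]) = horner (map (\<lambda>x. v \<otimes> x) r1 @ [\<one>])"
      proof -
        have "map (\<lambda>d. ?C v \<otimes>\<^bsub>P\<^esub> d) (map ?C (r1 @ [u])) = map ?C (map (\<lambda>x. v \<otimes> x) (r1 @ [u]))"
          using ring_hom_mult[OF const_hom v(1)] \<rho>(1) sp(1) by auto
        from P.heval_map_mult[OF monom_closed[OF v(1), of 0] s1(1) Xc, unfolded this]
        have "?C v \<otimes>\<^bsub>P\<^esub> horner (r1 @ [u]) = horner (map (\<lambda>x. v \<otimes> x) (r1 @ [u]))"
          unfolding horner_def by (rule sym)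
        then show ?thesis using v(2) by (simp only: list.map map_append)
      qed
      finally have "?D (length r1)" using v(1) \<rho>(1) sp(1)
        by (intro exI[of _ "map (\<lambda>x. v \<otimes> x) r1"]) auto
      moreover have "length r1 < d" using sp(1) \<rho>(2) r(2) ds(1) by simp
      ultimately show False using d_min by blast
    qed
    then show ?thesis using geq Qc by blast
  qed
  let ?J = "PIdl\<^bsub>P\<^esub> F"
  interpret J: ideal ?J P using P.cgenideal_ideal[OF FcP] .
  define T where "T = P Quot ?J"
  define \<pi> where "\<pi> = (\<lambda>x. ?J +>\<^bsub>P\<^esub> x)"
  have Tc: "cring T" unfolding T_def by (rule J.quotient_is_cring[OF UP_cring])
  interpret T: cring T by (rule Tc)
  have \<pi>: "\<pi> \<in> ring_hom P T" unfolding \<pi>_def T_def by (rule J.rcos_ring_hom)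
  have \<pi>surj: "\<exists>p\<in>carrier P. x = \<pi> p" if "x \<in> carrier T" for x
    using that unfolding T_def \<pi>_def FactRing_def A_RCOSETS_def' by auto
  have \<pi>eq: "x \<ominus>\<^bsub>P\<^esub> y \<in> ?J" if "x \<in> carrier P" "y \<in> carrier P" "\<pi> x = \<pi> y" for x y
    using that P.quotient_eq_iff_same_a_r_cos[OF J.ideal_axioms, of x y] unfolding \<pi>_def by simp
  have JM: "?J \<subseteq> M" using M.I_l_closed[OF FM1] unfolding cgenideal_def by auto
  define h where "h = \<pi> \<circ> ?C"
  have h: "h \<in> ring_hom R T" unfolding h_def using ring_hom_trans[OF const_hom \<pi>] .
  have hinj: "inj_on h (carrier R)"
  proof (rule inj_onI)
    fix r s assume rs: "r \<in> carrier R" "s \<in> carrier R" "h r = h s"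
    have "?C r \<ominus>\<^bsub>P\<^esub> ?C s \<in> ?J" using \<pi>eq rs unfolding h_def by simp
    also have "?C r \<ominus>\<^bsub>P\<^esub> ?C s = ?C (r \<ominus> s)" using rs by (simp add: a_minus_def)
    finally obtain p where "p \<in> carrier P" "?C (r \<ominus> s) = p \<otimes>\<^bsub>P\<^esub> F" unfolding cgenideal_def by blast
    then have "r \<ominus> s = \<zero>"
      using const_monic_multiple[OF ds(2) dne, of "r \<ominus> s" p] rs P.m_comm[OF _ FcP] unfolding F_def by simp
    then show "r = s" using rs by (simp add: R.r_right_minus_eq)
  qed
  define y where "y = \<pi> ?X"
  have yc: "y \<in> carrier T" unfolding y_def using ring_hom_closed[OF \<pi> Xc] .
  have \<pi>horner: "\<pi> (horner zs) = heval T (map h zs) y" if "set zs \<subseteq> carrier R" for zs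
    using heval_hom[OF UP_cring Tc \<pi> map_const_set[OF that] Xc] unfolding horner_def h_def y_def by simp
  have \<pi>F: "\<pi> F = \<zero>\<^bsub>T\<^esub>"
  proof -
    have "\<pi> F = ?J" unfolding \<pi>_def using J.a_rcos_const P.cgenideal_self[OF FcP] by blast
    then show ?thesis unfolding T_def FactRing_def by simp
  qed
  have \<pi>M: "\<exists>\<rho>. set \<rho> \<subseteq> nonunits R \<and> \<pi> m = heval T (map h \<rho>) y" if m: "m \<in> M" for m
  proof -
    obtain q \<rho> where q: "q \<in> carrier P" "set \<rho> \<subseteq> nonunits R" "m = F \<otimes>\<^bsub>P\<^esub> q \<oplus>\<^bsub>P\<^esub> horner \<rho>"
      using Mgen[OF m] by blast
    have \<rho>c: "set \<rho> \<subseteq> carrier R" using q(2) by auto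
    have "\<pi> m = \<pi> F \<otimes>\<^bsub>T\<^esub> \<pi> q \<oplus>\<^bsub>T\<^esub> \<pi> (horner \<rho>)"
      using q FcP horner_closed[OF \<rho>c] ring_hom_add[OF \<pi>] ring_hom_mult[OF \<pi>] by simp
    also have "\<dots> = heval T (map h \<rho>) y"
      using \<pi>F \<pi>horner[OF \<rho>c] ring_hom_closed[OF \<pi> q(1)] ring_hom_closed[OF \<pi> horner_closed[OF \<rho>c]] by simp
    finally show ?thesis using q(2) by blast
  qed
  \<comment> \<open>The image of \<open>M\<close> is generated by images of nonunits of
    \<open>R\<close>; these are nilpotent and lie in every maximal ideal of
    \<open>T\<close>.\<close>
  have inmax: "\<pi> m \<in> M'" if m: "m \<in> M" and M': "maximalideal M' T" for m M'
  proof -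
    obtain \<rho> where \<rho>: "set \<rho> \<subseteq> nonunits R" "\<pi> m = heval T (map h \<rho>) y" using \<pi>M[OF m] by blast
    have "h a \<in> M'" if a: "a \<in> nonunits R" for a
    proof (rule T.prime_nilpotent[OF T.maximalideal_prime[OF M']])
      interpret hh: ring_hom_cring R T h
        using R.is_cring Tc h unfolding ring_hom_cring_def ring_hom_cring_axioms_def by blast
      show "h a \<in> carrier T" using a by simp
      have "h a [^]\<^bsub>T\<^esub> l = h (a [^] l)" using a by simp
      also have "\<dots> = \<zero>\<^bsub>T\<^esub>" using R.length_nilpotent[OF len loc a] by simp
      finally show "h a [^]\<^bsub>T\<^esub> l \<in> M'"
        using additive_subgroup.zero_closed[OF ideal.axioms(1)[OF maximalideal.axioms(1)[OF M']]] by simp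
    qed
    then show ?thesis unfolding \<rho>(2)
      using \<rho>(1) by (intro T.heval_ideal[OF maximalideal.axioms(1)[OF M'] _ yc]) auto
  qed
  have unitT: "\<pi> g \<in> Units T" if g: "g \<in> carrier P" "g \<notin> M" for g
  proof (rule ccontr)
    assume n: "\<pi> g \<notin> Units T"
    have "\<pi> g \<in> nonunits T" using n ring_hom_closed[OF \<pi> g(1)] unfolding nonunits_def by simp
    then obtain M' where M': "maximalideal M' T" "\<pi> g \<in> M'" using T.nonunit_in_maximal by blast
    interpret M': maximalideal M' T by fact
    have "M <+>\<^bsub>P\<^esub> PIdl\<^bsub>P\<^esub> g = carrier P"
    proof -
      have id: "ideal (M <+>\<^bsub>P\<^esub> PIdl\<^bsub>P\<^esub> g) P"
        using P.add_ideals[OF M.ideal_axioms P.cgenideal_ideal[OF g(1)]] .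
      have "M \<subseteq> M <+>\<^bsub>P\<^esub> PIdl\<^bsub>P\<^esub> g" "g \<in> M <+>\<^bsub>P\<^esub> PIdl\<^bsub>P\<^esub> g"
      proof -
        show "M \<subseteq> M <+>\<^bsub>P\<^esub> PIdl\<^bsub>P\<^esub> g"
        proof
          fix m assume m: "m \<in> M"
          have "m = m \<oplus>\<^bsub>P\<^esub> \<zero>\<^bsub>P\<^esub>" using M.Icarr[OF m] by simp
          moreover have "\<zero>\<^bsub>P\<^esub> \<in> PIdl\<^bsub>P\<^esub> g"
            using additive_subgroup.zero_closed[OF ideal.axioms(1)[OF P.cgenideal_ideal[OF g(1)]]] .
          ultimately show "m \<in> M <+>\<^bsub>P\<^esub> PIdl\<^bsub>P\<^esub> g" using m unfolding set_add_def' by blast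
        qed
        have "g = \<zero>\<^bsub>P\<^esub> \<oplus>\<^bsub>P\<^esub> g" using g(1) by simp
        then show "g \<in> M <+>\<^bsub>P\<^esub> PIdl\<^bsub>P\<^esub> g"
          using M.zero_closed P.cgenideal_self[OF g(1)] unfolding set_add_def' by blast
      qed
      then show ?thesis using M.I_maximal[OF id] g(2) ideal.Icarr[OF id] by blast
    qed
    then obtain m a where ma: "m \<in> M" "a \<in> carrier P" "\<one>\<^bsub>P\<^esub> = m \<oplus>\<^bsub>P\<^esub> a \<otimes>\<^bsub>P\<^esub> g"
      using P.one_closed unfolding set_add_def' cgenideal_def by blast
    have "\<one>\<^bsub>T\<^esub> = \<pi> m \<oplus>\<^bsub>T\<^esub> \<pi> a \<otimes>\<^bsub>T\<^esub> \<pi> g"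
      using ma g ring_hom_one[OF \<pi>] ring_hom_add[OF \<pi>] ring_hom_mult[OF \<pi>] M.Icarr P.m_closed by metis
    then have "\<one>\<^bsub>T\<^esub> \<in> M'"
      using inmax[OF ma(1) M'(1)] M'.I_l_closed[OF M'(2) ring_hom_closed[OF \<pi> ma(2)]] by simp
    then show False using M'.I_notcarr M'.one_imp_carrier by auto
  qed
  have nonunitT: "\<pi> m \<notin> Units T" if m: "m \<in> M" for m
  proof
    assume "\<pi> m \<in> Units T"
    then obtain t where "t \<in> carrier T" "\<pi> m \<otimes>\<^bsub>T\<^esub> t = \<one>\<^bsub>T\<^esub>" unfolding T.unit_iff by blast
    then obtain p where p: "p \<in> carrier P" "\<pi> (m \<otimes>\<^bsub>P\<^esub> p) = \<pi> \<one>\<^bsub>P\<^esub>"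
      using \<pi>surj ring_hom_mult[OF \<pi> M.Icarr[OF m]] ring_hom_one[OF \<pi>] by metis
    have mp: "m \<otimes>\<^bsub>P\<^esub> p \<in> M" using m p(1) M.I_r_closed by blast
    have "m \<otimes>\<^bsub>P\<^esub> p \<ominus>\<^bsub>P\<^esub> \<one>\<^bsub>P\<^esub> \<in> M" using \<pi>eq[OF M.Icarr[OF mp] P.one_closed p(2)] JM by blast
    then have "m \<otimes>\<^bsub>P\<^esub> p \<ominus>\<^bsub>P\<^esub> (m \<otimes>\<^bsub>P\<^esub> p \<ominus>\<^bsub>P\<^esub> \<one>\<^bsub>P\<^esub>) \<in> M" using mp by (simp add: a_minus_def)
    moreover have "m \<otimes>\<^bsub>P\<^esub> p \<ominus>\<^bsub>P\<^esub> (m \<otimes>\<^bsub>P\<^esub> p \<ominus>\<^bsub>P\<^esub> \<one>\<^bsub>P\<^esub>) = \<one>\<^bsub>P\<^esub>" using M.Icarr[OF mp] by algebra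
    ultimately show False using oneM by simp
  qed
  have oneT: "\<one>\<^bsub>T\<^esub> = \<pi> \<one>\<^bsub>P\<^esub>" using ring_hom_one[OF \<pi>] by simp
  have locT: "local_ring T"
    unfolding T.local_axioms_iff[symmetric]
  proof (intro conjI ballI)
    show "\<zero>\<^bsub>T\<^esub> \<noteq> \<one>\<^bsub>T\<^esub>" using nonunitT[OF FM1] \<pi>F by auto
    fix x assume "x \<in> carrier T"
    then obtain g where g: "g \<in> carrier P" "x = \<pi> g" using \<pi>surj by blast
    show "\<exists>y\<in>carrier T. x \<otimes>\<^bsub>T\<^esub> y = \<one>\<^bsub>T\<^esub> \<or> (\<one>\<^bsub>T\<^esub> \<oplus>\<^bsub>T\<^esub> \<ominus>\<^bsub>T\<^esub> x) \<otimes>\<^bsub>T\<^esub> y = \<one>\<^bsub>T\<^esub>"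
    proof (cases "g \<in> M")
      case True
      have "\<one>\<^bsub>P\<^esub> \<oplus>\<^bsub>P\<^esub> \<ominus>\<^bsub>P\<^esub> g \<notin> M"
      proof
        assume "\<one>\<^bsub>P\<^esub> \<oplus>\<^bsub>P\<^esub> \<ominus>\<^bsub>P\<^esub> g \<in> M"
        then have "(\<one>\<^bsub>P\<^esub> \<oplus>\<^bsub>P\<^esub> \<ominus>\<^bsub>P\<^esub> g) \<oplus>\<^bsub>P\<^esub> g \<in> M" using True by simp
        moreover have "(\<one>\<^bsub>P\<^esub> \<oplus>\<^bsub>P\<^esub> \<ominus>\<^bsub>P\<^esub> g) \<oplus>\<^bsub>P\<^esub> g = \<one>\<^bsub>P\<^esub>" using g(1) by algebra
        ultimately show False using oneM by simp
      qed
      then have "\<pi> (\<one>\<^bsub>P\<^esub> \<oplus>\<^bsub>P\<^esub> \<ominus>\<^bsub>P\<^esub> g) \<in> Units T" using g by (intro unitT) auto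
      moreover have "\<pi> (\<one>\<^bsub>P\<^esub> \<oplus>\<^bsub>P\<^esub> \<ominus>\<^bsub>P\<^esub> g) = \<one>\<^bsub>T\<^esub> \<oplus>\<^bsub>T\<^esub> \<ominus>\<^bsub>T\<^esub> x"
        using g ring_hom_add[OF \<pi>] ring_hom_one[OF \<pi>] ring_hom_minus[OF UP_cring Tc \<pi>] by simp
      ultimately show ?thesis unfolding T.unit_iff by auto
    next
      case False
      then show ?thesis using unitT[OF g(1)] g(2) unfolding T.unit_iff by auto
    qed
  qed
  interpret LT: loc_ring T using locT by (rule loc_ringI)
  have nonT: "\<exists>\<rho>. set \<rho> \<subseteq> nonunits R \<and> x = heval T (map h \<rho>) y" if x: "x \<in> nonunits T" for x
  proof -
    obtain g where g: "g \<in> carrier P" "x = \<pi> g" using \<pi>surj LT.nonunit_carrier[OF x] by blast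
    then have "g \<in> M" using unitT x LT.unit_not_nonunit by blast
    then show ?thesis using \<pi>M g by blast
  qed
  obtain n where n: "n \<le> l" "ring_length R = enat n"
    using len by (cases "ring_length R") auto
  obtain b where b: "comp_seq R b n" using L.ex_comp_seq[OF n(2)] .
  have bc: "range b \<subseteq> carrier R" using b unfolding comp_seq_def by blast
  have hb: "range (h \<circ> b) \<subseteq> carrier T" using bc ring_hom_closed[OF h] by auto
  have hspan: "h x \<in> lspan T (carrier T) (h \<circ> b) j" if "x \<in> lspan R (carrier R) b j" for x j
  proof -
    have "h ` carrier R \<subseteq> carrier T" using ring_hom_closed[OF h] by blast
    then show ?thesis
      using hom_lspan[OF R.is_cring Tc h order.refl bc, of j] lspan_mono[of "h ` carrier R" "carrier T" T] that by blast
  qed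
  \<comment> \<open>A nonunit of \<open>T\<close> is a polynomial in \<open>y\<close> with nonunits
    of \<open>R\<close> as coefficients, and each of these coefficients pushes
    \<open>h (b j)\<close> into the span of its predecessors.\<close>
  have "comp_seq T (h \<circ> b) n"
    unfolding comp_seq_def
  proof (intro conjI allI impI ballI)
    show "range (h \<circ> b) \<subseteq> carrier T" by (rule hb)
    show "\<one>\<^bsub>T\<^esub> \<in> lspan T (carrier T) (h \<circ> b) n"
      using hspan[of \<one> n] b ring_hom_one[OF h] unfolding comp_seq_def by simp
    fix j x assume j: "j < n" and x: "x \<in> nonunits T"
    obtain \<rho> where \<rho>: "set \<rho> \<subseteq> nonunits R" "x = heval T (map h \<rho>) y" using nonT[OF x] by blast
    have bj: "b j \<in> carrier R" using bc by auto
    show "x \<otimes>\<^bsub>T\<^esub> (h \<circ> b) j \<in> lspan T (carrier T) (h \<circ> b) j"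
      unfolding \<rho>(2)
    proof (rule T.heval_mult_ideal[OF T.lspan_ideal[OF hb] _ yc])
      show "(h \<circ> b) j \<in> carrier T" using hb by auto
      show "set (map h \<rho>) \<subseteq> carrier T" using \<rho>(1) ring_hom_closed[OF h] by auto
      fix c assume "c \<in> set (map h \<rho>)"
      then obtain a where a: "a \<in> nonunits R" "c = h a" using \<rho>(1) by auto
      have "a \<otimes> b j \<in> lspan R (carrier R) b j" using b j a(1) unfolding comp_seq_def by blast
      from hspan[OF this] show "c \<otimes>\<^bsub>T\<^esub> (h \<circ> b) j \<in> lspan T (carrier T) (h \<circ> b) j"
        unfolding a(2) o_apply ring_hom_mult[OF h L.nonunit_carrier[OF a(1)] bj] .
    qed
  qed
  from LT.comp_seq_length_le[OF this]
  have "ring_length T \<le> enat (card {j. j < n \<and> (h \<circ> b) j \<notin> lspan T (carrier T) (h \<circ> b) j})" .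
  also have "card {j. j < n \<and> (h \<circ> b) j \<notin> lspan T (carrier T) (h \<circ> b) j} \<le> card {..<n}"
    by (intro card_mono) auto
  finally have "ring_length T \<le> enat l" using n(1) by (simp add: order.trans)
  then have "is_model (Art l) T" unfolding Art_model_iff using Tc locT by blast
  moreover have "heval T (map h (cs @ [\<one>])) y \<in> nonunits T"
  proof -
    have "\<pi> (horner (cs @ [\<one>])) \<in> nonunits T"
      using LT.nonunitI[OF ring_hom_closed[OF \<pi> Fc] nonunitT[OF FM']] .
    then show ?thesis using \<pi>horner[of "cs @ [\<one>]"] cs by simp
  qed
  ultimately show ?thesis using h hinj yc by blast
qed

end

text \<open>The elementary hull of the image of \<open>S\<close> and of the root brings the
  extension back to the type \<open>'b\<close>, so that the construction can be iterated.\<close>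

lemma root_extension:
  fixes S :: "'b ring"
  assumes model: "is_model (Art l) S" and inf: "infinite (UNIV :: 'b set)"
    and cs: "set cs \<subseteq> carrier S" "cs \<noteq> []"
  shows "\<exists>(T :: 'b ring) h y. is_model (Art l) T \<and> h \<in> ring_hom S T \<and> inj_on h (carrier S) \<and>
    y \<in> carrier T \<and> heval T (map h (cs @ [\<one>\<^bsub>S\<^esub>])) y \<in> nonunits T"
proof -
  have S: "cring S" "local_ring S" "ring_length S \<le> enat l" using model unfolding Art_model_iff by auto
  interpret S: UP_cring S "UP S" using S(1) by (simp add: UP_cring_def)
  obtain T :: "(nat \<Rightarrow> 'b) set ring" and h y where T: "is_model (Art l) T" "h \<in> ring_hom S T"
    "inj_on h (carrier S)" "y \<in> carrier T" "heval T (map h (cs @ [\<one>\<^bsub>S\<^esub>])) y \<in> nonunits T"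
    using S.root_extension_UP[OF S(2,3) cs] by blast
  have Tc: "cring T" using T(1) unfolding Art_model_iff by blast
  have hT: "h ` carrier S \<subseteq> carrier T" using ring_hom_closed[OF T(2)] by blast
  have yT: "range (\<lambda>_::nat. y) \<subseteq> carrier T" using T(4) by auto
  obtain T0 :: "'b ring" and g where T0: "cring T0" "g \<in> ring_hom T0 T" "inj_on g (carrier T0)"
    "h ` carrier S \<subseteq> g ` carrier T0" "range (\<lambda>_::nat. y) \<subseteq> g ` carrier T0"
    "\<And>e \<phi>. range e \<subseteq> carrier T0 \<Longrightarrow> sat T0 e \<phi> \<longleftrightarrow> sat T (g \<circ> e) \<phi>"
    using loewenheim_skolem[OF Tc hT yT inf, of id] by (metis inj_on_id)
  let ?k = "inv_into (carrier T0) g"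
  have k: "?k \<circ> h \<in> ring_hom S T0" "\<And>x. x \<in> carrier S \<Longrightarrow> g (?k (h x)) = h x"
    using ring_hom_factor[OF T0(2,3) T(2) T0(1) S(1) T0(4)] by blast+
  obtain y0 where y0: "y0 \<in> carrier T0" "g y0 = y" using T0(5) by auto
  have m: "is_model (Art l) T0"
    using elementary_is_model[of T0 g T "Art l"] ring_structure_cring[OF T0(1)]
      ring_hom_closed[OF T0(2)] T0(6) T(1) by blast
  have kinj: "inj_on (?k \<circ> h) (carrier S)"
    using k(2) T(3) unfolding inj_on_def by (metis o_apply)
  let ?z = "heval T0 (map (?k \<circ> h) (cs @ [\<one>\<^bsub>S\<^esub>])) y0"
  have s: "set (map (?k \<circ> h) (cs @ [\<one>\<^bsub>S\<^esub>])) \<subseteq> carrier T0"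
    using ring_hom_closed[OF k(1)] cs(1) S.R.one_closed by auto
  have "map g (map (?k \<circ> h) (cs @ [\<one>\<^bsub>S\<^esub>])) = map h (cs @ [\<one>\<^bsub>S\<^esub>])"
    using k(2) cs(1) S.R.one_closed by auto
  from heval_hom[OF T0(1) Tc T0(2) s y0(1), unfolded this y0(2)] T(5)
  have "g ?z \<in> nonunits T" by (simp only:)
  moreover have zc: "?z \<in> carrier T0" using cring.heval_closed[OF T0(1) s y0(1)] .
  ultimately have "?z \<in> nonunits T0"
    using ring_hom_unit[OF T0(1) Tc T0(2)] unfolding nonunits_def by blast
  then show ?thesis using m k(1) kinj y0(1) by blast
qed

section \<open>Existentially closed models are Gorenstein of full length\<close>

text \<open>It frees the extension from the type \<open>'b\<close>: by Loewenheim-Skolem only an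
  elementary substructure over \<open>R\<close> has to fit there.\<close>

lemma existentially_closed_transfer:
  fixes R :: "('a, 'm) ring_scheme" and T :: "('c, 'k) ring_scheme"
  assumes ec: "existentially_closed TYPE('b) (Art l) R"
    and inf: "infinite (UNIV :: 'b set)" and f: "inj_on (f :: 'a \<Rightarrow> 'b) (carrier R)"
    and T: "is_model (Art l) T" "h \<in> ring_hom R T" "inj_on h (carrier R)"
    and \<phi>: "existential \<phi>" and e: "range e \<subseteq> carrier R" and sat: "sat T (h \<circ> e) \<phi>"
  shows "sat R e \<phi>"
proof -
  have Tc: "cring T" using T(1) unfolding Art_model_iff by blast
  have Rc: "cring R" using ec unfolding existentially_closed_def Art_model_iff by blast
  interpret T: cring T by fact
  have hT: "h ` carrier R \<subseteq> carrier T" using ring_hom_closed[OF T(2)] by blast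
  have yT: "range (\<lambda>_::nat. \<zero>\<^bsub>T\<^esub>) \<subseteq> carrier T" by auto
  obtain T0 :: "'b ring" and g where T0: "cring T0" "g \<in> ring_hom T0 T" "inj_on g (carrier T0)"
    "h ` carrier R \<subseteq> g ` carrier T0"
    "\<And>e \<phi>. range e \<subseteq> carrier T0 \<Longrightarrow> sat T0 e \<phi> \<longleftrightarrow> sat T (g \<circ> e) \<phi>"
    using loewenheim_skolem[OF Tc hT yT inf f] by metis
  let ?k = "inv_into (carrier T0) g"
  have k: "?k \<circ> h \<in> ring_hom R T0" "\<And>x. x \<in> carrier R \<Longrightarrow> g (?k (h x)) = h x"
    using ring_hom_factor[OF T0(2,3) T(2) T0(1) Rc T0(4)] by blast+
  have kinj: "inj_on (?k \<circ> h) (carrier R)"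
    using k(2) T(3) unfolding inj_on_def by (metis o_apply)
  have m: "is_model (Art l) T0"
    using elementary_is_model[of T0 g T "Art l"] ring_structure_cring[OF T0(1)]
      ring_hom_closed[OF T0(2)] T0(5) T(1) by blast
  have r: "range (?k \<circ> h \<circ> e) \<subseteq> carrier T0" using ring_hom_closed[OF k(1)] e by auto
  have "g \<circ> (?k \<circ> h \<circ> e) = h \<circ> e" using k(2) e by (auto simp: fun_eq_iff)
  then have "sat T0 (?k \<circ> h \<circ> e) \<phi>" using T0(5)[OF r, of \<phi>] sat by (simp only:)
  then show ?thesis
    using ec m k(1) kinj \<phi> e unfolding existentially_closed_def by blast
qed

subsection \<open>The residue field\<close>

text \<open>Algebraic closedness of the residue field, expressed in \<open>R\<close> itself. A
  nonempty \<open>cs\<close> means positive degree.\<close>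

definition root_closed :: "('a, 'm) ring_scheme \<Rightarrow> bool" where
  "root_closed R \<longleftrightarrow> (\<forall>cs. set cs \<subseteq> carrier R \<and> cs \<noteq> [] \<longrightarrow>
     (\<exists>y\<in>carrier R. heval R (cs @ [\<one>\<^bsub>R\<^esub>]) y \<in> nonunits R))"

primrec horner_term :: "nat \<Rightarrow> nat \<Rightarrow> rterm" where
  "horner_term k 0 = TZero"
| "horner_term k (Suc n) = TAdd (TVar k) (TMul (TVar 0) (horner_term (Suc k) n))"

primrec power_term :: "rterm \<Rightarrow> nat \<Rightarrow> rterm" where
  "power_term t 0 = TOne"
| "power_term t (Suc n) = TMul (power_term t n) t"

lemma teval_horner_term: "teval R e (horner_term k n) = heval R (map e [k..<k + n]) (e 0)"
proof (induction n arbitrary: k)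
  case (Suc n)
  have "[k..<k + Suc n] = k # [Suc k..<Suc k + n]" by (simp add: upt_rec)
  then show ?case using Suc by simp
qed simp

lemma teval_power_term: "teval R e (power_term t n) = teval R e t [^]\<^bsub>R\<^esub> n"
  by (induction n) (auto simp: nat_pow_def)

lemma existentially_closed_root_closed:
  fixes R :: "('a, 'm) ring_scheme"
  assumes ec: "existentially_closed TYPE('b) (Art l) R"
    and inf: "infinite (UNIV :: 'b set)" and f: "inj_on (f :: 'a \<Rightarrow> 'b) (carrier R)"
  shows "root_closed R"
  unfolding root_closed_def
proof (intro allI impI, elim conjE)
  fix cs assume cs: "set cs \<subseteq> carrier R" "cs \<noteq> []"
  have R: "cring R" "local_ring R" "ring_length R \<le> enat l"
    using ec unfolding existentially_closed_def Art_model_iff by blast+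
  interpret loc_ring R using R(2) by (rule loc_ringI)
  have U: "UP_cring R" using R(1) by (simp add: UP_cring_def)
  obtain T :: "(nat \<Rightarrow> 'a) set ring" and h y where T: "is_model (Art l) T" "h \<in> ring_hom R T"
    "inj_on h (carrier R)" "y \<in> carrier T" "heval T (map h (cs @ [\<one>\<^bsub>R\<^esub>])) y \<in> nonunits T"
    using UP_cring.root_extension_UP[OF U R(2,3) cs] by blast
  have TT: "cring T" "local_ring T" "ring_length T \<le> enat l" using T(1) unfolding Art_model_iff by blast+
  define zs where "zs = cs @ [\<one>\<^bsub>R\<^esub>]"
  have zs: "set zs \<subseteq> carrier R" using cs unfolding zs_def by simp
  \<comment> \<open>Variable 0 is reserved for the root, so the coefficients occupy the variables
    from 1 on.\<close>
  define e where "e i = (if i = 0 then \<zero>\<^bsub>R\<^esub> else padded \<zero>\<^bsub>R\<^esub> zs (i - 1))" for i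
  have e: "range e \<subseteq> carrier R" using zs unfolding e_def padded_def by (auto simp: subset_iff)
  let ?n = "length zs"
  have me: "map e [1..<1 + ?n] = zs"
    by (rule nth_equalityI) (simp_all add: e_def padded_def del: upt_Suc)
  \<comment> \<open>By \<open>length_nilpotent\<close>, the vanishing of the \<open>l\<close>-th
    power says that the value is a nonunit. This form is quantifier free, whereas non-invertibility
    would need a universal quantifier.\<close>
  let ?\<phi> = "FEx 0 (FEq (power_term (horner_term 1 ?n) l) TZero)"
  have ev: "sat S (e'(0 := x)) (FEq (power_term (horner_term 1 ?n) l) TZero) \<longleftrightarrow>
      heval S (map e' [1..<1 + ?n]) x [^]\<^bsub>S\<^esub> l = \<zero>\<^bsub>S\<^esub>"
    for S :: "('z, 'y) ring_scheme" and e' x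
  proof -
    have "map (e'(0 := x)) [1..<1 + ?n] = map e' [1..<1 + ?n]" by auto
    then show ?thesis by (simp only: sat.simps teval_power_term teval_horner_term teval.simps fun_upd_same)
  qed
  have "map (h \<circ> e) [1..<1 + ?n] = map h zs" using me by (metis map_map)
  moreover have "heval T (map h zs) y [^]\<^bsub>T\<^esub> l = \<zero>\<^bsub>T\<^esub>"
    using cring.length_nilpotent[OF TT(1,3,2)] T(5) unfolding zs_def by blast
  ultimately have "sat T (h \<circ> e) ?\<phi>" using ev[of T "h \<circ> e" y] T(4) by auto
  moreover have "existential ?\<phi>" by (intro existential.intros) simp
  ultimately have "sat R e ?\<phi>" using existentially_closed_transfer[OF ec inf f T(1-3) _ e] by blast
  then obtain x where x: "x \<in> carrier R" "heval R zs x [^]\<^bsub>R\<^esub> l = \<zero>\<^bsub>R\<^esub>" using ev[of R e] me by auto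
  have "heval R zs x \<notin> Units R"
  proof
    assume "heval R zs x \<in> Units R"
    then have "heval R zs x [^]\<^bsub>R\<^esub> l \<in> Units R" by (rule Units_pow_closed)
    then show False using x(2) unit_not_nonunit[of "\<zero>\<^bsub>R\<^esub>"] by simp
  qed
  then have "heval R zs x \<in> nonunits R" using nonunitI[OF heval_closed[OF zs x(1)]] by blast
  then show "\<exists>y\<in>carrier R. heval R (cs @ [\<one>\<^bsub>R\<^esub>]) y \<in> nonunits R"
    using x(1) unfolding zs_def by blast
qed

text \<open>The lists evaluated by \<open>eval\<close> start with the leading coefficient, hence the
  reversal.\<close>

lemma (in cring) eval_eq_heval:
  assumes "set p \<subseteq> carrier R" "x \<in> carrier R"
  shows "eval p x = heval R (rev p) x"
  using assms(1)
proof (induction p)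
  case (Cons a p)
  have s: "set (rev p) \<subseteq> carrier R" "a \<in> carrier R" using Cons.prems by auto
  have "eval (a # p) x = a \<otimes> x [^] length p \<oplus> heval R (rev p) x" using Cons by simp
  also have "\<dots> = heval R (rev (a # p)) x"
    using heval_snoc[OF s assms(2)] s assms(2) by (simp add: a_comm)
  finally show ?case .
qed simp

context loc_ring
begin

lemma residue_hom:
  "cring (residue_field R)" "field (residue_field R)"
  "(\<lambda>x. nonunits R +> x) \<in> ring_hom R (residue_field R)"
  "carrier (residue_field R) = (\<lambda>x. nonunits R +> x) ` carrier R"
proof -
  have eq: "residue_field R = R Quot nonunits R" unfolding residue_field_def max_ideal_eq ..
  show "cring (residue_field R)" unfolding eq by (rule N.quotient_is_cring[OF is_cring])
  show "field (residue_field R)" unfolding eq by (rule N.quotient_is_field[OF is_cring])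
  show "(\<lambda>x. nonunits R +> x) \<in> ring_hom R (residue_field R)" unfolding eq by (rule N.rcos_ring_hom)
  show "carrier (residue_field R) = (\<lambda>x. nonunits R +> x) ` carrier R"
    unfolding eq FactRing_def A_RCOSETS_def' by auto
qed

lemma residue_eq_iff:
  assumes "x \<in> carrier R" "y \<in> carrier R"
  shows "nonunits R +> x = nonunits R +> y \<longleftrightarrow> x \<ominus> y \<in> nonunits R"
  using quotient_eq_iff_same_a_r_cos[OF N.ideal_axioms assms] by simp

lemma residue_zero_iff:
  assumes "x \<in> carrier R"
  shows "nonunits R +> x = \<zero>\<^bsub>residue_field R\<^esub> \<longleftrightarrow> x \<in> nonunits R"
proof -
  have "\<zero>\<^bsub>residue_field R\<^esub> = nonunits R +> \<zero>"
    using ring_hom_zero[OF residue_hom(3) ring_axioms cring.axioms(1)[OF residue_hom(1)]] by simp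
  then show ?thesis using residue_eq_iff[OF assms zero_closed] assms by (simp add: a_minus_def)
qed

text \<open>Coefficients are lifted from the residue field one by one. A lift of a nonzero leading
  coefficient is a unit, and dividing by it gives the monic form that \<open>root_closed\<close>
  speaks about.\<close>

lemma algebraically_closed_iff_root_closed:
  "algebraically_closed (residue_field R) \<longleftrightarrow> root_closed R"
proof
  let ?K = "residue_field R" and ?\<pi> = "\<lambda>x. nonunits R +> x"
  interpret K: field ?K by (rule residue_hom(2))
  note \<pi> = residue_hom(3)
  {
    assume "algebraically_closed ?K"
    then interpret A: algebraically_closed ?K .
    show "root_closed R"
      unfolding root_closed_def
    proof (intro allI impI, elim conjE)
      fix cs assume cs: "set cs \<subseteq> carrier R" "cs \<noteq> []"
      let ?p = "rev (map ?\<pi> (cs @ [\<one>]))"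
      have s: "set (cs @ [\<one>]) \<subseteq> carrier R" using cs by simp
      have pc: "set ?p \<subseteq> carrier ?K" using s ring_hom_closed[OF \<pi>] by auto
      have "hd ?p = \<one>\<^bsub>?K\<^esub>" using ring_hom_one[OF \<pi>] by simp
      then have "?p \<in> carrier (poly_ring ?K)"
        using pc unfolding univ_poly_carrier[symmetric] polynomial_def by simp
      moreover have "length ?p - 1 > 0" using cs(2) by simp
      ultimately have "K.roots ?p \<noteq> {#}" using A.roots_over_carrier unfolding K.splitted_def by force
      then obtain x where "x \<in># K.roots ?p" by blast
      then have x: "x \<in> carrier ?K" "K.eval ?p x = \<zero>\<^bsub>?K\<^esub>"
        using K.roots_mem_iff_is_root[OF \<open>?p \<in> _\<close>] unfolding K.is_root_def by auto
      then obtain y where y: "y \<in> carrier R" "x = ?\<pi> y" unfolding residue_hom(4) by blast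
      have "?\<pi> (heval R (cs @ [\<one>]) y) = heval ?K (map ?\<pi> (cs @ [\<one>])) (?\<pi> y)"
        using heval_hom[OF is_cring residue_hom(1) \<pi> s y(1)] .
      also have "\<dots> = \<zero>\<^bsub>?K\<^esub>" using x K.eval_eq_heval[OF pc x(1)] y(2) by simp
      finally show "\<exists>y\<in>carrier R. heval R (cs @ [\<one>]) y \<in> nonunits R"
        using residue_zero_iff heval_closed[OF s y(1)] y(1) by blast
    qed
  next
    assume rc: "root_closed R"
    show "algebraically_closed ?K"
    proof (rule K.algebraically_closedI)
      fix p assume p: "p \<in> carrier (poly_ring ?K)" and deg: "degree p > 1"
      have pp: "set p \<subseteq> carrier ?K" "hd p \<noteq> \<zero>\<^bsub>?K\<^esub>" "p \<noteq> []"
        using p deg unfolding univ_poly_carrier[symmetric] polynomial_def by auto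
      have "\<exists>qs. set qs \<subseteq> carrier R \<and> map ?\<pi> qs = rev p"
      proof -
        have "\<exists>qs. set qs \<subseteq> carrier R \<and> map ?\<pi> qs = r" if "set r \<subseteq> carrier ?K" for r
          using that
        proof (induction r)
          case (Cons c r)
          then obtain qs q where "set qs \<subseteq> carrier R" "map ?\<pi> qs = r" "q \<in> carrier R" "?\<pi> q = c"
            unfolding residue_hom(4) by auto
          then show ?case by (intro exI[of _ "q # qs"]) auto
        qed simp
        then show ?thesis using pp(1) by simp
      qed
      then obtain qs where qs: "set qs \<subseteq> carrier R" "map ?\<pi> qs = rev p" by blast
      have "length qs = length p" using qs(2) by (metis length_map length_rev)
      then obtain rs u where rs: "qs = rs @ [u]" using pp(3) by (metis length_0_conv rev_exhaust)
      have rsc: "set rs \<subseteq> carrier R" "u \<in> carrier R" using qs(1) rs by auto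
      have "?\<pi> u = hd p" using qs(2) rs pp(3) by (metis hd_rev last_map last_snoc rev_rev_ident snoc_eq_iff_butlast)
      then have "u \<notin> nonunits R" using pp(2) residue_zero_iff[OF rsc(2)] by simp
      then have u: "u \<in> Units R" using nonunitI rsc(2) by blast
      let ?cs = "map (\<lambda>x. inv u \<otimes> x) rs"
      have iu: "inv u \<in> carrier R" using u by simp
      have csc: "set ?cs \<subseteq> carrier R" using rsc iu by auto
      have "?cs \<noteq> []" using deg \<open>length qs = length p\<close> rs by auto
      then obtain y where y: "y \<in> carrier R" "heval R (?cs @ [\<one>]) y \<in> nonunits R"
        using rc csc unfolding root_closed_def by blast
      have "?cs @ [\<one>] = map (\<lambda>x. inv u \<otimes> x) qs" using rs u by simp
      then have "inv u \<otimes> heval R qs y \<in> nonunits R"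
        using y heval_map_mult[OF iu qs(1) y(1)] by simp
      then have "heval R qs y \<in> nonunits R"
        using unit_mult_nonunit_iff[OF Units_inv_Units[OF u]] qs(1) y(1) by simp
      then have "?\<pi> (heval R qs y) = \<zero>\<^bsub>?K\<^esub>" using residue_zero_iff qs(1) y(1) by simp
      then have "heval ?K (rev p) (?\<pi> y) = \<zero>\<^bsub>?K\<^esub>"
        using heval_hom[OF is_cring residue_hom(1) \<pi> qs(1) y(1)] qs(2) by simp
      moreover have yk: "?\<pi> y \<in> carrier ?K" using ring_hom_closed[OF \<pi> y(1)] .
      ultimately show "\<exists>x\<in>carrier ?K. K.eval p x = \<zero>\<^bsub>?K\<^esub>"
        using K.eval_eq_heval[OF pp(1) yk] by auto
    qed
  }
qed

text \<open>If \<open>y\<close> is a root modulo nonunits of \<open>\<one>\<close> plus the product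
  of all \<open>x \<ominus> c i\<close>, then none of the differences \<open>y \<ominus> c i\<close>
  can be a nonunit. For \<open>n = 0\<close> that polynomial is constant, so the first element is
  treated separately.\<close>

lemma root_closed_many:
  assumes "root_closed R"
  shows "\<exists>c. range c \<subseteq> carrier R \<and> (\<forall>i<n. \<forall>j<n. i \<noteq> j \<longrightarrow> c i \<ominus> c (j::nat) \<in> Units R)"
proof (induction n)
  case 0
  show ?case by (intro exI[of _ "\<lambda>_. \<zero>"]) auto
next
  case (Suc n)
  then obtain c where c: "range c \<subseteq> carrier R"
    and cu: "\<And>i j. i < n \<Longrightarrow> j < n \<Longrightarrow> i \<noteq> j \<Longrightarrow> c i \<ominus> c j \<in> Units R" by blast
  have ci: "c i \<in> carrier R" for i using c by blast
  have len_ladd: "length xs = length ys \<Longrightarrow> length (ladd R xs ys) = length ys" for xs ys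
    by (induction xs ys rule: list_induct2') auto
  have prod: "\<exists>gs. length gs = k \<and> set gs \<subseteq> carrier R \<and>
    (\<forall>x\<in>carrier R. \<forall>i<k. \<exists>t\<in>carrier R. heval R (gs @ [\<one>]) x = (x \<ominus> c i) \<otimes> t)" for k
  proof (induction k)
    case 0
    show ?case by simp
  next
    case (Suc k)
    then obtain gs where gs: "length gs = k" "set gs \<subseteq> carrier R"
      and t: "\<And>x i. x \<in> carrier R \<Longrightarrow> i < k \<Longrightarrow> \<exists>t\<in>carrier R. heval R (gs @ [\<one>]) x = (x \<ominus> c i) \<otimes> t" by blast
    let ?m = "map (\<lambda>d. (\<ominus> c k) \<otimes> d) (gs @ [\<one>])"
    let ?g = "ladd R (\<zero> # gs) ?m"
    have ms: "set ?m \<subseteq> carrier R" and zs: "set (\<zero> # gs) \<subseteq> carrier R" and os: "set (gs @ [\<one>]) \<subseteq> carrier R"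
      using gs ci by auto
    have gc: "set ?g \<subseteq> carrier R" using ladd_set[OF carrier_is_subring zs ms] .
    have gl: "length ?g = Suc k" using gs(1) by (subst len_ladd) auto
    have eq: "heval R (?g @ [\<one>]) x = (x \<ominus> c k) \<otimes> heval R (gs @ [\<one>]) x" if x: "x \<in> carrier R" for x
    proof -
      let ?G = "heval R gs x"
      have Gc: "?G \<in> carrier R" "x [^] k \<in> carrier R" using gs(2) x by auto
      have p: "x [^] Suc k = x \<otimes> x [^] k" using nat_pow_Suc2[OF x] .
      have F: "heval R (gs @ [\<one>]) x = ?G \<oplus> x [^] k"
        using heval_snoc[OF gs(2) one_closed x] gs(1) x by simp
      have "heval R (?g @ [\<one>]) x = ((\<zero> \<oplus> x \<otimes> ?G) \<oplus> (\<ominus> c k) \<otimes> (?G \<oplus> x [^] k)) \<oplus> \<one> \<otimes> (x \<otimes> x [^] k)"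
        unfolding heval_snoc[OF gc one_closed x] gl p heval_ladd[OF zs ms x]
          heval_map_mult[OF a_inv_closed[OF ci] os x] F by simp
      also have "\<dots> = (x \<ominus> c k) \<otimes> (?G \<oplus> x [^] k)" using Gc x ci[of k] by algebra
      finally show ?thesis using F by simp
    qed
    have "\<exists>t\<in>carrier R. heval R (?g @ [\<one>]) x = (x \<ominus> c i) \<otimes> t" if x: "x \<in> carrier R" and i: "i < Suc k" for x i
    proof (cases "i = k")
      case True
      then show ?thesis using eq[OF x] heval_closed[OF os x] by blast
    next
      case False
      then obtain t where t: "t \<in> carrier R" "heval R (gs @ [\<one>]) x = (x \<ominus> c i) \<otimes> t" using t[OF x, of i] i by auto
      have "heval R (?g @ [\<one>]) x = (x \<ominus> c i) \<otimes> ((x \<ominus> c k) \<otimes> t)"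
        unfolding eq[OF x] t(2) using x ci[of i] ci[of k] t(1) by algebra
      then show ?thesis using x ci t(1) by blast
    qed
    then show ?case using gl gc by blast
  qed
  show ?case
  proof (cases "n = 0")
    case True
    then show ?thesis using c by (intro exI[of _ c]) auto
  next
    case False
    obtain gs where gs: "length gs = n" "set gs \<subseteq> carrier R"
      and t: "\<And>x i. x \<in> carrier R \<Longrightarrow> i < n \<Longrightarrow> \<exists>t\<in>carrier R. heval R (gs @ [\<one>]) x = (x \<ominus> c i) \<otimes> t"
      using prod[of n] by blast
    obtain g gs' where g: "gs = g # gs'" using False gs(1) by (cases gs) auto
    have s: "set ((g \<oplus> \<one>) # gs') \<subseteq> carrier R" using gs(2) g by auto
    obtain y where y: "y \<in> carrier R" "heval R (((g \<oplus> \<one>) # gs') @ [\<one>]) y \<in> nonunits R"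
      using assms s unfolding root_closed_def by blast
    have cl: "g \<in> carrier R" "heval R (gs' @ [\<one>]) y \<in> carrier R" using gs(2) g y(1) by auto
    have e: "heval R (((g \<oplus> \<one>) # gs') @ [\<one>]) y = \<one> \<oplus> heval R (gs @ [\<one>]) y"
      unfolding g append_Cons heval.simps using cl y(1) by algebra
    have u: "y \<ominus> c i \<in> Units R" if i: "i < n" for i
    proof (rule ccontr)
      assume "y \<ominus> c i \<notin> Units R"
      then have "y \<ominus> c i \<in> nonunits R" using y(1) ci by (intro nonunitI) auto
      then have n: "heval R (gs @ [\<one>]) y \<in> nonunits R" using t[OF y(1) i] N.I_r_closed by metis
      have "\<one> \<oplus> heval R (gs @ [\<one>]) y \<in> Units R" by (rule unit_plus_nonunit[OF Units_one_closed n])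
      then show False using y(2) e unit_not_nonunit by simp
    qed
    have u': "c i \<ominus> y \<in> Units R" if i: "i < n" for i
    proof (rule ccontr)
      assume "c i \<ominus> y \<notin> Units R"
      then have "c i \<ominus> y \<in> nonunits R" using y(1) ci by (intro nonunitI) auto
      then have "\<ominus> (c i \<ominus> y) \<in> nonunits R" by simp
      moreover have "\<ominus> (c i \<ominus> y) = y \<ominus> c i" using y(1) ci[of i] by algebra
      ultimately show False using u[OF i] unit_not_nonunit by simp
    qed
    let ?c = "c(n := y)"
    have "?c i \<ominus> ?c j \<in> Units R" if "i < Suc n" "j < Suc n" "i \<noteq> j" for i j
      using that cu u u' by (cases "i = n"; cases "j = n") auto
    moreover have "range ?c \<subseteq> carrier R" using c y(1) by auto
    ultimately show ?thesis by blast
  qed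
qed

end

subsection \<open>The length\<close>

text \<open>The pair \<open>(a, b)\<close> stands for \<open>a + b w\<close>, where \<open>w\<close>
  is an adjoined square root of \<open>s\<close>.\<close>

definition sqrt_ring :: "('a, 'm) ring_scheme \<Rightarrow> 'a \<Rightarrow> ('a \<times> 'a) ring" where
  "sqrt_ring R s = \<lparr>carrier = carrier R \<times> carrier R,
     monoid.mult = \<lambda>(a, b) (c, d). (a \<otimes>\<^bsub>R\<^esub> c \<oplus>\<^bsub>R\<^esub> s \<otimes>\<^bsub>R\<^esub> (b \<otimes>\<^bsub>R\<^esub> d), a \<otimes>\<^bsub>R\<^esub> d \<oplus>\<^bsub>R\<^esub> b \<otimes>\<^bsub>R\<^esub> c),
     one = (\<one>\<^bsub>R\<^esub>, \<zero>\<^bsub>R\<^esub>), zero = (\<zero>\<^bsub>R\<^esub>, \<zero>\<^bsub>R\<^esub>), add = \<lambda>(a, b) (c, d). (a \<oplus>\<^bsub>R\<^esub> c, b \<oplus>\<^bsub>R\<^esub> d)\<rparr>"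

lemma sqrt_ring_simps [simp]:
  "carrier (sqrt_ring R s) = carrier R \<times> carrier R"
  "(a, b) \<otimes>\<^bsub>sqrt_ring R s\<^esub> (c, d) = (a \<otimes>\<^bsub>R\<^esub> c \<oplus>\<^bsub>R\<^esub> s \<otimes>\<^bsub>R\<^esub> (b \<otimes>\<^bsub>R\<^esub> d), a \<otimes>\<^bsub>R\<^esub> d \<oplus>\<^bsub>R\<^esub> b \<otimes>\<^bsub>R\<^esub> c)"
  "\<one>\<^bsub>sqrt_ring R s\<^esub> = (\<one>\<^bsub>R\<^esub>, \<zero>\<^bsub>R\<^esub>)" "\<zero>\<^bsub>sqrt_ring R s\<^esub> = (\<zero>\<^bsub>R\<^esub>, \<zero>\<^bsub>R\<^esub>)"
  "(a, b) \<oplus>\<^bsub>sqrt_ring R s\<^esub> (c, d) = (a \<oplus>\<^bsub>R\<^esub> c, b \<oplus>\<^bsub>R\<^esub> d)"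
  by (simp_all add: sqrt_ring_def)

lemma (in cring) sqrt_ring_cring:
  assumes s: "s \<in> carrier R"
  shows "cring (sqrt_ring R s)"
proof (rule cringI)
  show "abelian_group (sqrt_ring R s)"
  proof (rule abelian_groupI)
    fix x assume "x \<in> carrier (sqrt_ring R s)"
    then obtain a b where "x = (a, b)" "a \<in> carrier R" "b \<in> carrier R" by auto
    then show "\<exists>y\<in>carrier (sqrt_ring R s). y \<oplus>\<^bsub>sqrt_ring R s\<^esub> x = \<zero>\<^bsub>sqrt_ring R s\<^esub>"
      by (intro bexI[of _ "(\<ominus> a, \<ominus> b)"]) (auto simp: l_neg)
  qed (auto simp: a_ac)
  show "comm_monoid (sqrt_ring R s)"
  proof (rule comm_monoidI)
    fix x y z assume "x \<in> carrier (sqrt_ring R s)" "y \<in> carrier (sqrt_ring R s)" "z \<in> carrier (sqrt_ring R s)"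
    then obtain a b c d u v where xyz: "x = (a, b)" "y = (c, d)" "z = (u, v)"
      and cl: "a \<in> carrier R" "b \<in> carrier R" "c \<in> carrier R" "d \<in> carrier R" "u \<in> carrier R" "v \<in> carrier R"
      by auto
    have "(a \<otimes> c \<oplus> s \<otimes> (b \<otimes> d)) \<otimes> u \<oplus> s \<otimes> ((a \<otimes> d \<oplus> b \<otimes> c) \<otimes> v)
        = a \<otimes> (c \<otimes> u \<oplus> s \<otimes> (d \<otimes> v)) \<oplus> s \<otimes> (b \<otimes> (c \<otimes> v \<oplus> d \<otimes> u))"
      "(a \<otimes> c \<oplus> s \<otimes> (b \<otimes> d)) \<otimes> v \<oplus> (a \<otimes> d \<oplus> b \<otimes> c) \<otimes> u
        = a \<otimes> (c \<otimes> v \<oplus> d \<otimes> u) \<oplus> b \<otimes> (c \<otimes> u \<oplus> s \<otimes> (d \<otimes> v))"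
      using cl s by algebra+
    then show "x \<otimes>\<^bsub>sqrt_ring R s\<^esub> y \<otimes>\<^bsub>sqrt_ring R s\<^esub> z = x \<otimes>\<^bsub>sqrt_ring R s\<^esub> (y \<otimes>\<^bsub>sqrt_ring R s\<^esub> z)"
      unfolding xyz by simp
  next
    fix x y assume "x \<in> carrier (sqrt_ring R s)" "y \<in> carrier (sqrt_ring R s)"
    then show "x \<otimes>\<^bsub>sqrt_ring R s\<^esub> y = y \<otimes>\<^bsub>sqrt_ring R s\<^esub> x" using s by (auto simp: m_comm a_comm)
  qed (use s in auto)
  fix x y z assume "x \<in> carrier (sqrt_ring R s)" "y \<in> carrier (sqrt_ring R s)" "z \<in> carrier (sqrt_ring R s)"
  then obtain a b c d u v where xyz: "x = (a, b)" "y = (c, d)" "z = (u, v)"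
    and cl: "a \<in> carrier R" "b \<in> carrier R" "c \<in> carrier R" "d \<in> carrier R" "u \<in> carrier R" "v \<in> carrier R"
    by auto
  have "(a \<oplus> c) \<otimes> u \<oplus> s \<otimes> ((b \<oplus> d) \<otimes> v) = (a \<otimes> u \<oplus> s \<otimes> (b \<otimes> v)) \<oplus> (c \<otimes> u \<oplus> s \<otimes> (d \<otimes> v))"
    "(a \<oplus> c) \<otimes> v \<oplus> (b \<oplus> d) \<otimes> u = (a \<otimes> v \<oplus> b \<otimes> u) \<oplus> (c \<otimes> v \<oplus> d \<otimes> u)"
    using cl s by algebra+
  then show "(x \<oplus>\<^bsub>sqrt_ring R s\<^esub> y) \<otimes>\<^bsub>sqrt_ring R s\<^esub> z
      = x \<otimes>\<^bsub>sqrt_ring R s\<^esub> z \<oplus>\<^bsub>sqrt_ring R s\<^esub> y \<otimes>\<^bsub>sqrt_ring R s\<^esub> z"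
    unfolding xyz by simp
qed

text \<open>The last generator is a unit: otherwise the relation for \<open>\<one>\<close> would
  leave a unit in the span before it, contrary to strictness. Multiplying it by nonunits then shows
  that this span contains the maximal ideal. A unit at an earlier place would make the chain reach
  the whole ring too soon.\<close>

lemma (in loc_ring) comp_seq_top:
  assumes b: "strict_seq R b (Suc n)" "comp_seq R b (Suc n)"
  shows "nonunits R \<subseteq> lspan R (carrier R) b n" "\<And>j. j < n \<Longrightarrow> b j \<in> nonunits R"
proof -
  have bc: "range b \<subseteq> carrier R" using b unfolding comp_seq_def by blast
  have bj: "b j \<in> carrier R" for j using bc by blast
  have full: "lspan R (carrier R) b j = carrier R" if "u \<in> Units R" "u \<in> lspan R (carrier R) b j" for u j
  proof -
    interpret J: ideal "lspan R (carrier R) b j" R by (rule lspan_ideal[OF bc])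
    have "u \<otimes> inv u \<in> lspan R (carrier R) b j"
      by (rule J.I_r_closed[OF that(2) Units_inv_closed[OF that(1)]])
    then show ?thesis using that(1) J.one_imp_carrier by simp
  qed
  have sub: "nonunits R \<subseteq> lspan R (carrier R) b j" if "b j \<in> Units R" "j < Suc n" for j
  proof
    fix a assume a: "a \<in> nonunits R"
    have iu: "inv (b j) \<in> carrier R" using that(1) by simp
    have "(inv (b j) \<otimes> a) \<otimes> b j \<in> lspan R (carrier R) b j"
      using b(2) that(2) N.I_l_closed[OF a iu] unfolding comp_seq_def by blast
    moreover have "(inv (b j) \<otimes> a) \<otimes> b j = (inv (b j) \<otimes> b j) \<otimes> a"
      using iu bj[of j] nonunit_carrier[OF a] by algebra
    ultimately show "a \<in> lspan R (carrier R) b j" using that(1) nonunit_carrier[OF a] by simp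
  qed
  have "b n \<in> Units R"
  proof (rule ccontr)
    assume "b n \<notin> Units R"
    then have bn: "b n \<in> nonunits R" using bj nonunitI by blast
    obtain x r where x: "x \<in> lspan R (carrier R) b n" "r \<in> carrier R" "\<one> = x \<oplus> r \<otimes> b n"
      using b(2) unfolding comp_seq_def by auto
    have xc: "x \<in> carrier R" using lspan_subset[OF bc order.refl carrier_is_subring] x(1) by blast
    have "\<one> \<ominus> r \<otimes> b n \<in> Units R" using one_minus_nonunit[OF N.I_l_closed[OF bn x(2)]] .
    moreover have "\<one> \<ominus> r \<otimes> b n = x" unfolding x(3) using xc x(2) bj[of n] by algebra
    ultimately have "x \<in> Units R" by simp
    then have "b n \<in> lspan R (carrier R) b n" using full x(1) bj by blast
    then show False using b(1) unfolding strict_seq_def by blast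
  qed
  then show "nonunits R \<subseteq> lspan R (carrier R) b n" using sub by blast
  fix j assume j: "j < n"
  show "b j \<in> nonunits R"
  proof (rule ccontr)
    assume "b j \<notin> nonunits R"
    then have "b j \<in> Units R" using bj nonunitI by blast
    then have "lspan R (carrier R) b (Suc j) = carrier R" using full mem_lspan_Suc[OF bc] by blast
    then have "b (Suc j) \<in> lspan R (carrier R) b (Suc j)" using bj by blast
    then show False using b(1) j unfolding strict_seq_def by auto
  qed
qed

lemma (in loc_ring) lspan_mult_zero:
  assumes "range b \<subseteq> carrier R" "x \<in> carrier R" "\<And>i. i < n \<Longrightarrow> b i \<otimes> x = \<zero>"
    "a \<in> lspan R (carrier R) b n"
  shows "a \<otimes> x = \<zero>"
  using assms(3,4)
proof (induction n arbitrary: a)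
  case 0
  then show ?case using assms(2) by simp
next
  case (Suc n)
  then obtain a' r where a': "a' \<in> lspan R (carrier R) b n" "r \<in> carrier R" "a = a' \<oplus> r \<otimes> b n" by auto
  have ac: "a' \<in> carrier R" using lspan_subset[OF assms(1) order.refl carrier_is_subring] a'(1) by blast
  have bn: "b n \<in> carrier R" using assms(1) by blast
  have "a \<otimes> x = a' \<otimes> x \<oplus> r \<otimes> (b n \<otimes> x)" unfolding a'(3) using ac a'(2) bn assms(2) by algebra
  then show ?case using Suc a'(1,2) by simp
qed

text \<open>\<open>T\<close> is obtained from \<open>R\<close> by adjoining \<open>w\<close> with
  square \<open>s\<close> and dividing by the products of \<open>w\<close> with nonunits. These
  products form an ideal because nonunits kill \<open>s\<close>, and this ideal meets
  \<open>R\<close> only in zero. The sequence \<open>b 0\<close>, ..., \<open>b (n - 1)\<close>,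
  \<open>w\<close>, \<open>\<one>\<close> shows that the length grows by at most one.\<close>

lemma (in loc_ring) length_extension:
  assumes b: "strict_seq R b (Suc n)" "comp_seq R b (Suc n)" and s: "s \<in> nonunits R"
    and ann: "\<And>a. a \<in> nonunits R \<Longrightarrow> s \<otimes> a = \<zero>"
  shows "\<exists>(T :: ('a \<times> 'a) set ring) h w. is_model (Art (Suc (Suc n))) T \<and> h \<in> ring_hom R T \<and> inj_on h (carrier R) \<and>
    w \<in> carrier T \<and> w \<noteq> \<zero>\<^bsub>T\<^esub> \<and> w \<otimes>\<^bsub>T\<^esub> w = h s \<and> (\<forall>a\<in>nonunits R. h a \<otimes>\<^bsub>T\<^esub> w = \<zero>\<^bsub>T\<^esub>)"
proof -
  have sc: "s \<in> carrier R" using s by simp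
  have bc: "range b \<subseteq> carrier R" using b unfolding comp_seq_def by blast
  have bj: "b j \<in> carrier R" for j using bc by blast
  let ?Q = "sqrt_ring R s"
  have Qc: "cring ?Q" by (rule sqrt_ring_cring[OF sc])
  interpret Q: cring ?Q by (rule Qc)
  let ?I = "{\<zero>} \<times> nonunits R"
  have Iid: "ideal ?I ?Q"
  proof (rule idealI[OF Q.ring_axioms])
    have neg: "\<ominus>\<^bsub>?Q\<^esub> (\<zero>, a) = (\<zero>, \<ominus> a)" if "a \<in> carrier R" for a
      by (rule Q.minus_equality) (use that in \<open>auto simp: l_neg\<close>)
    show "subgroup ?I (add_monoid ?Q)"
    proof (rule Q.add.subgroupI)
      fix x assume "x \<in> ?I"
      then obtain a where "x = (\<zero>, a)" "a \<in> nonunits R" by blast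
      then show "\<ominus>\<^bsub>?Q\<^esub> x \<in> ?I" using neg by simp
    qed (auto intro: zero_nonunit)
    fix x y assume "x \<in> ?I" "y \<in> carrier ?Q"
    then obtain a c d where x: "x = (\<zero>, a)" "a \<in> nonunits R" and y: "y = (c, d)" "c \<in> carrier R" "d \<in> carrier R"
      by auto
    have ac: "a \<in> carrier R" using x by simp
    have "s \<otimes> (a \<otimes> d) = \<zero>" using ann[OF x(2)] m_assoc[OF sc ac y(3)] y(3) by simp
    moreover have "s \<otimes> (d \<otimes> a) = \<zero>" using calculation m_comm[OF ac y(3)] by simp
    ultimately show "y \<otimes>\<^bsub>?Q\<^esub> x \<in> ?I" "x \<otimes>\<^bsub>?Q\<^esub> y \<in> ?I"
      unfolding x(1) y(1) using y(2,3) x(2) ac by (auto simp: N.I_l_closed N.I_r_closed)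
  qed
  interpret I: ideal ?I ?Q by (rule Iid)
  define T where "T = ?Q Quot ?I"
  define \<pi> where "\<pi> = (\<lambda>x. ?I +>\<^bsub>?Q\<^esub> x)"
  have Tc: "cring T" unfolding T_def by (rule I.quotient_is_cring[OF Qc])
  interpret T: cring T by (rule Tc)
  have \<pi>: "\<pi> \<in> ring_hom ?Q T" unfolding \<pi>_def T_def by (rule I.rcos_ring_hom)
  have \<pi>surj: "\<exists>a\<in>carrier R. \<exists>c\<in>carrier R. x = \<pi> (a, c)" if "x \<in> carrier T" for x
    using that unfolding T_def \<pi>_def FactRing_def A_RCOSETS_def' by auto
  have \<pi>zero: "\<pi> x = \<zero>\<^bsub>T\<^esub> \<longleftrightarrow> x \<in> ?I" if x: "x \<in> carrier ?Q" for x
  proof -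
    have "\<zero>\<^bsub>T\<^esub> = \<pi> \<zero>\<^bsub>?Q\<^esub>" using ring_hom_zero[OF \<pi> Q.ring_axioms T.ring_axioms] by (rule sym)
    then have "\<pi> x = \<zero>\<^bsub>T\<^esub> \<longleftrightarrow> x \<ominus>\<^bsub>?Q\<^esub> \<zero>\<^bsub>?Q\<^esub> \<in> ?I"
      using Q.quotient_eq_iff_same_a_r_cos[OF Iid x Q.zero_closed] unfolding \<pi>_def by (simp only:)
    moreover have "x \<ominus>\<^bsub>?Q\<^esub> \<zero>\<^bsub>?Q\<^esub> = x" using x unfolding a_minus_def by (simp only: Q.minus_zero Q.r_zero)
    ultimately show ?thesis by (simp only:)
  qed
  have \<pi>add: "\<pi> (a, c) \<oplus>\<^bsub>T\<^esub> \<pi> (d, e) = \<pi> (a \<oplus> d, c \<oplus> e)"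
    and \<pi>mult: "\<pi> (a, c) \<otimes>\<^bsub>T\<^esub> \<pi> (d, e) = \<pi> (a \<otimes> d \<oplus> s \<otimes> (c \<otimes> e), a \<otimes> e \<oplus> c \<otimes> d)"
    if "a \<in> carrier R" "c \<in> carrier R" "d \<in> carrier R" "e \<in> carrier R" for a c d e
    using ring_hom_add[OF \<pi>, of "(a, c)" "(d, e)"] ring_hom_mult[OF \<pi>, of "(a, c)" "(d, e)"] that by auto
  have \<pi>c: "\<pi> (a, c) \<in> carrier T" if "a \<in> carrier R" "c \<in> carrier R" for a c
    using ring_hom_closed[OF \<pi>, of "(a, c)"] that by simp
  have \<pi>one: "\<one>\<^bsub>T\<^esub> = \<pi> (\<one>, \<zero>)" using ring_hom_one[OF \<pi>] by simp
  have \<pi>second: "\<pi> (a, c) = \<pi> (a, \<zero>)" if "a \<in> carrier R" "c \<in> nonunits R" for a c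
  proof -
    have "\<pi> (a, c) = \<pi> (a, \<zero>) \<oplus>\<^bsub>T\<^esub> \<pi> (\<zero>, c)" using \<pi>add[of a \<zero> \<zero> c] that by simp
    moreover have "\<pi> (\<zero>, c) = \<zero>\<^bsub>T\<^esub>" using \<pi>zero[of "(\<zero>, c)"] that by simp
    ultimately show ?thesis using \<pi>c[of a \<zero>] that by simp
  qed
  define h where "h a = \<pi> (a, \<zero>)" for a
  define w where "w = \<pi> (\<zero>, \<one>)"
  have h: "h \<in> ring_hom R T"
    by (rule ring_hom_memI) (use \<pi>c \<pi>add \<pi>mult \<pi>one sc in \<open>auto simp: h_def\<close>)
  have hinj: "inj_on h (carrier R)"
  proof (rule inj_onI)
    fix x y assume xy: "x \<in> carrier R" "y \<in> carrier R" "h x = h y"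
    have "h (x \<ominus> y) = h x \<oplus>\<^bsub>T\<^esub> \<ominus>\<^bsub>T\<^esub> h y"
      using ring_hom_add[OF h, of x "\<ominus> y"] ring_hom_minus[OF is_cring Tc h xy(2)] xy by (simp add: a_minus_def)
    also have "\<dots> = \<zero>\<^bsub>T\<^esub>" using xy ring_hom_closed[OF h] by (simp add: T.r_neg)
    finally have "(x \<ominus> y, \<zero>) \<in> ?I" using \<pi>zero[of "(x \<ominus> y, \<zero>)"] xy unfolding h_def by simp
    then show "x = y" using xy by simp
  qed
  have wc: "w \<in> carrier T" unfolding w_def by (intro \<pi>c) auto
  have w0: "w \<noteq> \<zero>\<^bsub>T\<^esub>" unfolding w_def using \<pi>zero[of "(\<zero>, \<one>)"] by simp
  have ww: "w \<otimes>\<^bsub>T\<^esub> w = h s" unfolding w_def h_def using \<pi>mult[of \<zero> \<one> \<zero> \<one>] sc by simp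
  have hw: "h a \<otimes>\<^bsub>T\<^esub> w = \<zero>\<^bsub>T\<^esub>" if a: "a \<in> nonunits R" for a
  proof -
    have "h a \<otimes>\<^bsub>T\<^esub> w = \<pi> (\<zero>, a)" unfolding w_def h_def using \<pi>mult[of a \<zero> \<zero> \<one>] sc a by simp
    then show ?thesis using \<pi>zero[of "(\<zero>, a)"] a by simp
  qed
  \<comment> \<open>Multiplication by the conjugate gives the norm, which differs from
    \<open>a \<otimes> a\<close> by a nonunit.\<close>
  have unitT: "\<pi> (a, c) \<in> Units T" if a: "a \<in> Units R" and c: "c \<in> carrier R" for a c
  proof -
    have ac: "a \<in> carrier R" using Units_closed[OF a] .
    have n: "s \<otimes> (c \<otimes> \<ominus> c) \<in> nonunits R" using s c by (intro N.I_r_closed) auto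
    have "a \<otimes> a \<oplus> s \<otimes> (c \<otimes> \<ominus> c) \<in> Units R" using unit_plus_nonunit[OF _ n] a by simp
    then obtain v where v: "v \<in> carrier R" "(a \<otimes> a \<oplus> s \<otimes> (c \<otimes> \<ominus> c)) \<otimes> v = \<one>" unfolding unit_iff by blast
    have "\<pi> (a, c) \<otimes>\<^bsub>T\<^esub> \<pi> (a, \<ominus> c) = h (a \<otimes> a \<oplus> s \<otimes> (c \<otimes> \<ominus> c))"
    proof -
      have "a \<otimes> (\<ominus> c) \<oplus> c \<otimes> a = \<zero>" using ac c by algebra
      then show ?thesis unfolding h_def using \<pi>mult[of a c a "\<ominus> c"] ac c by simp
    qed
    then have "\<pi> (a, c) \<otimes>\<^bsub>T\<^esub> \<pi> (a, \<ominus> c) \<otimes>\<^bsub>T\<^esub> h v = h \<one>"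
      using ring_hom_mult[OF h, of "a \<otimes> a \<oplus> s \<otimes> (c \<otimes> \<ominus> c)" v] v ac c sc by simp
    then have "\<pi> (a, c) \<otimes>\<^bsub>T\<^esub> (\<pi> (a, \<ominus> c) \<otimes>\<^bsub>T\<^esub> h v) = \<one>\<^bsub>T\<^esub>"
      using T.m_assoc[OF \<pi>c \<pi>c ring_hom_closed[OF h v(1)], of a c a "\<ominus> c"] ac c ring_hom_one[OF h] by simp
    moreover have "\<pi> (a, \<ominus> c) \<otimes>\<^bsub>T\<^esub> h v \<in> carrier T" using ac c v(1) \<pi>c ring_hom_closed[OF h] by simp
    ultimately show ?thesis unfolding T.unit_iff using \<pi>c ac c by blast
  qed
  have locT: "local_ring T"
    unfolding T.local_axioms_iff[symmetric]
  proof (intro conjI ballI)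
    show "\<zero>\<^bsub>T\<^esub> \<noteq> \<one>\<^bsub>T\<^esub>" using \<pi>zero[of "(\<one>, \<zero>)"] \<pi>one one_neq_zero by auto
    fix x assume "x \<in> carrier T"
    then obtain a c where a: "a \<in> carrier R" "c \<in> carrier R" "x = \<pi> (a, c)" using \<pi>surj by blast
    show "\<exists>y\<in>carrier T. x \<otimes>\<^bsub>T\<^esub> y = \<one>\<^bsub>T\<^esub> \<or> (\<one>\<^bsub>T\<^esub> \<oplus>\<^bsub>T\<^esub> \<ominus>\<^bsub>T\<^esub> x) \<otimes>\<^bsub>T\<^esub> y = \<one>\<^bsub>T\<^esub>"
    proof (cases "a \<in> Units R")
      case True
      then show ?thesis using unitT[OF True a(2)] a(3) unfolding T.unit_iff by blast
    next
      case False
      have "\<ominus>\<^bsub>T\<^esub> x = \<pi> (\<ominus> a, \<ominus> c)"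
      proof (rule T.minus_equality)
        show "\<pi> (\<ominus> a, \<ominus> c) \<oplus>\<^bsub>T\<^esub> x = \<zero>\<^bsub>T\<^esub>"
          unfolding a(3) using \<pi>add[of "\<ominus> a" "\<ominus> c" a c] a(1,2) \<pi>zero[of "(\<zero>, \<zero>)"] by (simp add: l_neg)
      qed (use a \<pi>c in auto)
      then have "\<one>\<^bsub>T\<^esub> \<oplus>\<^bsub>T\<^esub> \<ominus>\<^bsub>T\<^esub> x = \<pi> (\<one> \<ominus> a, \<ominus> c)"
        unfolding \<pi>one using \<pi>add[of \<one> \<zero> "\<ominus> a" "\<ominus> c"] a(1,2) by (simp add: a_minus_def)
      moreover have "\<one> \<ominus> a \<in> Units R" using one_minus_nonunit[OF nonunitI[OF a(1) False]] .
      ultimately have "\<one>\<^bsub>T\<^esub> \<oplus>\<^bsub>T\<^esub> \<ominus>\<^bsub>T\<^esub> x \<in> Units T" using unitT a(2) by simp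
      then show ?thesis unfolding T.unit_iff by blast
    qed
  qed
  interpret LT: loc_ring T using locT by (rule loc_ringI)
  have nonT: "\<exists>a\<in>nonunits R. \<exists>c\<in>carrier R. x = \<pi> (a, c)" if x: "x \<in> nonunits T" for x
  proof -
    obtain a c where a: "a \<in> carrier R" "c \<in> carrier R" "x = \<pi> (a, c)"
      using \<pi>surj LT.nonunit_carrier[OF x] by blast
    then have "a \<in> nonunits R" using unitT x LT.unit_not_nonunit nonunitI by blast
    then show ?thesis using a by blast
  qed
  let ?b = "\<lambda>j. if j < n then h (b j) else if j = n then w else \<one>\<^bsub>T\<^esub>"
  have b'c: "range ?b \<subseteq> carrier T" using ring_hom_closed[OF h] bj wc by auto
  have hspan: "h x \<in> lspan T (carrier T) ?b j" if x: "x \<in> lspan R (carrier R) b j" and j: "j \<le> n" for x j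
  proof -
    have "lspan T (carrier T) (h \<circ> b) j = lspan T (carrier T) ?b j"
      using j by (induction j) auto
    moreover have "h ` carrier R \<subseteq> carrier T" using ring_hom_closed[OF h] by blast
    ultimately show ?thesis
      using hom_lspan[OF is_cring Tc h order.refl bc, of j] lspan_mono[of "h ` carrier R" "carrier T" T] x by blast
  qed
  note top = comp_seq_top[OF b]
  have "comp_seq T ?b (Suc (Suc n))"
    unfolding comp_seq_def
  proof (intro conjI allI impI ballI)
    show "range ?b \<subseteq> carrier T" by (rule b'c)
    show "\<one>\<^bsub>T\<^esub> \<in> lspan T (carrier T) ?b (Suc (Suc n))"
      using T.mem_lspan_Suc[OF b'c, of "Suc n"] by simp
    fix j x assume j: "j < Suc (Suc n)" and x: "x \<in> nonunits T"
    obtain a c where a: "a \<in> nonunits R" "c \<in> carrier R" "x = \<pi> (a, c)" using nonT[OF x] by blast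
    have ac: "a \<in> carrier R" using a by simp
    consider "j < n" | "j = n" | "j = Suc n" using j by linarith
    then show "x \<otimes>\<^bsub>T\<^esub> ?b j \<in> lspan T (carrier T) ?b j"
    proof cases
      case 1
      have "x \<otimes>\<^bsub>T\<^esub> h (b j) = \<pi> (a \<otimes> b j, c \<otimes> b j)"
        unfolding a(3) h_def using \<pi>mult[of a c "b j" \<zero>] ac a(2) bj sc by simp
      also have "\<dots> = h (a \<otimes> b j)"
        unfolding h_def using top(2)[OF 1] ac a(2) bj by (intro \<pi>second) (auto simp: N.I_l_closed)
      finally have "x \<otimes>\<^bsub>T\<^esub> h (b j) = h (a \<otimes> b j)" .
      moreover have "a \<otimes> b j \<in> lspan R (carrier R) b j"
        using b(2) 1 a(1) unfolding comp_seq_def by auto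
      ultimately have "x \<otimes>\<^bsub>T\<^esub> h (b j) \<in> lspan T (carrier T) ?b j" using hspan 1 by simp
      then show ?thesis using 1 by (simp only: if_True)
    next
      case 2
      have "x \<otimes>\<^bsub>T\<^esub> w = \<pi> (s \<otimes> c, a)"
        unfolding a(3) w_def using \<pi>mult[of a c \<zero> \<one>] ac a(2) sc by simp
      also have "\<dots> = h (s \<otimes> c)" unfolding h_def using sc a by (intro \<pi>second) auto
      finally have "x \<otimes>\<^bsub>T\<^esub> w = h (s \<otimes> c)" .
      moreover have "s \<otimes> c \<in> lspan R (carrier R) b n" using top(1) N.I_r_closed[OF s a(2)] by blast
      ultimately have "x \<otimes>\<^bsub>T\<^esub> w \<in> lspan T (carrier T) ?b n" using hspan by simp
      then show ?thesis using 2 by (simp only: less_irrefl if_False if_True refl)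
    next
      case 3
      have "x = h a \<oplus>\<^bsub>T\<^esub> h c \<otimes>\<^bsub>T\<^esub> w"
      proof -
        have "h c \<otimes>\<^bsub>T\<^esub> w = \<pi> (\<zero>, c)" unfolding h_def w_def using \<pi>mult[of c \<zero> \<zero> \<one>] a(2) sc by simp
        then show ?thesis unfolding a(3) h_def using \<pi>add[of a \<zero> \<zero> c] ac a(2) by simp
      qed
      moreover have "h a \<in> lspan T (carrier T) ?b n" using hspan top(1) a(1) by blast
      moreover have "h c \<in> carrier T" using ring_hom_closed[OF h a(2)] .
      ultimately have "x \<in> lspan T (carrier T) ?b (Suc n)"
        unfolding lspan.simps by (simp only: less_irrefl if_False if_True refl) blast
      then show ?thesis using 3 LT.nonunit_carrier[OF x] by simp
    qed
  qed
  from LT.comp_seq_length_le[OF this]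
  have "ring_length T \<le> enat (card {j. j < Suc (Suc n) \<and> ?b j \<notin> lspan T (carrier T) ?b j})" .
  also have "card {j. j < Suc (Suc n) \<and> ?b j \<notin> lspan T (carrier T) ?b j} \<le> card {..<Suc (Suc n)}"
    by (intro card_mono) auto
  finally have "ring_length T \<le> enat (Suc (Suc n))" by simp
  then have "is_model (Art (Suc (Suc n))) T" unfolding Art_model_iff using Tc locT by blast
  then show ?thesis using h hinj wc w0 ww hw by blast
qed

lemma Art_mono: "is_model (Art k) R \<Longrightarrow> k \<le> l \<Longrightarrow> is_model (Art l) R"
  unfolding Art_model_iff by (meson enat_ord_simps(1) order.trans)

lemma sat_foldr_FAnd: "sat R e (foldr FAnd \<phi>s \<psi>) \<longleftrightarrow> (\<forall>\<phi>\<in>set \<phi>s. sat R e \<phi>) \<and> sat R e \<psi>"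
  by (induction \<phi>s) auto

lemma quantifier_free_foldr_FAnd:
  "quantifier_free (foldr FAnd \<phi>s \<psi>) \<longleftrightarrow> (\<forall>\<phi>\<in>set \<phi>s. quantifier_free \<phi>) \<and> quantifier_free \<psi>"
  by (induction \<phi>s) auto

text \<open>If the length is smaller than \<open>l\<close>, adjoin a nonzero square root \<open>w\<close> of a socle element \<open>s\<close> such
  that the maximal ideal annihilates \<open>w\<close>. A root with these properties in \<open>R\<close> would give \<open>s = 0\<close>,
  and \<open>s \<noteq> 0\<close> can be chosen unless \<open>R\<close> is a field.\<close>

lemma existentially_closed_length:
  fixes R :: "('a, 'm) ring_scheme"
  assumes ec: "existentially_closed TYPE('b) (Art l) R"
    and inf: "infinite (UNIV :: 'b set)" and f: "inj_on (f :: 'a \<Rightarrow> 'b) (carrier R)"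
  shows "ring_length R = enat l"
proof -
  have R: "cring R" "local_ring R" "ring_length R \<le> enat l"
    using ec unfolding existentially_closed_def Art_model_iff by blast+
  interpret loc_ring R using R(2) by (rule loc_ringI)
  obtain k where k: "ring_length R = enat k" "k \<le> l" using R(3) by (cases "ring_length R") auto
  obtain b where b: "strict_seq R b k" "comp_seq R b k" using ex_comp_seq[OF k(1)] .
  have bc: "range b \<subseteq> carrier R" using b unfolding comp_seq_def by blast
  have bj: "b j \<in> carrier R" for j using bc by blast
  obtain n where n: "k = Suc n"
    using b(2) one_neq_zero unfolding comp_seq_def by (cases k) auto
  note bb = b[unfolded n]
  note top = comp_seq_top[OF bb]
  show ?thesis
  proof (rule ccontr)
    assume "ring_length R \<noteq> enat l"
    then have l: "Suc (Suc n) \<le> l" using k n by auto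
    \<comment> \<open>\<open>b 0\<close> is killed by nonunits since the span before it is zero, and
      strictness makes it nonzero. If \<open>R\<close> is a field, \<open>s = \<zero>\<close>
      serves: a nonzero element with square zero is already new.\<close>
    define s where "s = (if n = 0 then \<zero>\<^bsub>R\<^esub> else b 0)"
    have s: "s \<in> nonunits R" unfolding s_def using top(2)[of 0] by simp
    have ann: "s \<otimes>\<^bsub>R\<^esub> a = \<zero>\<^bsub>R\<^esub>" if a: "a \<in> nonunits R" for a
    proof -
      have "a \<otimes>\<^bsub>R\<^esub> b 0 \<in> lspan R (carrier R) b 0" using bb(2) a unfolding comp_seq_def by blast
      then show ?thesis unfolding s_def using a bj[of 0] m_comm[of a "b 0"] by simp
    qed
    obtain T :: "('a \<times> 'a) set ring" and h w where T: "is_model (Art (Suc (Suc n))) T" "h \<in> ring_hom R T"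
      "inj_on h (carrier R)" "w \<in> carrier T" "w \<noteq> \<zero>\<^bsub>T\<^esub>" "w \<otimes>\<^bsub>T\<^esub> w = h s"
      "\<And>a. a \<in> nonunits R \<Longrightarrow> h a \<otimes>\<^bsub>T\<^esub> w = \<zero>\<^bsub>T\<^esub>"
      using length_extension[OF bb s ann] by blast
    \<comment> \<open>Variable 0 is the root, variable 1 is \<open>s\<close> and the others are the
      \<open>b j\<close>. Annihilation by the maximal ideal is a finite conjunction because
      \<open>b 0\<close>, ..., \<open>b (n - 1)\<close> generate it.\<close>
    let ?\<psi> = "FAnd (FNot (FEq (TVar 0) TZero)) (FEq (TMul (TVar 0) (TVar 0)) (TVar 1))"
    let ?\<chi> = "foldr FAnd (map (\<lambda>j. FEq (TMul (TVar (2 + j)) (TVar 0)) TZero) [0..<n]) ?\<psi>"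
    let ?\<phi> = "FEx 0 ?\<chi>"
    let ?e = "\<lambda>i. if i \<le> 1 then s else b (i - 2)"
    have e: "range ?e \<subseteq> carrier R" using s bj by auto
    have "sat T ((h \<circ> ?e)(0 := w)) ?\<chi>"
      unfolding sat_foldr_FAnd using T(5-7) top(2) by auto
    then have "sat T (h \<circ> ?e) ?\<phi>" using T(4) by auto
    moreover have "existential ?\<phi>"
      by (intro existential.intros) (auto simp: quantifier_free_foldr_FAnd)
    ultimately have "sat R ?e ?\<phi>"
      using existentially_closed_transfer[OF ec inf f Art_mono[OF T(1) l] T(2,3) _ e] by blast
    then obtain x where x: "x \<in> carrier R" and sx: "sat R (?e(0 := x)) ?\<chi>" by auto
    have x0: "x \<noteq> \<zero>\<^bsub>R\<^esub>" "x \<otimes>\<^bsub>R\<^esub> x = s" and xb: "\<And>j. j < n \<Longrightarrow> b j \<otimes>\<^bsub>R\<^esub> x = \<zero>\<^bsub>R\<^esub>"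
      using sx unfolding sat_foldr_FAnd by auto
    have xn: "x \<in> nonunits R" using nonunit_mult_iff[OF x x] x0(2) s by simp
    have xann: "a \<otimes>\<^bsub>R\<^esub> x = \<zero>\<^bsub>R\<^esub>" if "a \<in> nonunits R" for a
      using lspan_mult_zero[OF bc x xb] top(1) that by blast
    show False
    proof (cases "n = 0")
      case True
      then show ?thesis using top(1) xn x0(1) by auto
    next
      case False
      have "b 0 = \<zero>\<^bsub>R\<^esub>" using xann[OF xn] x0(2) False unfolding s_def by simp
      then show ?thesis using bb(1) unfolding strict_seq_def by auto
    qed
  qed
qed

subsection \<open>The socle\<close>

lemma elementary_extension_model:
  fixes R' :: "('c, 'k) ring_scheme"
  assumes "cring R'" "k \<in> ring_hom R R'"
    and el: "\<And>e \<phi>. range e \<subseteq> carrier R \<Longrightarrow> sat R' (k \<circ> e) \<phi> \<longleftrightarrow> sat R e \<phi>"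
    and model: "is_model (Art l) R"
  shows "is_model (Art l) R'"
proof -
  interpret R': cring R' by fact
  have R: "cring R" using model unfolding Art_model_iff by blast
  interpret R: cring R by fact
  let ?e = "\<lambda>_::nat. \<zero>\<^bsub>R\<^esub>"
  have ax: "sat R' (k \<circ> ?e) \<phi>" if "\<phi> \<in> Art l" for \<phi>
    using model el[of ?e \<phi>] that unfolding is_model_def by auto
  have "\<forall>\<phi>\<in>local_axioms_fo. sat R' (k \<circ> ?e) \<phi>" using ax unfolding Art_def by blast
  then have "local_ring R'"
    unfolding R'.local_axioms_iff[symmetric] local_axioms_fo_def Let_def by auto
  moreover have "sat R' (k \<circ> ?e) (length_axiom_fo l)" using ax unfolding Art_def by blast
  then have "ring_length R' \<le> enat l"
    unfolding sat_length_axiom_fo[OF R'.zero_closed] R'.length_axiom_iff .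
  ultimately show ?thesis unfolding Art_model_iff using assms(1) by blast
qed

lemma hom_lincomb:
  assumes "ring R" "ring S" "h \<in> ring_hom R S" "cring R" "range r \<subseteq> carrier R" "range a \<subseteq> carrier R"
  shows "h (lincomb R r a i) = lincomb S (h \<circ> r) (h \<circ> a) i"
proof (induction i)
  case 0
  show ?case using ring_hom_zero[OF assms(3,1,2)] by simp
next
  case (Suc i)
  have c: "lincomb R r a i \<in> carrier R" "r i \<in> carrier R" "a i \<in> carrier R"
    using cring.lincomb_closed[OF assms(4-6)] assms(5,6) by auto
  interpret cring R by fact
  show ?case using Suc c ring_hom_add[OF assms(3)] ring_hom_mult[OF assms(3)] by simp
qed

lemma surjective_image_model:
  assumes model: "is_model (Art l) A" and T: "cring T" "\<one>\<^bsub>T\<^esub> \<noteq> \<zero>\<^bsub>T\<^esub>"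
    and h: "h \<in> ring_hom A T" "h ` carrier A = carrier T"
  shows "is_model (Art l) T"
proof -
  have A: "cring A" "local_ring A" "ring_length A \<le> enat l" using model unfolding Art_model_iff by blast+
  interpret A: cring A by fact
  interpret T: cring T by fact
  have "local_ring T"
    unfolding T.local_axioms_iff[symmetric]
  proof (intro conjI ballI)
    show "\<zero>\<^bsub>T\<^esub> \<noteq> \<one>\<^bsub>T\<^esub>" using T(2) by simp
    fix x assume "x \<in> carrier T"
    then obtain a where a: "a \<in> carrier A" "x = h a" using h(2) by blast
    obtain b where b: "b \<in> carrier A" "a \<otimes>\<^bsub>A\<^esub> b = \<one>\<^bsub>A\<^esub> \<or> (\<one>\<^bsub>A\<^esub> \<oplus>\<^bsub>A\<^esub> \<ominus>\<^bsub>A\<^esub> a) \<otimes>\<^bsub>A\<^esub> b = \<one>\<^bsub>A\<^esub>"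
      using A(2) a(1) unfolding A.local_axioms_iff[symmetric] by blast
    have "h (a \<otimes>\<^bsub>A\<^esub> b) = x \<otimes>\<^bsub>T\<^esub> h b" using ring_hom_mult[OF h(1) a(1) b(1)] a(2) by simp
    moreover have "h ((\<one>\<^bsub>A\<^esub> \<oplus>\<^bsub>A\<^esub> \<ominus>\<^bsub>A\<^esub> a) \<otimes>\<^bsub>A\<^esub> b) = (\<one>\<^bsub>T\<^esub> \<oplus>\<^bsub>T\<^esub> \<ominus>\<^bsub>T\<^esub> x) \<otimes>\<^bsub>T\<^esub> h b"
      using ring_hom_mult[OF h(1), of "\<one>\<^bsub>A\<^esub> \<oplus>\<^bsub>A\<^esub> \<ominus>\<^bsub>A\<^esub> a" b] ring_hom_add[OF h(1), of "\<one>\<^bsub>A\<^esub>" "\<ominus>\<^bsub>A\<^esub> a"]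
        ring_hom_minus[OF A(1) T(1) h(1) a(1)] ring_hom_one[OF h(1)] a b(1) by simp
    ultimately show "\<exists>y\<in>carrier T. x \<otimes>\<^bsub>T\<^esub> y = \<one>\<^bsub>T\<^esub> \<or> (\<one>\<^bsub>T\<^esub> \<oplus>\<^bsub>T\<^esub> \<ominus>\<^bsub>T\<^esub> x) \<otimes>\<^bsub>T\<^esub> y = \<one>\<^bsub>T\<^esub>"
      using b ring_hom_one[OF h(1)] ring_hom_closed[OF h(1) b(1)] by metis
  qed
  moreover have "ring_length T \<le> enat l"
    unfolding T.length_axiom_iff[symmetric]
  proof (intro allI impI)
    fix a :: "nat \<Rightarrow> _" assume a: "range a \<subseteq> carrier T"
    have "\<forall>i. \<exists>x. x \<in> carrier A \<and> h x = a i" using a h(2) by (metis image_iff rangeI subsetD)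
    then obtain a' where a': "\<And>i. a' i \<in> carrier A" "\<And>i. h (a' i) = a i" by metis
    have ra: "range a' \<subseteq> carrier A" using a'(1) by blast
    obtain i r where i: "i \<le> l" "range r \<subseteq> carrier A" "a' i = lincomb A r a' i"
      using A(3) ra unfolding A.length_axiom_iff[symmetric] by blast
    have "h \<circ> a' = a" using a'(2) by auto
    then have "a i = lincomb T (h \<circ> r) a i"
      using hom_lincomb[OF A.ring_axioms T.ring_axioms h(1) A(1) i(2) ra, of i] i(3) a'(2)[of i] by simp
    moreover have "range (h \<circ> r) \<subseteq> carrier T" using i(2) ring_hom_closed[OF h(1)] by auto
    ultimately show "\<exists>i\<le>l. \<exists>r. range r \<subseteq> carrier T \<and> a i = lincomb T r a i" using i(1) by blast
  qed
  ultimately show ?thesis unfolding Art_model_iff using T(1) by blast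
qed

section \<open>Linear dependence in the socle\<close>

context loc_ring
begin

lemma socle_iff: "x \<in> socle R \<longleftrightarrow> x \<in> carrier R \<and> (\<forall>a\<in>nonunits R. x \<otimes> a = \<zero>)"
  unfolding socle_def max_ideal_eq by blast

lemma socle_nonunit_iff:
  assumes "x \<in> socle R" "x \<noteq> \<zero>" "a \<in> carrier R"
  shows "a \<otimes> x = \<zero> \<longleftrightarrow> a \<in> nonunits R"
proof
  have x: "x \<in> carrier R" using assms(1) socle_iff by blast
  assume z: "a \<otimes> x = \<zero>"
  show "a \<in> nonunits R"
  proof (rule ccontr)
    assume "a \<notin> nonunits R"
    then have "a \<in> Units R" using assms(3) nonunitI by blast
    then obtain b where b: "b \<in> carrier R" "a \<otimes> b = \<one>" unfolding unit_iff by blast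
    have "b \<otimes> (a \<otimes> x) = (a \<otimes> b) \<otimes> x" using b(1) assms(3) x by algebra
    then show False using z b x assms(2) by simp
  qed
next
  assume a: "a \<in> nonunits R"
  then have "x \<otimes> a = \<zero>" using assms(1) socle_iff by blast
  then show "a \<otimes> x = \<zero>" using m_comm[of a x] a assms(1) socle_iff by simp
qed

text \<open>Over the residue field \<open>x\<close> and \<open>y\<close> span a plane, and a nonzero
  vector on the line through \<open>y - u x\<close> determines the residue of \<open>u\<close>.
  Consequently a nonzero element of the ground ring cannot be a multiple of \<open>y - u x\<close>
  when the residue of \<open>u\<close> is new.\<close>

lemma socle_independent:
  assumes x: "x \<in> socle R" "x \<noteq> \<zero>" and y: "y \<in> socle R" "y \<notin> PIdl x"
    and cl: "u \<in> carrier R" "v \<in> carrier R" "c \<in> carrier R" "d \<in> carrier R"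
    and eq: "c \<otimes> (y \<ominus> u \<otimes> x) = r" "d \<otimes> (y \<ominus> v \<otimes> x) = r" and r: "r \<noteq> \<zero>"
  shows "u \<ominus> v \<in> nonunits R"
proof -
  have xc: "x \<in> carrier R" and yc: "y \<in> carrier R" using x y socle_iff by blast+
  have y0: "y \<noteq> \<zero>" using y(2) additive_subgroup.zero_closed[OF ideal.axioms(1)[OF cgenideal_ideal[OF xc]]] by metis
  have unit: "c' \<in> Units R" if c': "c' \<in> carrier R" "c' \<otimes> (y \<ominus> u' \<otimes> x) = r" "u' \<in> carrier R" for c' u'
  proof (rule ccontr)
    assume "c' \<notin> Units R"
    then have n: "c' \<in> nonunits R" using c'(1) nonunitI by blast
    have "c' \<otimes> (y \<ominus> u' \<otimes> x) = c' \<otimes> y \<ominus> u' \<otimes> (c' \<otimes> x)" using c' xc yc by algebra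
    also have "\<dots> = \<zero>"
      using socle_nonunit_iff[OF x c'(1)] socle_nonunit_iff[OF y(1) y0 c'(1)] n c'(3)
      by (simp add: a_minus_def)
    finally show False using c'(2) r by simp
  qed
  obtain c1 where c1: "c1 \<in> carrier R" "c \<otimes> c1 = \<one>" using unit[OF cl(3) eq(1) cl(1)] unfolding unit_iff by blast
  let ?v = "c1 \<otimes> d"
  have vc: "?v \<in> carrier R" using c1 cl by simp
  have "(c \<otimes> c1) \<otimes> (y \<ominus> u \<otimes> x) = c1 \<otimes> (c \<otimes> (y \<ominus> u \<otimes> x))" using c1(1) cl xc yc by algebra
  also have "\<dots> = ?v \<otimes> (y \<ominus> v \<otimes> x)" unfolding eq(1) eq(2)[symmetric] using c1(1) cl xc yc by algebra
  finally have e: "y \<ominus> u \<otimes> x = ?v \<otimes> (y \<ominus> v \<otimes> x)" using c1(2) xc yc cl by simp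
  have "(\<one> \<ominus> ?v) \<otimes> y = (y \<ominus> u \<otimes> x) \<oplus> u \<otimes> x \<ominus> ?v \<otimes> y" using vc xc yc cl by algebra
  also have "\<dots> = (u \<ominus> ?v \<otimes> v) \<otimes> x" unfolding e using c1(1) xc yc cl by algebra
  finally have e2: "(\<one> \<ominus> ?v) \<otimes> y = (u \<ominus> ?v \<otimes> v) \<otimes> x" .
  have n1: "\<one> \<ominus> ?v \<in> nonunits R"
  proof (rule ccontr)
    assume "\<one> \<ominus> ?v \<notin> nonunits R"
    then have "\<one> \<ominus> ?v \<in> Units R" using vc nonunitI by blast
    then obtain t where t: "t \<in> carrier R" "(\<one> \<ominus> ?v) \<otimes> t = \<one>" unfolding unit_iff by blast
    have oc: "\<one> \<ominus> ?v \<in> carrier R" "u \<ominus> ?v \<otimes> v \<in> carrier R" using vc cl by auto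
    have "y = ((\<one> \<ominus> ?v) \<otimes> t) \<otimes> y" using t(2) yc by simp
    also have "\<dots> = t \<otimes> ((\<one> \<ominus> ?v) \<otimes> y)" using oc(1) t(1) yc m_comm m_assoc by metis
    also have "\<dots> = (t \<otimes> (u \<ominus> ?v \<otimes> v)) \<otimes> x" unfolding e2 using oc(2) t(1) xc by (simp add: m_assoc)
    finally have "y \<in> PIdl x" unfolding cgenideal_def using t(1) oc(2) by blast
    then show False using y(2) by blast
  qed
  then have "(\<one> \<ominus> ?v) \<otimes> y = \<zero>" using socle_nonunit_iff[OF y(1) y0] vc by simp
  then have n2: "u \<ominus> ?v \<otimes> v \<in> nonunits R" using e2 socle_nonunit_iff[OF x] vc cl by simp
  have "(u \<ominus> ?v \<otimes> v) \<ominus> (\<one> \<ominus> ?v) \<otimes> v \<in> nonunits R"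
    using nonunit_minus_closed[OF n2 N.I_r_closed[OF n1 cl(2)]] .
  moreover have "(u \<ominus> ?v \<otimes> v) \<ominus> (\<one> \<ominus> ?v) \<otimes> v = u \<ominus> v" using vc cl by algebra
  ultimately show ?thesis by simp
qed

lemma socle_ideal: "ideal (socle R) R"
proof (rule idealI[OF ring_axioms])
  show "subgroup (socle R) (add_monoid R)"
  proof (rule add.subgroupI)
    show "socle R \<subseteq> carrier R" using socle_iff by blast
    have "\<zero> \<in> socle R" unfolding socle_iff by simp
    then show "socle R \<noteq> {}" by blast
  qed (auto simp: socle_iff l_distr l_minus)
  fix a x assume a: "a \<in> socle R" "x \<in> carrier R"
  show "x \<otimes> a \<in> socle R" using a by (auto simp: socle_iff m_assoc)
  then show "a \<otimes> x \<in> socle R" using a m_comm[of a x] by (auto simp: socle_iff)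
qed

end

text \<open>If the socle contains independent elements \<open>x\<close> and \<open>y\<close>, choose \<open>u\<close> in an elementary
  extension \<open>R'\<close> whose residue does not come from \<open>R\<close>. In \<open>R' / (y - u x)\<close>, which still contains
  \<open>R\<close>, the element \<open>y\<close> becomes a multiple of \<open>x\<close>.\<close>

lemma existentially_closed_socle:
  fixes R :: "('a, 'm) ring_scheme"
  assumes ec: "existentially_closed TYPE('b) (Art l) R"
    and inf: "infinite (UNIV :: 'b set)" and f: "inj_on (f :: 'a \<Rightarrow> 'b) (carrier R)"
  shows "principalideal (socle R) R"
proof -
  have model: "is_model (Art l) R" using ec unfolding existentially_closed_def by blast
  then have R: "cring R" "local_ring R" "ring_length R \<le> enat l" unfolding Art_model_iff by blast+
  interpret loc_ring R using R(2) by (rule loc_ringI)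
  interpret S: ideal "socle R" R by (rule socle_ideal)
  show ?thesis
  proof (rule ccontr)
    assume np: "\<not> principalideal (socle R) R"
    have ne: "\<exists>y\<in>socle R. y \<notin> PIdl\<^bsub>R\<^esub> x" if x: "x \<in> socle R" for x
    proof (rule ccontr)
      assume "\<not> ?thesis"
      then have "socle R = PIdl\<^bsub>R\<^esub> x"
        using cgenideal_minimal[OF socle_ideal x] by blast
      moreover have "x \<in> carrier R" using x by simp
      ultimately have "principalideal (socle R) R"
        using cgenideal_is_principalideal[of x] by simp
      then show False using np by blast
    qed
    obtain x where x: "x \<in> socle R" "x \<noteq> \<zero>\<^bsub>R\<^esub>"
      using ne[OF S.zero_closed] cgenideal_ideal[OF zero_closed]
        additive_subgroup.zero_closed[OF ideal.axioms(1)] by metis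
    obtain y where y: "y \<in> socle R" "y \<notin> PIdl\<^bsub>R\<^esub> x" using ne[OF x(1)] by blast
    have xc: "x \<in> carrier R" and yc: "y \<in> carrier R" using x y by auto
    have rc: "root_closed R" by (rule existentially_closed_root_closed[OF ec inf f])
    \<comment> \<open>The index type \<open>'a set\<close> has more elements than \<open>R\<close>,
      so by Cantor's theorem some \<open>\<iota> z\<close> is not congruent to any element of
      \<open>R\<close>.\<close>
    obtain R' :: "('a set set \<Rightarrow> 'a) ring" and k and \<iota> :: "'a set \<Rightarrow> 'a set set \<Rightarrow> 'a" where R': "cring R'"
      "k \<in> ring_hom R R'" "inj_on k (carrier R)"
      "\<And>e \<phi>. range e \<subseteq> carrier R \<Longrightarrow> sat R' (k \<circ> e) \<phi> \<longleftrightarrow> sat R e \<phi>"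
      "range \<iota> \<subseteq> carrier R'" "\<And>z z'. z \<noteq> z' \<Longrightarrow> \<iota> z \<ominus>\<^bsub>R'\<^esub> \<iota> z' \<in> Units R'"
      using elementary_extension[OF root_closed_many[OF rc], where ?'z = "'a set"] by blast
    have mR': "is_model (Art l) R'" using elementary_extension_model[of R' k R l] R'(1,2,4) model by blast
    then have lR': "local_ring R'" unfolding Art_model_iff by blast
    interpret R': loc_ring R' using lR' by (rule loc_ringI)
    have kc: "k a \<in> carrier R'" if "a \<in> carrier R" for a using ring_hom_closed[OF R'(2) that] .
    have \<iota>c: "\<iota> z \<in> carrier R'" for z using R'(5) by blast
    have "\<exists>z. \<forall>a\<in>carrier R. \<iota> z \<ominus>\<^bsub>R'\<^esub> k a \<in> Units R'"
    proof (rule ccontr)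
      assume "\<not> ?thesis"
      then have "\<forall>z. \<exists>a. a \<in> carrier R \<and> \<iota> z \<ominus>\<^bsub>R'\<^esub> k a \<notin> Units R'" by blast
      then obtain r where r: "\<And>z. r z \<in> carrier R" "\<And>z. \<iota> z \<ominus>\<^bsub>R'\<^esub> k (r z) \<notin> Units R'" by metis
      have rn: "\<iota> z \<ominus>\<^bsub>R'\<^esub> k (r z) \<in> nonunits R'" for z
        using r kc[OF r(1)] \<iota>c by (intro R'.nonunitI) auto
      have "inj r"
      proof (rule injI, rule ccontr)
        fix z z' assume rz: "r z = r z'" and zz: "z \<noteq> z'"
        have "(\<iota> z \<ominus>\<^bsub>R'\<^esub> k (r z)) \<ominus>\<^bsub>R'\<^esub> (\<iota> z' \<ominus>\<^bsub>R'\<^esub> k (r z)) \<in> nonunits R'"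
          using R'.nonunit_minus_closed[OF rn[of z] rn[of z']] rz by simp
        moreover have "(\<iota> z \<ominus>\<^bsub>R'\<^esub> k (r z)) \<ominus>\<^bsub>R'\<^esub> (\<iota> z' \<ominus>\<^bsub>R'\<^esub> k (r z)) = \<iota> z \<ominus>\<^bsub>R'\<^esub> \<iota> z'"
          using \<iota>c[of z] \<iota>c[of z'] kc[OF r(1)[of z]] by algebra
        ultimately show False using R'(6)[OF zz] R'.unit_not_nonunit by simp
      qed
      then have "surj (inv_into UNIV r)" by (rule inj_imp_surj_inv)
      then show False using Cantors_theorem[of UNIV] by auto
    qed
    then obtain u where u: "u \<in> carrier R'" and un: "\<And>a. a \<in> carrier R \<Longrightarrow> u \<ominus>\<^bsub>R'\<^esub> k a \<in> Units R'"
      using \<iota>c by blast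
    let ?w = "k y \<ominus>\<^bsub>R'\<^esub> u \<otimes>\<^bsub>R'\<^esub> k x"
    have wc: "?w \<in> carrier R'" using kc[OF xc] kc[OF yc] u by simp
    \<comment> \<open>Elementarity is used twice. It first gives a solution \<open>u0\<close>,
      \<open>c0\<close> in \<open>R\<close>; its residue differs from that of \<open>u\<close>, so
      there are two solutions in \<open>R'\<close> with different residues, and hence two such
      solutions in \<open>R\<close>, contrary to \<open>socle_independent\<close>.\<close>
    have no_multiple: "r = \<zero>\<^bsub>R\<^esub>" if r: "r \<in> carrier R" and c: "c \<in> carrier R'" "c \<otimes>\<^bsub>R'\<^esub> ?w = k r" for r c
    proof (rule ccontr)
      assume r0: "r \<noteq> \<zero>\<^bsub>R\<^esub>"
      let ?E = "\<lambda>u c. FEq (TMul (TVar c) (TAdd (TVar 1) (TNeg (TMul (TVar u) (TVar 0))))) (TVar 2)"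
      let ?e = "\<lambda>n::nat. if n = 0 then x else if n = 1 then y else r"
      have e: "range ?e \<subseteq> carrier R" using xc yc r by auto
      have "sat R' (k \<circ> ?e) (FEx 3 (FEx 4 (?E 3 4)))"
        using u c kc[OF xc] kc[OF yc] by (auto simp: a_minus_def)
      then have "sat R ?e (FEx 3 (FEx 4 (?E 3 4)))" unfolding R'(4)[OF e] .
      then obtain u0 c0 where uc0: "u0 \<in> carrier R" "c0 \<in> carrier R" "c0 \<otimes>\<^bsub>R\<^esub> (y \<oplus>\<^bsub>R\<^esub> \<ominus>\<^bsub>R\<^esub> (u0 \<otimes>\<^bsub>R\<^esub> x)) = r"
        by auto
      have k0: "k c0 \<otimes>\<^bsub>R'\<^esub> (k y \<oplus>\<^bsub>R'\<^esub> \<ominus>\<^bsub>R'\<^esub> (k u0 \<otimes>\<^bsub>R'\<^esub> k x)) = k r"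
        using uc0 xc yc ring_hom_mult[OF R'(2)] ring_hom_add[OF R'(2)] ring_hom_minus[OF is_cring R'(1,2)]
        by (metis a_closed a_inv_closed m_closed)
      obtain t where t: "t \<in> carrier R'" "(u \<ominus>\<^bsub>R'\<^esub> k u0) \<otimes>\<^bsub>R'\<^esub> t = \<one>\<^bsub>R'\<^esub>"
        using un[OF uc0(1)] unfolding R'.unit_iff by blast
      let ?\<psi> = "FAnd (?E 3 4) (FAnd (?E 5 6) (FEq (TMul (TAdd (TVar 3) (TNeg (TVar 5))) (TVar 7)) TOne))"
      let ?\<phi> = "FEx 3 (FEx 4 (FEx 5 (FEx 6 (FEx 7 ?\<psi>))))"
      have "sat R' ((k \<circ> ?e)(3 := u, 4 := c, 5 := k u0, 6 := k c0, 7 := t)) ?\<psi>"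
        using c t(2) k0 by (simp add: a_minus_def)
      then have "sat R' (k \<circ> ?e) ?\<phi>"
        unfolding sat.simps(5) using u c(1) kc[OF uc0(1)] kc[OF uc0(2)] t(1) by blast
      then have "sat R ?e ?\<phi>" unfolding R'(4)[OF e] .
      then obtain u1 c1 v1 d1 t1 where 1: "u1 \<in> carrier R" "c1 \<in> carrier R" "v1 \<in> carrier R" "d1 \<in> carrier R"
        "t1 \<in> carrier R" "sat R (?e(3 := u1, 4 := c1, 5 := v1, 6 := d1, 7 := t1)) ?\<psi>"
        unfolding sat.simps(5) by blast
      from 1(6) have 2: "c1 \<otimes>\<^bsub>R\<^esub> (y \<ominus>\<^bsub>R\<^esub> u1 \<otimes>\<^bsub>R\<^esub> x) = r" "d1 \<otimes>\<^bsub>R\<^esub> (y \<ominus>\<^bsub>R\<^esub> v1 \<otimes>\<^bsub>R\<^esub> x) = r"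
        "(u1 \<ominus>\<^bsub>R\<^esub> v1) \<otimes>\<^bsub>R\<^esub> t1 = \<one>\<^bsub>R\<^esub>"
        by (simp_all add: a_minus_def)
      have "u1 \<ominus>\<^bsub>R\<^esub> v1 \<in> nonunits R"
        by (rule socle_independent[OF x y 1(1,3,2,4) 2(1,2) r0])
      then have "(u1 \<ominus>\<^bsub>R\<^esub> v1) \<otimes>\<^bsub>R\<^esub> t1 \<in> nonunits R" using 1(5) N.I_r_closed by blast
      then show False using 2(3) by simp
    qed
    let ?J = "PIdl\<^bsub>R'\<^esub> ?w"
    interpret J: ideal ?J R' by (rule R'.cgenideal_ideal[OF wc])
    define T where "T = R' Quot ?J"
    define \<pi> where "\<pi> = (\<lambda>a. ?J +>\<^bsub>R'\<^esub> a)"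
    have Tc: "cring T" unfolding T_def by (rule J.quotient_is_cring[OF R'(1)])
    interpret T: cring T by (rule Tc)
    have \<pi>: "\<pi> \<in> ring_hom R' T" unfolding \<pi>_def T_def by (rule J.rcos_ring_hom)
    have \<pi>surj: "\<pi> ` carrier R' = carrier T"
      unfolding T_def \<pi>_def FactRing_def A_RCOSETS_def' by auto
    have \<pi>zero: "\<pi> a = \<zero>\<^bsub>T\<^esub> \<longleftrightarrow> a \<in> ?J" if a: "a \<in> carrier R'" for a
    proof -
      have "\<zero>\<^bsub>T\<^esub> = \<pi> \<zero>\<^bsub>R'\<^esub>" using ring_hom_zero[OF \<pi> R'.ring_axioms T.ring_axioms] by (rule sym)
      then have "\<pi> a = \<zero>\<^bsub>T\<^esub> \<longleftrightarrow> a \<ominus>\<^bsub>R'\<^esub> \<zero>\<^bsub>R'\<^esub> \<in> ?J"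
        using R'.quotient_eq_iff_same_a_r_cos[OF J.ideal_axioms a R'.zero_closed] unfolding \<pi>_def by (simp only:)
      then show ?thesis using a by (simp add: a_minus_def)
    qed
    define h where "h = \<pi> \<circ> k"
    have h: "h \<in> ring_hom R T" unfolding h_def using ring_hom_trans[OF R'(2) \<pi>] .
    have hzero: "r = \<zero>\<^bsub>R\<^esub>" if r: "r \<in> carrier R" "h r = \<zero>\<^bsub>T\<^esub>" for r
    proof -
      have "k r \<in> ?J" using \<pi>zero[OF kc[OF r(1)]] r(2) unfolding h_def by simp
      then obtain c where "c \<in> carrier R'" "k r = c \<otimes>\<^bsub>R'\<^esub> ?w" unfolding cgenideal_def by blast
      then show ?thesis using no_multiple[OF r(1)] by simp
    qed
    have hinj: "inj_on h (carrier R)"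
    proof (rule inj_onI)
      fix a b assume ab: "a \<in> carrier R" "b \<in> carrier R" "h a = h b"
      have "h (a \<ominus>\<^bsub>R\<^esub> b) = h a \<oplus>\<^bsub>T\<^esub> \<ominus>\<^bsub>T\<^esub> h b"
        using ring_hom_add[OF h, of a "\<ominus>\<^bsub>R\<^esub> b"] ring_hom_minus[OF is_cring Tc h ab(2)] ab by (simp add: a_minus_def)
      also have "\<dots> = \<zero>\<^bsub>T\<^esub>" using ab ring_hom_closed[OF h] by (simp add: T.r_neg)
      finally have "a \<ominus>\<^bsub>R\<^esub> b = \<zero>\<^bsub>R\<^esub>" using hzero ab by simp
      then show "a = b" using ab by simp
    qed
    have "\<one>\<^bsub>T\<^esub> \<noteq> \<zero>\<^bsub>T\<^esub>"
      using hzero[OF one_closed] ring_hom_one[OF h] one_neq_zero by metis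
    then have mT: "is_model (Art l) T"
      by (rule surjective_image_model[OF mR' Tc _ \<pi> \<pi>surj])
    let ?\<phi> = "FEx 2 (FEq (TVar 1) (TMul (TVar 2) (TVar 0)))"
    let ?e = "\<lambda>n::nat. if n = 0 then x else y"
    have e: "range ?e \<subseteq> carrier R" using xc yc by auto
    have "h y = \<pi> u \<otimes>\<^bsub>T\<^esub> h x"
    proof -
      have ux: "u \<otimes>\<^bsub>R'\<^esub> k x \<in> carrier R'" using u kc[OF xc] by simp
      have "?J +>\<^bsub>R'\<^esub> k y = ?J +>\<^bsub>R'\<^esub> (u \<otimes>\<^bsub>R'\<^esub> k x)"
        using R'.quotient_eq_iff_same_a_r_cos[OF J.ideal_axioms kc[OF yc] ux] R'.cgenideal_self[OF wc] by simp
      then have "\<pi> (k y) = \<pi> (u \<otimes>\<^bsub>R'\<^esub> k x)" unfolding \<pi>_def .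
      then show ?thesis unfolding h_def using ring_hom_mult[OF \<pi> u kc[OF xc]] by simp
    qed
    then have "sat T (h \<circ> ?e) ?\<phi>" using ring_hom_closed[OF \<pi> u] by auto
    moreover have "existential ?\<phi>" by (intro existential.intros) simp
    ultimately have "sat R ?e ?\<phi>"
      using existentially_closed_transfer[OF ec inf f mT h hinj _ e] by blast
    then have "y \<in> PIdl\<^bsub>R\<^esub> x" unfolding cgenideal_def by auto
    then show False using y(2) by blast
  qed
qed

theorem existentially_closed_imp_gorenstein:
  fixes R :: "('a, 'm) ring_scheme"
  assumes ec: "existentially_closed TYPE('b) (Art l) R"
    and inf: "infinite (UNIV :: 'b set)" and f: "inj_on (f :: 'a \<Rightarrow> 'b) (carrier R)"
  shows "artinian_local_gorenstein_ring R" "ring_length R = enat l" "algebraically_closed (residue_field R)"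
proof -
  have model: "is_model (Art l) R" using ec unfolding existentially_closed_def by blast
  then show "artinian_local_gorenstein_ring R"
    unfolding artinian_local_gorenstein_ring_def is_model_Art_iff
    using existentially_closed_socle[OF ec inf f] by blast
  show "ring_length R = enat l" by (rule existentially_closed_length[OF ec inf f])
  have "loc_ring R" using model loc_ringI unfolding Art_model_iff by blast
  then show "algebraically_closed (residue_field R)"
    using loc_ring.algebraically_closed_iff_root_closed existentially_closed_root_closed[OF ec inf f] by blast
qed

section \<open>Extensions of Gorenstein rings of full length\<close>

text \<open>Counting lengths shows that the annihilators of the ideals of a composition series again form
  a composition series; this is where the Gorenstein property enters.\<close>

lemma (in loc_ring) gorenstein_separates:
  assumes soc: "principalideal (socle R) R" and len: "ring_length R = enat l" and b: "comp_seq R b l"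
    and j: "j < l"
  shows "\<exists>c\<in>carrier R. (\<forall>i<j. c \<otimes> b i = \<zero>) \<and> c \<otimes> b j \<noteq> \<zero>"
proof -
  have bc: "range b \<subseteq> carrier R" using b unfolding comp_seq_def by blast
  have bj: "b i \<in> carrier R" for i using bc by blast
  let ?ann = "\<lambda>j. {z \<in> carrier R. \<forall>i<j. z \<otimes> b i = \<zero>}"
  obtain \<sigma> where \<sigma>: "\<sigma> \<in> carrier R" "socle R = PIdl \<sigma>"
    using principalideal.generate[OF soc] cgenideal_eq_genideal by metis
  have \<sigma>s: "\<sigma> \<in> socle R" using \<sigma> cgenideal_self by simp
  \<comment> \<open>A nonunit moves \<open>b i\<close> into the span of its predecessors, and
    \<open>z\<close> annihilates that span.\<close>
  have prod_socle: "z \<otimes> b i \<in> socle R" if z: "z \<in> ?ann i" and i: "i < l" for z i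
    unfolding socle_iff
  proof (intro conjI ballI)
    show "z \<otimes> b i \<in> carrier R" using z bj by simp
    fix a assume a: "a \<in> nonunits R"
    have zc: "z \<in> carrier R" and ac: "a \<in> carrier R" using z a by auto
    have "a \<otimes> b i \<in> lspan R (carrier R) b i" using b i a unfolding comp_seq_def by blast
    moreover have "b k \<otimes> z = \<zero>" if "k < i" for k using z that m_comm[OF bj zc] by simp
    ultimately have "(a \<otimes> b i) \<otimes> z = \<zero>" using lspan_mult_zero[OF bc zc] by blast
    moreover have "z \<otimes> b i \<otimes> a = (a \<otimes> b i) \<otimes> z" using zc ac bj[of i] by algebra
    ultimately show "z \<otimes> b i \<otimes> a = \<zero>" by simp
  qed
  \<comment> \<open>The value \<open>\<zero>\<close> marks the positions without a separating
    element; the final count shows that there are none below \<open>l\<close>.\<close>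
  define c where "c i = (if \<exists>z\<in>?ann i. z \<otimes> b i \<noteq> \<zero> then SOME z. z \<in> ?ann i \<and> z \<otimes> b i \<noteq> \<zero> else \<zero>)" for i
  have c1: "c i \<in> ?ann i \<and> c i \<otimes> b i \<noteq> \<zero>" if ex: "\<exists>z\<in>?ann i. z \<otimes> b i \<noteq> \<zero>" for i
  proof -
    have "\<exists>z. z \<in> ?ann i \<and> z \<otimes> b i \<noteq> \<zero>" using ex by blast
    from someI_ex[OF this] show ?thesis unfolding c_def if_P[OF ex] .
  qed
  have c0: "c i = \<zero>" if "\<not> (\<exists>z\<in>?ann i. z \<otimes> b i \<noteq> \<zero>)" for i unfolding c_def using that by (simp only: if_False)
  have ca: "c i \<in> ?ann i" for i
  proof (cases "\<exists>z\<in>?ann i. z \<otimes> b i \<noteq> \<zero>")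
    case True then show ?thesis using c1 by blast
  next
    case False then show ?thesis using c0 bj by simp
  qed
  have cc: "c i \<in> carrier R" for i using ca[of i] by simp
  \<comment> \<open>Annihilators shrink as spans grow, so the order is reversed to obtain an
    increasing chain.\<close>
  define d where "d i = c (l - Suc i)" for i
  have dc: "range d \<subseteq> carrier R" unfolding d_def using cc by auto
  \<comment> \<open>A principal socle has dimension at most one over the residue field. So
    \<open>z \<otimes> b ?j\<close> is a multiple of the nonzero \<open>c ?j \<otimes> b ?j\<close>,
    and subtracting that multiple of \<open>c ?j\<close> from \<open>z\<close> leads into the next
    smaller annihilator.\<close>
  have ann_span: "?ann (l - i) \<subseteq> lspan R (carrier R) d i" if "i \<le> l" for i
    using that
  proof (induction i)
    case 0
    show ?case
    proof
      fix z assume z: "z \<in> ?ann (l - 0)"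
      then have zc: "z \<in> carrier R" by simp
      have "b k \<otimes> z = \<zero>" if "k < l" for k using z that m_comm[OF bj zc] by simp
      then have "\<one> \<otimes> z = \<zero>" using lspan_mult_zero[OF bc zc, of l \<one>] b unfolding comp_seq_def by blast
      then show "z \<in> lspan R (carrier R) d 0" using zc by simp
    qed
  next
    case (Suc i)
    let ?j = "l - Suc i"
    have j: "?j < l" "l - i = Suc ?j" using Suc.prems by auto
    interpret J: ideal "lspan R (carrier R) d i" R by (rule lspan_ideal[OF dc])
    show ?case
    proof
      fix z assume z: "z \<in> ?ann (l - Suc i)"
      have zc: "z \<in> carrier R" using z by simp
      show "z \<in> lspan R (carrier R) d (Suc i)"
      proof (cases "\<exists>z\<in>?ann ?j. z \<otimes> b ?j \<noteq> \<zero>")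
        case False
        then have "z \<in> ?ann (Suc ?j)" using z by (auto simp: less_Suc_eq)
        then have "z \<in> lspan R (carrier R) d i" using Suc j by auto
        then show ?thesis using lspan_Suc_mono[OF order.refl dc zero_closed] by blast
      next
        case True
        note c = c1[OF True]
        have "c ?j \<otimes> b ?j \<in> socle R" "z \<otimes> b ?j \<in> socle R" using prod_socle[OF _ j(1)] c z by blast+
        then obtain v t where v: "v \<in> carrier R" "c ?j \<otimes> b ?j = v \<otimes> \<sigma>" and t: "t \<in> carrier R" "z \<otimes> b ?j = t \<otimes> \<sigma>"
          unfolding \<sigma>(2) cgenideal_def by blast
        have "\<sigma> \<noteq> \<zero>" using c v by auto
        then have "v \<notin> nonunits R" using socle_nonunit_iff[OF \<sigma>s _ v(1)] c v(2) by simp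
        then have "v \<in> Units R" using v(1) nonunitI by blast
        then obtain w where w: "w \<in> carrier R" "v \<otimes> w = \<one>" unfolding unit_iff by blast
        let ?g = "t \<otimes> w"
        have gc: "?g \<in> carrier R" using t w by simp
        have "?g \<otimes> (c ?j \<otimes> b ?j) = t \<otimes> ((v \<otimes> w) \<otimes> \<sigma>)" unfolding v(2) using t(1) w(1) v(1) \<sigma>(1) by algebra
        then have e: "?g \<otimes> (c ?j \<otimes> b ?j) = z \<otimes> b ?j" using w(2) t \<sigma>(1) by simp
        have "z \<ominus> ?g \<otimes> c ?j \<in> ?ann (Suc ?j)"
        proof (intro CollectI conjI allI impI)
          show "z \<ominus> ?g \<otimes> c ?j \<in> carrier R" using zc gc cc by simp
          fix k assume k: "k < Suc ?j"
          have ex: "(z \<ominus> ?g \<otimes> c ?j) \<otimes> b k = z \<otimes> b k \<ominus> ?g \<otimes> (c ?j \<otimes> b k)"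
            using zc gc cc[of ?j] bj[of k] t(1) w(1) by algebra
          show "(z \<ominus> ?g \<otimes> c ?j) \<otimes> b k = \<zero>"
          proof (cases "k = ?j")
            case True
            then show ?thesis unfolding ex using e zc bj by (simp add: a_minus_def r_neg)
          next
            case False
            then have "z \<otimes> b k = \<zero>" "c ?j \<otimes> b k = \<zero>" using k z c by auto
            then show ?thesis unfolding ex using gc by (simp add: a_minus_def)
          qed
        qed
        then have m: "z \<ominus> ?g \<otimes> c ?j \<in> lspan R (carrier R) d i" using Suc j by auto
        have "z = (z \<ominus> ?g \<otimes> c ?j) \<oplus> ?g \<otimes> d i" unfolding d_def using zc gc cc[of ?j] t(1) w(1) by algebra
        then show ?thesis unfolding lspan.simps using m gc by blast
      qed
    qed
  qed
  have "comp_seq R d l"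
    unfolding comp_seq_def
  proof (intro conjI allI impI ballI)
    show "range d \<subseteq> carrier R" by (rule dc)
    show "\<one> \<in> lspan R (carrier R) d l" using ann_span[of l] by auto
    fix i a assume i: "i < l" and a: "a \<in> nonunits R"
    let ?j = "l - Suc i"
    have j: "?j < l" "l - i = Suc ?j" using i by auto
    have ac: "a \<in> carrier R" using a by simp
    have "c ?j \<otimes> b ?j \<in> socle R" using prod_socle[OF ca j(1)] .
    then have z: "c ?j \<otimes> b ?j \<otimes> a = \<zero>" using a socle_iff by blast
    have "a \<otimes> c ?j \<in> ?ann (Suc ?j)"
    proof (intro CollectI conjI allI impI)
      show "a \<otimes> c ?j \<in> carrier R" using ac cc by simp
      fix k assume k: "k < Suc ?j"
      have ex: "a \<otimes> c ?j \<otimes> b k = c ?j \<otimes> b k \<otimes> a" using ac cc[of ?j] bj[of k] by algebra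
      show "a \<otimes> c ?j \<otimes> b k = \<zero>"
      proof (cases "k = ?j")
        case True then show ?thesis using ex z by simp
      next
        case False
        then have "c ?j \<otimes> b k = \<zero>" using k ca[of ?j] by auto
        then show ?thesis using ex ac by simp
      qed
    qed
    then have "a \<otimes> c ?j \<in> lspan R (carrier R) d i" using ann_span[of i] i j(2) by auto
    moreover have "d i = c ?j" by (simp only: d_def)
    ultimately show "a \<otimes> d i \<in> lspan R (carrier R) d i" by simp
  qed
  \<comment> \<open>A chain with \<open>l\<close> simple or zero factors in a ring of length
    \<open>l\<close> has no zero factor; hence no \<open>c j\<close> with \<open>j < l\<close> is
    \<open>\<zero>\<close>.\<close>
  from comp_seq_length_le[OF this] len
  have "l \<le> card {i. i < l \<and> d i \<notin> lspan R (carrier R) d i}" by simp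
  moreover have "{i. i < l \<and> d i \<notin> lspan R (carrier R) d i} \<subseteq> {..<l}" by auto
  ultimately have all: "{i. i < l \<and> d i \<notin> lspan R (carrier R) d i} = {..<l}"
    by (intro card_seteq) auto
  have i: "l - Suc j < l" "l - Suc (l - Suc j) = j" using j by auto
  then have "d (l - Suc j) \<notin> lspan R (carrier R) d (l - Suc j)" using all by auto
  moreover have "\<zero> \<in> lspan R (carrier R) d (l - Suc j)"
    by (rule additive_subgroup.zero_closed[OF ideal.axioms(1)[OF lspan_ideal[OF dc]]])
  moreover have "d (l - Suc j) = c j" by (simp only: d_def i(2))
  ultimately have "c j \<noteq> \<zero>" by metis
  then have "\<exists>z\<in>?ann j. z \<otimes> b j \<noteq> \<zero>" using c0 by blast
  then show ?thesis by blast
qed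

text \<open>Multiplication by \<open>h c\<close>, with \<open>c\<close> from
  \<open>gorenstein_separates\<close>, kills the images of the earlier generators but not that of
  \<open>b j\<close>; by injectivity this persists in \<open>S\<close>. The bound \<open>l\<close>
  on the length of \<open>S\<close> then turns the strict sequence into a composition
  series.\<close>

lemma gorenstein_extension_strict:
  assumes R: "local_ring R" "principalideal (socle R) R" "ring_length R = enat l" "comp_seq R b l"
    and S: "is_model (Art l) S" and h: "h \<in> ring_hom R S" "inj_on h (carrier R)"
  shows "strict_seq S (h \<circ> b) l" "comp_seq S (h \<circ> b) l"
proof -
  interpret R: loc_ring R using R(1) by (rule loc_ringI)
  have SS: "cring S" "local_ring S" "ring_length S \<le> enat l" using S unfolding Art_model_iff by blast+
  interpret S: loc_ring S using SS(2) by (rule loc_ringI)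
  have bc: "range b \<subseteq> carrier R" using R(4) unfolding comp_seq_def by blast
  have bj: "b i \<in> carrier R" for i using bc by blast
  have hb: "range (h \<circ> b) \<subseteq> carrier S" using ring_hom_closed[OF h(1)] bj by auto
  have hz: "h \<zero>\<^bsub>R\<^esub> = \<zero>\<^bsub>S\<^esub>" using ring_hom_zero[OF h(1) R.ring_axioms S.ring_axioms] .
  show "strict_seq S (h \<circ> b) l"
    unfolding strict_seq_def
  proof (intro conjI allI impI notI)
    show "range (h \<circ> b) \<subseteq> carrier S" by (rule hb)
    fix j assume j: "j < l" and m: "(h \<circ> b) j \<in> lspan S (carrier S) (h \<circ> b) j"
    obtain c where c: "c \<in> carrier R" "\<And>i. i < j \<Longrightarrow> c \<otimes>\<^bsub>R\<^esub> b i = \<zero>\<^bsub>R\<^esub>" "c \<otimes>\<^bsub>R\<^esub> b j \<noteq> \<zero>\<^bsub>R\<^esub>"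
      using R.gorenstein_separates[OF R(2-4) j] by blast
    have prod: "(h \<circ> b) i \<otimes>\<^bsub>S\<^esub> h c = h (c \<otimes>\<^bsub>R\<^esub> b i)" for i
      using ring_hom_mult[OF h(1) bj[of i] c(1)] R.m_comm[OF c(1) bj[of i]] by simp
    have "(h \<circ> b) i \<otimes>\<^bsub>S\<^esub> h c = \<zero>\<^bsub>S\<^esub>" if "i < j" for i unfolding prod using c(2)[OF that] hz by simp
    then have "(h \<circ> b) j \<otimes>\<^bsub>S\<^esub> h c = \<zero>\<^bsub>S\<^esub>"
      using S.lspan_mult_zero[OF hb ring_hom_closed[OF h(1) c(1)] _ m] by blast
    then have "h (c \<otimes>\<^bsub>R\<^esub> b j) = h \<zero>\<^bsub>R\<^esub>" unfolding prod using hz by simp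
    then have "c \<otimes>\<^bsub>R\<^esub> b j = \<zero>\<^bsub>R\<^esub>"
      using inj_onD[OF h(2)] R.m_closed[OF c(1) bj[of j]] R.zero_closed by blast
    then show False using c(3) by blast
  qed
  then show "comp_seq S (h \<circ> b) l" using S.strict_seq_imp_comp_seq SS(3) by blast
qed

subsection \<open>Ideals generated inside a subring\<close>

text \<open>If \<open>G\<close> is a subring containing \<open>M\<close>, this is the ideal of
  \<open>G\<close>, not of the whole ring, generated by \<open>M\<close>. It grows by single
  products, so that properties can be checked on one summand at a time.\<close>

inductive_set mspan :: "('a, 'm) ring_scheme \<Rightarrow> 'a set \<Rightarrow> 'a set \<Rightarrow> 'a set" for R M G where
  zero: "\<zero>\<^bsub>R\<^esub> \<in> mspan R M G"
| add: "x \<in> mspan R M G \<Longrightarrow> \<mu> \<in> M \<Longrightarrow> g \<in> G \<Longrightarrow> x \<oplus>\<^bsub>R\<^esub> \<mu> \<otimes>\<^bsub>R\<^esub> g \<in> mspan R M G"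

lemma mspan_mono: "G \<subseteq> H \<Longrightarrow> mspan R M G \<subseteq> mspan R M H"
proof
  fix x assume GH: "G \<subseteq> H" and "x \<in> mspan R M G"
  from this(2) show "x \<in> mspan R M H"
    by (induction rule: mspan.induct) (use GH in \<open>auto intro: mspan.intros\<close>)
qed

context cring
begin

lemma mspan_subset_ideal:
  assumes "ideal I R" "M \<subseteq> I" "G \<subseteq> carrier R"
  shows "mspan R M G \<subseteq> I"
proof
  interpret I: ideal I R by fact
  fix x assume "x \<in> mspan R M G"
  then show "x \<in> I"
  proof (induction rule: mspan.induct)
    case zero show ?case by (rule I.zero_closed)
  next
    case (add x \<mu> g)
    then have "\<mu> \<otimes> g \<in> I" using assms by (intro I.I_r_closed) auto
    then show ?case using add I.a_closed by blast
  qed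
qed

lemma mspan_subset:
  assumes "subring G R" "M \<subseteq> G"
  shows "mspan R M G \<subseteq> G"
proof
  fix x assume "x \<in> mspan R M G"
  then show "x \<in> G"
  proof (induction rule: mspan.induct)
    case zero show ?case by (rule subringE(2)[OF assms(1)])
  next
    case (add x \<mu> g)
    then show ?case using assms(2) subringE(6,7)[OF assms(1)] by blast
  qed
qed

lemma mspan_add:
  assumes "subring G R" "M \<subseteq> G" "x \<in> mspan R M G" "y \<in> mspan R M G"
  shows "x \<oplus> y \<in> mspan R M G"
proof -
  have GR: "G \<subseteq> carrier R" using subringE(1)[OF assms(1)] .
  have sub: "mspan R M G \<subseteq> carrier R" using mspan_subset[OF assms(1,2)] GR by blast
  show ?thesis
    using assms(4)
  proof (induction rule: mspan.induct)
    case zero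
    then show ?case using assms(3) sub by auto
  next
    case (add y \<mu> g)
    have "x \<oplus> (y \<oplus> \<mu> \<otimes> g) = (x \<oplus> y) \<oplus> \<mu> \<otimes> g"
      using assms(2,3) add sub GR by (intro a_assoc[symmetric]) auto
    then show ?case using mspan.add[OF add.IH add.hyps(2,3)] by simp
  qed
qed

lemma mspan_mult:
  assumes "subring G R" "M \<subseteq> G" "x \<in> mspan R M G" "y \<in> G"
  shows "y \<otimes> x \<in> mspan R M G" "x \<otimes> y \<in> mspan R M G"
proof -
  have GR: "G \<subseteq> carrier R" using subringE(1)[OF assms(1)] .
  have sub: "mspan R M G \<subseteq> carrier R" using mspan_subset[OF assms(1,2)] GR by blast
  have yc: "y \<in> carrier R" using assms(4) GR by blast
  show 1: "y \<otimes> x \<in> mspan R M G"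
    using assms(3)
  proof (induction rule: mspan.induct)
    case zero
    then show ?case using yc mspan.zero[of R M G] by simp
  next
    case (add x \<mu> g)
    have c: "x \<in> carrier R" "\<mu> \<in> carrier R" "g \<in> carrier R" using add sub assms(2) GR by auto
    have "y \<otimes> (x \<oplus> \<mu> \<otimes> g) = y \<otimes> x \<oplus> \<mu> \<otimes> (y \<otimes> g)" using c yc by algebra
    moreover have "y \<otimes> g \<in> G" using assms(4) add.hyps(3) subringE(6)[OF assms(1)] by blast
    ultimately show ?case using mspan.add[OF add.IH add.hyps(2)] by simp
  qed
  have "x \<in> carrier R" using assms(3) sub by blast
  then show "x \<otimes> y \<in> mspan R M G" using 1 m_comm[OF _ yc] by simp
qed

lemma mspan_base:
  assumes "\<one> \<in> G" "M \<subseteq> carrier R" "\<mu> \<in> M"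
  shows "\<mu> \<in> mspan R M G"
proof -
  have "\<mu> \<in> carrier R" using assms by blast
  then show ?thesis using mspan.add[OF mspan.zero assms(3,1), of R] by simp
qed

lemma mspan_minus:
  assumes "subring G R" "M \<subseteq> G" "x \<in> mspan R M G"
  shows "\<ominus> x \<in> mspan R M G"
proof -
  have "x \<in> carrier R" using mspan_subset[OF assms(1,2)] subringE(1)[OF assms(1)] assms(3) by blast
  then have "\<ominus> x = \<ominus> \<one> \<otimes> x" by (simp add: l_minus)
  then show ?thesis using mspan_mult(1)[OF assms, of "\<ominus> \<one>"] subringE(3,5)[OF assms(1)] by simp
qed

lemma lspan_add:
  assumes "subring G R" "range b \<subseteq> carrier R" "x \<in> lspan R G b j" "y \<in> lspan R G b j"
  shows "x \<oplus> y \<in> lspan R G b j"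
  using assms(3,4)
proof (induction j arbitrary: x y)
  case 0 then show ?case by simp
next
  case (Suc j)
  have GR: "G \<subseteq> carrier R" using subringE(1)[OF assms(1)] .
  obtain x' g where x: "x' \<in> lspan R G b j" "g \<in> G" "x = x' \<oplus> g \<otimes> b j" using Suc.prems(1) by auto
  obtain y' k where y: "y' \<in> lspan R G b j" "k \<in> G" "y = y' \<oplus> k \<otimes> b j" using Suc.prems(2) by auto
  have c: "x' \<in> carrier R" "y' \<in> carrier R" "g \<in> carrier R" "k \<in> carrier R" "b j \<in> carrier R"
    using lspan_subset[OF assms(2) GR carrier_is_subring] x y GR assms(2) by auto
  have "x \<oplus> y = (x' \<oplus> y') \<oplus> (g \<oplus> k) \<otimes> b j" unfolding x(3) y(3) using c by algebra
  moreover have "g \<oplus> k \<in> G" using x y subringE(7)[OF assms(1)] by blast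
  ultimately show ?case using Suc.IH[OF x(1) y(1)] by auto
qed

lemma lspan_mult:
  assumes "subring G R" "range b \<subseteq> carrier R" "x \<in> lspan R G b j" "y \<in> G"
  shows "y \<otimes> x \<in> lspan R G b j"
  using assms(3)
proof (induction j arbitrary: x)
  case 0
  then show ?case using assms(4) subringE(1)[OF assms(1)] by auto
next
  case (Suc j)
  have GR: "G \<subseteq> carrier R" using subringE(1)[OF assms(1)] .
  obtain x' g where x: "x' \<in> lspan R G b j" "g \<in> G" "x = x' \<oplus> g \<otimes> b j" using Suc.prems(1) by auto
  have c: "x' \<in> carrier R" "g \<in> carrier R" "b j \<in> carrier R" "y \<in> carrier R"
    using lspan_subset[OF assms(2) GR carrier_is_subring] x GR assms(2,4) by auto
  have "y \<otimes> x = y \<otimes> x' \<oplus> (y \<otimes> g) \<otimes> b j" unfolding x(3) using c by algebra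
  moreover have "y \<otimes> g \<in> G" using x assms(4) subringE(6)[OF assms(1)] by blast
  ultimately show ?case using Suc.IH[OF x(1)] by auto
qed

end

section \<open>Maximal partial isomorphisms\<close>

context cring
begin

lemma heval_cong_ideal:
  assumes "ideal N R" "x \<in> carrier R" "y \<in> carrier R" "set cs \<subseteq> carrier R" "x \<ominus> y \<in> N"
  shows "heval R cs x \<ominus> heval R cs y \<in> N"
proof -
  have cl: "heval R cs y \<in> carrier R" "heval R (synth_div R y cs) x \<in> carrier R" "x \<ominus> y \<in> carrier R"
    using assms synth_div_set[of y cs] by auto
  have "heval R cs x \<ominus> heval R cs y = (x \<ominus> y) \<otimes> heval R (synth_div R y cs) x"
    unfolding heval_synth_div[OF assms(3,2,4)] using cl by algebra
  then show ?thesis using ideal.I_r_closed[OF assms(1,5) cl(2)] by simp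
qed

text \<open>Newton's iteration with one power gained per step: with \<open>a\<close> the initial
  value, a value divisible by \<open>a [^] Suc i\<close> becomes divisible by
  \<open>a [^] Suc (Suc i)\<close>, and nilpotency ends the process. All corrections lie in
  \<open>N\<close>, and the assumption on \<open>N\<close> keeps the derivative a unit.\<close>

lemma newton:
  assumes N: "ideal N R" and uN: "\<And>u \<nu>. u \<in> Units R \<Longrightarrow> \<nu> \<in> N \<Longrightarrow> u \<oplus> \<nu> \<in> Units R"
    and cs: "set cs \<subseteq> carrier R" and x: "x \<in> carrier R" and F: "heval R cs x \<in> N"
    and der: "hder R cs x \<in> Units R" and nil: "heval R cs x [^] (l::nat) = \<zero>"
  shows "\<exists>y\<in>carrier R. y \<ominus> x \<in> N \<and> heval R cs y = \<zero>"
proof -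
  interpret N: ideal N R by fact
  let ?a = "heval R cs x"
  have ac: "?a \<in> carrier R" using cs x by simp
  have "\<exists>y\<in>carrier R. y \<ominus> x \<in> N \<and> (\<exists>t\<in>carrier R. heval R cs y = ?a [^] Suc i \<otimes> t)" for i
  proof (induction i)
    case 0
    have "x \<ominus> x \<in> N" using x by (simp add: a_minus_def r_neg)
    moreover have "?a = ?a [^] Suc 0 \<otimes> \<one>" using ac by simp
    ultimately show ?case using x by blast
  next
    case (Suc i)
    then obtain y t where y: "y \<in> carrier R" "y \<ominus> x \<in> N" and t: "t \<in> carrier R"
      and Fy: "heval R cs y = ?a [^] Suc i \<otimes> t" by blast
    obtain b where b: "b = ?a [^] i" "b \<in> carrier R" using ac by simp
    have Fyc: "heval R cs y \<in> carrier R" using cs y by simp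
    have Fyn: "heval R cs y = ?a \<otimes> (b \<otimes> t)"
      unfolding Fy using b t ac by (simp add: m_ac)
    then have Fn: "heval R cs y \<in> N" using F b t by (simp add: N.I_r_closed)
    have du: "hder R cs y \<in> Units R"
    proof (cases cs)
      case Nil
      then show ?thesis using der by simp
    next
      case (Cons c cs')
      have s: "set (der_list R 1 cs') \<subseteq> carrier R"
        using der_list_set[OF carrier_is_subring] cs Cons by simp
      have eq: "hder R cs z = heval R (der_list R 1 cs') z" if "z \<in> carrier R" for z
        unfolding Cons by (rule hder_eq_heval) (use that cs Cons in auto)
      have n: "hder R cs y \<ominus> hder R cs x \<in> N"
        using heval_cong_ideal[OF N y(1) x s y(2)] eq x y(1) by simp
      have "hder R cs x \<oplus> (hder R cs y \<ominus> hder R cs x) \<in> Units R"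
        by (rule uN[OF der n])
      moreover have "hder R cs x \<oplus> (hder R cs y \<ominus> hder R cs x) = hder R cs y"
        using hder_closed[OF cs x] hder_closed[OF cs y(1)] by algebra
      ultimately show ?thesis by simp
    qed
    then obtain d where d: "d \<in> carrier R" "hder R cs y \<otimes> d = \<one>" unfolding unit_iff by blast
    define e where "e = \<ominus> (heval R cs y \<otimes> d)"
    have e: "e \<in> carrier R" "e \<in> N"
      unfolding e_def using Fn Fyc d by (auto simp: N.I_r_closed)
    obtain s where s: "s \<in> carrier R"
      "heval R cs (y \<oplus> e) = heval R cs y \<oplus> hder R cs y \<otimes> e \<oplus> e \<otimes> e \<otimes> s"
      using taylor[OF y(1) e(1) cs] by blast
    have D: "hder R cs y \<in> carrier R" using cs y by simp
    have "heval R cs y \<oplus> hder R cs y \<otimes> e = heval R cs y \<ominus> (hder R cs y \<otimes> d) \<otimes> heval R cs y"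
      unfolding e_def using D Fyc d(1) by algebra
    also have "\<dots> = \<zero>" unfolding d(2) using Fyc by (simp add: a_minus_def r_neg)
    finally have z: "heval R cs y \<oplus> hder R cs y \<otimes> e = \<zero>" .
    have "heval R cs (y \<oplus> e) = e \<otimes> e \<otimes> s" unfolding s(2) z using e s by simp
    also have "\<dots> = (b \<otimes> ?a \<otimes> ?a) \<otimes> ((t \<otimes> d) \<otimes> (t \<otimes> d) \<otimes> b \<otimes> s)"
      unfolding e_def Fyn using ac b(2) t d(1) s(1) by algebra
    also have "b \<otimes> ?a \<otimes> ?a = ?a [^] Suc (Suc i)" using b by simp
    finally have "\<exists>t\<in>carrier R. heval R cs (y \<oplus> e) = ?a [^] Suc (Suc i) \<otimes> t"
      using t d s b by blast
    moreover have "(y \<ominus> x) \<oplus> e \<in> N" using y(2) e(2) by simp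
    moreover have "(y \<ominus> x) \<oplus> e = (y \<oplus> e) \<ominus> x" using y(1) x e(1) by algebra
    ultimately show ?case using y(1) e(1) by (intro bexI[of _ "y \<oplus> e"]) auto
  qed
  then obtain y t where "y \<in> carrier R" "y \<ominus> x \<in> N" "t \<in> carrier R" "heval R cs y = ?a [^] Suc l \<otimes> t"
    by blast
  then show ?thesis using nil ac by (intro bexI[of _ y]) auto
qed

end

text \<open>In the application \<open>R\<close> is a product \<open>S \<times> T\<close> of two local rings and \<open>p1\<close>, \<open>p2\<close> are its two
  maximal ideals. A good subring is, modulo them, the graph of an isomorphism between subfields of
  the residue fields, and its nonunits are generated by \<open>M\<close>.\<close>

locale partial_iso = cring R for R (structure) +
  fixes p1 p2 D M :: "'a set"
  assumes p1: "primeideal p1 R" and p2: "primeideal p2 R"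
    and units: "\<And>x. x \<in> carrier R \<Longrightarrow> x \<notin> p1 \<Longrightarrow> x \<notin> p2 \<Longrightarrow> x \<in> Units R"
    and D: "subring D R" and MD: "M \<subseteq> D" and Mp: "M \<subseteq> p1 \<inter> p2"
begin

definition good :: "'a set \<Rightarrow> bool" where
  "good G \<longleftrightarrow> subring G R \<and> D \<subseteq> G \<and> G \<inter> (p1 \<union> p2) \<subseteq> mspan R M G"

sublocale P1: primeideal p1 R by (rule p1)
sublocale P2: primeideal p2 R by (rule p2)

lemma unit_iff_notin: "x \<in> Units R \<longleftrightarrow> x \<in> carrier R \<and> x \<notin> p1 \<and> x \<notin> p2"
proof -
  have "x \<notin> p" if "x \<in> Units R" "primeideal p R" for p
  proof
    interpret p: primeideal p R by fact
    assume "x \<in> p"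
    then have "x \<otimes> inv x \<in> p" using that(1) by (intro p.I_r_closed) auto
    then show False using that(1) p.one_imp_carrier p.I_notcarr by auto
  qed
  then show ?thesis using units[of x] p1 p2 Units_closed[of x] by blast
qed

lemma Np: "ideal (p1 \<inter> p2) R"
  using i_intersect[OF P1.ideal_axioms P2.ideal_axioms] .

lemma mspan_p:
  assumes "good G"
  shows "mspan R M G \<subseteq> p1 \<inter> p2" "mspan R M G \<subseteq> G"
proof -
  have "subring G R" "M \<subseteq> G" using assms MD unfolding good_def by auto
  note G = this
  show "mspan R M G \<subseteq> p1 \<inter> p2" by (rule mspan_subset_ideal[OF Np Mp subringE(1)[OF G(1)]])
  show "mspan R M G \<subseteq> G" by (rule mspan_subset[OF G])
qed

lemma good_p_iff: "good G \<Longrightarrow> x \<in> G \<Longrightarrow> x \<in> p1 \<longleftrightarrow> x \<in> p2"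
  using mspan_p(1)[of G] unfolding good_def by blast

lemma good_p_mspan: "good G \<Longrightarrow> x \<in> G \<Longrightarrow> x \<in> p1 \<or> x \<in> p2 \<Longrightarrow> x \<in> mspan R M G"
  unfolding good_def by blast

lemma heval_mspan:
  assumes G: "subring G R" "M \<subseteq> G" and H: "subring H R" "G \<subseteq> H" "z \<in> H" and cs: "set cs \<subseteq> mspan R M G"
  shows "heval R cs z \<in> mspan R M H"
  using cs
proof (induction cs)
  case Nil
  show ?case by (simp add: mspan.zero)
next
  case (Cons c cs)
  have MH: "M \<subseteq> H" using G(2) H(2) by blast
  have "c \<in> mspan R M H" using Cons.prems mspan_mono[OF H(2)] by auto
  moreover have "z \<otimes> heval R cs z \<in> mspan R M H" using mspan_mult(1)[OF H(1) MH _ H(3)] Cons by simp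
  ultimately show ?case using mspan_add[OF H(1) MH] by simp
qed

lemma good_adjoin_transcendental:
  assumes G: "good G" and z: "z \<in> carrier R"
    and tr: "\<And>cs. set cs \<subseteq> G \<Longrightarrow> heval R cs z \<in> p1 \<or> heval R cs z \<in> p2 \<Longrightarrow> set cs \<subseteq> p1"
  shows "good (adjoin G z)"
proof -
  have G': "subring G R" "D \<subseteq> G" "M \<subseteq> G" using G MD unfolding good_def by auto
  note a = adjoin_subring[OF G'(1) z]
  have "x \<in> mspan R M (adjoin G z)" if x: "x \<in> adjoin G z" "x \<in> p1 \<union> p2" for x
  proof -
    obtain cs where cs: "set cs \<subseteq> G" "x = heval R cs z" using x(1) unfolding adjoin_def by blast
    then have "set cs \<subseteq> mspan R M G" using tr[OF cs(1)] x(2) good_p_mspan[OF G] by blast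
    then show ?thesis unfolding cs(2) using heval_mspan[OF G'(1,3) a] by blast
  qed
  then show ?thesis unfolding good_def using a G'(2) by blast
qed

text \<open>Division by the monic polynomial leaves a remainder of smaller degree, to which
  \<open>min\<close> applies. The multiple of the polynomial stays in the ideal generated by
  \<open>M\<close> because its value at \<open>z\<close> is \<open>\<zero>\<close> or belongs to
  \<open>M\<close>.\<close>

lemma good_adjoin_algebraic:
  assumes G: "good G" and z: "z \<in> carrier R" and fs: "set fs \<subseteq> G" "fs \<noteq> []"
    and Fz: "heval R (fs @ [\<one>]) z \<in> insert \<zero> M"
    and min: "\<And>cs. set cs \<subseteq> G \<Longrightarrow> length cs \<le> length fs \<Longrightarrow> heval R cs z \<in> p1 \<or> heval R cs z \<in> p2 \<Longrightarrow> set cs \<subseteq> p1"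
  shows "good (adjoin G z)"
proof -
  have G': "subring G R" "D \<subseteq> G" "M \<subseteq> G" using G MD unfolding good_def by auto
  note a = adjoin_subring[OF G'(1) z]
  let ?A = "adjoin G z"
  have MA: "M \<subseteq> ?A" using G'(3) a(2) by blast
  have GR: "G \<subseteq> carrier R" using subringE(1)[OF G'(1)] .
  have Fm: "heval R (fs @ [\<one>]) z \<in> mspan R M ?A"
  proof (cases "heval R (fs @ [\<one>]) z = \<zero>")
    case True
    then show ?thesis by (simp add: mspan.zero)
  next
    case False
    then show ?thesis using Fz mspan_base[OF subringE(3)[OF a(1)]] MA subringE(1)[OF a(1)] by blast
  qed
  have "x \<in> mspan R M ?A" if x: "x \<in> ?A" "x \<in> p1 \<union> p2" for x
  proof -
    obtain cs where cs: "set cs \<subseteq> G" "x = heval R cs z" using x(1) unfolding adjoin_def by blast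
    obtain q r where q: "set q \<subseteq> G" and r: "set r \<subseteq> G" "length r = length fs"
      and eq: "\<forall>z\<in>carrier R. heval R cs z = heval R (fs @ [\<one>]) z \<otimes> heval R q z \<oplus> heval R r z"
      using monic_division[OF G'(1) fs cs(1)] by blast
    have xe: "x = heval R (fs @ [\<one>]) z \<otimes> heval R q z \<oplus> heval R r z" using bspec[OF eq z] cs(2) by simp
    have qA: "heval R q z \<in> ?A" using q unfolding adjoin_def by blast
    have Fq: "heval R (fs @ [\<one>]) z \<otimes> heval R q z \<in> mspan R M ?A" by (rule mspan_mult(2)[OF a(1) MA Fm qA])
    have sub: "mspan R M ?A \<subseteq> p1 \<inter> p2" by (rule mspan_subset_ideal[OF Np Mp subringE(1)[OF a(1)]])
    have rc: "heval R r z \<in> carrier R" using r GR z by auto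
    have "heval R r z = x \<ominus> heval R (fs @ [\<one>]) z \<otimes> heval R q z"
    proof -
      have c: "heval R (fs @ [\<one>]) z \<otimes> heval R q z \<in> carrier R" using Fq sub P1.Icarr by blast
      have "b = (a \<oplus> b) \<ominus> a" if "a \<in> carrier R" "b \<in> carrier R" for a b using that by algebra
      from this[OF c rc] show ?thesis unfolding xe .
    qed
    then have "heval R r z \<in> p1 \<or> heval R r z \<in> p2"
      using x(2) Fq sub by (auto simp: a_minus_def)
    then have "set r \<subseteq> mspan R M G" using min[OF r(1)] r good_p_mspan[OF G] by auto
    then have "heval R r z \<in> mspan R M ?A" using heval_mspan[OF G'(1,3) a] by blast
    then show ?thesis unfolding xe using mspan_add[OF a(1) MA Fq] by blast
  qed
  then show ?thesis unfolding good_def using a G'(2) by blast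
qed

text \<open>Every element of the extension is an element of \<open>G\<close> divided by a power of
  \<open>u\<close>, and such a unit factor does not affect membership in the two primes. A maximal
  good subring is therefore closed under these inverses, and polynomials over it can be made
  monic.\<close>

lemma good_adjoin_inverse:
  assumes G: "good G" and u: "u \<in> G" "u \<in> Units R"
  shows "good (adjoin G (inv u))"
proof -
  have G': "subring G R" "D \<subseteq> G" "M \<subseteq> G" using G MD unfolding good_def by auto
  have ic: "inv u \<in> carrier R" using u by simp
  have uc: "u \<in> carrier R" using u(2) by (rule Units_closed)
  note a = adjoin_subring[OF G'(1) ic]
  let ?A = "adjoin G (inv u)"
  have MA: "M \<subseteq> ?A" using G'(3) a(2) by blast
  have GR: "G \<subseteq> carrier R" using subringE(1)[OF G'(1)] .
  have upow: "u [^] k \<in> G" for k :: nat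
    using u(1) subringE(3,6)[OF G'(1)] by (induction k) auto
  have ipow: "inv u [^] k \<in> ?A" for k :: nat
    using a(3) subringE(3,6)[OF a(1)] by (induction k) auto
  have form: "\<exists>g\<in>G. heval R cs (inv u) = g \<otimes> inv u [^] length cs" if "set cs \<subseteq> G" for cs
    using that
  proof (induction cs)
    case Nil
    then show ?case using subringE(2)[OF G'(1)] by (intro bexI[of _ \<zero>]) auto
  next
    case (Cons c cs)
    then obtain g where g: "g \<in> G" "heval R cs (inv u) = g \<otimes> inv u [^] length cs" by auto
    have cl: "c \<in> carrier R" "g \<in> carrier R" using Cons.prems g GR by auto
    obtain k where k: "k = length cs" by simp
    have one: "u [^] Suc k \<otimes> inv u [^] Suc k = \<one>"
      using u(2) by (metis Units_closed Units_inv_closed Units_r_inv nat_pow_distrib nat_pow_one)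
    obtain U V W where UVW: "U = u [^] Suc k" "V = inv u [^] Suc k" "W = inv u [^] k" "U \<in> carrier R" "V \<in> carrier R" "W \<in> carrier R"
      using uc ic by auto
    have VW: "V = inv u \<otimes> W" using nat_pow_Suc2[OF ic, of k] UVW by simp
    have "(c \<otimes> U \<oplus> g) \<otimes> V = c \<otimes> (U \<otimes> V) \<oplus> g \<otimes> V" using cl UVW(4,5) by algebra
    also have "\<dots> = c \<oplus> inv u \<otimes> (g \<otimes> W)" using one UVW VW cl ic by (simp add: m_lcomm)
    finally have "heval R (c # cs) (inv u) = (c \<otimes> U \<oplus> g) \<otimes> V" using g(2) UVW k by simp
    moreover have "c \<otimes> U \<oplus> g \<in> G"
      using Cons.prems g upow[of "Suc k"] subringE(6,7)[OF G'(1)] unfolding UVW by auto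
    ultimately show ?case using UVW k by auto
  qed
  have "x \<in> mspan R M ?A" if x: "x \<in> ?A" "x \<in> p1 \<union> p2" for x
  proof -
    obtain cs where cs: "set cs \<subseteq> G" "x = heval R cs (inv u)" using x(1) unfolding adjoin_def by blast
    obtain g where g: "g \<in> G" "x = g \<otimes> inv u [^] length cs" using form[OF cs(1)] cs(2) by blast
    have iu: "inv u [^] length cs \<in> Units R" using u(2) by (intro Units_pow_closed) simp
    have gc: "g \<in> carrier R" "inv u [^] length cs \<in> carrier R" using g GR ic by auto
    have "g \<in> p1 \<or> g \<in> p2"
      using x(2) g(2) P1.I_prime[OF gc] P2.I_prime[OF gc] iu unit_iff_notin by auto
    then have "g \<in> mspan R M ?A" using good_p_mspan[OF G g(1)] mspan_mono[OF a(2)] by blast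
    then show ?thesis unfolding g(2) by (rule mspan_mult(2)[OF a(1) MA _ ipow])
  qed
  then show ?thesis unfolding good_def using a G'(2) by blast
qed

lemma good_maximal:
  assumes "good D"
  obtains G where "good G" "\<And>H. good H \<Longrightarrow> G \<subseteq> H \<Longrightarrow> H = G"
proof -
  have "\<exists>G\<in>{G. good G}. \<forall>H\<in>{G. good G}. G \<subseteq> H \<longrightarrow> H = G"
  proof (rule subset_Zorn_nonempty)
    show "{G. good G} \<noteq> {}" using assms by blast
    fix C assume C: "C \<noteq> {}" "subset.chain {G. good G} C"
    have gd: "good G" if "G \<in> C" for G using C(2) that unfolding pred_on.chain_def by blast
    have sub: "subring G R" if "G \<in> C" for G using gd[OF that] unfolding good_def by blast
    have two: "\<exists>G\<in>C. x \<in> G \<and> y \<in> G" if xy: "x \<in> \<Union>C" "y \<in> \<Union>C" for x y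
    proof -
      obtain G H where GH: "G \<in> C" "x \<in> G" "H \<in> C" "y \<in> H" using xy by blast
      have "G \<subseteq> H \<or> H \<subseteq> G" using C(2) GH unfolding pred_on.chain_def by blast
      then show ?thesis using GH by blast
    qed
    obtain G0 where G0: "G0 \<in> C" using C(1) by blast
    have "subring (\<Union>C) R"
    proof (rule subringI)
      show "\<Union>C \<subseteq> carrier R" using sub subringE(1) by blast
      show "\<one> \<in> \<Union>C" using sub[OF G0] subringE(3) G0 by blast
      show "\<ominus> x \<in> \<Union>C" if x: "x \<in> \<Union>C" for x
      proof -
        obtain G where G: "G \<in> C" "x \<in> G" using x by blast
        then show ?thesis using subringE(5)[OF sub[OF G(1)] G(2)] by blast
      qed
      fix x y assume "x \<in> \<Union>C" "y \<in> \<Union>C"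
      then obtain G where G: "G \<in> C" "x \<in> G" "y \<in> G" using two by blast
      then show "x \<otimes> y \<in> \<Union>C" "x \<oplus> y \<in> \<Union>C" using subringE(6,7)[OF sub[OF G(1)]] by blast+
    qed
    moreover have "D \<subseteq> \<Union>C" using gd[OF G0] G0 unfolding good_def by blast
    moreover have "x \<in> mspan R M (\<Union>C)" if "x \<in> \<Union>C" "x \<in> p1 \<union> p2" for x
    proof -
      obtain G where G: "G \<in> C" "x \<in> G" using \<open>x \<in> \<Union>C\<close> by blast
      then have "x \<in> mspan R M G" using good_p_mspan[OF gd] \<open>x \<in> p1 \<union> p2\<close> by blast
      moreover have "G \<subseteq> \<Union>C" using G(1) by blast
      ultimately show ?thesis using mspan_mono by blast
    qed
    ultimately show "\<Union>C \<in> {G. good G}" unfolding good_def by blast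
  qed
  then show ?thesis using that by blast
qed

end

text \<open>\<open>root\<close> and \<open>transcendental\<close> keep \<open>s\<close> modulo
  \<open>p1\<close> and prescribe the behaviour modulo \<open>p2\<close>, as is possible in a
  product. \<open>correction\<close> lists the two ways in which the value at a common root modulo
  \<open>p1\<close> and \<open>p2\<close> gets into \<open>insert \<zero> M\<close>: either
  \<open>M\<close> is all of \<open>p1 \<inter> p2\<close>, or the equations are separable and
  Newton's iteration makes the value zero.\<close>

locale partial_iso_extension = partial_iso +
  fixes l :: nat
  assumes goodD: "good D"
    and root: "\<And>G fs s. good G \<Longrightarrow> set fs \<subseteq> G \<Longrightarrow> fs \<noteq> [] \<Longrightarrow> s \<in> carrier R \<Longrightarrow>
      \<exists>z\<in>carrier R. z \<ominus> s \<in> p1 \<and> heval R (fs @ [\<one>]) z \<in> p2"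
    and transcendental: "\<And>G s. good G \<Longrightarrow> s \<in> carrier R \<Longrightarrow>
      \<exists>z\<in>carrier R. z \<ominus> s \<in> p1 \<and> (\<forall>cs. set cs \<subseteq> G \<and> heval R cs z \<in> p2 \<longrightarrow> set cs \<subseteq> p2)"
    and correction: "M = p1 \<inter> p2 \<or>
      ((\<forall>n::nat. [Suc n] \<cdot> \<one> \<notin> p1) \<and> (\<forall>a\<in>p1 \<inter> p2. a [^] l = \<zero>))"
begin

text \<open>Let \<open>G\<close> be a maximal good subring. For any \<open>s\<close>, a good
  extension by some \<open>z\<close> congruent to \<open>s\<close> modulo \<open>p1\<close> is
  constructed, and maximality puts \<open>z\<close> into \<open>G\<close>. A transcendental residue
  is matched with a transcendental one. For an algebraic residue, the polynomial of least degree
  modulo \<open>p1\<close> must be shown to have least degree modulo \<open>p2\<close> as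
  well.\<close>

theorem good_onto:
  "\<exists>G. good G \<and> (\<forall>s\<in>carrier R. \<exists>g\<in>G. s \<ominus> g \<in> p1)"
proof -
  obtain G where G: "good G" and mx: "\<And>H. good H \<Longrightarrow> G \<subseteq> H \<Longrightarrow> H = G" by (rule good_maximal[OF goodD]) blast
  have G': "subring G R" "D \<subseteq> G" "M \<subseteq> G" using G MD unfolding good_def by auto
  have GR: "G \<subseteq> carrier R" using subringE(1)[OF G'(1)] .
  have in_G: "z \<in> G" if "good (adjoin G z)" "z \<in> carrier R" for z
    using mx[OF that(1)] adjoin_subring[OF G'(1) that(2)] by blast
  have inv_G: "inv u \<in> G" if "u \<in> G" "u \<in> Units R" for u
    using in_G[OF good_adjoin_inverse[OF G that]] that(2) by simp
  have cong: "heval R cs z \<in> p1 \<longleftrightarrow> heval R cs s \<in> p1"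
    if "set cs \<subseteq> carrier R" "z \<in> carrier R" "s \<in> carrier R" "z \<ominus> s \<in> p1" for cs z s
  proof -
    have d: "heval R cs z \<ominus> heval R cs s \<in> p1" by (rule heval_cong_ideal[OF P1.ideal_axioms that(2,3,1,4)])
    have c: "heval R cs z \<in> carrier R" "heval R cs s \<in> carrier R" using that by auto
    have e: "heval R cs z = (heval R cs z \<ominus> heval R cs s) \<oplus> heval R cs s"
      "heval R cs s = heval R cs z \<ominus> (heval R cs z \<ominus> heval R cs s)"
      using c by algebra+
    show ?thesis
    proof
      assume "heval R cs z \<in> p1"
      then have "heval R cs z \<ominus> (heval R cs z \<ominus> heval R cs s) \<in> p1" using d by (simp add: a_minus_def)
      then show "heval R cs s \<in> p1" using e(2) by simp
    next
      assume "heval R cs s \<in> p1"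
      then have "(heval R cs z \<ominus> heval R cs s) \<oplus> heval R cs s \<in> p1" using d by simp
      then show "heval R cs z \<in> p1" using e(1) by simp
    qed
  qed
  have cong2: "heval R cs z \<in> p2 \<longleftrightarrow> heval R cs s \<in> p2"
    if "set cs \<subseteq> carrier R" "z \<in> carrier R" "s \<in> carrier R" "z \<ominus> s \<in> p2" for cs z s
  proof -
    have d: "heval R cs z \<ominus> heval R cs s \<in> p2" by (rule heval_cong_ideal[OF P2.ideal_axioms that(2,3,1,4)])
    have c: "heval R cs z \<in> carrier R" "heval R cs s \<in> carrier R" using that by auto
    have e: "heval R cs z = (heval R cs z \<ominus> heval R cs s) \<oplus> heval R cs s"
      "heval R cs s = heval R cs z \<ominus> (heval R cs z \<ominus> heval R cs s)"
      using c by algebra+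
    show ?thesis
    proof
      assume "heval R cs z \<in> p2"
      then have "heval R cs z \<ominus> (heval R cs z \<ominus> heval R cs s) \<in> p2" using d by (simp add: a_minus_def)
      then show "heval R cs s \<in> p2" using e(2) by simp
    next
      assume "heval R cs s \<in> p2"
      then have "(heval R cs z \<ominus> heval R cs s) \<oplus> heval R cs s \<in> p2" using d by simp
      then show "heval R cs z \<in> p2" using e(1) by simp
    qed
  qed
  have "\<exists>g\<in>G. s \<ominus> g \<in> p1" if s: "s \<in> carrier R" for s
  proof -
    have step: "\<exists>z\<in>carrier R. z \<ominus> s \<in> p1 \<and> good (adjoin G z)"
    proof (cases "\<forall>cs. set cs \<subseteq> G \<and> heval R cs s \<in> p1 \<longrightarrow> set cs \<subseteq> p1")
      case True
      obtain z where z: "z \<in> carrier R" "z \<ominus> s \<in> p1"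
        and tr: "\<forall>cs. set cs \<subseteq> G \<and> heval R cs z \<in> p2 \<longrightarrow> set cs \<subseteq> p2"
        using transcendental[OF G s] by blast
      have "good (adjoin G z)"
      proof (rule good_adjoin_transcendental[OF G z(1)])
        fix cs assume cs: "set cs \<subseteq> G" "heval R cs z \<in> p1 \<or> heval R cs z \<in> p2"
        then show "set cs \<subseteq> p1"
          using True tr cong[of cs z s] z s GR good_p_iff[OF G] by blast
      qed
      then show ?thesis using z by blast
    next
      case False
      let ?B = "\<lambda>n. \<exists>cs. length cs = n \<and> set cs \<subseteq> G \<and> heval R cs s \<in> p1 \<and> \<not> set cs \<subseteq> p1"
      have ex: "\<exists>n. ?B n" using False by blast
      define n where "n = (LEAST n. ?B n)"
      have "?B n" unfolding n_def using ex by (rule LeastI_ex)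
      then obtain cs where cs: "length cs = n" "set cs \<subseteq> G" "heval R cs s \<in> p1" "\<not> set cs \<subseteq> p1" by blast
      have min: "set ds \<subseteq> p1" if "set ds \<subseteq> G" "heval R ds s \<in> p1" "length ds < n" for ds
        using not_less_Least[of "length ds" ?B] that unfolding n_def by blast
      have "cs \<noteq> []" using cs(4) by auto
      then obtain bs u where bs: "cs = bs @ [u]" by (metis rev_exhaust)
      have bG: "set bs \<subseteq> G" "u \<in> G" using cs(2) bs by auto
      have bc: "set bs \<subseteq> carrier R" "u \<in> carrier R" using bG GR by auto
      have un: "u \<notin> p1"
      proof
        assume u: "u \<in> p1"
        have up: "u \<otimes> s [^] length bs \<in> p1" using u s by (intro P1.I_r_closed) auto
        have c: "heval R bs s \<in> carrier R" using bc s by simp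
        have "heval R bs s \<oplus> u \<otimes> s [^] length bs \<in> p1" using cs(3) heval_snoc[OF bc s] bs by simp
        then have "(heval R bs s \<oplus> u \<otimes> s [^] length bs) \<ominus> u \<otimes> s [^] length bs \<in> p1"
          using up by (simp add: a_minus_def)
        moreover have "(heval R bs s \<oplus> u \<otimes> s [^] length bs) \<ominus> u \<otimes> s [^] length bs = heval R bs s"
          using c P1.Icarr[OF up] by algebra
        ultimately have "heval R bs s \<in> p1" by simp
        then have "set bs \<subseteq> p1" using min[OF bG(1)] cs(1) bs by simp
        then show False using cs(4) u bs by simp
      qed
      then have u: "u \<in> Units R" using good_p_iff[OF G bG(2)] units bc(2) by blast
      have iG: "inv u \<in> G" by (rule inv_G[OF bG(2) u])
      have ic: "inv u \<in> carrier R" using u by simp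
      define fs where "fs = map (\<lambda>x. inv u \<otimes> x) bs"
      have fG: "set fs \<subseteq> G" unfolding fs_def using bG(1) iG subringE(6)[OF G'(1)] by auto
      have fc: "set fs \<subseteq> carrier R" "set (fs @ [\<one>]) \<subseteq> carrier R" using fG GR by auto
      have feq: "fs @ [\<one>] = map (\<lambda>x. inv u \<otimes> x) cs" unfolding fs_def bs using u by simp
      have csc: "set cs \<subseteq> carrier R" using cs(2) GR by blast
      have Fs: "heval R (fs @ [\<one>]) s \<in> p1"
        unfolding feq using heval_map_mult[OF ic csc s] cs(3) ic P1.I_l_closed by simp
      have lf: "n = Suc (length fs)" using cs(1) bs unfolding fs_def by simp
      have one1: "\<one> \<notin> p1" "\<one> \<notin> p2"
        using P1.one_imp_carrier P1.I_notcarr P2.one_imp_carrier P2.I_notcarr by auto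
      have fne: "fs \<noteq> []"
      proof
        assume "fs = []"
        then have "heval R (fs @ [\<one>]) s = \<one>" using s by simp
        then show False using Fs one1 by simp
      qed
      obtain z where z: "z \<in> carrier R" "z \<ominus> s \<in> p1" "heval R (fs @ [\<one>]) z \<in> p2"
        using root[OF G fG fne s] by blast
      have Fz1: "heval R (fs @ [\<one>]) z \<in> p1" using cong[OF fc(2) z(1) s z(2)] Fs by blast
      have min1: "set ds \<subseteq> p1" if "set ds \<subseteq> G" "heval R ds z \<in> p1" "length ds \<le> length fs" for ds
        using min[OF that(1)] cong[of ds z s] z s that GR lf by auto
      \<comment> \<open>Irreducibility is transferred from \<open>p1\<close> to \<open>p2\<close>. A
        shorter relation modulo \<open>p2\<close> yields a monic one, \<open>hs @ [\<one>]\<close>,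
        of least degree. Dividing the polynomial of \<open>fs\<close> by it leaves a remainder with
        coefficients in \<open>p1\<close>, by that minimality, so the polynomial factors modulo
        \<open>p1\<close> too. As \<open>p1\<close> is prime, one factor vanishes there at
        \<open>z\<close>, contrary to \<open>min1\<close>.\<close>
      have min2: "set ds \<subseteq> p1" if ds: "set ds \<subseteq> G" "heval R ds z \<in> p2" "length ds \<le> length fs" for ds
      proof (rule ccontr)
        assume nds: "\<not> set ds \<subseteq> p1"
        let ?B2 = "\<lambda>n. \<exists>ds. length ds = n \<and> set ds \<subseteq> G \<and> heval R ds z \<in> p2 \<and> \<not> set ds \<subseteq> p1"
        define m where "m = (LEAST n. ?B2 n)"
        have "?B2 (length ds)" using ds nds by blast
        then have m: "?B2 m" "m \<le> length ds" unfolding m_def by (rule LeastI, rule Least_le)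
        then obtain es where es: "length es = m" "set es \<subseteq> G" "heval R es z \<in> p2" "\<not> set es \<subseteq> p1" by blast
        have mmin: "set ds \<subseteq> p1" if "set ds \<subseteq> G" "heval R ds z \<in> p2" "length ds < m" for ds
          using not_less_Least[of "length ds" ?B2] that unfolding m_def by blast
        have "es \<noteq> []" using es(4) by auto
        then obtain as v where as: "es = as @ [v]" by (metis rev_exhaust)
        have aG: "set as \<subseteq> G" "v \<in> G" using es(2) as by auto
        have ac: "set as \<subseteq> carrier R" "v \<in> carrier R" using aG GR by auto
        have vn: "v \<notin> p1"
        proof
          assume v: "v \<in> p1"
          then have v2: "v \<in> p2" using good_p_iff[OF G aG(2)] by blast
          have vp: "v \<otimes> z [^] length as \<in> p2" using v2 z(1) by (intro P2.I_r_closed) auto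
          have c: "heval R as z \<in> carrier R" using ac z(1) by simp
          have "heval R as z \<oplus> v \<otimes> z [^] length as \<in> p2" using es(3) heval_snoc[OF ac z(1)] as by simp
          then have "(heval R as z \<oplus> v \<otimes> z [^] length as) \<ominus> v \<otimes> z [^] length as \<in> p2"
            using vp by (simp add: a_minus_def)
          moreover have "(heval R as z \<oplus> v \<otimes> z [^] length as) \<ominus> v \<otimes> z [^] length as = heval R as z"
            using c P2.Icarr[OF vp] by algebra
          ultimately have "heval R as z \<in> p2" by simp
          then have "set as \<subseteq> p1" using mmin[OF aG(1)] es(1) as by simp
          then show False using es(4) v as by simp
        qed
        then have v: "v \<in> Units R" using good_p_iff[OF G aG(2)] units ac(2) by blast
        have ivG: "inv v \<in> G" by (rule inv_G[OF aG(2) v])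
        have ivc: "inv v \<in> carrier R" using v by simp
        define hs where "hs = map (\<lambda>x. inv v \<otimes> x) as"
        have hG: "set hs \<subseteq> G" unfolding hs_def using aG(1) ivG subringE(6)[OF G'(1)] by auto
        have heq: "hs @ [\<one>] = map (\<lambda>x. inv v \<otimes> x) es" unfolding hs_def as using v by simp
        have esc: "set es \<subseteq> carrier R" using es(2) GR by blast
        have Hz: "heval R (hs @ [\<one>]) z \<in> p2"
          unfolding heq using heval_map_mult[OF ivc esc z(1)] es(3) ivc P2.I_l_closed by simp
        have lh: "m = Suc (length hs)" using es(1) as unfolding hs_def by simp
        have hne: "hs \<noteq> []"
        proof
          assume "hs = []"
          then have "heval R (hs @ [\<one>]) z = \<one>" using z(1) by simp
          then show False using Hz one1 by simp
        qed
        have oG: "\<one> \<in> G" by (rule subringE(3)[OF G'(1)])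
        have fG1: "set (fs @ [\<one>]) \<subseteq> G" and hG1: "set (hs @ [\<one>]) \<subseteq> G" using fG hG oG by auto
        obtain q r where q: "set q \<subseteq> G" "length q = length (fs @ [\<one>]) - length hs" "q \<noteq> [] \<longrightarrow> last q = last (fs @ [\<one>])"
          and r: "set r \<subseteq> G" "length r = length hs"
          and eq: "\<forall>z\<in>carrier R. heval R (fs @ [\<one>]) z = heval R (hs @ [\<one>]) z \<otimes> heval R q z \<oplus> heval R r z"
          using monic_division[OF G'(1) hG hne fG1] by blast
        have cl: "heval R q z \<in> carrier R" "heval R r z \<in> carrier R" "heval R (hs @ [\<one>]) z \<in> carrier R"
          using heval_closed[OF subset_trans[OF q(1) GR] z(1)] heval_closed[OF subset_trans[OF r(1) GR] z(1)]
            heval_closed[OF subset_trans[OF hG1 GR] z(1)] .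
        have eqz: "heval R (fs @ [\<one>]) z = heval R (hs @ [\<one>]) z \<otimes> heval R q z \<oplus> heval R r z"
          by (rule bspec[OF eq z(1)])
        have rz: "heval R r z = heval R (fs @ [\<one>]) z \<ominus> heval R (hs @ [\<one>]) z \<otimes> heval R q z"
          unfolding eqz using cl by algebra
        have "heval R (hs @ [\<one>]) z \<otimes> heval R q z \<in> p2" by (rule P2.I_r_closed[OF Hz cl(1)])
        then have "heval R r z \<in> p2" unfolding rz using z(3) by (simp add: a_minus_def)
        then have rp: "set r \<subseteq> p1" using mmin[OF r(1)] r(2) lh by simp
        then have "heval R r z \<in> p1" using heval_ideal[OF P1.ideal_axioms _ z(1)] by blast
        then have "heval R (fs @ [\<one>]) z \<ominus> heval R r z \<in> p1" using Fz1 by (simp add: a_minus_def)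
        moreover have "heval R (fs @ [\<one>]) z \<ominus> heval R r z = heval R (hs @ [\<one>]) z \<otimes> heval R q z"
          unfolding eqz using cl by algebra
        ultimately have "heval R (hs @ [\<one>]) z \<in> p1 \<or> heval R q z \<in> p1"
          using P1.I_prime[OF cl(3,1)] by simp
        then show False
        proof
          assume "heval R (hs @ [\<one>]) z \<in> p1"
          then have "set (hs @ [\<one>]) \<subseteq> p1" using min1[OF hG1] m(2) ds(3) lh by simp
          then show False using one1 by simp
        next
          assume "heval R q z \<in> p1"
          moreover have "length q \<le> length fs" using q(2) hne by (cases hs) auto
          ultimately have "set q \<subseteq> p1" using min1[OF q(1)] by blast
          moreover have "q \<noteq> []" using q(2) lh m(2) ds(3) by (cases q) auto
          ultimately show False using q(3) one1 by (metis last_in_set last_snoc subsetD)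
        qed
      qed
      have "\<exists>z'\<in>carrier R. z' \<ominus> z \<in> p1 \<inter> p2 \<and> heval R (fs @ [\<one>]) z' \<in> insert \<zero> M"
      proof (cases "M = p1 \<inter> p2")
        case True
        have "z \<ominus> z \<in> p1 \<inter> p2" using z(1) by (simp add: a_minus_def r_neg)
        then show ?thesis using True Fz1 z by blast
      next
        case False
        then have ch: "\<And>n::nat. [Suc n] \<cdot> \<one> \<notin> p1" and nil: "\<And>a. a \<in> p1 \<inter> p2 \<Longrightarrow> a [^] l = \<zero>"
          using correction by blast+
        obtain f fs' where f: "fs = f # fs'" using fne by (cases fs) auto
        let ?d = "der_list R 1 (fs' @ [\<one>])"
        have dG: "set ?d \<subseteq> G" using der_list_set[OF G'(1)] fG f subringE(3)[OF G'(1)] by simp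
        have dl: "length ?d \<le> length fs" using f by simp
        have last: "last ?d = [Suc (length fs')] \<cdot> \<one>" using last_der_list[of "fs' @ [\<one>]" R 1] by simp
        have dne: "?d \<noteq> []" by (metis length_der_list length_0_conv snoc_eq_iff_butlast)
        \<comment> \<open>The leading coefficient of the derivative is a positive multiple of
          \<open>\<one>\<close>, and its degree is too small for a relation modulo \<open>p1\<close>
          or \<open>p2\<close>; so its value at \<open>z\<close> is a unit.\<close>
        have "\<not> set ?d \<subseteq> p1" using ch[of "length fs'"] last last_in_set[OF dne] by (metis subsetD)
        then have "heval R ?d z \<notin> p1" "heval R ?d z \<notin> p2" using min1[OF dG] min2[OF dG] dl by blast+
        moreover have "heval R ?d z \<in> carrier R" using dG GR z(1) by auto
        moreover have "hder R (fs @ [\<one>]) z = heval R ?d z"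
          using hder_eq_heval[of z f "fs' @ [\<one>]"] fc(2) z(1) unfolding f by simp
        ultimately have du: "hder R (fs @ [\<one>]) z \<in> Units R" using units by simp
        have uN: "u \<oplus> \<nu> \<in> Units R" if u: "u \<in> Units R" and \<nu>: "\<nu> \<in> p1 \<inter> p2" for u \<nu>
        proof -
          have c: "u \<in> carrier R" "\<nu> \<in> carrier R" using u \<nu> P1.Icarr by auto
          have e: "u = (u \<oplus> \<nu>) \<ominus> \<nu>" using c by algebra
          have "u \<oplus> \<nu> \<notin> p1"
          proof
            assume "u \<oplus> \<nu> \<in> p1"
            then have "(u \<oplus> \<nu>) \<ominus> \<nu> \<in> p1" using \<nu> by (simp add: a_minus_def)
            then show False using e u unit_iff_notin by simp
          qed
          moreover have "u \<oplus> \<nu> \<notin> p2"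
          proof
            assume "u \<oplus> \<nu> \<in> p2"
            then have "(u \<oplus> \<nu>) \<ominus> \<nu> \<in> p2" using \<nu> by (simp add: a_minus_def)
            then show False using e u unit_iff_notin by simp
          qed
          ultimately show ?thesis using c units by simp
        qed
        have FN: "heval R (fs @ [\<one>]) z \<in> p1 \<inter> p2" using Fz1 z(3) by blast
        show ?thesis using newton[OF Np uN fc(2) z(1) FN du nil[OF FN]] by blast
      qed
      then obtain z' where z': "z' \<in> carrier R" "z' \<ominus> z \<in> p1 \<inter> p2" "heval R (fs @ [\<one>]) z' \<in> insert \<zero> M" by blast
      have "good (adjoin G z')"
      proof (rule good_adjoin_algebraic[OF G z'(1) fG fne z'(3)])
        fix ds assume ds: "set ds \<subseteq> G" "length ds \<le> length fs" "heval R ds z' \<in> p1 \<or> heval R ds z' \<in> p2"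
        have dc: "set ds \<subseteq> carrier R" using ds(1) GR by blast
        then have "heval R ds z \<in> p1 \<or> heval R ds z \<in> p2"
          using ds(3) cong[OF dc z'(1) z(1)] cong2[OF dc z'(1) z(1)] z'(2) by blast
        then show "set ds \<subseteq> p1" using min1[OF ds(1)] min2[OF ds(1)] ds(2) by blast
      qed
      moreover have "z' \<ominus> s \<in> p1"
      proof -
        have "(z' \<ominus> z) \<oplus> (z \<ominus> s) \<in> p1" using z'(2) z(2) by simp
        moreover have "(z' \<ominus> z) \<oplus> (z \<ominus> s) = z' \<ominus> s" using z'(1) z(1) s by algebra
        ultimately show ?thesis by simp
      qed
      ultimately show ?thesis using z'(1) by blast
    qed
    then obtain z where z: "z \<in> carrier R" "z \<ominus> s \<in> p1" "good (adjoin G z)" by blast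
    have "z \<in> G" by (rule in_G[OF z(3,1)])
    moreover have "s \<ominus> z \<in> p1"
    proof -
      have "\<ominus> (z \<ominus> s) \<in> p1" using z(2) by simp
      moreover have "\<ominus> (z \<ominus> s) = s \<ominus> z" using z(1) s by algebra
      ultimately show ?thesis by simp
    qed
    ultimately show ?thesis by blast
  qed
  then show ?thesis using G by blast
qed

end

section \<open>Products of two local rings\<close>

lemma RDirProd_simps [simp]:
  "\<zero>\<^bsub>RDirProd S T\<^esub> = (\<zero>\<^bsub>S\<^esub>, \<zero>\<^bsub>T\<^esub>)" "\<one>\<^bsub>RDirProd S T\<^esub> = (\<one>\<^bsub>S\<^esub>, \<one>\<^bsub>T\<^esub>)"
  "x \<oplus>\<^bsub>RDirProd S T\<^esub> y = (fst x \<oplus>\<^bsub>S\<^esub> fst y, snd x \<oplus>\<^bsub>T\<^esub> snd y)"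
  "x \<otimes>\<^bsub>RDirProd S T\<^esub> y = (fst x \<otimes>\<^bsub>S\<^esub> fst y, snd x \<otimes>\<^bsub>T\<^esub> snd y)"
  by (auto simp: RDirProd_def DirProd_def monoid.defs split: prod.splits)

lemma fst_hom: "fst \<in> ring_hom (RDirProd S T) S" and snd_hom: "snd \<in> ring_hom (RDirProd S T) T"
  by (auto simp: ring_hom_def RDirProd_carrier)

lemma pair_hom:
  "h \<in> ring_hom R S \<Longrightarrow> k \<in> ring_hom R T \<Longrightarrow> (\<lambda>r. (h r, k r)) \<in> ring_hom R (RDirProd S T)"
  by (auto simp: ring_hom_def RDirProd_carrier)

lemma RDirProd_cring:
  assumes "cring S" "cring T"
  shows "cring (RDirProd S T)"
proof -
  interpret S: cring S by fact
  interpret T: cring T by fact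
  interpret ring "RDirProd S T" by (rule RDirProd_ring[OF S.ring_axioms T.ring_axioms])
  show ?thesis
    by unfold_locales (auto simp: RDirProd_carrier S.m_comm T.m_comm)
qed

lemma ring_hom_diff:
  assumes "cring R" "cring S" "h \<in> ring_hom R S" "x \<in> carrier R" "y \<in> carrier R"
  shows "h (x \<ominus>\<^bsub>R\<^esub> y) = h x \<ominus>\<^bsub>S\<^esub> h y"
proof -
  interpret R: cring R by fact
  show ?thesis
    unfolding a_minus_def using assms(4,5) ring_hom_add[OF assms(3)] ring_hom_minus[OF assms(1-4)]
      ring_hom_minus[OF assms(1-3,5)] by simp
qed

lemma ring_hom_nat_pow:
  assumes "cring R" "cring S" "h \<in> ring_hom R S" "x \<in> carrier R"
  shows "h (x [^]\<^bsub>R\<^esub> (n::nat)) = h x [^]\<^bsub>S\<^esub> n"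
proof -
  interpret ring_hom_cring R S h
    using assms unfolding ring_hom_cring_def ring_hom_cring_axioms_def by blast
  show ?thesis using assms(4) by simp
qed

text \<open>In a model the nonunits are nilpotent, and a homomorphism preserves nilpotency.\<close>

lemma model_hom_nonunit:
  assumes "is_model (Art l) S" "is_model (Art l) T" "g \<in> ring_hom S T" "x \<in> nonunits S"
  shows "g x \<in> nonunits T"
proof -
  have S: "cring S" "local_ring S" "ring_length S \<le> enat l" using assms(1) unfolding Art_model_iff by blast+
  have T: "cring T" "local_ring T" using assms(2) unfolding Art_model_iff by blast+
  interpret T: loc_ring T using T(2) by (rule loc_ringI)
  have x: "x \<in> carrier S" using assms(4) by (simp add: nonunits_def)
  have g0: "g \<zero>\<^bsub>S\<^esub> = \<zero>\<^bsub>T\<^esub>" by (rule ring_hom_zero[OF assms(3) cring.axioms(1)[OF S(1)] cring.axioms(1)[OF T(1)]])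
  have "g x [^]\<^bsub>T\<^esub> l = g (x [^]\<^bsub>S\<^esub> l)" using ring_hom_nat_pow[OF S(1) T(1) assms(3) x] by simp
  also have "\<dots> = \<zero>\<^bsub>T\<^esub>"
    using cring.length_nilpotent[OF S(1,3,2) assms(4)] g0 by simp
  finally have "g x \<notin> Units T"
    using T.Units_pow_closed[of "g x" l] T.unit_not_nonunit[of "\<zero>\<^bsub>T\<^esub>"] by auto
  then show ?thesis using T.nonunitI[OF ring_hom_closed[OF assms(3) x]] by blast
qed

lemma (in cring) heval_cong_coeffs:
  assumes "ideal I R" "list_all2 (\<lambda>c d. c \<in> carrier R \<and> d \<in> carrier R \<and> c \<ominus> d \<in> I) cs ds"
    "x \<in> carrier R"
  shows "heval R cs x \<ominus> heval R ds x \<in> I"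
proof -
  interpret I: ideal I R by fact
  show ?thesis
    using assms(2)
  proof (induction rule: list_all2_induct)
    case Nil
    show ?case using I.zero_closed by (simp add: a_minus_def)
  next
    case (Cons c cs d ds)
    have "set cs \<subseteq> carrier R \<and> set ds \<subseteq> carrier R"
      using Cons.hyps(2) by (induction rule: list_all2_induct) auto
    then have c: "heval R cs x \<in> carrier R" "heval R ds x \<in> carrier R" using assms(3) by auto
    have "(c \<ominus> d) \<oplus> x \<otimes> (heval R cs x \<ominus> heval R ds x) \<in> I"
      using Cons.hyps(1) Cons.IH I.I_l_closed[OF _ assms(3)] I.a_closed by blast
    moreover have "(c \<ominus> d) \<oplus> x \<otimes> (heval R cs x \<ominus> heval R ds x)
        = (c \<oplus> x \<otimes> heval R cs x) \<ominus> (d \<oplus> x \<otimes> heval R ds x)"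
    proof -
      have "c \<in> carrier R" "d \<in> carrier R" using Cons.hyps(1) by blast+
      then show ?thesis using c assms(3) by algebra
    qed
    ultimately show ?case by simp
  qed
qed

locale loc_ring_pair = S: loc_ring S + T: loc_ring T
  for S :: "('b, 'k) ring_scheme" and T :: "('c, 'n) ring_scheme"
begin

abbreviation P :: "('b \<times> 'c) ring" where "P \<equiv> RDirProd S T"

definition p1 :: "('b \<times> 'c) set" where "p1 = nonunits S \<times> carrier T"
definition p2 :: "('b \<times> 'c) set" where "p2 = carrier S \<times> nonunits T"

lemma mem_p [simp]:
  "x \<in> p1 \<longleftrightarrow> fst x \<in> nonunits S \<and> snd x \<in> carrier T"
  "x \<in> p2 \<longleftrightarrow> fst x \<in> carrier S \<and> snd x \<in> nonunits T"
  by (auto simp: p1_def p2_def mem_Times_iff)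

sublocale P: cring P
  by (rule RDirProd_cring[OF S.is_cring T.is_cring])

lemma carrier_P [simp]: "carrier P = carrier S \<times> carrier T"
  by (rule RDirProd_carrier)

lemma minus_P [simp]: "x \<in> carrier S \<times> carrier T \<Longrightarrow> \<ominus>\<^bsub>P\<^esub> x = (\<ominus>\<^bsub>S\<^esub> fst x, \<ominus>\<^bsub>T\<^esub> snd x)"
  using ring_hom_minus[OF P.is_cring S.is_cring fst_hom, of x] ring_hom_minus[OF P.is_cring T.is_cring snd_hom, of x]
  by (simp add: prod_eq_iff)

lemma diff_P [simp]:
  "x \<in> carrier S \<times> carrier T \<Longrightarrow> y \<in> carrier S \<times> carrier T \<Longrightarrow> x \<ominus>\<^bsub>P\<^esub> y = (fst x \<ominus>\<^bsub>S\<^esub> fst y, snd x \<ominus>\<^bsub>T\<^esub> snd y)"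
  by (simp add: a_minus_def)

lemma pow_P: "x \<in> carrier P \<Longrightarrow> x [^]\<^bsub>P\<^esub> (n::nat) = (fst x [^]\<^bsub>S\<^esub> n, snd x [^]\<^bsub>T\<^esub> n)"
  using ring_hom_nat_pow[OF P.is_cring S.is_cring fst_hom] ring_hom_nat_pow[OF P.is_cring T.is_cring snd_hom]
  by (simp add: prod_eq_iff)

lemma Units_P: "x \<in> Units P \<longleftrightarrow> fst x \<in> Units S \<and> snd x \<in> Units T"
proof
  assume "x \<in> Units P"
  then show "fst x \<in> Units S \<and> snd x \<in> Units T"
    using ring_hom_unit[OF P.is_cring S.is_cring fst_hom] ring_hom_unit[OF P.is_cring T.is_cring snd_hom] by blast
next
  assume "fst x \<in> Units S \<and> snd x \<in> Units T"
  then obtain y z where "y \<in> carrier S" "fst x \<otimes>\<^bsub>S\<^esub> y = \<one>\<^bsub>S\<^esub>" "z \<in> carrier T" "snd x \<otimes>\<^bsub>T\<^esub> z = \<one>\<^bsub>T\<^esub>"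
    and c: "x \<in> carrier P"
    unfolding S.unit_iff T.unit_iff by (auto simp: mem_Times_iff)
  then have "(y, z) \<in> carrier P" "x \<otimes>\<^bsub>P\<^esub> (y, z) = \<one>\<^bsub>P\<^esub>" by auto
  then show "x \<in> Units P" unfolding P.unit_iff using c by blast
qed

lemma heval_P:
  assumes "set cs \<subseteq> carrier P" "z \<in> carrier P"
  shows "heval P cs z = (heval S (map fst cs) (fst z), heval T (map snd cs) (snd z))"
  using heval_hom[OF P.is_cring S.is_cring fst_hom assms] heval_hom[OF P.is_cring T.is_cring snd_hom assms]
  by (simp add: prod_eq_iff)

lemma primeideal_P: "primeideal p1 P" "primeideal p2 P"
proof -
  interpret f: ring_hom_ring P S fst
    by (rule ring_hom_ringI2[OF P.ring_axioms S.ring_axioms fst_hom])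
  interpret s: ring_hom_ring P T snd
    by (rule ring_hom_ringI2[OF P.ring_axioms T.ring_axioms snd_hom])
  have "primeideal {r \<in> carrier P. fst r \<in> nonunits S} P"
    by (rule f.primeideal_vimage[OF P.is_cring S.maximalideal_prime[OF S.N.maximalideal_axioms]])
  moreover have "{r \<in> carrier P. fst r \<in> nonunits S} = p1" by auto
  ultimately show "primeideal p1 P" by simp
  have "primeideal {r \<in> carrier P. snd r \<in> nonunits T} P"
    by (rule s.primeideal_vimage[OF P.is_cring T.maximalideal_prime[OF T.N.maximalideal_axioms]])
  moreover have "{r \<in> carrier P. snd r \<in> nonunits T} = p2" by auto
  ultimately show "primeideal p2 P" by simp
qed

lemma notin_p_Units: "x \<in> carrier P \<Longrightarrow> x \<notin> p1 \<Longrightarrow> x \<notin> p2 \<Longrightarrow> x \<in> Units P"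
  unfolding Units_P carrier_P mem_Times_iff mem_p using S.nonunitI T.nonunitI by blast

text \<open>Terms are evaluated inside \<open>G\<close>, and an equation asks whether a difference
  in \<open>G\<close> is zero; by assumption its two components vanish together.\<close>

lemma sat_graph:
  assumes G: "subring G P" and z: "\<And>x. x \<in> G \<Longrightarrow> fst x = \<zero>\<^bsub>S\<^esub> \<longleftrightarrow> snd x = \<zero>\<^bsub>T\<^esub>"
    and \<epsilon>: "range \<epsilon> \<subseteq> G" and qf: "quantifier_free \<psi>"
  shows "sat S (fst \<circ> \<epsilon>) \<psi> \<longleftrightarrow> sat T (snd \<circ> \<epsilon>) \<psi>"
  using qf
proof (induction \<psi>)
  case (FEq s t)
  have \<epsilon>P: "range \<epsilon> \<subseteq> carrier P" using \<epsilon> subringE(1)[OF G] by blast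
  have tG: "teval P \<epsilon> t \<in> G" for t
  proof (induction t)
    case (TVar n)
    then show ?case using \<epsilon> by auto
  qed (simp_all only: teval.simps subringE(2,3,5-7)[OF G])
  have tc: "teval P \<epsilon> t \<in> carrier P" for t using tG subringE(1)[OF G] by blast
  let ?d = "teval P \<epsilon> s \<ominus>\<^bsub>P\<^esub> teval P \<epsilon> t"
  have "?d \<in> G" unfolding a_minus_def using tG subringE(5,7)[OF G] by blast
  then have "fst ?d = \<zero>\<^bsub>S\<^esub> \<longleftrightarrow> snd ?d = \<zero>\<^bsub>T\<^esub>" by (rule z)
  moreover have "fst ?d = fst (teval P \<epsilon> s) \<ominus>\<^bsub>S\<^esub> fst (teval P \<epsilon> t)" "snd ?d = snd (teval P \<epsilon> s) \<ominus>\<^bsub>T\<^esub> snd (teval P \<epsilon> t)"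
    using tc[of s] tc[of t] by auto
  moreover have "fst (teval P \<epsilon> u) \<in> carrier S" "snd (teval P \<epsilon> u) \<in> carrier T" for u
    using tc[of u] by auto
  ultimately have "fst (teval P \<epsilon> s) = fst (teval P \<epsilon> t) \<longleftrightarrow> snd (teval P \<epsilon> s) = snd (teval P \<epsilon> t)"
    by (metis S.r_right_minus_eq T.r_right_minus_eq)
  then show ?case
    using teval_hom[OF P.is_cring S.is_cring fst_hom \<epsilon>P] teval_hom[OF P.is_cring T.is_cring snd_hom \<epsilon>P] by (simp only: sat.simps)
qed auto

text \<open>An algebraic equation for \<open>\<iota> z\<close> over \<open>G\<close> is determined modulo nonunits by the list of first components
  of its coefficients, and it has finitely many roots; so \<open>\<iota>\<close> has more values than there are algebraic
  residues.\<close>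

lemma exists_transcendental:
  fixes \<iota> :: "('b list \<times> nat) set \<Rightarrow> 'c"
  assumes \<iota>: "range \<iota> \<subseteq> carrier T" "\<And>z z'. z \<noteq> z' \<Longrightarrow> \<iota> z \<ominus>\<^bsub>T\<^esub> \<iota> z' \<in> Units T"
    and G: "subring G P" "\<And>x. x \<in> G \<Longrightarrow> x \<in> p1 \<Longrightarrow> x \<in> p2"
  shows "\<exists>y\<in>carrier T. \<forall>cs. set cs \<subseteq> G \<and> heval T (map snd cs) y \<in> nonunits T \<longrightarrow> set cs \<subseteq> p2"
proof (rule ccontr)
  assume no: "\<not> ?thesis"
  have GP: "G \<subseteq> carrier S \<times> carrier T" using subringE(1)[OF G(1)] by simp
  have \<iota>c: "\<iota> z \<in> carrier T" for z using \<iota>(1) by blast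
  have "\<forall>z. \<exists>cs. set cs \<subseteq> G \<and> heval T (map snd cs) (\<iota> z) \<in> nonunits T \<and> \<not> set cs \<subseteq> p2"
    using no \<iota>c by blast
  then obtain F where F: "\<And>z. set (F z) \<subseteq> G" "\<And>z. heval T (map snd (F z)) (\<iota> z) \<in> nonunits T"
    "\<And>z. \<not> set (F z) \<subseteq> p2" by metis
  let ?key = "\<lambda>z. map fst (F z)"
  have fin: "finite {z. ?key z = \<kappa>}" for \<kappa>
  proof (cases "{z. ?key z = \<kappa>} = {}")
    case True
    then show ?thesis by simp
  next
    case False
    then obtain z0 where z0: "?key z0 = \<kappa>" by blast
    have cs: "set (map snd (F z0)) \<subseteq> carrier T" using F(1)[of z0] GP by auto
    have nn: "\<not> set (map snd (F z0)) \<subseteq> nonunits T"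
    proof -
      obtain c where c: "c \<in> set (F z0)" "c \<notin> p2" using F(3)[of z0] by blast
      have "c \<in> carrier S \<times> carrier T" using c(1) F(1)[of z0] GP by blast
      then have "snd c \<notin> nonunits T" using c(2) by (simp add: mem_Times_iff)
      then show ?thesis using c(1) by auto
    qed
    have "finite (\<iota> ` {z. ?key z = \<kappa>})"
    proof (rule T.finite_roots[OF cs nn])
      fix y assume "y \<in> \<iota> ` {z. ?key z = \<kappa>}"
      then obtain z where z: "?key z = \<kappa>" "y = \<iota> z" by blast
      have "length (F z) = length (F z0)" using z(1) z0 by (metis length_map)
      then have "list_all2 (\<lambda>c d. c \<in> carrier T \<and> d \<in> carrier T \<and> c \<ominus>\<^bsub>T\<^esub> d \<in> nonunits T)
          (map snd (F z0)) (map snd (F z))"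
        unfolding list_all2_conv_all_nth
      proof (intro conjI allI impI)
        fix i assume i: "i < length (map snd (F z0))" "length (F z) = length (F z0)"
        let ?a = "F z0 ! i" and ?b = "F z ! i"
        have ab: "?a \<in> G" "?b \<in> G" using F(1)[of z0] F(1)[of z] i by auto
        have abP: "?a \<in> carrier S \<times> carrier T" "?b \<in> carrier S \<times> carrier T" using ab GP by auto
        have "fst ?a = fst ?b" using z(1) z0 i by (metis length_map nth_map)
        \<comment> \<open>The difference lies in \<open>p1\<close> because its first component is
          zero, and elements of \<open>G\<close> in \<open>p1\<close> are also in
          \<open>p2\<close>.\<close>
        then have d: "?a \<ominus>\<^bsub>P\<^esub> ?b = (\<zero>\<^bsub>S\<^esub>, snd ?a \<ominus>\<^bsub>T\<^esub> snd ?b)"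
          using abP by (auto simp: a_minus_def S.r_neg)
        have "?a \<ominus>\<^bsub>P\<^esub> ?b \<in> G" unfolding a_minus_def using ab subringE(5,7)[OF G(1)] by blast
        moreover have "?a \<ominus>\<^bsub>P\<^esub> ?b \<in> p1" unfolding d using abP by auto
        ultimately have "?a \<ominus>\<^bsub>P\<^esub> ?b \<in> p2" by (rule G(2))
        then have n: "snd ?a \<ominus>\<^bsub>T\<^esub> snd ?b \<in> nonunits T" unfolding d by simp
        have m: "map snd (F z0) ! i = snd ?a" "map snd (F z) ! i = snd ?b" using i by simp_all
        show "map snd (F z0) ! i \<in> carrier T" "map snd (F z) ! i \<in> carrier T"
          "map snd (F z0) ! i \<ominus>\<^bsub>T\<^esub> map snd (F z) ! i \<in> nonunits T"
          unfolding m using n abP by auto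
      qed auto
      from T.heval_cong_coeffs[OF T.N.ideal_axioms this \<iota>c[of z]]
      have d: "heval T (map snd (F z0)) (\<iota> z) \<ominus>\<^bsub>T\<^esub> heval T (map snd (F z)) (\<iota> z) \<in> nonunits T" .
      have c: "heval T (map snd (F z0)) (\<iota> z) \<in> carrier T" "heval T (map snd (F z)) (\<iota> z) \<in> carrier T"
        using T.heval_closed[OF cs \<iota>c[of z]] F(2)[of z] by auto
      have "(heval T (map snd (F z0)) (\<iota> z) \<ominus>\<^bsub>T\<^esub> heval T (map snd (F z)) (\<iota> z)) \<oplus>\<^bsub>T\<^esub> heval T (map snd (F z)) (\<iota> z) \<in> nonunits T"
        using d F(2)[of z] by (rule T.N.a_closed)
      moreover have "(a \<ominus>\<^bsub>T\<^esub> b) \<oplus>\<^bsub>T\<^esub> b = a" if "a \<in> carrier T" "b \<in> carrier T" for a b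
        using that by algebra
      ultimately show "heval T (map snd (F z0)) y \<in> nonunits T" unfolding z(2) using c by simp
    next
      fix x y assume "x \<in> \<iota> ` {z. ?key z = \<kappa>}" "y \<in> \<iota> ` {z. ?key z = \<kappa>}" "x \<noteq> y"
      then obtain z z' where "x = \<iota> z" "y = \<iota> z'" "z \<noteq> z'" by blast
      then show "x \<ominus>\<^bsub>T\<^esub> y \<in> Units T" using \<iota>(2)[of z z'] by simp
    qed (use \<iota>c in blast)
    moreover have "inj \<iota>"
    proof (rule injI, rule ccontr)
      fix z z' assume e: "\<iota> z = \<iota> z'" and "z \<noteq> z'"
      then have "\<iota> z \<ominus>\<^bsub>T\<^esub> \<iota> z' \<in> Units T" using \<iota>(2) by blast
      moreover have "\<iota> z \<ominus>\<^bsub>T\<^esub> \<iota> z' = \<zero>\<^bsub>T\<^esub>" unfolding e using \<iota>c by simp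
      ultimately show False using T.unit_not_nonunit[of "\<zero>\<^bsub>T\<^esub>"] by simp
    qed
    ultimately show ?thesis using finite_imageD inj_on_subset subset_UNIV by metis
  qed
  have "\<forall>\<kappa>. \<exists>f :: _ \<Rightarrow> nat. inj_on f {z. ?key z = \<kappa>}"
    using finite_imp_inj_to_nat_seg[OF fin] by blast
  then obtain f :: "_ \<Rightarrow> _ \<Rightarrow> nat" where f: "\<And>\<kappa>. inj_on (f \<kappa>) {z. ?key z = \<kappa>}" by metis
  \<comment> \<open>The fibres of the key are finite, so numbering their elements would embed the
    power set of \<open>'b list \<times> nat\<close> into \<open>'b list \<times> nat\<close>. This
    is the reason for the index type of \<open>\<iota>\<close>.\<close>
  have "inj (\<lambda>z. (?key z, f (?key z) z))"
  proof (rule injI)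
    fix z z' assume "(?key z, f (?key z) z) = (?key z', f (?key z') z')"
    then have "?key z' = ?key z" "f (?key z) z = f (?key z) z'" by auto
    then show "z = z'" using f[of "?key z"] unfolding inj_on_def by blast
  qed
  then have "surj (inv_into UNIV (\<lambda>z. (?key z, f (?key z) z)))" by (rule inj_imp_surj_inv)
  then show False using Cantors_theorem[of "UNIV :: ('b list \<times> nat) set"] by auto
qed

end

section \<open>Graphs of approximate isomorphisms over a Gorenstein ring\<close>

lemma (in cring) lspan_zero:
  assumes "\<zero> \<in> G" "range b \<subseteq> carrier R"
  shows "\<zero> \<in> lspan R G b j"
proof (induction j)
  case (Suc j)
  have "b j \<in> carrier R" using assms(2) by blast
  then have "\<zero> = \<zero> \<oplus> \<zero> \<otimes> b j" by simp
  then show ?case unfolding lspan.simps using Suc assms(1) by blast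
qed simp

text \<open>The form in which strictness enters the graph argument: a unit coefficient at the top
  index cannot be cancelled by the earlier generators.\<close>

lemma (in cring) strict_seq_unit_sum:
  assumes "strict_seq R b n" "j < n" "x \<in> lspan R (carrier R) b j" "u \<in> Units R"
  shows "x \<oplus> u \<otimes> b j \<noteq> \<zero>"
proof
  assume z: "x \<oplus> u \<otimes> b j = \<zero>"
  have b: "range b \<subseteq> carrier R" "b j \<notin> lspan R (carrier R) b j" using assms(1,2) unfolding strict_seq_def by auto
  have bj: "b j \<in> carrier R" using b(1) by blast
  interpret I: ideal "lspan R (carrier R) b j" R by (rule lspan_ideal[OF b(1)])
  have c: "x \<in> carrier R" "u \<in> carrier R" "inv u \<in> carrier R" using assms(3,4) by auto
  have "inv u \<otimes> (\<ominus> x) \<in> lspan R (carrier R) b j" using assms(3) c(3) I.I_l_closed by simp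
  moreover have "\<ominus> x = u \<otimes> b j" using z c bj by (metis a_comm m_closed minus_equality)
  moreover have "inv u \<otimes> (u \<otimes> b j) = b j"
    using c bj assms(4) by (metis Units_l_inv l_one m_assoc)
  ultimately show False using b(2) by simp
qed

lemma (in cring) comp_seq_all:
  assumes "comp_seq R b n" "x \<in> carrier R"
  shows "x \<in> lspan R (carrier R) b n"
proof -
  have b: "range b \<subseteq> carrier R" "\<one> \<in> lspan R (carrier R) b n" using assms(1) unfolding comp_seq_def by blast+
  show ?thesis using ideal.I_r_closed[OF lspan_ideal[OF b(1)] b(2) assms(2)] assms(2) by simp
qed

lemma ring_hom_nat_one:
  assumes "ring R" "ring S" "h \<in> ring_hom R S"
  shows "h ([(n::nat)] \<cdot>\<^bsub>R\<^esub> \<one>\<^bsub>R\<^esub>) = [n] \<cdot>\<^bsub>S\<^esub> \<one>\<^bsub>S\<^esub>"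
proof -
  interpret R: ring R by fact
  interpret S: ring S by fact
  show ?thesis
  proof (induction n)
    case 0
    show ?case using ring_hom_zero[OF assms(3,1,2)] by simp
  next
    case (Suc n)
    then show ?case
      using ring_hom_add[OF assms(3), of "[n] \<cdot>\<^bsub>R\<^esub> \<one>\<^bsub>R\<^esub>" "\<one>\<^bsub>R\<^esub>"] ring_hom_one[OF assms(3)]
      by (simp add: R.add.nat_pow_Suc S.add.nat_pow_Suc)
  qed
qed

text \<open>In the application \<open>S\<close> is an extension in which a formula holds and
  \<open>T\<close> is an elementary extension of \<open>R\<close>. One sequence \<open>b\<close>
  serves as composition series in all three rings, which makes expansions in \<open>S\<close> and
  \<open>T\<close> comparable.\<close>

locale extension_pair = loc_ring_pair S T + R: loc_ring R
  for S :: "('b, 'k) ring_scheme" and T :: "('c, 'n) ring_scheme" and R :: "('a, 'm) ring_scheme" +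
  fixes h :: "'a \<Rightarrow> 'b" and k :: "'a \<Rightarrow> 'c" and b :: "nat \<Rightarrow> 'a" and l :: nat
    and \<iota> :: "('b list \<times> nat) set \<Rightarrow> 'c"
  assumes model_R: "is_model (Art l) R" and model_S: "is_model (Art l) S" and model_T: "is_model (Art l) T"
    and h: "h \<in> ring_hom R S" and k: "k \<in> ring_hom R T"
    and comp_R: "comp_seq R b l"
    and strict_S: "strict_seq S (h \<circ> b) l" and comp_S: "comp_seq S (h \<circ> b) l"
    and strict_T: "strict_seq T (k \<circ> b) l" and comp_T: "comp_seq T (k \<circ> b) l"
    and root_R: "root_closed R" and root_T: "root_closed T"
    and \<iota>: "range \<iota> \<subseteq> carrier T" "\<And>z z'. z \<noteq> z' \<Longrightarrow> \<iota> z \<ominus>\<^bsub>T\<^esub> \<iota> z' \<in> Units T"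
begin

definition d :: "'a \<Rightarrow> 'b \<times> 'c" where "d r = (h r, k r)"

lemma d_hom: "d \<in> ring_hom R P"
  using pair_hom[OF h k] unfolding d_def by simp

lemma fst_d [simp]: "fst (d r) = h r" and snd_d [simp]: "snd (d r) = k r"
  by (simp_all add: d_def)

lemma d_closed: "r \<in> carrier R \<Longrightarrow> d r \<in> carrier P"
  using ring_hom_closed[OF d_hom, of r] by simp

lemma b_closed: "b j \<in> carrier R" "range b \<subseteq> carrier R" "range (d \<circ> b) \<subseteq> carrier P"
proof -
  show "range b \<subseteq> carrier R" using comp_R unfolding comp_seq_def by blast
  then show bj: "b j \<in> carrier R" for j by blast
  then show "range (d \<circ> b) \<subseteq> carrier P" using d_closed by (metis comp_apply image_subsetI)
qed

lemma nonunit_d_iff: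
  assumes "r \<in> carrier R"
  shows "d r \<in> p1 \<longleftrightarrow> r \<in> nonunits R" "d r \<in> p2 \<longleftrightarrow> r \<in> nonunits R"
proof -
  have "h r \<in> nonunits S \<longleftrightarrow> r \<in> nonunits R" "k r \<in> nonunits T \<longleftrightarrow> r \<in> nonunits R"
    using model_hom_nonunit[OF model_R model_S h] model_hom_nonunit[OF model_R model_T k]
      ring_hom_unit[OF R.is_cring S.is_cring h] ring_hom_unit[OF R.is_cring T.is_cring k]
      R.nonunitI[OF assms] S.unit_not_nonunit T.unit_not_nonunit by blast+
  then show "d r \<in> p1 \<longleftrightarrow> r \<in> nonunits R" "d r \<in> p2 \<longleftrightarrow> r \<in> nonunits R"
    using ring_hom_closed[OF h assms] ring_hom_closed[OF k assms] by (simp_all add: d_def)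
qed

text \<open>In \<open>R\<close> a nonunit moves \<open>b j\<close> into the span of its predecessors
  with coefficients from \<open>R\<close>. On the diagonal these coefficients belong to
  \<open>G\<close>, so the expansion never leaves \<open>G\<close>.\<close>

lemma lspan_step:
  assumes G: "subring G P" "d ` carrier R \<subseteq> G" and j: "j < l" and x: "x \<in> mspan P (d ` nonunits R) G"
  shows "x \<otimes>\<^bsub>P\<^esub> (d \<circ> b) j \<in> lspan P G (d \<circ> b) j"
proof -
  have GP: "G \<subseteq> carrier P" by (rule subringE(1)[OF G(1)])
  have M: "d ` nonunits R \<subseteq> G" using G(2) by auto
  have bP: "(d \<circ> b) j \<in> carrier P" using b_closed(3) by blast
  show ?thesis
    using x
  proof (induction rule: mspan.induct)
    case zero
    then show ?case
      using P.lspan_zero[OF subringE(2)[OF G(1)] b_closed(3)] P.l_null[OF bP] by (simp only:)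
  next
    case (add x \<mu> g)
    obtain m where m: "m \<in> nonunits R" "\<mu> = d m" using add.hyps(2) by blast
    have mc: "m \<in> carrier R" using m(1) by simp
    have c: "x \<in> carrier P" "\<mu> \<in> carrier P" "g \<in> carrier P"
      using P.mspan_subset[OF G(1) M] add.hyps M GP by blast+
    have "m \<otimes>\<^bsub>R\<^esub> b j \<in> lspan R (carrier R) b j" using comp_R j m(1) unfolding comp_seq_def by blast
    then have "d (m \<otimes>\<^bsub>R\<^esub> b j) \<in> lspan P G (d \<circ> b) j"
      using hom_lspan[OF R.is_cring P.is_cring d_hom order.refl b_closed(2)] lspan_mono[OF G(2)] by blast
    moreover have "d (m \<otimes>\<^bsub>R\<^esub> b j) = \<mu> \<otimes>\<^bsub>P\<^esub> (d \<circ> b) j"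
      using ring_hom_mult[OF d_hom mc b_closed(1)] m(2) by simp
    ultimately have "g \<otimes>\<^bsub>P\<^esub> (\<mu> \<otimes>\<^bsub>P\<^esub> (d \<circ> b) j) \<in> lspan P G (d \<circ> b) j"
      using P.lspan_mult[OF G(1) b_closed(3) _ add.hyps(3)] by (simp only:)
    from P.lspan_add[OF G(1) b_closed(3) add.IH this]
    have "x \<otimes>\<^bsub>P\<^esub> (d \<circ> b) j \<oplus>\<^bsub>P\<^esub> g \<otimes>\<^bsub>P\<^esub> (\<mu> \<otimes>\<^bsub>P\<^esub> (d \<circ> b) j) \<in> lspan P G (d \<circ> b) j" .
    moreover have "(Z \<oplus>\<^bsub>P\<^esub> N \<otimes>\<^bsub>P\<^esub> A) \<otimes>\<^bsub>P\<^esub> B = Z \<otimes>\<^bsub>P\<^esub> B \<oplus>\<^bsub>P\<^esub> A \<otimes>\<^bsub>P\<^esub> (N \<otimes>\<^bsub>P\<^esub> B)"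
      if "Z \<in> carrier P" "N \<in> carrier P" "A \<in> carrier P" "B \<in> carrier P" for Z N A B
      using that by (simp only: P.l_distr P.m_ac P.m_closed)
    ultimately show ?case using c bP by (simp only:)
  qed
qed

text \<open>Passing from \<open>\<Gamma>\<^sub>j\<^sub>+\<^sub>1\<close> to \<open>\<Gamma>\<^sub>j\<close> lowers the filtration by one step: the coefficient of \<open>b\<^sub>j\<close> cannot be a
  unit by strictness, so it is a combination of nonunits of \<open>R\<close>, which multiply \<open>b\<^sub>j\<close> into the span
  of the earlier \<open>b\<^sub>i\<close>.\<close>

lemma lspan_graph:
  assumes sub: "\<And>i. subring (\<Gamma> i) P" and dec: "\<And>i. \<Gamma> (Suc i) \<subseteq> \<Gamma> i" and diag: "\<And>i. d ` carrier R \<subseteq> \<Gamma> i"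
    and split: "\<And>i x. x \<in> \<Gamma> (Suc i) \<Longrightarrow> x \<in> p1 \<union> p2 \<Longrightarrow> x \<in> mspan P (d ` nonunits R) (\<Gamma> i)"
    and "j \<le> l" "x \<in> lspan P (\<Gamma> j) (d \<circ> b) j" "fst x = \<zero>\<^bsub>S\<^esub> \<or> snd x = \<zero>\<^bsub>T\<^esub>"
  shows "x = \<zero>\<^bsub>P\<^esub>"
  using assms(5-7)
proof (induction j arbitrary: x)
  case 0
  then show ?case by (simp only: lspan.simps singleton_iff)
next
  case (Suc j)
  have j: "j < l" using Suc.prems(1) by simp
  have GP: "\<Gamma> i \<subseteq> carrier P" for i by (rule subringE(1)[OF sub])
  obtain y g where y: "y \<in> lspan P (\<Gamma> (Suc j)) (d \<circ> b) j" and g: "g \<in> \<Gamma> (Suc j)"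
    and x: "x = y \<oplus>\<^bsub>P\<^esub> g \<otimes>\<^bsub>P\<^esub> (d \<circ> b) j" using Suc.prems(2) unfolding lspan.simps by blast
  have yP: "y \<in> lspan P (carrier P) (d \<circ> b) j" using y lspan_mono[OF GP] by blast
  have gP: "g \<in> carrier P" using g GP by blast
  have yS: "fst y \<in> lspan S (carrier S) (h \<circ> b) j"
  proof -
    have "fst y \<in> lspan S (fst ` carrier P) (fst \<circ> (d \<circ> b)) j"
      using hom_lspan[OF P.is_cring S.is_cring fst_hom order.refl b_closed(3)] yP by blast
    moreover have "fst \<circ> (d \<circ> b) = h \<circ> b" by auto
    moreover have "fst ` carrier P \<subseteq> carrier S" by auto
    ultimately show ?thesis using lspan_mono by (metis subsetD)
  qed
  have yT: "snd y \<in> lspan T (carrier T) (k \<circ> b) j"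
  proof -
    have "snd y \<in> lspan T (snd ` carrier P) (snd \<circ> (d \<circ> b)) j"
      using hom_lspan[OF P.is_cring T.is_cring snd_hom order.refl b_closed(3)] yP by blast
    moreover have "snd \<circ> (d \<circ> b) = k \<circ> b" by auto
    moreover have "snd ` carrier P \<subseteq> carrier T" by auto
    ultimately show ?thesis using lspan_mono by (metis subsetD)
  qed
  have "g \<in> p1 \<union> p2"
  proof (rule ccontr)
    assume "g \<notin> p1 \<union> p2"
    then have "g \<in> Units P" using notin_p_Units[OF gP] by blast
    then have u: "fst g \<in> Units S" "snd g \<in> Units T" using Units_P by blast+
    have "fst x = fst y \<oplus>\<^bsub>S\<^esub> fst g \<otimes>\<^bsub>S\<^esub> (h \<circ> b) j" "snd x = snd y \<oplus>\<^bsub>T\<^esub> snd g \<otimes>\<^bsub>T\<^esub> (k \<circ> b) j"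
      unfolding x by simp_all
    then show False
      using S.strict_seq_unit_sum[OF strict_S j yS u(1)] T.strict_seq_unit_sum[OF strict_T j yT u(2)]
        Suc.prems(3) by simp
  qed
  then have "g \<otimes>\<^bsub>P\<^esub> (d \<circ> b) j \<in> lspan P (\<Gamma> j) (d \<circ> b) j"
    using lspan_step[OF sub diag j] split[OF g] by blast
  moreover have "y \<in> lspan P (\<Gamma> j) (d \<circ> b) j" using y lspan_mono[OF dec] by blast
  ultimately have "x \<in> lspan P (\<Gamma> j) (d \<circ> b) j" unfolding x using P.lspan_add[OF sub b_closed(3)] by blast
  then show ?case using Suc.IH[OF _ _ Suc.prems(3)] j less_imp_le by blast
qed

text \<open>\<open>\<one>\<close> lies in the span of \<open>b 0\<close>, ...,
  \<open>b (l - 1)\<close>, so multiplying by \<open>x\<close> expands \<open>x\<close> with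
  coefficients in \<open>\<Gamma> l\<close>. After \<open>l\<close> descents the span is zero. Thus
  \<open>\<Gamma> l\<close> is the graph of an isomorphism between subrings of \<open>S\<close> and
  \<open>T\<close>.\<close>

lemma graph_zero:
  assumes sub: "\<And>i. subring (\<Gamma> i) P" and dec: "\<And>i. \<Gamma> (Suc i) \<subseteq> \<Gamma> i" and diag: "\<And>i. d ` carrier R \<subseteq> \<Gamma> i"
    and split: "\<And>i x. x \<in> \<Gamma> (Suc i) \<Longrightarrow> x \<in> p1 \<union> p2 \<Longrightarrow> x \<in> mspan P (d ` nonunits R) (\<Gamma> i)"
    and x: "x \<in> \<Gamma> l"
  shows "fst x = \<zero>\<^bsub>S\<^esub> \<longleftrightarrow> snd x = \<zero>\<^bsub>T\<^esub>"
proof -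
  have xP: "x \<in> carrier P" using x subringE(1)[OF sub] by blast
  have "d \<one>\<^bsub>R\<^esub> \<in> lspan P (\<Gamma> l) (d \<circ> b) l"
    using hom_lspan[OF R.is_cring P.is_cring d_hom order.refl b_closed(2), of l] lspan_mono[OF diag]
      comp_R unfolding comp_seq_def by blast
  then have "x \<otimes>\<^bsub>P\<^esub> d \<one>\<^bsub>R\<^esub> \<in> lspan P (\<Gamma> l) (d \<circ> b) l"
    using P.lspan_mult[OF sub b_closed(3) _ x] by blast
  then have xl: "x \<in> lspan P (\<Gamma> l) (d \<circ> b) l"
    unfolding ring_hom_one[OF d_hom] P.r_one[OF xP] .
  have "x = \<zero>\<^bsub>P\<^esub>" if "fst x = \<zero>\<^bsub>S\<^esub> \<or> snd x = \<zero>\<^bsub>T\<^esub>"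
    using lspan_graph[of \<Gamma> l x, OF sub dec diag split order.refl xl that] by blast
  then show ?thesis by auto
qed

text \<open>Parameters travel along the diagonal and witnesses along the graph
  \<open>\<Gamma> l\<close>.\<close>

lemma graph_transfer:
  assumes sub: "\<And>i. subring (\<Gamma> i) P" and dec: "\<And>i. \<Gamma> (Suc i) \<subseteq> \<Gamma> i" and diag: "\<And>i. d ` carrier R \<subseteq> \<Gamma> i"
    and split: "\<And>i x. x \<in> \<Gamma> (Suc i) \<Longrightarrow> x \<in> p1 \<union> p2 \<Longrightarrow> x \<in> mspan P (d ` nonunits R) (\<Gamma> i)"
    and e: "range e \<subseteq> carrier R" and qf: "quantifier_free \<psi>"
    and e': "\<And>n. n \<notin> set ns \<Longrightarrow> e' n = h (e n)" "\<And>n. n \<in> set ns \<Longrightarrow> e' n \<in> fst ` \<Gamma> l" "sat S e' \<psi>"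
  shows "sat T (k \<circ> e) (foldr FEx ns \<psi>)"
proof -
  have "\<exists>x\<in>\<Gamma> l. e' n = fst x \<and> (n \<notin> set ns \<longrightarrow> snd x = k (e n))" for n
  proof (cases "n \<in> set ns")
    case True
    then show ?thesis using e'(2) by auto
  next
    case False
    have "d (e n) \<in> \<Gamma> l" using diag e by blast
    then show ?thesis using e'(1)[OF False] by (intro bexI[of _ "d (e n)"]) auto
  qed
  then obtain \<epsilon> where \<epsilon>: "\<And>n. \<epsilon> n \<in> \<Gamma> l" "\<And>n. e' n = fst (\<epsilon> n)" "\<And>n. n \<notin> set ns \<Longrightarrow> snd (\<epsilon> n) = k (e n)"
    by metis
  have z: "fst x = \<zero>\<^bsub>S\<^esub> \<longleftrightarrow> snd x = \<zero>\<^bsub>T\<^esub>" if "x \<in> \<Gamma> l" for x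
    using graph_zero[of \<Gamma> x, OF sub dec diag split that] by blast
  have "fst \<circ> \<epsilon> = e'" using \<epsilon>(2) by auto
  then have "sat T (snd \<circ> \<epsilon>) \<psi>"
    using sat_graph[OF sub z _ qf, of l \<epsilon>] \<epsilon>(1) e'(3) by auto
  moreover have "\<forall>n\<in>set ns. (snd \<circ> \<epsilon>) n \<in> carrier T"
  proof
    fix n
    have "\<epsilon> n \<in> carrier P" using \<epsilon>(1) subringE(1)[OF sub] by blast
    then show "(snd \<circ> \<epsilon>) n \<in> carrier T" by (simp add: mem_Times_iff)
  qed
  ultimately show ?thesis unfolding sat_foldr_FEx using \<epsilon>(3) by (intro exI[of _ "snd \<circ> \<epsilon>"]) auto
qed

lemma nilpotent_P: "x \<in> p1 \<inter> p2 \<Longrightarrow> x [^]\<^bsub>P\<^esub> l = \<zero>\<^bsub>P\<^esub>"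
proof -
  assume x: "x \<in> p1 \<inter> p2"
  then have n: "fst x \<in> nonunits S" "snd x \<in> nonunits T" by auto
  then have "x \<in> carrier P" by (simp add: mem_Times_iff)
  moreover have "ring_length S \<le> enat l" "ring_length T \<le> enat l"
    using model_S model_T unfolding Art_model_iff by blast+
  ultimately show ?thesis
    using pow_P S.length_nilpotent[OF _ S.local n(1)] T.length_nilpotent[OF _ T.local n(2)] by simp
qed

lemma good_exists:
  assumes pi: "partial_iso P p1 p2 D M" and gD: "partial_iso.good P p1 p2 D M D"
    and corr: "M = p1 \<inter> p2 \<or> (\<forall>n::nat. [Suc n] \<cdot>\<^bsub>P\<^esub> \<one>\<^bsub>P\<^esub> \<notin> p1)"
  shows "\<exists>G. partial_iso.good P p1 p2 D M G \<and> (\<forall>s\<in>carrier S. \<exists>g\<in>G. s \<ominus>\<^bsub>S\<^esub> fst g \<in> nonunits S)"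
proof -
  interpret I: partial_iso P p1 p2 D M by (rule pi)
  have "partial_iso_extension P p1 p2 D M l"
  proof
    show "I.good D" by (rule gD)
  next
    fix G fs s assume G: "I.good G" and fs: "set fs \<subseteq> G" "fs \<noteq> []" and s: "s \<in> carrier P"
    have GP: "G \<subseteq> carrier P" using G subringE(1) unfolding I.good_def by blast
    have st: "set (map snd fs) \<subseteq> carrier T" "map snd fs \<noteq> []" using fs GP by auto
    obtain y where y: "y \<in> carrier T" "heval T (map snd fs @ [\<one>\<^bsub>T\<^esub>]) y \<in> nonunits T"
      using root_T st unfolding root_closed_def by blast
    \<comment> \<open>Only the second component of \<open>s\<close> is exchanged, for a root of the
      projected polynomial, so nothing changes modulo \<open>p1\<close>.\<close>
    have zc: "(fst s, y) \<in> carrier P" using s y(1) by auto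
    have fc: "set (fs @ [\<one>\<^bsub>P\<^esub>]) \<subseteq> carrier P" using fs(1) GP P.one_closed by (simp del: RDirProd_simps carrier_P)
    have "(fst s, y) \<ominus>\<^bsub>P\<^esub> s \<in> p1" using s y(1) by (auto simp: a_minus_def S.r_neg)
    moreover have "heval P (fs @ [\<one>\<^bsub>P\<^esub>]) (fst s, y) \<in> p2"
      using P.heval_closed[OF fc zc] y(2) unfolding heval_P[OF fc zc] by auto
    ultimately show "\<exists>z\<in>carrier P. z \<ominus>\<^bsub>P\<^esub> s \<in> p1 \<and> heval P (fs @ [\<one>\<^bsub>P\<^esub>]) z \<in> p2" using zc by blast
  next
    fix G s assume G: "I.good G" and s: "s \<in> carrier P"
    have G': "subring G P" using G unfolding I.good_def by blast
    have GP: "G \<subseteq> carrier P" by (rule subringE(1)[OF G'])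
    obtain y where y: "y \<in> carrier T"
      "\<And>cs. set cs \<subseteq> G \<Longrightarrow> heval T (map snd cs) y \<in> nonunits T \<Longrightarrow> set cs \<subseteq> p2"
      using exists_transcendental[OF \<iota> G'] I.good_p_iff[OF G] by blast
    have zc: "(fst s, y) \<in> carrier P" using s y(1) by auto
    have "(fst s, y) \<ominus>\<^bsub>P\<^esub> s \<in> p1" using s y(1) by (auto simp: a_minus_def S.r_neg)
    moreover have "set cs \<subseteq> p2" if cs: "set cs \<subseteq> G" "heval P cs (fst s, y) \<in> p2" for cs
    proof -
      have "set cs \<subseteq> carrier P" using cs(1) GP by blast
      then show ?thesis using y(2)[OF cs(1)] cs(2) heval_P[OF _ zc] by auto
    qed
    ultimately show "\<exists>z\<in>carrier P. z \<ominus>\<^bsub>P\<^esub> s \<in> p1 \<and> (\<forall>cs. set cs \<subseteq> G \<and> heval P cs z \<in> p2 \<longrightarrow> set cs \<subseteq> p2)"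
      using zc by blast
  next
    show "M = p1 \<inter> p2 \<or> (\<forall>n::nat. [Suc n] \<cdot>\<^bsub>P\<^esub> \<one>\<^bsub>P\<^esub> \<notin> p1) \<and> (\<forall>a\<in>p1 \<inter> p2. a [^]\<^bsub>P\<^esub> l = \<zero>\<^bsub>P\<^esub>)"
      using corr nilpotent_P by blast
  qed
  from partial_iso_extension.good_onto[OF this]
  obtain G where G: "I.good G" "\<And>s. s \<in> carrier P \<Longrightarrow> \<exists>g\<in>G. s \<ominus>\<^bsub>P\<^esub> g \<in> p1" by blast
  have GP: "G \<subseteq> carrier P" using G(1) subringE(1) unfolding I.good_def by blast
  have "\<exists>g\<in>G. s \<ominus>\<^bsub>S\<^esub> fst g \<in> nonunits S" if s: "s \<in> carrier S" for s
  proof -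
    have sP: "(s, \<zero>\<^bsub>T\<^esub>) \<in> carrier P" using s by simp
    obtain g where g: "g \<in> G" "(s, \<zero>\<^bsub>T\<^esub>) \<ominus>\<^bsub>P\<^esub> g \<in> p1" using G(2)[OF sP] by blast
    have "g \<in> carrier P" using g(1) GP by blast
    then show ?thesis using g sP by auto
  qed
  then show ?thesis using G(1) by blast
qed

text \<open>Surjectivity on residues is lifted along the composition series: replacing the
  coefficient of \<open>b j\<close> by one from \<open>G\<close> leaves a nonunit error, which moves
  into the span of the earlier generators.\<close>

lemma lspan_onto:
  assumes G: "subring G P" "d ` carrier R \<subseteq> G"
    and onto: "\<And>s. s \<in> carrier S \<Longrightarrow> \<exists>g\<in>G. s \<ominus>\<^bsub>S\<^esub> fst g \<in> nonunits S"
    and "j \<le> l" "s \<in> lspan S (carrier S) (h \<circ> b) j"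
  shows "s \<in> fst ` G"
  using assms(4,5)
proof (induction j arbitrary: s)
  case 0
  then have "s = fst \<zero>\<^bsub>P\<^esub>" by simp
  then show ?case using subringE(2)[OF G(1)] by blast
next
  case (Suc j)
  have bS: "range (h \<circ> b) \<subseteq> carrier S" "(h \<circ> b) j \<in> carrier S" using comp_S unfolding comp_seq_def by auto
  obtain x c where x: "x \<in> lspan S (carrier S) (h \<circ> b) j" "c \<in> carrier S" "s = x \<oplus>\<^bsub>S\<^esub> c \<otimes>\<^bsub>S\<^esub> (h \<circ> b) j"
    using Suc.prems(2) unfolding lspan.simps by blast
  obtain g where g: "g \<in> G" "c \<ominus>\<^bsub>S\<^esub> fst g \<in> nonunits S" using onto[OF x(2)] by blast
  have gc: "g \<in> carrier P" "fst g \<in> carrier S" using g(1) subringE(1)[OF G(1)] by auto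
  interpret I: ideal "lspan S (carrier S) (h \<circ> b) j" S by (rule S.lspan_ideal[OF bS(1)])
  have "(c \<ominus>\<^bsub>S\<^esub> fst g) \<otimes>\<^bsub>S\<^esub> (h \<circ> b) j \<in> lspan S (carrier S) (h \<circ> b) j"
    using comp_S g(2) Suc.prems(1) unfolding comp_seq_def by auto
  then have "x \<oplus>\<^bsub>S\<^esub> (c \<ominus>\<^bsub>S\<^esub> fst g) \<otimes>\<^bsub>S\<^esub> (h \<circ> b) j \<in> fst ` G"
    using Suc.IH[OF _ I.a_closed[OF x(1)]] Suc.prems(1) Suc_leD by blast
  then obtain g' where g': "g' \<in> G" "x \<oplus>\<^bsub>S\<^esub> (c \<ominus>\<^bsub>S\<^esub> fst g) \<otimes>\<^bsub>S\<^esub> (h \<circ> b) j = fst g'" by auto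
  have "s = (x \<oplus>\<^bsub>S\<^esub> (c \<ominus>\<^bsub>S\<^esub> fst g) \<otimes>\<^bsub>S\<^esub> (h \<circ> b) j) \<oplus>\<^bsub>S\<^esub> fst g \<otimes>\<^bsub>S\<^esub> (h \<circ> b) j"
  proof -
    have "x \<oplus>\<^bsub>S\<^esub> c \<otimes>\<^bsub>S\<^esub> B = (x \<oplus>\<^bsub>S\<^esub> (c \<ominus>\<^bsub>S\<^esub> fst g) \<otimes>\<^bsub>S\<^esub> B) \<oplus>\<^bsub>S\<^esub> fst g \<otimes>\<^bsub>S\<^esub> B" if "B \<in> carrier S" for B
      using that I.Icarr[OF x(1)] x(2) gc(2) by algebra
    then show ?thesis unfolding x(3) using bS(2) by blast
  qed
  also have "\<dots> = fst (g' \<oplus>\<^bsub>P\<^esub> g \<otimes>\<^bsub>P\<^esub> d (b j))" unfolding g'(2) by simp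
  finally have "s = fst (g' \<oplus>\<^bsub>P\<^esub> g \<otimes>\<^bsub>P\<^esub> d (b j))" .
  moreover have "d (b j) \<in> G" using G(2) b_closed(1) by blast
  then have "g' \<oplus>\<^bsub>P\<^esub> g \<otimes>\<^bsub>P\<^esub> d (b j) \<in> G" using g'(1) g(1) subringE(6,7)[OF G(1)] by blast
  ultimately show ?case by blast
qed

lemma diag_subring: "subring (d ` carrier R) P"
proof (rule P.subringI)
  show "d ` carrier R \<subseteq> carrier P" using d_closed by blast
  show "\<one>\<^bsub>P\<^esub> \<in> d ` carrier R" using ring_hom_one[OF d_hom] R.one_closed by (metis imageI)
  show "\<ominus>\<^bsub>P\<^esub> x \<in> d ` carrier R" if x: "x \<in> d ` carrier R" for x
  proof -
    obtain r where r: "r \<in> carrier R" "x = d r" using x by blast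
    show ?thesis
      unfolding r(2) ring_hom_minus[OF R.is_cring P.is_cring d_hom r(1), symmetric]
      by (rule imageI[OF R.a_inv_closed[OF r(1)]])
  qed
  fix x y assume "x \<in> d ` carrier R" "y \<in> d ` carrier R"
  then obtain r r' where r: "r \<in> carrier R" "x = d r" "r' \<in> carrier R" "y = d r'" by blast
  show "x \<otimes>\<^bsub>P\<^esub> y \<in> d ` carrier R"
    using ring_hom_mult[OF d_hom r(1,3)] R.m_closed[OF r(1,3)] r(2,4) by (metis imageI)
  show "x \<oplus>\<^bsub>P\<^esub> y \<in> d ` carrier R"
    using ring_hom_add[OF d_hom r(1,3)] R.a_closed[OF r(1,3)] r(2,4) by (metis imageI)
qed

lemma nat_mult_d: "d ([(n::nat)] \<cdot>\<^bsub>R\<^esub> \<one>\<^bsub>R\<^esub>) = [n] \<cdot>\<^bsub>P\<^esub> \<one>\<^bsub>P\<^esub>"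
  by (rule ring_hom_nat_one[OF R.ring_axioms P.ring_axioms d_hom])

text \<open>The diagonal is good because homomorphisms between models preserve and reflect nonunits.
  Since the positive integers are units, roots can be corrected to exact ones; the generators of
  nonunits then remain those of \<open>R\<close>, and one good subring serves as every
  \<open>\<Gamma> i\<close>.\<close>

theorem transfer_char_0:
  assumes ch: "\<And>n::nat. [Suc n] \<cdot>\<^bsub>R\<^esub> \<one>\<^bsub>R\<^esub> \<in> Units R"
    and e: "range e \<subseteq> carrier R" and qf: "quantifier_free \<psi>"
    and e': "\<And>n. n \<notin> set ns \<Longrightarrow> e' n = h (e n)" "\<And>n. n \<in> set ns \<Longrightarrow> e' n \<in> carrier S" "sat S e' \<psi>"
  shows "sat T (k \<circ> e) (foldr FEx ns \<psi>)"
proof -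
  let ?D = "d ` carrier R" and ?M = "d ` nonunits R"
  have MD: "?M \<subseteq> ?D" by auto
  have Mp: "?M \<subseteq> p1 \<inter> p2"
  proof
    fix x assume "x \<in> ?M"
    then obtain r where r: "r \<in> nonunits R" "x = d r" by blast
    then have "r \<in> carrier R" by simp
    then show "x \<in> p1 \<inter> p2" using nonunit_d_iff r by blast
  qed
  have pi: "partial_iso P p1 p2 ?D ?M"
    using notin_p_Units
    by (intro partial_iso.intro partial_iso_axioms.intro P.is_cring primeideal_P diag_subring MD Mp) blast
  interpret I: partial_iso P p1 p2 ?D ?M by (rule pi)
  have gD: "I.good ?D"
    unfolding I.good_def
  proof (intro conjI diag_subring order.refl subsetI)
    fix x assume "x \<in> ?D \<inter> (p1 \<union> p2)"
    then obtain r where r: "r \<in> carrier R" "x = d r" "d r \<in> p1 \<or> d r \<in> p2" by blast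
    then have "x \<in> ?M" using nonunit_d_iff[OF r(1)] by blast
    then show "x \<in> mspan P ?M ?D"
      by (rule P.mspan_base[OF subringE(3)[OF diag_subring] subset_trans[OF MD subringE(1)[OF diag_subring]]])
  qed
  have "[Suc n] \<cdot>\<^bsub>P\<^esub> \<one>\<^bsub>P\<^esub> \<notin> p1" for n :: nat
    using nonunit_d_iff(1)[of "[Suc n] \<cdot>\<^bsub>R\<^esub> \<one>\<^bsub>R\<^esub>"] ch[of n] R.unit_not_nonunit R.Units_closed
    unfolding nat_mult_d by blast
  then obtain G where G: "I.good G" "\<And>s. s \<in> carrier S \<Longrightarrow> \<exists>g\<in>G. s \<ominus>\<^bsub>S\<^esub> fst g \<in> nonunits S"
    using good_exists[OF pi gD] by blast
  have G': "subring G P" "?D \<subseteq> G" "\<And>x. x \<in> G \<Longrightarrow> x \<in> p1 \<union> p2 \<Longrightarrow> x \<in> mspan P ?M G"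
    using G(1) unfolding I.good_def by blast+
  have "s \<in> fst ` G" if "s \<in> carrier S" for s
    using lspan_onto[OF G'(1,2) G(2) order.refl, of s] S.comp_seq_all[OF comp_S] that by blast
  then show ?thesis
    using graph_transfer[of "\<lambda>_. G", OF G'(1) order.refl G'(2) G'(3) e qf e'(1) _ e'(3)] e'(2) by blast
qed

end

section \<open>Residue characteristic $p$\<close>

context cring
begin

lemma nat_mult_subring:
  fixes n :: nat
  assumes "subring H R" "x \<in> H"
  shows "[n] \<cdot> x \<in> H"
  using assms subringE(1)[of H R] by (induction n) (auto simp: subringE add.nat_pow_Suc)

lemma nat_pow_subring: "subring H R \<Longrightarrow> x \<in> H \<Longrightarrow> x [^] (n::nat) \<in> H"
  by (induction n) (auto simp: subringE)

text \<open>Partial sums of the binomial expansion of \<open>(u \<oplus> v) [^] n\<close>, so that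
  Pascal's rule can be proved by induction on the cut-off \<open>m\<close>.\<close>

abbreviation binsum :: "'a \<Rightarrow> 'a \<Rightarrow> nat \<Rightarrow> nat \<Rightarrow> 'a" where
  "binsum u v n m \<equiv> lincomb R (\<lambda>i. [(n choose i)] \<cdot> (u [^] i)) (\<lambda>i. v [^] (n - i)) m"

lemma binsum_closed: "u \<in> carrier R \<Longrightarrow> v \<in> carrier R \<Longrightarrow> binsum u v n m \<in> carrier R"
  by (rule lincomb_closed) auto

lemma binsum_pascal:
  assumes u: "u \<in> carrier R" and v: "v \<in> carrier R" and m: "m \<le> n"
  shows "binsum u v (Suc n) (Suc m) = v \<otimes> binsum u v n (Suc m) \<oplus> u \<otimes> binsum u v n m"
  using m
proof (induction m)
  case 0
  show ?case using u v by (simp add: m_comm)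
next
  case (Suc m)
  define B where "B = binsum u v n"
  define U where "U = u [^] m"
  define V where "V = v [^] (n - Suc m)"
  have c: "U \<in> carrier R" "V \<in> carrier R" "B i \<in> carrier R" for i
    unfolding U_def V_def B_def using u v binsum_closed by auto
  have e: "n - m = Suc (n - Suc m)" using Suc.prems by simp
  have Bs: "B (Suc (Suc m)) = B (Suc m) \<oplus> [(n choose Suc m)] \<cdot> (U \<otimes> u) \<otimes> V"
    "B (Suc m) = B m \<oplus> [(n choose m)] \<cdot> U \<otimes> (V \<otimes> v)"
    unfolding B_def U_def V_def by (simp_all add: e)
  have "binsum u v (Suc n) (Suc (Suc m)) = binsum u v (Suc n) (Suc m) \<oplus> [(Suc n choose Suc m)] \<cdot> (U \<otimes> u) \<otimes> (V \<otimes> v)"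
    by (simp add: U_def V_def e)
  also have "\<dots> = (v \<otimes> B (Suc m) \<oplus> u \<otimes> B m) \<oplus> ([(n choose m)] \<cdot> (U \<otimes> u) \<oplus> [(n choose Suc m)] \<cdot> (U \<otimes> u)) \<otimes> (V \<otimes> v)"
    using Suc c u by (simp add: B_def add.nat_pow_mult)
  also have "[(n choose m)] \<cdot> (U \<otimes> u) = [(n choose m)] \<cdot> U \<otimes> u"
    using c u by (simp add: add_pow_ldistr)
  also have "(v \<otimes> B (Suc m) \<oplus> u \<otimes> B m) \<oplus> ([(n choose m)] \<cdot> U \<otimes> u \<oplus> [(n choose Suc m)] \<cdot> (U \<otimes> u)) \<otimes> (V \<otimes> v)
      = v \<otimes> (B (Suc m) \<oplus> [(n choose Suc m)] \<cdot> (U \<otimes> u) \<otimes> V) \<oplus> u \<otimes> (B m \<oplus> [(n choose m)] \<cdot> U \<otimes> (V \<otimes> v))"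
  proof -
    have "(v \<otimes> x \<oplus> u \<otimes> y) \<oplus> (z \<otimes> u \<oplus> w) \<otimes> (V \<otimes> v) = v \<otimes> (x \<oplus> w \<otimes> V) \<oplus> u \<otimes> (y \<oplus> z \<otimes> (V \<otimes> v))"
      if "x \<in> carrier R" "y \<in> carrier R" "z \<in> carrier R" "w \<in> carrier R" for x y z w
      using that c(2) u v by algebra
    then show ?thesis using c u by simp
  qed
  finally show ?case unfolding Bs[symmetric] unfolding B_def .
qed

lemma binomial_power:
  assumes u: "u \<in> carrier R" and v: "v \<in> carrier R"
  shows "(u \<oplus> v) [^] n = binsum u v n (Suc n)"
proof (induction n)
  case 0
  show ?case using u v by simp
next
  case (Suc n)
  have c: "binsum u v n (Suc n) \<in> carrier R" "binsum u v n n \<in> carrier R" "u [^] n \<in> carrier R"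
    using u v binsum_closed by auto
  have t: "binsum u v n (Suc n) = binsum u v n n \<oplus> u [^] n" using u v by simp
  have "binsum u v (Suc n) (Suc (Suc n)) = binsum u v (Suc n) (Suc n) \<oplus> u [^] n \<otimes> u" using u v by simp
  also have "\<dots> = (v \<otimes> binsum u v n (Suc n) \<oplus> u \<otimes> binsum u v n n) \<oplus> u [^] n \<otimes> u"
    using binsum_pascal[OF u v order.refl, of n] by (simp only:)
  also have "\<dots> = v \<otimes> binsum u v n (Suc n) \<oplus> u \<otimes> (binsum u v n n \<oplus> u [^] n)"
    using c u v by (simp add: r_distr a_assoc m_comm)
  also have "\<dots> = binsum u v n (Suc n) \<otimes> (u \<oplus> v)"
    unfolding t[symmetric] using c(1) u v by (simp only: r_distr m_comm a_comm m_closed)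
  finally show ?case using Suc by (simp only: nat_pow_Suc)
qed

text \<open>The factor \<open>u\<close> in the error shows that \<open>p\<close>-th powers bring
  congruent elements closer together. That \<open>w\<close> stays in the subring \<open>H\<close> is
  what the power tower needs.\<close>

lemma prime_power_add:
  assumes p: "prime (p::nat)" and H: "subring H R" "u \<in> H" "v \<in> H"
  shows "\<exists>w\<in>H. (u \<oplus> v) [^] p = u [^] p \<oplus> v [^] p \<oplus> [p] \<cdot> (u \<otimes> w)"
proof -
  have uv: "u \<in> carrier R" "v \<in> carrier R" using H subringE(1)[OF H(1)] by auto
  have HR: "H \<subseteq> carrier R" by (rule subringE(1)[OF H(1)])
  have "\<exists>w\<in>H. binsum u v p (Suc m) = v [^] p \<oplus> [p] \<cdot> (u \<otimes> w)" if "m < p" for m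
    using that
  proof (induction m)
    case 0
    have "binsum u v p (Suc 0) = v [^] p \<oplus> [p] \<cdot> (u \<otimes> \<zero>)" using uv by simp
    then show ?case using subringE(2)[OF H(1)] by blast
  next
    case (Suc m)
    then obtain w where w: "w \<in> H" "binsum u v p (Suc m) = v [^] p \<oplus> [p] \<cdot> (u \<otimes> w)" by auto
    have "p dvd (p choose Suc m)" using p Suc.prems by (intro dvd_choose_prime) auto
    then obtain a where a: "(p choose Suc m) = p * a" by blast
    define U where "U = u [^] m"
    define V where "V = v [^] (p - Suc m)"
    have UV: "U \<in> H" "V \<in> H" unfolding U_def V_def using H nat_pow_subring by auto
    have c: "U \<in> carrier R" "V \<in> carrier R" "w \<in> carrier R" using UV w HR by auto
    have wH: "w \<oplus> [a] \<cdot> (U \<otimes> V) \<in> H"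
      using w(1) UV nat_mult_subring[OF H(1)] subringE(6,7)[OF H(1)] by auto
    have "[(p * a)] \<cdot> (U \<otimes> u) \<otimes> V = [p] \<cdot> ([a] \<cdot> ((U \<otimes> u) \<otimes> V))"
      using c uv by (simp add: add_pow_ldistr add.nat_pow_pow mult.commute)
    also have "(U \<otimes> u) \<otimes> V = u \<otimes> (U \<otimes> V)" using c uv by algebra
    also have "[a] \<cdot> (u \<otimes> (U \<otimes> V)) = u \<otimes> [a] \<cdot> (U \<otimes> V)" using c uv by (simp add: add_pow_rdistr)
    finally have t: "[(p * a)] \<cdot> (U \<otimes> u) \<otimes> V = [p] \<cdot> (u \<otimes> [a] \<cdot> (U \<otimes> V))" .
    have "binsum u v p (Suc (Suc m)) = binsum u v p (Suc m) \<oplus> [(p choose Suc m)] \<cdot> (U \<otimes> u) \<otimes> V"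
      by (simp add: U_def V_def)
    also have "\<dots> = (v [^] p \<oplus> [p] \<cdot> (u \<otimes> w)) \<oplus> [p] \<cdot> (u \<otimes> [a] \<cdot> (U \<otimes> V))"
      unfolding w(2) a t ..
    also have "\<dots> = v [^] p \<oplus> [p] \<cdot> (u \<otimes> (w \<oplus> [a] \<cdot> (U \<otimes> V)))"
      using uv c by (simp add: r_distr add.nat_pow_distrib a_assoc)
    finally show ?case using wH by blast
  qed
  from this[of "p - 1"] obtain w where w: "w \<in> H" "binsum u v p p = v [^] p \<oplus> [p] \<cdot> (u \<otimes> w)"
    using prime_gt_0_nat[OF p] by auto
  have "w \<in> carrier R" using w(1) HR by blast
  then have "(u \<oplus> v) [^] p = u [^] p \<oplus> v [^] p \<oplus> [p] \<cdot> (u \<otimes> w)"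
    unfolding binomial_power[OF uv] using w(2) uv by (simp add: a_ac)
  then show ?thesis using w(1) by blast
qed

lemma prime_power_power_add:
  assumes p: "prime (p::nat)" and H: "subring H R" "u \<in> H" "v \<in> H"
  shows "\<exists>w\<in>H. (u \<oplus> v) [^] (p ^ i) = u [^] (p ^ i) \<oplus> v [^] (p ^ i) \<oplus> [p] \<cdot> w"
proof (induction i)
  case 0
  have "u \<in> carrier R" "v \<in> carrier R" using H subringE(1)[OF H(1)] by auto
  then have "(u \<oplus> v) [^] (p ^ 0) = u [^] (p ^ 0) \<oplus> v [^] (p ^ 0) \<oplus> [p] \<cdot> \<zero>" by simp
  then show ?case using subringE(2)[OF H(1)] by blast
next
  case (Suc i)
  have HR: "H \<subseteq> carrier R" by (rule subringE(1)[OF H(1)])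
  obtain w where w: "w \<in> H" "(u \<oplus> v) [^] (p ^ i) = u [^] (p ^ i) \<oplus> v [^] (p ^ i) \<oplus> [p] \<cdot> w" using Suc by blast
  define a where "a = u [^] (p ^ i)"
  define b where "b = v [^] (p ^ i)"
  define c where "c = [p] \<cdot> w"
  have ab: "a \<in> H" "b \<in> H" "c \<in> H" "a \<oplus> b \<in> H"
    unfolding a_def b_def c_def using H w(1) nat_pow_subring nat_mult_subring subringE(7)[OF H(1)] by auto
  have abc: "a \<in> carrier R" "b \<in> carrier R" "c \<in> carrier R" "w \<in> carrier R" using ab w HR by auto
  obtain w1 where w1: "w1 \<in> H" "(c \<oplus> (a \<oplus> b)) [^] p = c [^] p \<oplus> (a \<oplus> b) [^] p \<oplus> [p] \<cdot> (c \<otimes> w1)"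
    using prime_power_add[OF p H(1) ab(3,4)] by blast
  obtain w2 where w2: "w2 \<in> H" "(a \<oplus> b) [^] p = a [^] p \<oplus> b [^] p \<oplus> [p] \<cdot> (a \<otimes> w2)"
    using prime_power_add[OF p H(1) ab(1,2)] by blast
  have "p = Suc (p - 1)" using prime_gt_0_nat[OF p] by simp
  then have "c [^] p = c [^] (p - 1) \<otimes> [p] \<cdot> w" unfolding c_def by (metis nat_pow_Suc)
  then have cp: "c [^] p = [p] \<cdot> (c [^] (p - 1) \<otimes> w)" using abc by (simp add: add_pow_rdistr)
  have eH: "c [^] (p - 1) \<otimes> w \<in> H" "a \<otimes> w2 \<in> H" "c \<otimes> w1 \<in> H"
    using ab w w1 w2 nat_pow_subring[OF H(1)] subringE(6)[OF H(1)] by auto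
  then have ec: "c [^] (p - 1) \<otimes> w \<in> carrier R" "a \<otimes> w2 \<in> carrier R" "c \<otimes> w1 \<in> carrier R" using HR by auto
  have pw: "x [^] (p ^ Suc i) = (x [^] (p ^ i)) [^] p" if "x \<in> carrier R" for x
    using that by (simp add: nat_pow_pow mult.commute)
  have uv: "u \<in> carrier R" "v \<in> carrier R" using H HR by auto
  let ?w = "c [^] (p - 1) \<otimes> w \<oplus> (a \<otimes> w2 \<oplus> c \<otimes> w1)"
  have "(u \<oplus> v) [^] (p ^ Suc i) = (c \<oplus> (a \<oplus> b)) [^] p"
    unfolding pw[OF a_closed[OF uv]] w(2) a_def[symmetric] b_def[symmetric] c_def[symmetric]
    using abc by (simp add: a_ac)
  also have "\<dots> = a [^] p \<oplus> b [^] p \<oplus> ([p] \<cdot> (c [^] (p - 1) \<otimes> w) \<oplus> ([p] \<cdot> (a \<otimes> w2) \<oplus> [p] \<cdot> (c \<otimes> w1)))"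
    unfolding w1(2) w2(2) cp using ec abc by (simp add: a_ac)
  also have "\<dots> = a [^] p \<oplus> b [^] p \<oplus> [p] \<cdot> ?w"
    using ec by (simp add: add.nat_pow_distrib)
  finally have "(u \<oplus> v) [^] (p ^ Suc i) = u [^] (p ^ Suc i) \<oplus> v [^] (p ^ Suc i) \<oplus> [p] \<cdot> ?w"
    unfolding pw[OF uv(1)] pw[OF uv(2)] a_def b_def .
  moreover have "?w \<in> H" using eH subringE(7)[OF H(1)] by blast
  ultimately show ?case by blast
qed

end

text \<open>Let \<open>z\<close> be the difference of the \<open>p^i\<close>-th powers. The next
  difference is \<open>z^p\<close> plus \<open>p\<close> times a multiple of \<open>z\<close>, that
  is, \<open>z\<close> times a nonunit. So each \<open>p\<close>-th power lowers the difference by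
  one step of the composition series, and after \<open>l\<close> of them it is zero.\<close>

lemma (in loc_ring) pow_eq_of_congruent:
  assumes p: "prime (p::nat)" "[p] \<cdot> \<one> \<in> nonunits R" and b: "comp_seq R b l"
    and uv: "u \<in> carrier R" "v \<in> carrier R" "u \<ominus> v \<in> nonunits R"
  shows "u [^] (p ^ l) = v [^] (p ^ l)"
proof -
  have bc: "range b \<subseteq> carrier R" using b unfolding comp_seq_def by blast
  let ?L = "lspan R (carrier R) b"
  have down: "a \<otimes> x \<in> ?L j" if a: "a \<in> nonunits R" and x: "x \<in> ?L (Suc j)" and j: "j < l" for a x j
  proof -
    interpret I: ideal "?L j" R by (rule lspan_ideal[OF bc])
    obtain y g where y: "y \<in> ?L j" "g \<in> carrier R" "x = y \<oplus> g \<otimes> b j" using x by auto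
    have bj: "b j \<in> carrier R" using bc by blast
    have "a \<otimes> b j \<in> ?L j" using b a j unfolding comp_seq_def by blast
    then have "a \<otimes> y \<oplus> g \<otimes> (a \<otimes> b j) \<in> ?L j"
      using I.a_closed[OF I.I_l_closed[OF y(1) nonunit_carrier[OF a]] I.I_l_closed[OF _ y(2)]] by blast
    moreover have "a \<otimes> x = a \<otimes> y \<oplus> g \<otimes> (a \<otimes> b j)"
      unfolding y(3) using nonunit_carrier[OF a] I.Icarr[OF y(1)] y(2) bj by algebra
    ultimately show ?thesis by simp
  qed
  have "u [^] (p ^ i) \<ominus> v [^] (p ^ i) \<in> nonunits R \<inter> ?L (l - i)" if "i \<le> l" for i
    using that
  proof (induction i)
    case 0
    then show ?case using uv comp_seq_all[OF b] by simp
  next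
    case (Suc i)
    define x where "x = u [^] (p ^ i)"
    define y where "y = v [^] (p ^ i)"
    define z where "z = x \<ominus> y"
    have c: "x \<in> carrier R" "y \<in> carrier R" "z \<in> carrier R" unfolding x_def y_def z_def using uv by auto
    let ?j = "l - Suc i"
    have j: "?j < l" "l - i = Suc ?j" using Suc.prems by auto
    have z: "z \<in> nonunits R" "z \<in> ?L (Suc ?j)" using Suc j unfolding z_def x_def y_def by auto
    interpret I: ideal "?L ?j" R by (rule lspan_ideal[OF bc])
    obtain w where w: "w \<in> carrier R" "(z \<oplus> y) [^] p = z [^] p \<oplus> y [^] p \<oplus> [p] \<cdot> (z \<otimes> w)"
      using prime_power_add[OF p(1) carrier_is_subring c(3,2)] by blast
    have zy: "z \<oplus> y = x" unfolding z_def using c by algebra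
    have "p = Suc (Suc (p - 2))" using prime_ge_2_nat[OF p(1)] by simp
    then have zp: "z [^] p = z [^] Suc (p - 2) \<otimes> z" by (metis nat_pow_Suc)
    have zn: "z [^] Suc (p - 2) \<in> nonunits R" using z(1) c(3) by (simp add: N.I_l_closed)
    have pz: "[p] \<cdot> (z \<otimes> w) = (([p] \<cdot> \<one>) \<otimes> w) \<otimes> z"
    proof -
      have "[p] \<cdot> (z \<otimes> w) = ([p] \<cdot> \<one>) \<otimes> (z \<otimes> w)" using c w(1) by (simp add: add_pow_ldistr)
      then show ?thesis using c w(1) by (simp add: m_ac)
    qed
    have pn: "([p] \<cdot> \<one>) \<otimes> w \<in> nonunits R" using p(2) w(1) by (simp add: N.I_r_closed)
    have "z [^] p \<oplus> [p] \<cdot> (z \<otimes> w) \<in> ?L ?j"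
      unfolding zp pz using down[OF zn z(2) j(1)] down[OF pn z(2) j(1)] by (rule I.a_closed)
    moreover have "z [^] p \<oplus> [p] \<cdot> (z \<otimes> w) \<in> nonunits R"
      unfolding zp pz using N.I_l_closed[OF z(1)] zn pn by (intro N.a_closed) auto
    moreover have "x [^] p \<ominus> y [^] p = z [^] p \<oplus> [p] \<cdot> (z \<otimes> w)"
    proof -
      have e: "r = (s \<oplus> r) \<ominus> s" if "s \<in> carrier R" "r \<in> carrier R" for r s
        using that by algebra
      have "x [^] p = y [^] p \<oplus> (z [^] p \<oplus> [p] \<cdot> (z \<otimes> w))"
        using w c unfolding zy by (simp add: a_ac)
      then show ?thesis using e[of "y [^] p" "z [^] p \<oplus> [p] \<cdot> (z \<otimes> w)"] w(1) c by simp
    qed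
    moreover have "u [^] (p ^ Suc i) = x [^] p" "v [^] (p ^ Suc i) = y [^] p"
      unfolding x_def y_def using uv by (simp_all add: nat_pow_pow mult.commute)
    ultimately show ?case by simp
  qed
  from this[of l] have "u [^] (p ^ l) \<ominus> v [^] (p ^ l) = \<zero>" by simp
  then show ?thesis using uv by simp
qed

subsection \<open>Subrings generated by powers\<close>

text \<open>Elements of \<open>G\<close> with the same residue have the same \<open>q\<close>-th power for \<open>q = p\<^sup>l\<close>, so \<open>q\<close>-th powers are
  Teichmueller-like representatives. They are not closed under addition, but the error is
  divisible by \<open>p\<close>, which lies in \<open>M\<close>.\<close>

primrec power_tower :: "('a, 'm) ring_scheme \<Rightarrow> nat \<Rightarrow> 'a set \<Rightarrow> 'a set \<Rightarrow> nat \<Rightarrow> 'a set" where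
  "power_tower R q M G 0 = G"
| "power_tower R q M G (Suc i) =
    {g [^]\<^bsub>R\<^esub> (q ^ Suc i) \<oplus>\<^bsub>R\<^esub> \<mu> | g \<mu>. g \<in> G \<and> \<mu> \<in> mspan R M (power_tower R q M G i)}"

context cring
begin

text \<open>Addition is the delicate point. On \<open>G\<close> the \<open>q^i\<close>-th power is
  additive modulo \<open>p\<close>, and a further \<open>q\<close>-th power turns this congruence
  into an equality: the \<open>q^(i+1)\<close>-th power of \<open>g \<oplus> g'\<close> is
  \<open>(A \<oplus> B) [^] q\<close> with \<open>A\<close> and \<open>B\<close> in
  \<open>H\<close>. Its expansion has an error \<open>p w\<close> with \<open>w\<close> in
  \<open>H\<close>, hence in the ideal of \<open>H\<close> generated by \<open>M\<close>. This is
  why each stage adds the ideal of the preceding one.\<close>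

lemma power_tower_step:
  assumes p: "prime (p::nat)" "[p] \<cdot> \<one> \<in> M" and q: "q = p ^ l"
    and G: "subring G R" and D: "subring D R" "D \<subseteq> G" "M \<subseteq> D" and N: "ideal N R" "M \<subseteq> N"
    and pow: "\<And>u v. u \<in> G \<Longrightarrow> v \<in> G \<Longrightarrow> u \<ominus> v \<in> N \<Longrightarrow> u [^] q = v [^] q"
    and roots: "\<And>r i. r \<in> D \<Longrightarrow> \<exists>y\<in>D. \<exists>\<mu>\<in>M. r = y [^] (q ^ i) \<oplus> \<mu>"
    and H: "subring H R" "D \<subseteq> H" "H \<subseteq> G" "\<And>g. g \<in> G \<Longrightarrow> g [^] (q ^ i) \<in> H"
    and H': "H' = {g [^] (q ^ Suc i) \<oplus> \<mu> | g \<mu>. g \<in> G \<and> \<mu> \<in> mspan R M H}"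
  shows "subring H' R" "D \<subseteq> H'" "H' \<subseteq> H" "\<And>g. g \<in> G \<Longrightarrow> g [^] (q ^ Suc i) \<in> H'"
proof -
  let ?Q = "q ^ Suc i"
  interpret N: ideal N R by fact
  have GR: "G \<subseteq> carrier R" by (rule subringE(1)[OF G])
  have HR: "H \<subseteq> carrier R" by (rule subringE(1)[OF H(1)])
  have MH: "M \<subseteq> H" using D(3) H(2) by blast
  have pc: "[p] \<cdot> \<one> \<in> carrier R" by simp
  have pw: "x [^] ?Q = (x [^] (q ^ i)) [^] q" "x [^] ?Q = (x [^] q) [^] (q ^ i)" if "x \<in> carrier R" for x
    using that by (simp_all add: nat_pow_pow mult.commute)
  have QH: "g [^] ?Q \<in> H" if "g \<in> G" for g
    using pw(2)[of g] that GR H(4) nat_pow_subring[OF G] by auto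
  show sub: "H' \<subseteq> H"
    unfolding H' using QH mspan_subset[OF H(1) MH] subringE(7)[OF H(1)] by blast
  show powH': "g [^] ?Q \<in> H'" if g: "g \<in> G" for g
  proof -
    have "g [^] ?Q = g [^] ?Q \<oplus> \<zero>" using g GR by auto
    then show ?thesis unfolding H' using g mspan.zero by blast
  qed
  show DH': "D \<subseteq> H'"
  proof
    fix r assume "r \<in> D"
    then obtain y \<mu> where y: "y \<in> D" "\<mu> \<in> M" "r = y [^] ?Q \<oplus> \<mu>" using roots by blast
    have "\<mu> \<in> mspan R M H" using mspan_base[OF subringE(3)[OF H(1)]] MH HR y(2) by blast
    then show "r \<in> H'" unfolding H' using y D(2) by blast
  qed
  have mult: "x \<otimes> y \<in> H'" if x: "x \<in> H'" and y: "y \<in> H'" for x y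
  proof -
    obtain g \<mu> where g: "g \<in> G" "\<mu> \<in> mspan R M H" "x = g [^] ?Q \<oplus> \<mu>" using x unfolding H' by blast
    obtain g' \<nu> where g': "g' \<in> G" "\<nu> \<in> mspan R M H" "y = g' [^] ?Q \<oplus> \<nu>" using y unfolding H' by blast
    obtain A B where AB: "A = g [^] ?Q" "B = g' [^] ?Q" by simp
    have ABH: "A \<in> H" "B \<in> H" unfolding AB using QH g g' by blast+
    have yH: "y \<in> H" using y sub by blast
    have mH: "\<mu> \<in> H" "\<nu> \<in> H" using mspan_subset[OF H(1) MH] g g' by blast+
    have c: "A \<in> carrier R" "B \<in> carrier R" "\<mu> \<in> carrier R" "\<nu> \<in> carrier R" using ABH mH HR by auto
    have "A \<otimes> \<nu> \<oplus> \<mu> \<otimes> (B \<oplus> \<nu>) \<in> mspan R M H"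
      using mspan_add[OF H(1) MH mspan_mult(1)[OF H(1) MH g'(2) ABH(1)] mspan_mult(2)[OF H(1) MH g(2) yH]]
      unfolding g'(3) AB .
    moreover have "x \<otimes> y = (g \<otimes> g') [^] ?Q \<oplus> (A \<otimes> \<nu> \<oplus> \<mu> \<otimes> (B \<oplus> \<nu>))"
    proof -
      have "(g \<otimes> g') [^] ?Q = A \<otimes> B" unfolding AB using g(1) g'(1) GR by (intro nat_pow_distrib) auto
      moreover have "(A \<oplus> \<mu>) \<otimes> (B \<oplus> \<nu>) = A \<otimes> B \<oplus> (A \<otimes> \<nu> \<oplus> \<mu> \<otimes> (B \<oplus> \<nu>))" using c by algebra
      ultimately show ?thesis unfolding g(3) g'(3) AB by simp
    qed
    moreover have "g \<otimes> g' \<in> G" using g g' subringE(6)[OF G] by blast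
    ultimately show ?thesis unfolding H' by blast
  qed
  have add: "x \<oplus> y \<in> H'" if x: "x \<in> H'" and y: "y \<in> H'" for x y
  proof -
    obtain g \<mu> where g: "g \<in> G" "\<mu> \<in> mspan R M H" "x = g [^] ?Q \<oplus> \<mu>" using x unfolding H' by blast
    obtain g' \<nu> where g': "g' \<in> G" "\<nu> \<in> mspan R M H" "y = g' [^] ?Q \<oplus> \<nu>" using y unfolding H' by blast
    have gc: "g \<in> carrier R" "g' \<in> carrier R" "g \<oplus> g' \<in> carrier R" using g g' GR by auto
    define A where "A = g [^] (q ^ i)"
    define B where "B = g' [^] (q ^ i)"
    have ABH: "A \<in> H" "B \<in> H" unfolding A_def B_def using H(4) g g' by blast+
    have c: "A \<in> carrier R" "B \<in> carrier R" using ABH HR by auto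
    have ggG: "g \<oplus> g' \<in> G" using g g' subringE(7)[OF G] by blast
    obtain w0 where w0: "w0 \<in> G" "(g \<oplus> g') [^] (q ^ i) = A \<oplus> B \<oplus> [p] \<cdot> w0"
      using prime_power_power_add[OF p(1) G g(1) g'(1), of "l * i"] unfolding A_def B_def q power_mult by blast
    have w0c: "w0 \<in> carrier R" using w0(1) GR by blast
    have "[p] \<cdot> w0 = ([p] \<cdot> \<one>) \<otimes> w0" using w0c by (simp add: add_pow_ldistr)
    then have "[p] \<cdot> w0 \<in> N" using p(2) N(2) w0c N.I_r_closed by auto
    moreover have "(A \<oplus> B \<oplus> [p] \<cdot> w0) \<ominus> (A \<oplus> B) = [p] \<cdot> w0"
    proof -
      have e: "r = (s \<oplus> r) \<ominus> s" if "s \<in> carrier R" "r \<in> carrier R" for r s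
        using that by algebra
      show ?thesis using e[of "A \<oplus> B" "[p] \<cdot> w0"] w0c c by simp
    qed
    ultimately have d: "(g \<oplus> g') [^] (q ^ i) \<ominus> (A \<oplus> B) \<in> N" unfolding w0(2) by simp
    have "((g \<oplus> g') [^] (q ^ i)) [^] q = (A \<oplus> B) [^] q"
      by (rule pow[OF _ _ d]) (use ggG ABH H(3) nat_pow_subring[OF G] subringE(7)[OF G] in blast)+
    then have e1: "(g \<oplus> g') [^] ?Q = (A \<oplus> B) [^] q" using pw(1)[OF gc(3)] by simp
    obtain w where w: "w \<in> H" "(A \<oplus> B) [^] q = A [^] q \<oplus> B [^] q \<oplus> [p] \<cdot> w"
      using prime_power_power_add[OF p(1) H(1) ABH, of l] unfolding q by blast
    have wc: "w \<in> carrier R" using w(1) HR by blast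
    have e2: "A [^] q = g [^] ?Q" "B [^] q = g' [^] ?Q" unfolding A_def B_def using pw(1) gc by simp_all
    have pwm: "\<ominus> ([p] \<cdot> w) \<in> mspan R M H"
    proof -
      have "[p] \<cdot> w = ([p] \<cdot> \<one>) \<otimes> w" using wc by (simp add: add_pow_ldistr)
      moreover have "([p] \<cdot> \<one>) \<otimes> w \<in> mspan R M H"
        using mspan_mult(2)[OF H(1) MH mspan_base[OF subringE(3)[OF H(1)] _ p(2)] w(1)] MH HR by blast
      ultimately show ?thesis using mspan_minus[OF H(1) MH] by simp
    qed
    have "\<ominus> ([p] \<cdot> w) \<oplus> (\<mu> \<oplus> \<nu>) \<in> mspan R M H"
      by (intro mspan_add[OF H(1) MH] pwm g(2) g'(2))
    moreover have "x \<oplus> y = (g \<oplus> g') [^] ?Q \<oplus> (\<ominus> ([p] \<cdot> w) \<oplus> (\<mu> \<oplus> \<nu>))"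
    proof -
      have m: "\<mu> \<in> carrier R" "\<nu> \<in> carrier R" "[p] \<cdot> w \<in> carrier R" "g [^] ?Q \<in> carrier R" "g' [^] ?Q \<in> carrier R"
        using mspan_subset[OF H(1) MH] g g' HR wc gc by auto
      have "(a \<oplus> \<mu>) \<oplus> (b \<oplus> \<nu>) = (a \<oplus> b \<oplus> e) \<oplus> (\<ominus> e \<oplus> (\<mu> \<oplus> \<nu>))"
        if "a \<in> carrier R" "b \<in> carrier R" "e \<in> carrier R" for a b e
        using that m(1,2) by algebra
      from this[OF m(4,5,3)] show ?thesis unfolding g(3) g'(3) e1 w(2) e2 .
    qed
    ultimately show ?thesis unfolding H' using ggG by blast
  qed
  show "subring H' R"
  proof (rule subringI)
    show "H' \<subseteq> carrier R" using sub HR by blast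
    show "\<one> \<in> H'" using DH' subringE(3)[OF D(1)] by blast
    fix x assume x: "x \<in> H'"
    have "\<ominus> \<one> \<in> H'" using DH' subringE(3,5)[OF D(1)] by blast
    then have "\<ominus> \<one> \<otimes> x \<in> H'" using mult x by blast
    moreover have "\<ominus> \<one> \<otimes> x = \<ominus> x" using x sub HR by (auto simp: l_minus)
    ultimately show "\<ominus> x \<in> H'" by simp
  qed (use mult add in auto)
qed

lemma power_tower:
  assumes p: "prime (p::nat)" "[p] \<cdot> \<one> \<in> M" and q: "q = p ^ l"
    and G: "subring G R" and D: "subring D R" "D \<subseteq> G" "M \<subseteq> D" and N: "ideal N R" "M \<subseteq> N"
    and pow: "\<And>u v. u \<in> G \<Longrightarrow> v \<in> G \<Longrightarrow> u \<ominus> v \<in> N \<Longrightarrow> u [^] q = v [^] q"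
    and roots: "\<And>r i. r \<in> D \<Longrightarrow> \<exists>y\<in>D. \<exists>\<mu>\<in>M. r = y [^] (q ^ i) \<oplus> \<mu>"
  shows "subring (power_tower R q M G i) R" "D \<subseteq> power_tower R q M G i"
    "power_tower R q M G (Suc i) \<subseteq> power_tower R q M G i" "g \<in> G \<Longrightarrow> g [^] (q ^ i) \<in> power_tower R q M G i"
proof -
  let ?t = "power_tower R q M G"
  have "subring (?t i) R \<and> D \<subseteq> ?t i \<and> ?t i \<subseteq> G \<and> (\<forall>g\<in>G. g [^] (q ^ i) \<in> ?t i)"
  proof (induction i)
    case 0
    then show ?case using G D subringE(1)[OF G] by auto
  next
    case (Suc i)
    then have H: "subring (?t i) R" "D \<subseteq> ?t i" "?t i \<subseteq> G" "\<And>g. g \<in> G \<Longrightarrow> g [^] (q ^ i) \<in> ?t i" by blast+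
    note s = power_tower_step[OF p q G D N pow roots H power_tower.simps(2)]
    show ?case using s H(3) by blast
  qed
  then have H: "subring (?t i) R" "D \<subseteq> ?t i" "?t i \<subseteq> G" "\<And>g. g \<in> G \<Longrightarrow> g [^] (q ^ i) \<in> ?t i" by blast+
  show "subring (?t i) R" "D \<subseteq> ?t i" "g \<in> G \<Longrightarrow> g [^] (q ^ i) \<in> ?t i" using H by blast+
  show "?t (Suc i) \<subseteq> ?t i" 
    using power_tower_step(3)[OF p q G D N pow roots H power_tower.simps(2)] by blast
qed

end

text \<open>The inverse image of the image of \<open>B\<close> modulo \<open>N\<close>; with the
  diagonal as \<open>B\<close> it starts the construction in characteristic
  \<open>p\<close>.\<close>

lemma (in cring) congruent_subring:
  assumes B: "subring B R" and N: "ideal N R"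
  shows "subring {x \<in> carrier R. \<exists>y\<in>B. x \<ominus> y \<in> N} R"
proof -
  interpret N: ideal N R by fact
  have BR: "B \<subseteq> carrier R" by (rule subringE(1)[OF B])
  show ?thesis
  proof (rule subringI)
    have "\<one> \<ominus> \<one> = \<zero>" by (simp add: a_minus_def r_neg)
    then have "\<one> \<ominus> \<one> \<in> N" using N.zero_closed by (simp only:)
    then show "\<one> \<in> {x \<in> carrier R. \<exists>y\<in>B. x \<ominus> y \<in> N}" using subringE(3)[OF B] by blast
  next
    fix x assume "x \<in> {x \<in> carrier R. \<exists>y\<in>B. x \<ominus> y \<in> N}"
    then obtain y where y: "x \<in> carrier R" "y \<in> B" "x \<ominus> y \<in> N" by blast
    have yc: "y \<in> carrier R" using y(2) BR by blast
    have "\<ominus> (x \<ominus> y) \<in> N" using y(3) by simp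
    moreover have "\<ominus> (x \<ominus> y) = \<ominus> x \<ominus> \<ominus> y" using y(1) yc by algebra
    ultimately show "\<ominus> x \<in> {x \<in> carrier R. \<exists>y\<in>B. x \<ominus> y \<in> N}"
      using y(1) subringE(5)[OF B y(2)] by auto
  next
    fix x x' assume "x \<in> {x \<in> carrier R. \<exists>y\<in>B. x \<ominus> y \<in> N}" "x' \<in> {x \<in> carrier R. \<exists>y\<in>B. x \<ominus> y \<in> N}"
    then obtain y y' where y: "x \<in> carrier R" "y \<in> B" "x \<ominus> y \<in> N" and y': "x' \<in> carrier R" "y' \<in> B" "x' \<ominus> y' \<in> N"
      by blast
    have yc: "y \<in> carrier R" "y' \<in> carrier R" using y(2) y'(2) BR by blast+
    have "x \<otimes> (x' \<ominus> y') \<oplus> (x \<ominus> y) \<otimes> y' \<in> N"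
      by (rule N.a_closed[OF N.I_l_closed[OF y'(3) y(1)] N.I_r_closed[OF y(3) yc(2)]])
    moreover have "x \<otimes> (x' \<ominus> y') \<oplus> (x \<ominus> y) \<otimes> y' = x \<otimes> x' \<ominus> y \<otimes> y'" using y(1) y'(1) yc by algebra
    ultimately show "x \<otimes> x' \<in> {x \<in> carrier R. \<exists>y\<in>B. x \<ominus> y \<in> N}"
      using y(1) y'(1) subringE(6)[OF B y(2) y'(2)] by auto
    have "(x \<ominus> y) \<oplus> (x' \<ominus> y') \<in> N" by (rule N.a_closed[OF y(3) y'(3)])
    moreover have "(x \<ominus> y) \<oplus> (x' \<ominus> y') = (x \<oplus> x') \<ominus> (y \<oplus> y')" using y(1) y'(1) yc by algebra
    ultimately show "x \<oplus> x' \<in> {x \<in> carrier R. \<exists>y\<in>B. x \<ominus> y \<in> N}"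
      using y(1) y'(1) subringE(7)[OF B y(2) y'(2)] by auto
  qed blast
qed

lemma (in cring) heval_power_minus:
  assumes "a \<in> carrier R" "y \<in> carrier R" "n > 0"
  shows "heval R ((\<ominus> a # replicate (n - 1) \<zero>) @ [\<one>]) y = \<ominus> (a \<ominus> y [^] n)"
proof -
  have s: "set (\<ominus> a # replicate (n - 1) \<zero>) \<subseteq> carrier R" using assms(1) by auto
  have "heval R ((\<ominus> a # replicate (n - 1) \<zero>) @ [\<one>]) y = \<ominus> a \<oplus> y [^] n"
    using heval_snoc[OF s one_closed assms(2)] assms heval_replicate_zero[OF assms(2)] by simp
  also have "\<dots> = \<ominus> (a \<ominus> y [^] n)"
  proof -
    have "\<ominus> a \<oplus> z = \<ominus> (a \<ominus> z)" if "z \<in> carrier R" for z using that assms(1) by algebra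
    then show ?thesis using assms(2) by simp
  qed
  finally show ?thesis .
qed

text \<open>For powers of the residue characteristic this says that the residue field is
  perfect.\<close>

lemma (in loc_ring) root_closed_power:
  assumes "root_closed R" "a \<in> carrier R" "n > 0"
  shows "\<exists>y\<in>carrier R. a \<ominus> y [^] (n::nat) \<in> nonunits R"
proof -
  have s: "set (\<ominus> a # replicate (n - 1) \<zero>) \<subseteq> carrier R" using assms(2) by auto
  then obtain y where y: "y \<in> carrier R" "heval R ((\<ominus> a # replicate (n - 1) \<zero>) @ [\<one>]) y \<in> nonunits R"
    using assms(1) unfolding root_closed_def by blast
  have "\<ominus> (\<ominus> (a \<ominus> y [^] n)) \<in> nonunits R"
    using y(2) unfolding heval_power_minus[OF assms(2) y(1) assms(3)] by (rule N.a_inv_closed)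
  then show ?thesis using y(1) assms(2) by auto
qed

context extension_pair
begin

lemma lspan_powers:
  assumes G: "subring \<Gamma> P" "d ` carrier R \<subseteq> \<Gamma>" and pow: "\<And>x. x \<in> carrier S \<Longrightarrow> x [^]\<^bsub>S\<^esub> (n::nat) \<in> fst ` \<Gamma>"
  shows "s \<in> lspan S {x [^]\<^bsub>S\<^esub> n | x. x \<in> carrier S} (h \<circ> b) j \<Longrightarrow> s \<in> fst ` \<Gamma>"
proof (induction j arbitrary: s)
  case 0
  then have "s = fst \<zero>\<^bsub>P\<^esub>" by simp
  then show ?case using subringE(2)[OF G(1)] by blast
next
  case (Suc j)
  obtain y x where y: "y \<in> lspan S {x [^]\<^bsub>S\<^esub> n | x. x \<in> carrier S} (h \<circ> b) j" "x \<in> carrier S"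
    "s = y \<oplus>\<^bsub>S\<^esub> x [^]\<^bsub>S\<^esub> n \<otimes>\<^bsub>S\<^esub> (h \<circ> b) j" using Suc.prems unfolding lspan.simps by blast
  obtain v where v: "v \<in> \<Gamma>" "y = fst v" using Suc.IH[OF y(1)] by blast
  obtain w where w: "w \<in> \<Gamma>" "x [^]\<^bsub>S\<^esub> n = fst w" using pow[OF y(2)] by blast
  have "d (b j) \<in> \<Gamma>" using G(2) b_closed(1) by blast
  then have "v \<oplus>\<^bsub>P\<^esub> w \<otimes>\<^bsub>P\<^esub> d (b j) \<in> \<Gamma>" using v(1) w(1) subringE(6,7)[OF G(1)] by blast
  moreover have "s = fst (v \<oplus>\<^bsub>P\<^esub> w \<otimes>\<^bsub>P\<^esub> d (b j))" unfolding y(3) v(2) w(2) by simp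
  ultimately show ?case by blast
qed

text \<open>The residue isomorphism is found first, with all pairs of nonunits put into the subring,
  because inseparable roots cannot be corrected. The power tower over it, formed with the nonunits
  of \<open>R\<close> alone, then provides the decreasing subrings for the graph argument. Its stage
  \<open>l\<close> contains the diagonal and the \<open>q^l\<close>-th powers from \<open>G\<close>,
  with \<open>q = p^l\<close>; hence the exponent \<open>(p ^ l) ^ l\<close> for the
  witnesses.\<close>

theorem transfer_char_p:
  assumes p: "prime (p::nat)" "[p] \<cdot>\<^bsub>R\<^esub> \<one>\<^bsub>R\<^esub> \<in> nonunits R"
    and e: "range e \<subseteq> carrier R" and qf: "quantifier_free \<psi>"
    and e': "\<And>n. n \<notin> set ns \<Longrightarrow> e' n = h (e n)"
      "\<And>n. n \<in> set ns \<Longrightarrow> e' n \<in> lspan S {x [^]\<^bsub>S\<^esub> ((p ^ l) ^ l) | x. x \<in> carrier S} (h \<circ> b) l"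
      "sat S e' \<psi>"
  shows "sat T (k \<circ> e) (foldr FEx ns \<psi>)"
proof -
  define N where "N = p1 \<inter> p2"
  let ?\<Delta> = "d ` carrier R" and ?M = "d ` nonunits R"
  \<comment> \<open>With \<open>N\<close> as the generating set, being a root modulo both maximal
    ideals already suffices in \<open>correction\<close>; for this the subring must contain all of
    \<open>N\<close>.\<close>
  define D where "D = {x \<in> carrier P. \<exists>y\<in>?\<Delta>. x \<ominus>\<^bsub>P\<^esub> y \<in> N}"
  have N: "ideal N P"
    unfolding N_def using P.i_intersect primeideal.axioms(1)[OF primeideal_P(1)] primeideal.axioms(1)[OF primeideal_P(2)] .
  interpret N: ideal N P by (rule N)
  interpret P1: primeideal p1 P by (rule primeideal_P)
  interpret P2: primeideal p2 P by (rule primeideal_P)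
  have D: "subring D P" unfolding D_def by (rule P.congruent_subring[OF diag_subring N])
  have \<Delta>P: "?\<Delta> \<subseteq> carrier P" by (rule subringE(1)[OF diag_subring])
  have \<Delta>D: "?\<Delta> \<subseteq> D"
  proof
    fix x assume x: "x \<in> ?\<Delta>"
    then have xP: "x \<in> carrier P" using \<Delta>P by blast
    have "x \<ominus>\<^bsub>P\<^esub> x = \<zero>\<^bsub>P\<^esub>" unfolding a_minus_def by (rule P.r_neg[OF xP])
    then have "x \<ominus>\<^bsub>P\<^esub> x \<in> N" using N.zero_closed by (simp only:)
    then show "x \<in> D" unfolding D_def using x xP by blast
  qed
  have ND: "N \<subseteq> D"
  proof
    fix x assume x: "x \<in> N"
    have xP: "x \<in> carrier P" by (rule N.Icarr[OF x])
    have "x \<ominus>\<^bsub>P\<^esub> \<zero>\<^bsub>P\<^esub> = x" using xP unfolding a_minus_def by (simp only: P.minus_zero P.r_zero)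
    then have "x \<ominus>\<^bsub>P\<^esub> \<zero>\<^bsub>P\<^esub> \<in> N" using x by (simp only:)
    then show "x \<in> D" unfolding D_def using xP subringE(2)[OF diag_subring] by blast
  qed
  have MN: "?M \<subseteq> N"
  proof
    fix x assume "x \<in> ?M"
    then obtain r where r: "r \<in> nonunits R" "x = d r" by blast
    then have "r \<in> carrier R" by simp
    then show "x \<in> N" unfolding N_def using nonunit_d_iff r by blast
  qed
  have M\<Delta>: "?M \<subseteq> ?\<Delta>" by auto
  have pi: "partial_iso P p1 p2 D N"
    using notin_p_Units
    by (intro partial_iso.intro partial_iso_axioms.intro P.is_cring primeideal_P D ND) (auto simp: N_def)
  interpret I: partial_iso P p1 p2 D N by (rule pi)
  have gD: "I.good D"
    unfolding I.good_def
  proof (intro conjI D order.refl subsetI)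
    fix x assume x: "x \<in> D \<inter> (p1 \<union> p2)"
    then obtain r where r: "r \<in> carrier R" "x \<ominus>\<^bsub>P\<^esub> d r \<in> N" and xP: "x \<in> carrier P" unfolding D_def by blast
    have dP: "d r \<in> carrier P" by (rule d_closed[OF r(1)])
    have e1: "d r = x \<ominus>\<^bsub>P\<^esub> (x \<ominus>\<^bsub>P\<^esub> d r)" and e2: "x = d r \<oplus>\<^bsub>P\<^esub> (x \<ominus>\<^bsub>P\<^esub> d r)"
      using xP dP by algebra+
    have "d r \<in> p1 \<or> d r \<in> p2"
    proof -
      have n: "\<ominus>\<^bsub>P\<^esub> (x \<ominus>\<^bsub>P\<^esub> d r) \<in> p1" "\<ominus>\<^bsub>P\<^esub> (x \<ominus>\<^bsub>P\<^esub> d r) \<in> p2"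
        using N.a_inv_closed[OF r(2)] unfolding N_def by blast+
      from x have "x \<in> p1 \<or> x \<in> p2" by blast
      then have "x \<ominus>\<^bsub>P\<^esub> (x \<ominus>\<^bsub>P\<^esub> d r) \<in> p1 \<or> x \<ominus>\<^bsub>P\<^esub> (x \<ominus>\<^bsub>P\<^esub> d r) \<in> p2"
        unfolding a_minus_def[of P x "x \<ominus>\<^bsub>P\<^esub> d r"] using P1.a_closed[OF _ n(1)] P2.a_closed[OF _ n(2)] by blast
      then show ?thesis unfolding e1[symmetric] .
    qed
    then have "d r \<in> N" using nonunit_d_iff[OF r(1)] unfolding N_def by blast
    from N.a_closed[OF this r(2)] have "x \<in> N" unfolding e2[symmetric] .
    then show "x \<in> mspan P N D" by (rule P.mspan_base[OF subringE(3)[OF D] N.a_subset])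
  qed
  obtain G where G: "I.good G" "\<And>s. s \<in> carrier S \<Longrightarrow> \<exists>g\<in>G. s \<ominus>\<^bsub>S\<^esub> fst g \<in> nonunits S"
    using good_exists[OF pi gD] N_def by blast
  have G': "subring G P" "D \<subseteq> G" using G(1) unfolding I.good_def by blast+
  have GP: "G \<subseteq> carrier P" by (rule subringE(1)[OF G'(1)])
  have GN: "x \<in> N" if "x \<in> G" "x \<in> p1 \<or> x \<in> p2" for x
    using I.mspan_p(1)[OF G(1)] I.good_p_mspan[OF G(1) that] unfolding N_def by blast
  \<comment> \<open>\<open>G\<close> contains every pair of nonunits, so surjectivity on residues
    gives surjectivity onto \<open>S\<close> at once.\<close>
  have onto: "s \<in> fst ` G" if s: "s \<in> carrier S" for s
  proof -
    obtain g where g: "g \<in> G" "s \<ominus>\<^bsub>S\<^esub> fst g \<in> nonunits S" using G(2)[OF s] by blast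
    have gc: "fst g \<in> carrier S" using g(1) GP by (auto simp: mem_Times_iff)
    have "(s \<ominus>\<^bsub>S\<^esub> fst g, \<zero>\<^bsub>T\<^esub>) \<in> N" unfolding N_def using g(2) by simp
    then have "(s \<ominus>\<^bsub>S\<^esub> fst g, \<zero>\<^bsub>T\<^esub>) \<in> G" using ND G'(2) by blast
    then have "g \<oplus>\<^bsub>P\<^esub> (s \<ominus>\<^bsub>S\<^esub> fst g, \<zero>\<^bsub>T\<^esub>) \<in> G" using subringE(7)[OF G'(1)] g(1) by blast
    moreover have "fst (g \<oplus>\<^bsub>P\<^esub> (s \<ominus>\<^bsub>S\<^esub> fst g, \<zero>\<^bsub>T\<^esub>)) = s"
    proof -
      have "fst g \<oplus>\<^bsub>S\<^esub> (s \<ominus>\<^bsub>S\<^esub> fst g) = s" using s gc by algebra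
      then show ?thesis by simp
    qed
    ultimately show ?thesis by (metis imageI)
  qed
  define q where "q = p ^ l"
  have q0: "q ^ i > 0" for i using prime_gt_0_nat[OF p(1)] unfolding q_def by simp
  have pM: "[p] \<cdot>\<^bsub>P\<^esub> \<one>\<^bsub>P\<^esub> \<in> ?M" unfolding nat_mult_d[symmetric] using p(2) by blast
  have pST: "[p] \<cdot>\<^bsub>S\<^esub> \<one>\<^bsub>S\<^esub> \<in> nonunits S" "[p] \<cdot>\<^bsub>T\<^esub> \<one>\<^bsub>T\<^esub> \<in> nonunits T"
    using model_hom_nonunit[OF model_R model_S h p(2)] model_hom_nonunit[OF model_R model_T k p(2)]
      ring_hom_nat_one[OF R.ring_axioms S.ring_axioms h] ring_hom_nat_one[OF R.ring_axioms T.ring_axioms k] by simp_all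
  have pow: "u [^]\<^bsub>P\<^esub> q = v [^]\<^bsub>P\<^esub> q" if u: "u \<in> G" and v: "v \<in> G" and uv: "u \<ominus>\<^bsub>P\<^esub> v \<in> N" for u v
  proof -
    have c: "u \<in> carrier P" "v \<in> carrier P" using u v GP by blast+
    have c': "fst u \<in> carrier S" "fst v \<in> carrier S" "snd u \<in> carrier T" "snd v \<in> carrier T"
      using c by (auto simp: mem_Times_iff)
    have "fst u \<ominus>\<^bsub>S\<^esub> fst v \<in> nonunits S" "snd u \<ominus>\<^bsub>T\<^esub> snd v \<in> nonunits T"
      using uv c diff_P unfolding N_def by auto
    then show ?thesis
      unfolding pow_P[OF c(1)] pow_P[OF c(2)] q_def
      using S.pow_eq_of_congruent[OF p(1) pST(1) comp_S c'(1,2)] T.pow_eq_of_congruent[OF p(1) pST(2) comp_T c'(3,4)]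
      by simp
  qed
  \<comment> \<open>Up to a nonunit every element of \<open>R\<close> is a \<open>q^i\<close>-th
    power. This keeps the diagonal inside every stage of the tower.\<close>
  have roots: "\<exists>y\<in>?\<Delta>. \<exists>\<mu>\<in>?M. x = y [^]\<^bsub>P\<^esub> (q ^ i) \<oplus>\<^bsub>P\<^esub> \<mu>" if x: "x \<in> ?\<Delta>" for x i
  proof -
    obtain r where r: "r \<in> carrier R" "x = d r" using x by blast
    obtain y where y: "y \<in> carrier R" "r \<ominus>\<^bsub>R\<^esub> y [^]\<^bsub>R\<^esub> (q ^ i) \<in> nonunits R"
      using R.root_closed_power[OF root_R r(1) q0] by blast
    obtain z where z: "z = y [^]\<^bsub>R\<^esub> (q ^ i)" "z \<in> carrier R" using y(1) by simp
    have "r = z \<oplus>\<^bsub>R\<^esub> (r \<ominus>\<^bsub>R\<^esub> z)" using r(1) z(2) by algebra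
    then have "x = d z \<oplus>\<^bsub>P\<^esub> d (r \<ominus>\<^bsub>R\<^esub> z)"
      unfolding r(2) using ring_hom_add[OF d_hom z(2), of "r \<ominus>\<^bsub>R\<^esub> z"] R.minus_closed[OF r(1) z(2)] by (simp only:)
    moreover have "d z = d y [^]\<^bsub>P\<^esub> (q ^ i)"
      unfolding z(1) by (rule ring_hom_nat_pow[OF R.is_cring P.is_cring d_hom y(1)])
    ultimately have "x = d y [^]\<^bsub>P\<^esub> (q ^ i) \<oplus>\<^bsub>P\<^esub> d (r \<ominus>\<^bsub>R\<^esub> z)" by (simp only:)
    moreover have "d (r \<ominus>\<^bsub>R\<^esub> z) \<in> ?M" "d y \<in> ?\<Delta>" using y unfolding z(1) by (simp_all only: imageI)
    ultimately show ?thesis by (metis (no_types))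
  qed
  let ?\<Gamma> = "power_tower P q ?M G"
  note tower = P.power_tower[OF p(1) pM q_def G'(1) diag_subring subset_trans[OF \<Delta>D G'(2)] M\<Delta> N MN pow roots]
  have sub: "subring (?\<Gamma> i) P" and diag: "?\<Delta> \<subseteq> ?\<Gamma> i" and dec: "?\<Gamma> (Suc i) \<subseteq> ?\<Gamma> i" for i
    using tower(1-3) by blast+
  have powG: "g [^]\<^bsub>P\<^esub> (q ^ i) \<in> ?\<Gamma> i" if "g \<in> G" for g i
    using tower(4) that by blast
  \<comment> \<open>If \<open>x\<close> is a nonunit then so is \<open>g\<close>. It is nilpotent,
    and its power \<open>?Q\<close> vanishes since \<open>?Q\<close> is at least \<open>p^l\<close>
    and hence at least \<open>l\<close>. What remains of \<open>x\<close> is the summand generated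
    by nonunits of \<open>R\<close> over the preceding stage.\<close>
  have split: "x \<in> mspan P ?M (?\<Gamma> i)" if x: "x \<in> ?\<Gamma> (Suc i)" "x \<in> p1 \<union> p2" for i x
  proof -
    let ?Q = "q ^ Suc i"
    obtain g \<mu> where g: "g \<in> G" "\<mu> \<in> mspan P ?M (?\<Gamma> i)" "x = g [^]\<^bsub>P\<^esub> ?Q \<oplus>\<^bsub>P\<^esub> \<mu>"
      using x(1) unfolding power_tower.simps by blast
    have gP: "g \<in> carrier P" using g(1) GP by blast
    have \<mu>N: "\<mu> \<in> N" using P.mspan_subset_ideal[OF N MN subringE(1)[OF sub]] g(2) by blast
    have \<mu>p: "\<ominus>\<^bsub>P\<^esub> \<mu> \<in> p1" "\<ominus>\<^bsub>P\<^esub> \<mu> \<in> p2" using N.a_inv_closed[OF \<mu>N] unfolding N_def by blast+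
    have \<mu>P: "\<mu> \<in> carrier P" by (rule N.Icarr[OF \<mu>N])
    have gQ: "g [^]\<^bsub>P\<^esub> ?Q = x \<oplus>\<^bsub>P\<^esub> \<ominus>\<^bsub>P\<^esub> \<mu>"
    proof -
      have "z = (z \<oplus>\<^bsub>P\<^esub> \<mu>) \<oplus>\<^bsub>P\<^esub> \<ominus>\<^bsub>P\<^esub> \<mu>" if "z \<in> carrier P" for z using that \<mu>P by algebra
      from this[OF P.nat_pow_closed[OF gP]] show ?thesis unfolding g(3) .
    qed
    have "g [^]\<^bsub>P\<^esub> ?Q \<in> p1 \<or> g [^]\<^bsub>P\<^esub> ?Q \<in> p2"
      unfolding gQ using x(2) P1.a_closed[OF _ \<mu>p(1)] P2.a_closed[OF _ \<mu>p(2)] by blast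
    then have "g [^]\<^bsub>P\<^esub> ?Q \<notin> Units P" using I.unit_iff_notin by blast
    then have "g \<notin> Units P" using P.Units_pow_closed by blast
    then have "g \<in> N" using GN[OF g(1)] I.unit_iff_notin gP by blast
    then have gl: "g [^]\<^bsub>P\<^esub> l = \<zero>\<^bsub>P\<^esub>" unfolding N_def by (rule nilpotent_P)
    have "l \<le> p ^ l" using less_exp[of l] power_mono[OF prime_ge_2_nat[OF p(1)], of l] by linarith
    also have "\<dots> \<le> ?Q" unfolding q_def[symmetric] using q0[of i] by simp
    finally have "l + (?Q - l) = ?Q" by simp
    then have "g [^]\<^bsub>P\<^esub> ?Q = g [^]\<^bsub>P\<^esub> l \<otimes>\<^bsub>P\<^esub> g [^]\<^bsub>P\<^esub> (?Q - l)"
      using P.nat_pow_mult[OF gP, of l "?Q - l"] by (simp only:)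
    also have "\<dots> = \<zero>\<^bsub>P\<^esub>" unfolding gl by (rule P.l_null[OF P.nat_pow_closed[OF gP]])
    finally have "x = \<mu>" unfolding g(3) using P.l_zero[OF \<mu>P] by (simp only:)
    then show ?thesis using g(2) by simp
  qed
  have "x [^]\<^bsub>S\<^esub> (q ^ l) \<in> fst ` ?\<Gamma> l" if x: "x \<in> carrier S" for x
  proof -
    obtain g where g: "g \<in> G" "x = fst g" using onto[OF x] by blast
    have "g \<in> carrier P" using g(1) GP by blast
    then have "x [^]\<^bsub>S\<^esub> (q ^ l) = fst (g [^]\<^bsub>P\<^esub> (q ^ l))" using pow_P g(2) by simp
    then show ?thesis using powG[OF g(1)] by blast
  qed
  then have "e' n \<in> fst ` ?\<Gamma> l" if "n \<in> set ns" for n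
    using lspan_powers[OF sub diag _ e'(2)[OF that, folded q_def]] by blast
  then show ?thesis
    using graph_transfer[of ?\<Gamma>, OF sub dec diag split e qf e'(1) _ e'(3)] by blast
qed

end

subsection \<open>Extracting roots in an extension\<close>

text \<open>The roots are adjoined one after the other; a congruence obtained earlier survives
  because homomorphisms between models preserve nonunits.\<close>

lemma extension_with_powers:
  fixes S :: "'b ring"
  assumes inf: "infinite (UNIV :: 'b set)" and n: "n > 0"
    and "finite A" "is_model (Art l) S" "A \<subseteq> carrier S"
  shows "\<exists>(S' :: 'b ring) g. is_model (Art l) S' \<and> g \<in> ring_hom S S' \<and> inj_on g (carrier S) \<and>
    (\<forall>a\<in>A. \<exists>x\<in>carrier S'. g a \<ominus>\<^bsub>S'\<^esub> x [^]\<^bsub>S'\<^esub> (n::nat) \<in> nonunits S')"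
  using assms(3,5)
proof (induction A rule: finite_induct)
  case empty
  have "id \<in> ring_hom S S" by (rule ring_hom_memI) auto
  then have "is_model (Art l) S \<and> id \<in> ring_hom S S \<and> inj_on id (carrier S) \<and>
      (\<forall>a\<in>{}. \<exists>x\<in>carrier S. id a \<ominus>\<^bsub>S\<^esub> x [^]\<^bsub>S\<^esub> n \<in> nonunits S)"
    using assms(4) by simp
  then show ?case by (rule exI[of _ S, OF exI[of _ id]])
next
  case (insert a A)
  have "A \<subseteq> carrier S" using insert.prems by simp
  from insert.IH[OF this] obtain S1 :: "'b ring" and g1 where S1: "is_model (Art l) S1" "g1 \<in> ring_hom S S1"
    "inj_on g1 (carrier S)" and pow1: "\<forall>a\<in>A. \<exists>x\<in>carrier S1. g1 a \<ominus>\<^bsub>S1\<^esub> x [^]\<^bsub>S1\<^esub> n \<in> nonunits S1"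
    by (elim exE conjE) (rule that; assumption)
  have c1: "cring S1" using S1(1) unfolding Art_model_iff by blast
  interpret S1: cring S1 by (rule c1)
  have ac: "g1 a \<in> carrier S1" using ring_hom_closed[OF S1(2)] insert.prems by blast
  let ?cs = "\<ominus>\<^bsub>S1\<^esub> g1 a # replicate (n - 1) \<zero>\<^bsub>S1\<^esub>"
  have cs: "set ?cs \<subseteq> carrier S1" "?cs \<noteq> []" using ac by auto
  obtain S2 :: "'b ring" and g2 y where S2: "is_model (Art l) S2" "g2 \<in> ring_hom S1 S2" "inj_on g2 (carrier S1)"
    and y: "y \<in> carrier S2" "heval S2 (map g2 (?cs @ [\<one>\<^bsub>S1\<^esub>])) y \<in> nonunits S2"
    using root_extension[OF S1(1) inf cs] by blast
  have c2: "cring S2" "local_ring S2" using S2(1) unfolding Art_model_iff by blast+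
  interpret S2: loc_ring S2 using c2(2) by (rule loc_ringI)
  have z: "g2 \<zero>\<^bsub>S1\<^esub> = \<zero>\<^bsub>S2\<^esub>" by (rule ring_hom_zero[OF S2(2) S1.ring_axioms S2.ring_axioms])
  have gc: "g2 (g1 a) \<in> carrier S2" by (rule ring_hom_closed[OF S2(2) ac])
  have m: "map g2 (?cs @ [\<one>\<^bsub>S1\<^esub>]) = (\<ominus>\<^bsub>S2\<^esub> g2 (g1 a) # replicate (n - 1) \<zero>\<^bsub>S2\<^esub>) @ [\<one>\<^bsub>S2\<^esub>]"
    using ring_hom_minus[OF c1 c2(1) S2(2) ac] ring_hom_one[OF S2(2)] z by simp
  have "\<ominus>\<^bsub>S2\<^esub> (\<ominus>\<^bsub>S2\<^esub> (g2 (g1 a) \<ominus>\<^bsub>S2\<^esub> y [^]\<^bsub>S2\<^esub> n)) \<in> nonunits S2"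
    using y(2) unfolding m S2.heval_power_minus[OF gc y(1) n] by (rule S2.N.a_inv_closed)
  then have a: "g2 (g1 a) \<ominus>\<^bsub>S2\<^esub> y [^]\<^bsub>S2\<^esub> n \<in> nonunits S2" using gc y(1) by simp
  have "\<exists>x\<in>carrier S2. g2 (g1 c) \<ominus>\<^bsub>S2\<^esub> x [^]\<^bsub>S2\<^esub> n \<in> nonunits S2" if c: "c \<in> A" for c
  proof -
    obtain x where x: "x \<in> carrier S1" "g1 c \<ominus>\<^bsub>S1\<^esub> x [^]\<^bsub>S1\<^esub> n \<in> nonunits S1" using pow1 c by blast
    have cc: "g1 c \<in> carrier S1" using ring_hom_closed[OF S1(2)] insert.prems c by blast
    have "g2 (g1 c \<ominus>\<^bsub>S1\<^esub> x [^]\<^bsub>S1\<^esub> n) = g2 (g1 c) \<ominus>\<^bsub>S2\<^esub> g2 x [^]\<^bsub>S2\<^esub> n"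
      using ring_hom_diff[OF c1 c2(1) S2(2) cc, of "x [^]\<^bsub>S1\<^esub> n"] ring_hom_nat_pow[OF c1 c2(1) S2(2) x(1), of n] x(1) by simp
    then show ?thesis
      using model_hom_nonunit[OF S1(1) S2(1,2) x(2)] ring_hom_closed[OF S2(2) x(1)] by auto
  qed
  moreover have inj: "inj_on (g2 \<circ> g1) (carrier S)"
    using comp_inj_on[OF S1(3), of g2] inj_on_subset[OF S2(3)] ring_hom_closed[OF S1(2)] by blast
  ultimately have "\<forall>c\<in>insert a A. \<exists>x\<in>carrier S2. (g2 \<circ> g1) c \<ominus>\<^bsub>S2\<^esub> x [^]\<^bsub>S2\<^esub> n \<in> nonunits S2"
    using a y(1) by auto
  from conjI[OF S2(1) conjI[OF ring_hom_trans[OF S1(2) S2(2)] conjI[OF inj this]]]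
  show ?case by (rule exI[of _ S2, OF exI[of _ "g2 \<circ> g1"]])
qed

text \<open>In an extension the coefficient at the top index becomes an \<open>n\<close>-th power up
  to a nonunit, and the error moves into the span below, where the induction goes on. The Gorenstein
  property of \<open>R\<close> ensures that the images of \<open>b\<close> form a composition series
  in each of these extensions.\<close>

lemma extension_lspan_powers:
  fixes S :: "'b ring" and R :: "('a, 'm) ring_scheme"
  assumes inf: "infinite (UNIV :: 'b set)" and n: "n > 0"
    and R: "local_ring R" "principalideal (socle R) R" "ring_length R = enat l" "comp_seq R b l"
    and "is_model (Art l) S" "h \<in> ring_hom R S" "inj_on h (carrier R)"
    and "finite A" "A \<subseteq> lspan S (carrier S) (h \<circ> b) j" "j \<le> l"
  shows "\<exists>(S' :: 'b ring) g. is_model (Art l) S' \<and> g \<in> ring_hom S S' \<and> inj_on g (carrier S) \<and>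
    (\<forall>a\<in>A. g a \<in> lspan S' {x [^]\<^bsub>S'\<^esub> (n::nat) | x. x \<in> carrier S'} (g \<circ> h \<circ> b) j)"
  using assms(7-12)
proof (induction j arbitrary: S h A)
  case 0
  have c: "cring S" using 0(1) unfolding Art_model_iff by blast
  have "id \<in> ring_hom S S" by (rule ring_hom_memI) auto
  then have "is_model (Art l) S \<and> id \<in> ring_hom S S \<and> inj_on id (carrier S) \<and>
      (\<forall>a\<in>A. id a \<in> lspan S {x [^]\<^bsub>S\<^esub> n | x. x \<in> carrier S} (id \<circ> h \<circ> b) 0)"
    using 0(1,5) by auto
  then show ?case by (rule exI[of _ S, OF exI[of _ id]])
next
  case (Suc j)
  have cS: "cring S" using Suc.prems(1) unfolding Art_model_iff by blast
  interpret S: cring S by (rule cS)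
  have cR: "cring R" using R(1) unfolding local_ring_def by blast
  have bR: "b i \<in> carrier R" for i using R(4) unfolding comp_seq_def by blast
  have "\<forall>a\<in>A. \<exists>x c. x \<in> lspan S (carrier S) (h \<circ> b) j \<and> c \<in> carrier S \<and> a = x \<oplus>\<^bsub>S\<^esub> c \<otimes>\<^bsub>S\<^esub> (h \<circ> b) j"
    using Suc.prems(5) unfolding lspan.simps by blast
  then obtain V C where VC: "\<And>a. a \<in> A \<Longrightarrow> V a \<in> lspan S (carrier S) (h \<circ> b) j" "\<And>a. a \<in> A \<Longrightarrow> C a \<in> carrier S"
    "\<And>a. a \<in> A \<Longrightarrow> a = V a \<oplus>\<^bsub>S\<^esub> C a \<otimes>\<^bsub>S\<^esub> (h \<circ> b) j" by metis
  have hbS: "range (h \<circ> b) \<subseteq> carrier S" using ring_hom_closed[OF Suc.prems(2) bR] by auto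
  have bS: "(h \<circ> b) j \<in> carrier S" using hbS by blast
  have "C ` A \<subseteq> carrier S" using VC(2) by blast
  from extension_with_powers[OF inf n finite_imageI[OF Suc.prems(4)] Suc.prems(1) this]
  obtain S1 :: "'b ring" and g1 where S1: "is_model (Art l) S1" "g1 \<in> ring_hom S S1" "inj_on g1 (carrier S)"
    and pow1: "\<forall>a\<in>C ` A. \<exists>x\<in>carrier S1. g1 a \<ominus>\<^bsub>S1\<^esub> x [^]\<^bsub>S1\<^esub> n \<in> nonunits S1"
    by (elim exE conjE) (rule that; assumption)
  have c1: "cring S1" "local_ring S1" using S1(1) unfolding Art_model_iff by blast+
  interpret S1: loc_ring S1 using c1(2) by (rule loc_ringI)
  obtain Y where Y: "\<And>a. a \<in> A \<Longrightarrow> Y a \<in> carrier S1" "\<And>a. a \<in> A \<Longrightarrow> g1 (C a) \<ominus>\<^bsub>S1\<^esub> Y a [^]\<^bsub>S1\<^esub> n \<in> nonunits S1"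
  proof -
    have "\<forall>a\<in>A. \<exists>x. x \<in> carrier S1 \<and> g1 (C a) \<ominus>\<^bsub>S1\<^esub> x [^]\<^bsub>S1\<^esub> n \<in> nonunits S1" using pow1 by blast
    from bchoice[OF this] show ?thesis using that by blast
  qed
  have hom1: "g1 \<circ> h \<in> ring_hom R S1" "inj_on (g1 \<circ> h) (carrier R)"
    using ring_hom_trans[OF Suc.prems(2) S1(2)] comp_inj_on[OF Suc.prems(3), of g1] inj_on_subset[OF S1(3)]
      ring_hom_closed[OF Suc.prems(2)] by blast+
  have cs1: "comp_seq S1 (g1 \<circ> h \<circ> b) l" by (rule gorenstein_extension_strict(2)[OF R S1(1) hom1])
  have ghb: "range (g1 \<circ> h \<circ> b) \<subseteq> carrier S1" using cs1 unfolding comp_seq_def by blast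
  have bS1: "(g1 \<circ> h \<circ> b) j \<in> carrier S1" using ghb by blast
  interpret I: ideal "lspan S1 (carrier S1) (g1 \<circ> h \<circ> b) j" S1 by (rule S1.lspan_ideal[OF ghb])
  \<comment> \<open>The old remainder together with the error of the approximation by
    \<open>Y a [^] n\<close>; both lie in the span below index \<open>j\<close>.\<close>
  define Z where "Z a = g1 (V a) \<oplus>\<^bsub>S1\<^esub> (g1 (C a) \<ominus>\<^bsub>S1\<^esub> Y a [^]\<^bsub>S1\<^esub> n) \<otimes>\<^bsub>S1\<^esub> (g1 \<circ> h \<circ> b) j" for a
  have gV: "g1 (V a) \<in> lspan S1 (carrier S1) (g1 \<circ> h \<circ> b) j" if a: "a \<in> A" for a
  proof -
    have "g1 (V a) \<in> lspan S1 (g1 ` carrier S) (g1 \<circ> (h \<circ> b)) j"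
      using hom_lspan[OF cS c1(1) S1(2) order.refl hbS] VC(1)[OF a] by blast
    moreover have "g1 ` carrier S \<subseteq> carrier S1" using ring_hom_closed[OF S1(2)] by blast
    ultimately show ?thesis using lspan_mono unfolding comp_assoc by blast
  qed
  have Zl: "Z a \<in> lspan S1 (carrier S1) (g1 \<circ> h \<circ> b) j" if a: "a \<in> A" for a
    unfolding Z_def using cs1 Y(2)[OF a] Suc.prems(6) gV[OF a] unfolding comp_seq_def
    by (intro I.a_closed) auto
  have ga: "g1 a = Z a \<oplus>\<^bsub>S1\<^esub> Y a [^]\<^bsub>S1\<^esub> n \<otimes>\<^bsub>S1\<^esub> (g1 \<circ> h \<circ> b) j" if a: "a \<in> A" for a
  proof -
    have VS: "V a \<in> carrier S" using S.lspan_subset[OF hbS order.refl S.carrier_is_subring] VC(1)[OF a] by blast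
    have e: "g1 a = g1 (V a) \<oplus>\<^bsub>S1\<^esub> g1 (C a) \<otimes>\<^bsub>S1\<^esub> (g1 \<circ> h \<circ> b) j"
      using VC(3)[OF a] ring_hom_add[OF S1(2) VS, of "C a \<otimes>\<^bsub>S\<^esub> (h \<circ> b) j"]
        ring_hom_mult[OF S1(2) VC(2)[OF a] bS] VC(2)[OF a] bS by (metis S.m_closed comp_apply)
    have "x \<oplus>\<^bsub>S1\<^esub> c \<otimes>\<^bsub>S1\<^esub> v = (x \<oplus>\<^bsub>S1\<^esub> (c \<ominus>\<^bsub>S1\<^esub> y) \<otimes>\<^bsub>S1\<^esub> v) \<oplus>\<^bsub>S1\<^esub> y \<otimes>\<^bsub>S1\<^esub> v"
      if "x \<in> carrier S1" "c \<in> carrier S1" "v \<in> carrier S1" "y \<in> carrier S1" for x c v y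
      using that by algebra
    from this[OF I.Icarr[OF gV[OF a]] ring_hom_closed[OF S1(2) VC(2)[OF a]] bS1 S1.nat_pow_closed[OF Y(1)[OF a]]]
    show ?thesis unfolding e Z_def .
  qed
  have "Z ` A \<subseteq> lspan S1 (carrier S1) (g1 \<circ> h \<circ> b) j" "j \<le> l" using Zl Suc.prems(6) by auto
  from Suc.IH[OF S1(1) hom1 finite_imageI[OF Suc.prems(4)] this]
  obtain S2 :: "'b ring" and g2 where S2: "is_model (Art l) S2" "g2 \<in> ring_hom S1 S2" "inj_on g2 (carrier S1)"
    and pow2: "\<forall>a\<in>Z ` A. g2 a \<in> lspan S2 {x [^]\<^bsub>S2\<^esub> n | x. x \<in> carrier S2} (g2 \<circ> (g1 \<circ> h) \<circ> b) j"
    by (elim exE conjE) (rule that; assumption)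
  have c2: "cring S2" using S2(1) unfolding Art_model_iff by blast
  have "g2 (g1 a) \<in> lspan S2 {x [^]\<^bsub>S2\<^esub> n | x. x \<in> carrier S2} (g2 \<circ> g1 \<circ> h \<circ> b) (Suc j)" if a: "a \<in> A" for a
  proof -
    have Yn: "Y a [^]\<^bsub>S1\<^esub> n \<in> carrier S1" using Y(1)[OF a] by simp
    have "g2 (g1 a) = g2 (Z a) \<oplus>\<^bsub>S2\<^esub> g2 (Y a [^]\<^bsub>S1\<^esub> n) \<otimes>\<^bsub>S2\<^esub> g2 ((g1 \<circ> h \<circ> b) j)"
      unfolding ga[OF a] using ring_hom_add[OF S2(2) I.Icarr[OF Zl[OF a]] S1.m_closed[OF Yn bS1]]
        ring_hom_mult[OF S2(2) Yn bS1] by simp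
    then have "g2 (g1 a) = g2 (Z a) \<oplus>\<^bsub>S2\<^esub> g2 (Y a) [^]\<^bsub>S2\<^esub> n \<otimes>\<^bsub>S2\<^esub> (g2 \<circ> g1 \<circ> h \<circ> b) j"
      using ring_hom_nat_pow[OF c1(1) c2 S2(2) Y(1)[OF a]] by simp
    moreover have "g2 (Z a) \<in> lspan S2 {x [^]\<^bsub>S2\<^esub> n | x. x \<in> carrier S2} (g2 \<circ> g1 \<circ> h \<circ> b) j"
      using bspec[OF pow2 imageI[OF a]] by (simp only: comp_assoc)
    ultimately show ?thesis unfolding lspan.simps using ring_hom_closed[OF S2(2) Y(1)[OF a]] by blast
  qed
  then have "\<forall>a\<in>A. (g2 \<circ> g1) a \<in> lspan S2 {x [^]\<^bsub>S2\<^esub> n | x. x \<in> carrier S2} (g2 \<circ> g1 \<circ> h \<circ> b) (Suc j)"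
    unfolding comp_apply[of g2 g1] by blast
  moreover have inj: "inj_on (g2 \<circ> g1) (carrier S)"
    using comp_inj_on[OF S1(3), of g2] inj_on_subset[OF S2(3)] ring_hom_closed[OF S1(2)] by blast
  ultimately have "is_model (Art l) S2 \<and> g2 \<circ> g1 \<in> ring_hom S S2 \<and> inj_on (g2 \<circ> g1) (carrier S) \<and>
      (\<forall>a\<in>A. (g2 \<circ> g1) a \<in> lspan S2 {x [^]\<^bsub>S2\<^esub> n | x. x \<in> carrier S2} (g2 \<circ> g1 \<circ> h \<circ> b) (Suc j))"
    using conjI[OF S2(1) conjI[OF ring_hom_trans[OF S1(2) S2(2)] conjI[OF inj]]] by (simp only:)
  then show ?case by (rule exI[of _ S2, OF exI[of _ "g2 \<circ> g1"]])
qed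

section \<open>Gorenstein rings of full length are existentially closed\<close>

text \<open>For each degree this is a first-order sentence, since in models the nonunits are
  described by \<open>x [^] l = \<zero>\<close>.\<close>

lemma elementary_root_closed:
  fixes T :: "('c, 'n) ring_scheme"
  assumes R: "is_model (Art l) R" "root_closed R" and T: "is_model (Art l) T" and k: "k \<in> ring_hom R T"
    and el: "\<And>e \<phi>. range e \<subseteq> carrier R \<Longrightarrow> sat T (k \<circ> e) \<phi> \<longleftrightarrow> sat R e \<phi>"
  shows "root_closed T"
  unfolding root_closed_def
proof (intro allI impI, elim conjE)
  fix cs assume cs: "set cs \<subseteq> carrier T" "cs \<noteq> []"
  have RR: "cring R" "local_ring R" "ring_length R \<le> enat l" using R(1) unfolding Art_model_iff by blast+
  have TT: "local_ring T" using T unfolding Art_model_iff by blast+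
  interpret R: loc_ring R using RR(2) by (rule loc_ringI)
  interpret T: loc_ring T using TT by (rule loc_ringI)
  define n where "n = length cs"
  have n: "n > 0" using cs(2) unfolding n_def by simp
  let ?\<psi> = "FEq (power_term (horner_term 1 (Suc n)) l) TZero"
  \<comment> \<open>The parameters are constantly \<open>\<one>\<close>, so that the free variable
    \<open>Suc n\<close> supplies the leading coefficient.\<close>
  let ?e = "\<lambda>_::nat. \<one>\<^bsub>R\<^esub>"
  have ev: "sat S (e'(0 := x)) ?\<psi> \<longleftrightarrow>
      heval S (map e' [1..<Suc n] @ [e' (Suc n)]) x [^]\<^bsub>S\<^esub> l = \<zero>\<^bsub>S\<^esub>"
    for S :: "('z, 'y) ring_scheme" and e' x
  proof -
    have "map (e'(0 := x)) [1..<1 + Suc n] = map e' [1..<Suc n] @ [e' (Suc n)]" by auto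
    then show ?thesis by (simp only: sat.simps teval_power_term teval_horner_term teval.simps fun_upd_same)
  qed
  have "sat R ?e (foldr FAll [1..<Suc n] (FEx 0 ?\<psi>))"
    unfolding sat_foldr_FAll
  proof (intro allI impI, elim conjE)
    fix e' assume off: "\<forall>m. m \<notin> set [1..<Suc n] \<longrightarrow> e' m = \<one>\<^bsub>R\<^esub>" and on: "\<forall>m\<in>set [1..<Suc n]. e' m \<in> carrier R"
    have s: "set (map e' [1..<Suc n]) \<subseteq> carrier R" "map e' [1..<Suc n] \<noteq> []" using on n by auto
    obtain y where y: "y \<in> carrier R" "heval R (map e' [1..<Suc n] @ [\<one>\<^bsub>R\<^esub>]) y \<in> nonunits R"
      using R(2) s unfolding root_closed_def by blast
    have "e' (Suc n) = \<one>\<^bsub>R\<^esub>" using off by simp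
    then have "sat R (e'(0 := y)) ?\<psi>" unfolding ev using R.length_nilpotent[OF RR(3,2) y(2)] by simp
    then show "sat R e' (FEx 0 ?\<psi>)" unfolding sat.simps(5) using y(1) by blast
  qed
  then have T': "sat T (k \<circ> ?e) (foldr FAll [1..<Suc n] (FEx 0 ?\<psi>))"
    using el[of ?e] R.one_closed by auto
  define e' where "e' i = (if i = 0 \<or> i > n then \<one>\<^bsub>T\<^esub> else cs ! (i - 1))" for i
  have "sat T e' (FEx 0 ?\<psi>)"
    using T' unfolding sat_foldr_FAll
  proof (elim allE impE)
    show "(\<forall>m. m \<notin> set [1..<Suc n] \<longrightarrow> e' m = (k \<circ> ?e) m) \<and> (\<forall>m\<in>set [1..<Suc n]. e' m \<in> carrier T)"
      using ring_hom_one[OF k] cs(1) unfolding e'_def n_def by (auto simp: subset_iff)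
  qed
  then obtain y where y: "y \<in> carrier T" "sat T (e'(0 := y)) ?\<psi>" unfolding sat.simps(5) by blast
  have "map e' [1..<Suc n] = cs"
    by (rule nth_equalityI) (auto simp: e'_def n_def simp del: upt_Suc)
  moreover have "e' (Suc n) = \<one>\<^bsub>T\<^esub>" by (simp add: e'_def)
  ultimately have z: "heval T (cs @ [\<one>\<^bsub>T\<^esub>]) y [^]\<^bsub>T\<^esub> l = \<zero>\<^bsub>T\<^esub>" using y(2) unfolding ev by simp
  have s: "set (cs @ [\<one>\<^bsub>T\<^esub>]) \<subseteq> carrier T" using cs(1) by simp
  have "heval T (cs @ [\<one>\<^bsub>T\<^esub>]) y \<notin> Units T"
    using T.Units_pow_closed[of _ l] z T.unit_not_nonunit[OF _] T.zero_nonunit by metis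
  then show "\<exists>y\<in>carrier T. heval T (cs @ [\<one>\<^bsub>T\<^esub>]) y \<in> nonunits T"
    using T.nonunitI[OF T.heval_closed[OF _ y(1)]] y(1) s by blast
qed

lemma sat_hom_quantifier_free:
  assumes "cring R" "cring S" "h \<in> ring_hom R S" "inj_on h (carrier R)" "range e \<subseteq> carrier R" "quantifier_free \<psi>"
  shows "sat S (h \<circ> e) \<psi> \<longleftrightarrow> sat R e \<psi>"
  using assms(6)
proof (induction \<psi>)
  case (FEq s t)
  have "teval R e u \<in> carrier R" for u by (rule cring.teval_closed[OF assms(1,5)])
  then show ?case
    unfolding sat.simps teval_hom[OF assms(1-3,5)] using inj_on_eq_iff[OF assms(4)] by blast
qed auto

lemma existential_foldr:
  assumes "existential \<phi>"
  obtains ns \<psi> where "\<phi> = foldr FEx ns \<psi>" "quantifier_free \<psi>"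
proof -
  have "\<exists>ns \<psi>. \<phi> = foldr FEx ns \<psi> \<and> quantifier_free \<psi>"
    using assms
  proof (induction rule: existential.induct)
    case (1 \<phi>)
    then show ?case by (intro exI[of _ "[]"]) auto
  next
    case (2 \<phi> n)
    then obtain ns \<psi> where "\<phi> = foldr FEx ns \<psi>" "quantifier_free \<psi>" by blast
    then show ?case by (intro exI[of _ "n # ns"]) auto
  qed
  then show ?thesis using that by blast
qed

text \<open>The least positive integer that is a nonunit is prime, because a product of units is a
  unit.\<close>

lemma (in loc_ring) residue_characteristic:
  obtains "\<And>n::nat. [Suc n] \<cdot> \<one> \<in> Units R" | p :: nat where "prime p" "[p] \<cdot> \<one> \<in> nonunits R"
proof (cases "\<forall>n::nat. [Suc n] \<cdot> \<one> \<in> Units R")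
  case True
  then show ?thesis using that(1) by blast
next
  case False
  let ?Q = "\<lambda>n::nat. n > 0 \<and> [n] \<cdot> \<one> \<in> nonunits R"
  obtain m :: nat where "[Suc m] \<cdot> \<one> \<notin> Units R" using False by blast
  then have "?Q (Suc m)" using nonunitI[of "[Suc m] \<cdot> \<one>"] by simp
  then have Q: "?Q (LEAST n. ?Q n)" by (rule LeastI)
  define p where "p = (LEAST n. ?Q n)"
  have p: "p > 0" "[p] \<cdot> \<one> \<in> nonunits R" using Q unfolding p_def by blast+
  have min: "\<not> ?Q n" if "n < p" for n using not_less_Least that unfolding p_def by blast
  have "p \<noteq> 1"
  proof
    assume "p = 1"
    then have "\<one> \<in> nonunits R" using p(2) by simp
    then show False by simp
  qed
  moreover have "p = a \<or> p = 1 * a \<or> b = p" if ab: "p = a * b" for a b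
  proof (rule ccontr)
    assume c: "\<not> ?thesis"
    have pos: "a > 0" "b > 0" using p(1) ab by (auto intro: Nat.gr0I)
    have ne: "a \<noteq> p" "b \<noteq> p" using c by auto
    have "a dvd p" "b dvd p" using ab by simp_all
    then have "a < p" "b < p" using dvd_imp_le[OF _ p(1)] ne le_neq_implies_less by blast+
    have "[p] \<cdot> \<one> = [a] \<cdot> \<one> \<otimes> [b] \<cdot> \<one>"
      unfolding ab by (simp add: add_pow_ldistr add.nat_pow_pow mult.commute)
    then have "[a] \<cdot> \<one> \<in> nonunits R \<or> [b] \<cdot> \<one> \<in> nonunits R"
      using p(2) nonunit_mult_iff[of "[a] \<cdot> \<one>" "[b] \<cdot> \<one>"] by simp
    then show False using min[OF \<open>a < p\<close>] min[OF \<open>b < p\<close>] pos by blast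
  qed
  ultimately have "prime p"
    using p(1) unfolding prime_nat_iff
    by (metis One_nat_def Suc_lessI dvd_def mult.commute mult_cancel1 nat_mult_1_right not_gr_zero)
  then show ?thesis using that(2) p(2) by blast
qed

theorem gorenstein_imp_existentially_closed:
  fixes R :: "('a, 'm) ring_scheme"
  assumes inf: "infinite (UNIV :: 'b set)" and gor: "artinian_local_gorenstein_ring R"
    and len: "ring_length R = enat l" and ac: "algebraically_closed (residue_field R)"
  shows "existentially_closed TYPE('b) (Art l) R"
proof -
  have loc: "local_ring R" and soc: "principalideal (socle R) R"
    using gor unfolding artinian_local_gorenstein_ring_def artinian_local_ring_def by blast+
  interpret R: loc_ring R using loc by (rule loc_ringI)
  have model: "is_model (Art l) R" unfolding Art_model_iff using R.is_cring loc len by simp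
  have rc: "root_closed R" using ac unfolding R.algebraically_closed_iff_root_closed .
  obtain b where b: "comp_seq R b l" using R.ex_comp_seq[OF len] by blast
  have goal: "sat R e \<phi>"
    if S: "is_model (Art l) S" and h: "h \<in> ring_hom R S" "inj_on h (carrier R)"
      and \<phi>: "existential \<phi>" and e: "range e \<subseteq> carrier R" and sat: "sat S (h \<circ> e) \<phi>"
    for S :: "'b ring" and h \<phi> e
  proof -
    obtain ns \<psi> where \<psi>: "\<phi> = foldr FEx ns \<psi>" "quantifier_free \<psi>" using existential_foldr[OF \<phi>] .
    obtain e' where e': "\<And>n. n \<notin> set ns \<Longrightarrow> e' n = h (e n)" "\<And>n. n \<in> set ns \<Longrightarrow> e' n \<in> carrier S" "sat S e' \<psi>"
      using sat unfolding \<psi>(1) sat_foldr_FEx by auto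
    \<comment> \<open>This index type outnumbers the polynomials over any extension with carrier in
      \<open>'b\<close>. Therefore the same \<open>T\<close> can be paired with the further
      extension \<open>S'\<close> in characteristic \<open>p\<close>.\<close>
    obtain T :: "(('b list \<times> nat) set set \<Rightarrow> 'a) ring" and k
      and \<iota> :: "('b list \<times> nat) set \<Rightarrow> ('b list \<times> nat) set set \<Rightarrow> 'a" where T: "cring T"
      "k \<in> ring_hom R T" "inj_on k (carrier R)"
      and el: "\<And>e \<phi>. range e \<subseteq> carrier R \<Longrightarrow> sat T (k \<circ> e) \<phi> \<longleftrightarrow> sat R e \<phi>"
      and \<iota>: "range \<iota> \<subseteq> carrier T" "\<And>z z'. z \<noteq> z' \<Longrightarrow> \<iota> z \<ominus>\<^bsub>T\<^esub> \<iota> z' \<in> Units T"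
      using R.elementary_extension[OF R.root_closed_many[OF rc], where ?'z = "('b list \<times> nat) set"] by blast
    have mT: "is_model (Art l) T" using elementary_extension_model[of T k R l] T(1,2) el model by blast
    have lT: "local_ring T" using mT unfolding Art_model_iff by blast
    have rT: "root_closed T" using elementary_root_closed[of l R T k] model rc mT T(2) el by blast
    note cT = gorenstein_extension_strict[OF loc soc len b mT T(2,3)]
    have pair: "extension_pair S' T R h' k b l \<iota>"
      if S': "is_model (Art l) S'" and h': "h' \<in> ring_hom R S'" "inj_on h' (carrier R)" for S' :: "'b ring" and h'
    proof -
      have lS': "local_ring S'" using S' unfolding Art_model_iff by blast
      note cS' = gorenstein_extension_strict[OF loc soc len b S' h']
      show ?thesis
        by (intro extension_pair.intro extension_pair_axioms.intro loc_ring_pair.intro loc_ringI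
            lS' lT loc model S' mT h'(1) T(2) b cS' cT rc rT \<iota>)
    qed
    have "sat T (k \<circ> e) \<phi>"
    proof (rule R.residue_characteristic)
      assume ch: "\<And>n::nat. [Suc n] \<cdot>\<^bsub>R\<^esub> \<one>\<^bsub>R\<^esub> \<in> Units R"
      show ?thesis
        unfolding \<psi>(1)
        using extension_pair.transfer_char_0[OF pair[OF S h], of e \<psi> ns e'] ch e \<psi>(2) e' by blast
    next
      fix p :: nat assume p: "prime p" "[p] \<cdot>\<^bsub>R\<^esub> \<one>\<^bsub>R\<^esub> \<in> nonunits R"
      have cS: "cring S" "local_ring S" using S unfolding Art_model_iff by blast+
      interpret S: loc_ring S using cS(2) by (rule loc_ringI)
      have q: "(p ^ l) ^ l > 0" using prime_gt_0_nat[OF p(1)] by simp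
      have A: "finite (e' ` set ns)" "e' ` set ns \<subseteq> lspan S (carrier S) (h \<circ> b) l"
        using e'(2) S.comp_seq_all[OF gorenstein_extension_strict(2)[OF loc soc len b S h]] by auto
      \<comment> \<open>The finitely many witnesses are rewritten with coefficients that are high
        powers. Passing to \<open>S'\<close> does not affect the quantifier free formula
        \<open>\<psi>\<close>.\<close>
      obtain S' :: "'b ring" and g where S': "is_model (Art l) S'" "g \<in> ring_hom S S'" "inj_on g (carrier S)"
        and pow: "\<forall>a\<in>e' ` set ns. g a \<in> lspan S' {x [^]\<^bsub>S'\<^esub> ((p ^ l) ^ l) | x. x \<in> carrier S'} (g \<circ> h \<circ> b) l"
        using extension_lspan_powers[OF inf q loc soc len b S h A order.refl]
        by (elim exE conjE) (rule that; assumption)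
      have h': "g \<circ> h \<in> ring_hom R S'" "inj_on (g \<circ> h) (carrier R)"
        using ring_hom_trans[OF h(1) S'(2)] comp_inj_on[OF h(2), of g] inj_on_subset[OF S'(3)]
          ring_hom_closed[OF h(1)] by blast+
      have cS': "cring S'" using S'(1) unfolding Art_model_iff by blast
      have "e' n \<in> carrier S" for n
        using e'(1,2)[of n] ring_hom_closed[OF h(1)] e by (cases "n \<in> set ns") auto
      then have "range e' \<subseteq> carrier S" by blast
      then have sat': "sat S' (g \<circ> e') \<psi>"
        using sat_hom_quantifier_free[OF cS(1) cS' S'(2,3) _ \<psi>(2)] e'(3) by blast
      have off: "(g \<circ> e') n = (g \<circ> h) (e n)" if "n \<notin> set ns" for n using e'(1)[OF that] by simp
      have on: "(g \<circ> e') n \<in> lspan S' {x [^]\<^bsub>S'\<^esub> ((p ^ l) ^ l) | x. x \<in> carrier S'} ((g \<circ> h) \<circ> b) l"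
        if "n \<in> set ns" for n using bspec[OF pow imageI[OF that]] unfolding comp_apply[of g e'] .
      show ?thesis
        unfolding \<psi>(1)
        using extension_pair.transfer_char_p[OF pair[OF S'(1) h'] p e \<psi>(2), of ns "g \<circ> e'"] off on sat' by blast
    qed
    then show ?thesis using el[OF e] by blast
  qed
  show ?thesis unfolding existentially_closed_def using model goal by blast
qed

theorem theorem3p8:
  fixes l :: nat and R :: "('a, 'm) ring_scheme"
  assumes "l \<ge> 1"
    and "infinite (UNIV :: 'b set)"
    and "\<exists>f :: 'a \<Rightarrow> 'b. inj_on f (carrier R)"
  shows "existentially_closed TYPE('b) (Art l) R \<longleftrightarrow>
           artinian_local_gorenstein_ring R \<and> ring_length R = enat l \<and>
           algebraically_closed (residue_field R)"
  using existentially_closed_imp_gorenstein[OF _ assms(2)] gorenstein_imp_existentially_closed[OF assms(2)]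
    assms(3) by blast

end
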